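(* Let $\omega$, $L$, $Z$, $\tau$, $\sigma$ and $T_\omega$ be as described in the context. Let $A\in L^q(\mathbb T^2;\mathbb C)$ with $q>2+\sigma$, put $$\alpha=\frac{2-r-\mu}{r},\qquad r=\frac{q}{q-1},\qquad \mu=\frac{\sigma}{\sigma+1},$$ and set $$\nu(A)=\frac{-1}{2\pi i}\int_{\mathbb T^2}A\,dx\,dy .$$ Then the equation $Lu=Au$ has a solution $u\in C^\alpha(\mathbb T^2;\mathbb C)$, $u\not\equiv0$, if and only if there exist $j,k\in\mathbb Z$ such that $$\nu(A)=j+k\tau .$$ In this case any solution $u\in C^\alpha(\mathbb T^2;\mathbb C)$ of $Lu=Au$ satisfies, for some constant $C\in\mathbb C$, $$\Pi^\ast u(p)=C\exp\bigl(T_\omega\Pi^\ast A(p)-2\pi i k\,Z(p)\bigr)\qquad\text{for all }p\in\mathbb R^2 .$$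
   Context: Setting. Let $\mathbb T^2=\mathbb R^2/\mathbb Z^2$ with coordinates $(x,y)$ and covering map $\Pi:\mathbb R^2\to\mathbb T^2$. Let $\omega=a\,dx+b\,dy$ be a nowhere vanishing closed complex-valued one-form on $\mathbb T^2$ with $a,b\in C^{1+\varepsilon}(\mathbb T^2;\mathbb C)$, $\varepsilon>0$, such that: (a) the set $\Sigma=\{p\in\mathbb T^2:\ \omega(p)\wedge\overline{\omega(p)}=0\}$ is a one-dimensional (embedded) manifold, with connected components $\Sigma_1,\dots,\Sigma_N$; (b) for each $i$ there is a number $\sigma_i>0$ such that every $p\in\Sigma_i$ has a neighborhood in which $\omega\wedge\overline\omega=|\rho_i|^{\sigma_i}g\,dx\wedge dy$, where $\rho_i$ is a (real-valued) defining function of $\Sigma_i$ near $p$ and $g$ is a non-vanishing continuous function; (c) $\omega$ is hypocomplex: every $p\in\mathbb T^2$ has an open neighborhood $U$ with a first integral $\zeta\in C^{1+\varepsilon}(U;\mathbb C)$ (that is, $d\zeta\neq0$ and $d\zeta\wedge\omega=0$ on $U$) such that $\zeta:U\to\zeta(U)\subset\mathbb C$ is a homeomorphism; (d) near each $p\in\Sigma_i$ there are local ($C^1$) coordinates $(s,t)$ in which $\omega$ is a non-vanishing multiple of $ds+i|t|^{\sigma_i}dt$. Put $\sigma=\max_{1\le i\le N}\sigma_i$, $R=[0,1]\times[0,1]\subset\mathbb R^2$, $L=b\,\partial_x-a\,\partial_y$ on $\mathbb T^2$, and $Z(x,y)=\int_{(0,0)}^{(x,y)}\Pi^\ast\omega$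 on $\mathbb R^2$. It is assumed (normalization) that $Z(x+1,y)=Z(x,y)+1$ and $Z(x,y+1)=Z(x,y)+\tau$ for all $(x,y)$, where $\tau\in\mathbb C$, $\mathrm{Im}(\tau)>0$. Then $Z:\mathbb R^2\to\mathbb C$ is a homeomorphism. Theta function: $\Theta(z)=\sum_{m\in\mathbb Z}e^{\pi i m^2\tau}e^{2\pi i m z}$, which satisfies $\Theta(z+1)=\Theta(z)$, $\Theta(z+\tau)=e^{-i\pi\tau-2\pi i z}\Theta(z)$, and whose zeros are simple and are exactly the points $z_0+j+k\tau$, $j,k\in\mathbb Z$, with $z_0=(1+\tau)/2$. Operator: $$T_\omega g(p)=\frac1{2\pi i}\int_R\frac{\Theta'(Z(p)-Z(s)+z_0)}{\Theta(Z(p)-Z(s)+z_0)}\,g(s)\,d\mu_s,\qquad p\in\mathbb R^2,$$ where $d\mu_s$ is Lebesgue measure. $\Pi^\ast u=u\circ\Pi$ for a function $u$ on $\mathbb T^2$. Equations are understood in the sense of distributions: since $\omega$ is closed, $L$ is divergence free, and $Lu=f$ means $-\int_{\mathbb T^2}u\,L\phi\,dxdy=\int_{\mathbb T^2}f\phi\,dxdy$ for all $\phi\in C^\infty(\mathbb T^2)$. $C^\alpha(\mathbb T^2)$ is the space of Hölder continuous functions with exponent $\alpha$. *)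

theory Defs
  imports "HOL-Analysis.Analysis"
begin

definition torus_rel :: "real \<times> real \<Rightarrow> real \<times> real \<Rightarrow> bool" where
  "torus_rel P Q \<longleftrightarrow> fst P - fst Q \<in> \<int> \<and> snd P - snd Q \<in> \<int>"

lemma equivp_torus_rel: "equivp torus_rel"
proof (rule equivpI)
  show "reflp torus_rel"
    by (simp add: reflp_def torus_rel_def)
  show "symp torus_rel"
    unfolding symp_def torus_rel_def by (metis Ints_minus minus_diff_eq)
  show "transp torus_rel"
  proof (rule transpI)
    fix P Q S
    assume "torus_rel P Q" "torus_rel Q S"
    then have "(fst P - fst Q) + (fst Q - fst S) \<in> \<int>" "(snd P - snd Q) + (snd Q - snd S) \<in> \<int>"
      unfolding torus_rel_def by (blast intro: Ints_add)+
    then show "torus_rel P S"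
      by (simp add: torus_rel_def)
  qed
qed

quotient_type torus = "real \<times> real" / torus_rel
  by (rule equivp_torus_rel)

definition tproj :: "real \<times> real \<Rightarrow> torus" where
  "tproj = abs_torus"

lemma tproj_eq_iff: "tproj P = tproj Q \<longleftrightarrow> torus_rel P Q"
  by (simp add: tproj_def torus.abs_eq_iff)

lemma surj_tproj: "surj tproj"
  unfolding tproj_def by (metis Quotient3_abs_rep Quotient3_torus surjI)

instantiation torus :: topological_space
begin

definition open_torus :: "torus set \<Rightarrow> bool" where
  "open_torus U \<longleftrightarrow> open (tproj -` U)"

instance
  by standard (auto simp: open_torus_def vimage_Union)

end

(* Functions on the torus are differentiated, integrated and compared through their pullbacks
   along tproj, so the notions below are formulated for functions on the plane. *)

definition pdx :: "(real \<times> real \<Rightarrow> 'b::real_normed_vector) \<Rightarrow> real \<times> real \<Rightarrow> 'b" where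
  "pdx f P = frechet_derivative f (at P) (1, 0)"

definition pdy :: "(real \<times> real \<Rightarrow> 'b::real_normed_vector) \<Rightarrow> real \<times> real \<Rightarrow> 'b" where
  "pdy f P = frechet_derivative f (at P) (0, 1)"

definition holder_on :: "real \<Rightarrow> 'a::metric_space set \<Rightarrow> ('a \<Rightarrow> 'b::metric_space) \<Rightarrow> bool" where
  "holder_on \<alpha> S f \<longleftrightarrow> (\<exists>K. \<forall>P\<in>S. \<forall>Q\<in>S. dist (f P) (f Q) \<le> K * dist P Q powr \<alpha>)"

definition C1_on :: "(real \<times> real) set \<Rightarrow> (real \<times> real \<Rightarrow> 'b::real_normed_vector) \<Rightarrow> bool" where
  "C1_on S f \<longleftrightarrow> (\<forall>P\<in>S. f differentiable (at P))
     \<and> continuous_on S (pdx f) \<and> continuous_on S (pdy f)"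

definition C1_holder_on ::
  "real \<Rightarrow> (real \<times> real) set \<Rightarrow> (real \<times> real \<Rightarrow> 'b::real_normed_vector) \<Rightarrow> bool" where
  "C1_holder_on \<epsilon> S f \<longleftrightarrow> (\<forall>P\<in>S. f differentiable (at P))
     \<and> holder_on \<epsilon> S (pdx f) \<and> holder_on \<epsilon> S (pdy f)"

(* D i j is the mixed partial derivative of order i in x and j in y. *)
definition smooth_plane :: "(real \<times> real \<Rightarrow> complex) \<Rightarrow> bool" where
  "smooth_plane f \<longleftrightarrow> (\<exists>D :: nat \<Rightarrow> nat \<Rightarrow> real \<times> real \<Rightarrow> complex. D 0 0 = f \<and>
     (\<forall>i j P. (D i j has_derivative
        (\<lambda>h. fst h *\<^sub>R D (Suc i) j P + snd h *\<^sub>R D i (Suc j) P)) (at P)))"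

(* The quotient distance on the torus is the minimum of the planar distances between
   representatives, so a Hoelder bound for u in that distance is the same as the bound,
   with the same constant, for its pullback on the whole plane. *)
definition holder_torus :: "real \<Rightarrow> (torus \<Rightarrow> complex) \<Rightarrow> bool" where
  "holder_torus \<alpha> u \<longleftrightarrow> holder_on \<alpha> UNIV (u \<circ> tproj)"

definition unit_square :: "(real \<times> real) set" where
  "unit_square = {0..1} \<times> {0..1}"

definition torus_integral :: "(torus \<Rightarrow> complex) \<Rightarrow> complex" where
  "torus_integral f = (LINT P|lebesgue_on unit_square. f (tproj P))"

definition Lq_torus :: "real \<Rightarrow> (torus \<Rightarrow> complex) set" where
  "Lq_torus q = {f. f \<circ> tproj \<in> borel_measurable (lebesgue_on unit_square)
     \<and> integrable (lebesgue_on unit_square) (\<lambda>P. cmod (f (tproj P)) powr q)}"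

(* A one-form \<omega> = a dx + b dy is given by its coefficients a and b.
   The function below is the coefficient of \<omega> \<and> cnj \<omega> with respect to dx \<and> dy. *)
definition wedge_cnj :: "(torus \<Rightarrow> complex) \<Rightarrow> (torus \<Rightarrow> complex) \<Rightarrow> torus \<Rightarrow> complex" where
  "wedge_cnj a b p = a p * cnj (b p) - b p * cnj (a p)"

definition degeneracy_set :: "(torus \<Rightarrow> complex) \<Rightarrow> (torus \<Rightarrow> complex) \<Rightarrow> torus set" where
  "degeneracy_set a b = {p. wedge_cnj a b p = 0}"

(* By the inverse function theorem, (s, t) is then a C^1 diffeomorphism from U onto an
   open subset of the plane. *)
definition C1_coords :: "torus set \<Rightarrow> (torus \<Rightarrow> real) \<Rightarrow> (torus \<Rightarrow> real) \<Rightarrow> bool" where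
  "C1_coords U s t \<longleftrightarrow> open U \<and> inj_on (\<lambda>p. (s p, t p)) U
     \<and> C1_on (tproj -` U) (s \<circ> tproj) \<and> C1_on (tproj -` U) (t \<circ> tproj)
     \<and> (\<forall>P \<in> tproj -` U. pdx (s \<circ> tproj) P * pdy (t \<circ> tproj) P
                        - pdy (s \<circ> tproj) P * pdx (t \<circ> tproj) P \<noteq> 0)"

definition embedded_curve :: "torus set \<Rightarrow> bool" where
  "embedded_curve M \<longleftrightarrow>
     (\<forall>p\<in>M. \<exists>U s t. p \<in> U \<and> C1_coords U s t \<and> (\<forall>q\<in>U. q \<in> M \<longleftrightarrow> t q = 0))"

definition defining_function :: "torus set \<Rightarrow> torus set \<Rightarrow> (torus \<Rightarrow> real) \<Rightarrow> bool" where
  "defining_function M U \<rho> \<longleftrightarrow> C1_on (tproj -` U) (\<rho> \<circ> tproj)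
     \<and> (\<forall>q\<in>U. q \<in> M \<longleftrightarrow> \<rho> q = 0)
     \<and> (\<forall>P \<in> tproj -` (U \<inter> M). pdx (\<rho> \<circ> tproj) P \<noteq> 0 \<or> pdy (\<rho> \<circ> tproj) P \<noteq> 0)"

(* d\<zeta> \<noteq> 0 and d\<zeta> \<and> \<omega> = 0 on U *)
definition first_integral ::
  "(torus \<Rightarrow> complex) \<Rightarrow> (torus \<Rightarrow> complex) \<Rightarrow> real \<Rightarrow> torus set \<Rightarrow> (torus \<Rightarrow> complex) \<Rightarrow> bool" where
  "first_integral a b \<epsilon> U \<zeta> \<longleftrightarrow> C1_holder_on \<epsilon> (tproj -` U) (\<zeta> \<circ> tproj)
     \<and> (\<forall>P \<in> tproj -` U. (pdx (\<zeta> \<circ> tproj) P \<noteq> 0 \<or> pdy (\<zeta> \<circ> tproj) P \<noteq> 0)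
          \<and> pdx (\<zeta> \<circ> tproj) P * b (tproj P) - pdy (\<zeta> \<circ> tproj) P * a (tproj P) = 0)"

(* The integral of the pullback of \<omega> from the origin to P, taken along the line segment;
   for closed \<omega> it does not depend on the path. *)
definition Zint :: "(torus \<Rightarrow> complex) \<Rightarrow> (torus \<Rightarrow> complex) \<Rightarrow> real \<times> real \<Rightarrow> complex" where
  "Zint a b P =
     integral {0..1} (\<lambda>v. fst P *\<^sub>R a (tproj (v *\<^sub>R P)) + snd P *\<^sub>R b (tproj (v *\<^sub>R P)))"

(* C i (for 1 \<le> i \<le> N) are the connected components of the degeneracy set and sg i is the
   exponent attached to C i. At least one component is required, so that the maximum of the
   exponents makes sense. *)
locale hypocomplex_form =
  fixes a b :: "torus \<Rightarrow> complex" and \<epsilon> :: real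
    and N :: nat and C :: "nat \<Rightarrow> torus set" and sg :: "nat \<Rightarrow> real" and \<tau> :: complex
  assumes eps: "0 < \<epsilon>" "\<epsilon> < 1"
    and regular: "C1_holder_on \<epsilon> UNIV (a \<circ> tproj)" "C1_holder_on \<epsilon> UNIV (b \<circ> tproj)"
    and nonvanishing: "\<And>p. a p \<noteq> 0 \<or> b p \<noteq> 0"
    and closed_form: "\<And>P. pdx (b \<circ> tproj) P = pdy (a \<circ> tproj) P"
    and curve: "embedded_curve (degeneracy_set a b)"
    and comps: "1 \<le> N" "bij_betw C {1..N} (components (degeneracy_set a b))"
    and exponent_pos: "\<And>i. i \<in> {1..N} \<Longrightarrow> 0 < sg i"
    and degeneracy_order: "\<And>i p. i \<in> {1..N} \<Longrightarrow> p \<in> C i \<Longrightarrow>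
       \<exists>U \<rho> g. open U \<and> p \<in> U \<and> defining_function (C i) U \<rho> \<and> continuous_on U g
         \<and> (\<forall>x\<in>U. g x \<noteq> 0 \<and> wedge_cnj a b x = complex_of_real (\<bar>\<rho> x\<bar> powr sg i) * g x)"
    and hypocomplex: "\<And>p. \<exists>U \<zeta> \<xi>. open U \<and> p \<in> U \<and> first_integral a b \<epsilon> U \<zeta>
         \<and> homeomorphism U (\<zeta> ` U) \<zeta> \<xi>"
    and normal_form: "\<And>i p. i \<in> {1..N} \<Longrightarrow> p \<in> C i \<Longrightarrow>
       \<exists>U s t m. p \<in> U \<and> C1_coords U s t
         \<and> (\<forall>P \<in> tproj -` U. m (tproj P) \<noteq> (0::complex)
             \<and> a (tproj P) = m (tproj P) * (complex_of_real (pdx (s \<circ> tproj) P)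
                 + \<i> * complex_of_real (\<bar>t (tproj P)\<bar> powr sg i * pdx (t \<circ> tproj) P))
             \<and> b (tproj P) = m (tproj P) * (complex_of_real (pdy (s \<circ> tproj) P)
                 + \<i> * complex_of_real (\<bar>t (tproj P)\<bar> powr sg i * pdy (t \<circ> tproj) P)))"
    and period_x: "\<And>x y. Zint a b (x + 1, y) = Zint a b (x, y) + 1"
    and period_y: "\<And>x y. Zint a b (x, y + 1) = Zint a b (x, y) + \<tau>"
    and tau: "0 < Im \<tau>"

(* L u = f in the sense of distributions, for the divergence free field
   L = b d/dx - a d/dy and integrable u, f. *)
definition weak_solution ::
  "(torus \<Rightarrow> complex) \<Rightarrow> (torus \<Rightarrow> complex) \<Rightarrow> (torus \<Rightarrow> complex) \<Rightarrow> (torus \<Rightarrow> complex) \<Rightarrow> bool" where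
  "weak_solution a b u f \<longleftrightarrow> (\<forall>\<phi>. smooth_plane (\<phi> \<circ> tproj) \<longrightarrow>
     - (LINT P|lebesgue_on unit_square. u (tproj P) *
          (b (tproj P) * pdx (\<phi> \<circ> tproj) P - a (tproj P) * pdy (\<phi> \<circ> tproj) P))
     = torus_integral (\<lambda>p. f p * \<phi> p))"

definition Theta :: "complex \<Rightarrow> complex \<Rightarrow> complex" where
  "Theta \<tau> z = (\<Sum>\<^sub>\<infinity>m::int. exp (of_real pi * \<i> * (of_int m)\<^sup>2 * \<tau>) * exp (2 * of_real pi * \<i> * of_int m * z))"

definition theta_zero :: "complex \<Rightarrow> complex" where
  "theta_zero \<tau> = (1 + \<tau>) / 2"

definition T_op :: "(torus \<Rightarrow> complex) \<Rightarrow> (torus \<Rightarrow> complex) \<Rightarrow> complex \<Rightarrow>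
    (real \<times> real \<Rightarrow> complex) \<Rightarrow> real \<times> real \<Rightarrow> complex" where
  "T_op a b \<tau> g P = 1 / (2 * of_real pi * \<i>) *
     (LINT S|lebesgue_on unit_square.
        deriv (Theta \<tau>) (Zint a b P - Zint a b S + theta_zero \<tau>)
          / Theta \<tau> (Zint a b P - Zint a b S + theta_zero \<tau>) * g S)"

end

(* The pullback of L in the coordinate Z is a multiple of the Cauchy-Riemann operator, so formally
   u = exp (w o Z) with w the convolution of A against the logarithmic derivative of Theta. That kernel
   changes by -2 pi i under z |-> z + tau, so w changes by 2 pi i nu, and exp (w - 2 pi i k z) is
   doubly periodic exactly when nu = j + k tau.  Its Hoelder continuity rests on the area of the
   preimage of a disc under Z, estimated in the normal form ds + i |t|^sigma dt.

   Since Z is only C^1 and its Jacobian degenerates, all identities are first written for C^1 kernels that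
   agree with the meromorphic ones outside small discs around the poles; their conjugate derivatives
   are approximate identities on the torus, with mass computed by Green's formula.  For uniqueness the
   equation is tested with exp (-v) times a difference of two such kernels (if nu = j + k tau), or
   times the Szego kernel with multiplier exp (2 pi i nu) (otherwise): in the limit the pole evaluates
   u exp (-w) and shows that it is a multiple of exp (-2 pi i k Z), or zero. *)

theory Submission imports Defs "HOL-Complex_Analysis.Complex_Analysis"
begin

section \<open>Lattices and the Theta function\<close>

text \<open>The exponent \<alpha> has a single source. Discs of radius \<rho> have preimages in the
  unit square of area O(\<rho>^(1 + 1/(\<sigma>+1))); Hoelder's inequality for |A| raises this to
  the power 1 - 1/q, and the exponent becomes exactly 1 + \<alpha>. A planar measure with this
  growth has an \<alpha>-Hoelder Cauchy transform, and q > 2 + \<sigma> says that \<alpha> > 0.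
  Three facts of the setting are derived rather than assumed. The zeros of Theta come from a
  comparison with an explicit q-product: the quotient is entire and doubly periodic.
  \<open>Z\<close> is injective because it is a proper local homeomorphism onto a simply connected
  plane. The orientation of \<open>Z\<close> is found late: the normal form only shows that the
  Jacobian keeps one sign, and the positive mass of the approximate identities fixes which. The weak
  equation admits smooth test functions only, whereas the kernels composed with \<open>Z\<close> are
  merely C^1. Convolution with trigonometric polynomials bridges the gap, since it commutes with
  derivatives and stays on the torus.\<close>

definition lattice :: "complex \<Rightarrow> complex set" where
  "lattice \<tau> = {of_int m + of_int n * \<tau> | m n. True}"

lemma lattice_0: "0 \<in> lattice \<tau>"
  unfolding lattice_def by (rule CollectI, rule exI[of _ 0], rule exI[of _ 0]) simp

lemma latticeI: "of_int m + of_int n * \<tau> \<in> lattice \<tau>"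
  by (auto simp: lattice_def)

lemma lattice_add: "x \<in> lattice \<tau> \<Longrightarrow> y \<in> lattice \<tau> \<Longrightarrow> x + y \<in> lattice \<tau>"
proof -
  assume "x \<in> lattice \<tau>" "y \<in> lattice \<tau>"
  then obtain m n m' n' where "x = of_int m + of_int n * \<tau>" "y = of_int m' + of_int n' * \<tau>"
    by (auto simp: lattice_def)
  then have "x + y = of_int (m + m') + of_int (n + n') * \<tau>"
    by (simp add: algebra_simps)
  then show ?thesis by (metis latticeI)
qed

lemma lattice_uminus: "x \<in> lattice \<tau> \<Longrightarrow> - x \<in> lattice \<tau>"
proof -
  assume "x \<in> lattice \<tau>"
  then obtain m n where "x = of_int m + of_int n * \<tau>" by (auto simp: lattice_def)
  then have "- x = of_int (- m) + of_int (- n) * \<tau>"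
    by (simp add: algebra_simps)
  then show ?thesis by (metis latticeI)
qed

lemma lattice_diff: "x \<in> lattice \<tau> \<Longrightarrow> y \<in> lattice \<tau> \<Longrightarrow> x - y \<in> lattice \<tau>"
  using lattice_add[OF _ lattice_uminus] by force

lemma lattice_add_cancel: "y \<in> lattice \<tau> \<Longrightarrow> x + y \<in> lattice \<tau> \<longleftrightarrow> x \<in> lattice \<tau>"
  by (metis lattice_add lattice_diff add_diff_cancel_right')

lemma lattice_1: "1 \<in> lattice \<tau>" using latticeI[of 1 0] by simp
lemma lattice_tau: "\<tau> \<in> lattice \<tau>" using latticeI[of 0 1] by simp

lemma countable_lattice: "countable (lattice \<tau>)"
proof -
  have "lattice \<tau> = (\<lambda>(m, n). of_int m + of_int n * \<tau>) ` (UNIV :: (int \<times> int) set)"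
    by (auto simp: lattice_def)
  then show ?thesis by (metis countableI_type countable_image)
qed

lemma lattice_induct [consumes 1, case_names zero one minus_one tau minus_tau]:
  assumes "z \<in> lattice \<tau>" and z: "P 0"
    and 1: "\<And>x. P x \<Longrightarrow> P (x + 1)" and 2: "\<And>x. P x \<Longrightarrow> P (x - 1)"
    and 3: "\<And>x. P x \<Longrightarrow> P (x + \<tau>)" and 4: "\<And>x. P x \<Longrightarrow> P (x - \<tau>)"
  shows "P z"
proof -
  obtain m n where mn: "z = of_int m + of_int n * \<tau>" using assms(1) by (auto simp: lattice_def)
  have P1: "P (of_int m)" for m
  proof (induction m rule: int_induct[where k = 0])
    case base then show ?case using z by simp
  next
    case (step1 i) then show ?case using 1[of "of_int i"] by simp
  next
    case (step2 i) then show ?case using 2[of "of_int i"] by simp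
  qed
  have "P (of_int m + of_int n * \<tau>)" for n
  proof (induction n rule: int_induct[where k = 0])
    case base then show ?case using P1[of m] by simp
  next
    case (step1 i) then show ?case using 3[of "of_int m + of_int i * \<tau>"] by (simp add: algebra_simps)
  next
    case (step2 i) then show ?case using 4[of "of_int m + of_int i * \<tau>"] by (simp add: algebra_simps)
  qed
  then show ?thesis using mn by simp
qed

lemma lattice_periodic:
  assumes "l \<in> lattice \<tau>" and 1: "\<And>z. F (z + 1) = F z" and 2: "\<And>z. F (z + \<tau>) = F z"
  shows "F (z + l) = F z"
  using assms(1)
proof (induction rule: lattice_induct)
  case (one x)
  then show ?case using 1[of "z + x"] by (simp add: algebra_simps)
next
  case (minus_one x)
  then show ?case using 1[of "z + x - 1"] by (simp add: algebra_simps)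
next
  case (tau x)
  then show ?case using 2[of "z + x"] by (simp add: algebra_simps)
next
  case (minus_tau x)
  then show ?case using 2[of "z + x - \<tau>"] by (simp add: algebra_simps)
qed simp

lemma lattice_reduce:
  assumes "Im \<tau> > 0"
  obtains l x y where "l \<in> lattice \<tau>" "z = of_real x + of_real y * \<tau> + l"
    "0 \<le> x" "x \<le> 1" "0 \<le> y" "y \<le> 1"
proof -
  define y where "y = Im z / Im \<tau>"
  define x where "x = Re z - y * Re \<tau>"
  have z: "z = of_real x + of_real y * \<tau>"
    using assms by (simp add: x_def y_def complex_eq_iff)
  show thesis
  proof (rule that[of "of_int \<lfloor>x\<rfloor> + of_int \<lfloor>y\<rfloor> * \<tau>" "frac x" "frac y"])
    show "of_int \<lfloor>x\<rfloor> + of_int \<lfloor>y\<rfloor> * \<tau> \<in> lattice \<tau>" by (rule latticeI)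
    show "z = of_real (frac x) + of_real (frac y) * \<tau> + (of_int \<lfloor>x\<rfloor> + of_int \<lfloor>y\<rfloor> * \<tau>)"
      by (simp add: z frac_def algebra_simps)
    show "frac x \<le> 1" "frac y \<le> 1" using frac_lt_1[of x] frac_lt_1[of y] by linarith+
  qed auto
qed

lemma lattice_cell_compact:
  "compact ((\<lambda>(x, y). of_real x + of_real y * \<tau> :: complex) ` ({0..1::real} \<times> {0..1::real}))"
  by (intro compact_continuous_image compact_Times compact_Icc)
     (auto simp: case_prod_unfold intro!: continuous_intros)

text \<open>All values are taken on the compact period cell, so the function is bounded and
  Liouville's theorem applies.\<close>

lemma doubly_periodic_entire_constant:
  assumes "Im \<tau> > 0" "F holomorphic_on UNIV"
    and per: "\<And>z. F (z + 1) = F z" "\<And>z. F (z + \<tau>) = F z"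
  obtains c where "\<And>z. F z = c"
proof -
  define K where "K = (\<lambda>(x, y). of_real x + of_real y * \<tau> :: complex) ` ({0..1::real} \<times> {0..1::real})"
  have "bounded (F ` K)"
    unfolding K_def
    by (intro compact_imp_bounded compact_continuous_image[OF _ lattice_cell_compact]
        holomorphic_on_imp_continuous_on holomorphic_on_subset[OF assms(2)]) auto
  moreover have "F z \<in> F ` K" for z
  proof -
    obtain l x y where *: "l \<in> lattice \<tau>" "z = of_real x + of_real y * \<tau> + l"
      "0 \<le> x" "x \<le> 1" "0 \<le> y" "y \<le> 1" using lattice_reduce[OF assms(1), of z] by metis
    have "F z = F (of_real x + of_real y * \<tau>)"
      unfolding *(2) using *(1) per by (rule lattice_periodic)
    moreover have "of_real x + of_real y * \<tau> \<in> K" using * by (force simp: K_def)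
    ultimately show ?thesis by blast
  qed
  ultimately have "bounded (range F)" by (meson bounded_subset image_subsetI)
  then show thesis using Liouville_theorem[OF assms(2)] that by (metis constant_on_def UNIV_I)
qed

lemma isCont_eventually_nonzero:
  fixes f :: "'a::t2_space \<Rightarrow> 'b::t1_space"
  assumes "isCont f w" "f w \<noteq> c"
  shows "eventually (\<lambda>z. f z \<noteq> c) (nhds w)"
  using assms(1) unfolding continuous_at tendsto_at_iff_tendsto_nhds
  by (rule tendsto_imp_eventually_ne) (rule assms(2))

lemma norm_le_all_imp_zero: "(\<And>\<eta>::real. \<eta> > 0 \<Longrightarrow> norm (x::complex) \<le> \<eta>) \<Longrightarrow> x = 0"
  by (metis norm_le_zero_iff field_le_epsilon add_0)

text \<open>At a zero \<open>w\<close> of \<open>P\<close> both functions vanish, so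
  \<open>F\<close> and \<open>P\<close> may be replaced by their difference quotients
  \<open>F1\<close> and \<open>P1\<close> at \<open>w\<close>. These extend holomorphically,
  \<open>P1 w\<close> is the nonzero derivative, and \<open>F1 / P1\<close> agrees with the given
  function on a whole neighbourhood of \<open>w\<close>.\<close>

lemma holomorphic_divide_simple_zeros:
  assumes "open S" "F holomorphic_on S" "P holomorphic_on S"
    and zero: "\<And>z. z \<in> S \<Longrightarrow> P z = 0 \<Longrightarrow> F z = 0 \<and> deriv P z \<noteq> 0"
  shows "(\<lambda>z. if P z = 0 then deriv F z / deriv P z else F z / P z) holomorphic_on S"
    (is "?E holomorphic_on S")
proof -
  have "?E field_differentiable at w" if w: "w \<in> S" for w
  proof (cases "P w = 0")
    case False
    have "isCont P w" using assms(1,3) w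
      by (meson continuous_on_eq_continuous_at holomorphic_on_imp_continuous_on)
    then have "eventually (\<lambda>z. P z \<noteq> 0) (nhds w)"
      using False by (rule isCont_eventually_nonzero)
    then have ev: "eventually (\<lambda>z. F z / P z = ?E z) (nhds w)"
      by eventually_elim auto
    have "(\<lambda>z. F z / P z) field_differentiable at w"
      using assms w False by (intro field_differentiable_divide) (auto simp: holomorphic_on_imp_differentiable_at)
    then show ?thesis
      using DERIV_cong_ev[OF refl ev refl] by (auto simp: field_differentiable_def)
  next
    case True
    define F1 where "F1 = (\<lambda>z. if z = w then deriv F w else (F z - F w) / (z - w))"
    define P1 where "P1 = (\<lambda>z. if z = w then deriv P w else (P z - P w) / (z - w))"
    have hol: "F1 holomorphic_on S" "P1 holomorphic_on S"
      unfolding F1_def P1_def using assms(1-3) by (auto intro: pole_lemma_open)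
    have P1w: "P1 w \<noteq> 0" using zero[OF w True] by (simp add: P1_def)
    have "isCont P1 w" using assms(1) hol(2) w
      by (meson continuous_on_eq_continuous_at holomorphic_on_imp_continuous_on)
    then have "eventually (\<lambda>z. P1 z \<noteq> 0) (nhds w)"
      using P1w by (rule isCont_eventually_nonzero)
    then have ev: "eventually (\<lambda>z. F1 z / P1 z = ?E z) (nhds w)"
    proof eventually_elim
      case (elim z)
      show ?case
        using elim zero[OF w True] True by (auto simp: F1_def P1_def split: if_splits)
    qed
    have "(\<lambda>z. F1 z / P1 z) field_differentiable at w"
      using assms(1) hol w P1w by (intro field_differentiable_divide) (auto simp: holomorphic_on_imp_differentiable_at)
    then show ?thesis
      using DERIV_cong_ev[OF refl ev refl] by (auto simp: field_differentiable_def)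
  qed
  then show ?thesis
    using assms(1) by (simp add: holomorphic_on_def field_differentiable_at_within)
qed

section \<open>Entire q-products with known zeros\<close>

text \<open>The coefficients of the product of the factors \<open>1 - q^n x\<close>, read off from the
  functional equation \<open>g x = (1 - x) g (q x)\<close>.\<close>

fun qpoch_coeff :: "complex \<Rightarrow> nat \<Rightarrow> complex" where
  "qpoch_coeff q 0 = 1"
| "qpoch_coeff q (Suc n) = - (q ^ n) / (1 - q ^ Suc n) * qpoch_coeff q n"

text \<open>The q-Pochhammer function (x; q)_\<infinity> in Euler's expansion. As a power series it
  is entire as soon as it converges everywhere, and its zeros are found from the functional equation
  instead of from an infinite product.\<close>

definition qpoch :: "complex \<Rightarrow> complex \<Rightarrow> complex" where
  "qpoch q x = (\<Sum>n. qpoch_coeff q n * x ^ n)"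

lemma one_minus_power_nz:
  fixes q :: complex assumes "norm q < 1" shows "1 - q ^ Suc n \<noteq> 0"
proof
  assume "1 - q ^ Suc n = 0"
  then have "norm (q ^ Suc n) = 1" by (metis eq_iff_diff_eq_0 norm_one)
  moreover have "norm (q ^ Suc n) < 1"
    unfolding norm_power using assms power_decreasing[of 1 "Suc n" "norm q"] by simp
  ultimately show False by simp
qed

lemma summable_ratio_tendsto_0:
  fixes c :: "nat \<Rightarrow> 'a::banach"
  assumes "\<And>n. c (Suc n) = r n *\<^sub>R c n \<or> norm (c (Suc n)) \<le> \<bar>r n\<bar> * norm (c n)" "r \<longlonglongrightarrow> (0::real)"
  shows "summable c"
proof -
  have "eventually (\<lambda>n. \<bar>r n\<bar> < 1/2) sequentially"
    using assms(2) by (auto dest!: tendstoD[of _ _ _ "1/2"])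
  then obtain N where N: "\<And>n. n \<ge> N \<Longrightarrow> \<bar>r n\<bar> < 1/2"
    by (auto simp: eventually_sequentially)
  show ?thesis
  proof (rule summable_ratio_test[of "1/2" N])
    fix n assume "n \<ge> N"
    have "norm (c (Suc n)) \<le> \<bar>r n\<bar> * norm (c n)" using assms(1)[of n] by auto
    also have "\<dots> \<le> 1/2 * norm (c n)"
      using N[OF \<open>n \<ge> N\<close>] by (intro mult_right_mono) auto
    finally show "norm (c (Suc n)) \<le> 1/2 * norm (c n)" .
  qed auto
qed

lemma summable_qpoch:
  assumes q: "norm q < 1"
  shows "summable (\<lambda>n. qpoch_coeff q n * x ^ n)"
proof (rule summable_ratio_tendsto_0[where r = "\<lambda>n. norm (q ^ n / (1 - q ^ Suc n) * x)"])
  have 1: "(\<lambda>n. q ^ n) \<longlonglongrightarrow> 0" using q by (rule LIMSEQ_power_zero)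
  from LIMSEQ_Suc[OF this] have 2: "(\<lambda>n. 1 - q ^ Suc n) \<longlonglongrightarrow> 1 - 0" by (intro tendsto_intros)
  have "(\<lambda>n. q ^ n / (1 - q ^ Suc n) * x) \<longlonglongrightarrow> 0 / (1 - 0) * x"
    by (rule tendsto_mult[OF tendsto_divide[OF 1 2] tendsto_const]) simp
  then show "(\<lambda>n. norm (q ^ n / (1 - q ^ Suc n) * x)) \<longlonglongrightarrow> 0" using tendsto_norm_zero by force
qed (rule disjI2, simp add: norm_mult norm_divide norm_power mult_ac)

lemma qpoch_holomorphic: "norm q < 1 \<Longrightarrow> qpoch q holomorphic_on UNIV"
  using termdiffs_strong_converges_everywhere[OF summable_qpoch, of q]
  unfolding qpoch_def holomorphic_on_def field_differentiable_def by auto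

lemma qpoch_0 [simp]: "qpoch q 0 = 1"
proof -
  have "qpoch q 0 = (\<Sum>n. if n = 0 then 1 else 0 :: complex)"
    unfolding qpoch_def by (rule suminf_cong) auto
  also have "\<dots> = (\<Sum>n\<in>{0::nat}. if n = 0 then 1 else 0 :: complex)"
    by (rule suminf_finite) auto
  finally show ?thesis by simp
qed

lemma qpoch_step:
  assumes q: "norm q < 1" shows "qpoch q x = (1 - x) * qpoch q (q * x)"
proof -
  let ?a = "qpoch_coeff q"
  have s1: "summable (\<lambda>n. ?a n * x ^ n)" and s2: "summable (\<lambda>n. ?a n * (q * x) ^ n)"
    by (rule summable_qpoch[OF q])+
  have "qpoch q x - qpoch q (q * x) = (\<Sum>n. ?a n * x ^ n - ?a n * (q * x) ^ n)"
    unfolding qpoch_def by (rule suminf_diff[OF s1 s2])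
  also have "\<dots> = (\<Sum>n. ?a (Suc n) * x ^ Suc n - ?a (Suc n) * (q * x) ^ Suc n)"
    using suminf_split_head[OF summable_diff[OF s1 s2]] by simp
  also have "\<dots> = (\<Sum>n. - x * (?a n * (q * x) ^ n))"
  proof (rule suminf_cong)
    fix n
    show "?a (Suc n) * x ^ Suc n - ?a (Suc n) * (q * x) ^ Suc n = - x * (?a n * (q * x) ^ n)"
    proof -
      have "?a (Suc n) * (1 - q ^ Suc n) = - (q ^ n) * ?a n"
        using one_minus_power_nz[OF q, of n] by (simp add: field_simps)
      then have "?a (Suc n) * (1 - q ^ Suc n) * x ^ Suc n = - (q ^ n) * ?a n * x ^ Suc n"
        by (rule arg_cong)
      then show ?thesis
        by (simp del: qpoch_coeff.simps add: power_mult_distrib algebra_simps)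
    qed
  qed
  also have "\<dots> = - x * qpoch q (q * x)"
    unfolding qpoch_def using s2 by (rule suminf_mult)
  finally show ?thesis by (simp add: algebra_simps)
qed

lemma qpoch_iterate:
  assumes q: "norm q < 1" and "\<And>n. q ^ n * x \<noteq> 1" "qpoch q x = 0"
  shows "qpoch q (q ^ n * x) = 0"
proof (induction n)
  case (Suc n)
  then show ?case using qpoch_step[OF q, of "q ^ n * x"] assms(2)[of n] by (simp add: mult.assoc)
qed (use assms in simp)

text \<open>If no factor \<open>1 - q ^ n * x\<close> vanishes, the functional equation carries the
  zero at \<open>x\<close> to all points \<open>q ^ n * x\<close>. They tend to 0, where the value
  is 1.\<close>

lemma qpoch_zeroD:
  assumes q: "norm q < 1" and 0: "qpoch q x = 0" shows "\<exists>n. q ^ n * x = 1"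
proof (rule ccontr)
  assume "\<not> ?thesis"
  then have *: "\<And>n. qpoch q (q ^ n * x) = 0" using qpoch_iterate[OF q _ 0] by blast
  have "(\<lambda>n. q ^ n * x) \<longlonglongrightarrow> 0 * x" using q by (intro tendsto_intros LIMSEQ_power_zero)
  moreover have "isCont (qpoch q) 0"
    using qpoch_holomorphic[OF q] holomorphic_on_imp_continuous_on continuous_on_eq_continuous_at by blast
  ultimately have "(\<lambda>n. qpoch q (q ^ n * x)) \<longlonglongrightarrow> qpoch q 0"
    by (metis isCont_tendsto_compose mult_zero_left)
  then show False using * LIMSEQ_unique by fastforce
qed

lemma qpoch_1: "norm q < 1 \<Longrightarrow> qpoch q 1 = 0"
  using qpoch_step[of q 1] by simp

lemma exp_2pi_eq_1_iff: "exp (2 * of_real pi * \<i> * z) = 1 \<longleftrightarrow> (\<exists>m::int. z = of_int m)"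
proof
  assume "exp (2 * of_real pi * \<i> * z) = 1"
  then obtain n :: int where n: "Im (2 * of_real pi * \<i> * z) = of_int (2 * n) * pi" "Re (2 * of_real pi * \<i> * z) = 0"
    by (auto simp: exp_eq_1)
  then have "z = of_int n" by (simp add: complex_eq_iff)
  then show "\<exists>m::int. z = of_int m" by blast
next
  assume "\<exists>m::int. z = of_int m"
  then show "exp (2 * of_real pi * \<i> * z) = 1"
    by (auto simp: exp_eq_1 algebra_simps)
qed

lemma exp_2pi_int: "exp (2 * of_real pi * \<i> * of_int k) = 1"
  using exp_integer_2pi[OF Ints_of_int, of k] by (simp add: mult_ac)

lemma norm_exp_2pi_less_1: "Im \<tau> > 0 \<Longrightarrow> norm (exp (2 * of_real pi * \<i> * \<tau>)) < 1"
  and norm_exp_pi_less_1: "Im \<tau> > 0 \<Longrightarrow> norm (exp (of_real pi * \<i> * \<tau>)) < 1"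
  by (simp_all add: norm_exp_eq_Re)

text \<open>With w = exp(2 pi i z) and q = exp(2 pi i \<tau>) this is (w; q)_\<infinity> (q/w;
  q)_\<infinity>, the product side of Jacobi's triple product without the constant factor. That it
  is proportional to \<open>odd_theta\<close> times exp(2 pi i z) is obtained from Liouville's
  theorem in \<open>odd_theta_zeros\<close>.\<close>

definition qprod :: "complex \<Rightarrow> complex \<Rightarrow> complex" where
  "qprod \<tau> z = qpoch (exp (2 * of_real pi * \<i> * \<tau>)) (exp (2 * of_real pi * \<i> * z))
     * qpoch (exp (2 * of_real pi * \<i> * \<tau>)) (exp (2 * of_real pi * \<i> * (\<tau> - z)))"

lemma qpoch_compose_holomorphic:
  assumes "Im \<tau> > 0" "h holomorphic_on UNIV"
  shows "(\<lambda>z. qpoch (exp (2 * of_real pi * \<i> * \<tau>)) (h z)) holomorphic_on UNIV"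
  using holomorphic_on_compose[OF assms(2) holomorphic_on_subset[OF qpoch_holomorphic[OF norm_exp_2pi_less_1[OF assms(1)]]]]
  by (simp add: o_def)

lemma qprod_holomorphic: "Im \<tau> > 0 \<Longrightarrow> qprod \<tau> holomorphic_on UNIV"
  unfolding qprod_def
  by (intro holomorphic_on_mult qpoch_compose_holomorphic holomorphic_intros) auto

lemma exp_2pi_add_1: "exp (2 * of_real pi * \<i> * (z + 1)) = exp (2 * of_real pi * \<i> * z)"
  and exp_2pi_diff_1: "exp (2 * of_real pi * \<i> * (z - 1)) = exp (2 * of_real pi * \<i> * z)"
proof -
  show *: "exp (2 * of_real pi * \<i> * (z + 1)) = exp (2 * of_real pi * \<i> * z)" for z
    by (simp add: distrib_left exp_add)
  show "exp (2 * of_real pi * \<i> * (z - 1)) = exp (2 * of_real pi * \<i> * z)"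
    using *[of "z - 1"] by simp
qed

lemma qprod_add_1: "qprod \<tau> (z + 1) = qprod \<tau> z"
  unfolding qprod_def exp_2pi_add_1
  using exp_2pi_diff_1[of "\<tau> - z"] by (simp add: diff_diff_eq)

lemma qprod_add_tau:
  assumes t: "Im \<tau> > 0"
  shows "qprod \<tau> (z + \<tau>) = - exp (- 2 * of_real pi * \<i> * z) * qprod \<tau> z"
proof -
  define q w where "q = exp (2 * of_real pi * \<i> * \<tau>)" and "w = exp (2 * of_real pi * \<i> * z)"
  have q: "norm q < 1" using norm_exp_2pi_less_1[OF t] by (simp add: q_def)
  have w: "w \<noteq> 0" by (simp add: w_def)
  have inv: "exp (- 2 * of_real pi * \<i> * z) = 1 / w"
    by (simp add: w_def exp_minus field_simps)
  have P: "qprod \<tau> z = qpoch q w * qpoch q (q / w)"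
    by (simp add: qprod_def q_def w_def right_diff_distrib exp_diff)
  have Pt: "qprod \<tau> (z + \<tau>) = qpoch q (q * w) * qpoch q (1 / w)"
    by (simp add: qprod_def q_def w_def distrib_left exp_add exp_minus field_simps)
  show ?thesis
  proof (cases "w = 1")
    \<comment> \<open>The factor 1 - w cannot be cancelled here, but both sides contain
      \<open>qpoch q 1 = 0\<close>.\<close>
    case True
    then show ?thesis using qpoch_1[OF q] by (simp add: P Pt)
  next
    case False
    have "(1 - w) * qprod \<tau> (z + \<tau>) = qpoch q w * qpoch q (1 / w)"
      using qpoch_step[OF q, of w] by (simp add: Pt)
    also have "qpoch q (1 / w) = (1 - 1 / w) * qpoch q (q / w)"
      using qpoch_step[OF q, of "1 / w"] by simp
    finally have "(1 - w) * qprod \<tau> (z + \<tau>) = (1 - 1 / w) * qprod \<tau> z" by (simp add: P)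
    also have "\<dots> = (1 - w) * (- (1 / w) * qprod \<tau> z)" using w by (simp add: field_simps)
    finally show ?thesis
      unfolding inv by (rule mult_left_cancel[THEN iffD1, rotated]) (use False in simp)
  qed
qed

lemma qprod_zeroD:
  assumes t: "Im \<tau> > 0" and 0: "qprod \<tau> z = 0" shows "z \<in> lattice \<tau>"
proof -
  define q where "q = exp (2 * of_real pi * \<i> * \<tau>)"
  have q: "norm q < 1" using norm_exp_2pi_less_1[OF t] by (simp add: q_def)
  have qn: "q ^ n * exp (2 * of_real pi * \<i> * x) = exp (2 * of_real pi * \<i> * (of_nat n * \<tau> + x))" for n x
    by (simp add: q_def exp_of_nat_mult[symmetric] exp_add[symmetric] algebra_simps)
  have "(\<exists>n. q ^ n * exp (2 * of_real pi * \<i> * z) = 1) \<or> (\<exists>n. q ^ n * exp (2 * of_real pi * \<i> * (\<tau> - z)) = 1)"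
    using 0 qpoch_zeroD[OF q] unfolding qprod_def q_def[symmetric] by auto
  then obtain n :: nat and m :: int where "of_nat n * \<tau> + z = of_int m \<or> of_nat n * \<tau> + (\<tau> - z) = of_int m"
    unfolding qn exp_2pi_eq_1_iff by blast
  then have "z = of_int m + of_int (- int n) * \<tau> \<or> z = of_int (- m) + of_int (int n + 1) * \<tau>"
    by (auto simp: algebra_simps)
  then show ?thesis using latticeI by metis
qed

lemma qprod_0: assumes "Im \<tau> > 0" shows "qprod \<tau> 0 = 0"
  using qpoch_1[OF norm_exp_2pi_less_1[OF assms]] by (simp add: qprod_def)

text \<open>Splitting off the factor 1 - exp(2 pi i z), which has a simple zero at 0, leaves
  \<open>G\<close> with \<open>G 0 = (qpoch q q)\<^sup>2\<close>. This is nonzero since no power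
  \<open>q ^ Suc n\<close> equals 1.\<close>

lemma deriv_qprod_0:
  assumes t: "Im \<tau> > 0" shows "deriv (qprod \<tau>) 0 \<noteq> 0"
proof -
  define q where "q = exp (2 * of_real pi * \<i> * \<tau>)"
  have q: "norm q < 1" using norm_exp_2pi_less_1[OF t] by (simp add: q_def)
  define G where "G = (\<lambda>z. qpoch q (exp (2 * of_real pi * \<i> * (z + \<tau>))) * qpoch q (exp (2 * of_real pi * \<i> * (\<tau> - z))))"
  have G: "G holomorphic_on UNIV" unfolding G_def q_def
    by (intro holomorphic_on_mult qpoch_compose_holomorphic holomorphic_intros t)
  have eq: "qprod \<tau> z = (1 - exp (2 * of_real pi * \<i> * z)) * G z" for z
  proof -
    have "exp (2 * of_real pi * \<i> * (z + \<tau>)) = q * exp (2 * of_real pi * \<i> * z)"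
      by (simp add: q_def distrib_left exp_add)
    then show ?thesis
      using qpoch_step[OF q, of "exp (2 * of_real pi * \<i> * z)"]
      by (simp add: qprod_def G_def flip: q_def)
  qed
  obtain G' where G': "(G has_field_derivative G') (at 0)"
    using G by (meson UNIV_I field_differentiable_def holomorphic_on_imp_differentiable_at open_UNIV)
  have "((\<lambda>z. (1 - exp (2 * of_real pi * \<i> * z)) * G z) has_field_derivative - (2 * of_real pi * \<i>) * G 0) (at 0)"
    by (rule derivative_eq_intros G' refl | simp)+
  then have "deriv (qprod \<tau>) 0 = - (2 * of_real pi * \<i>) * G 0"
    unfolding eq[symmetric, abs_def] by (simp add: DERIV_imp_deriv)
  moreover have "G 0 \<noteq> 0"
  proof
    assume "G 0 = 0"
    then have "qpoch q q = 0" by (simp add: G_def q_def)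
    then obtain n where "q ^ n * q = 1" using qpoch_zeroD[OF q] by blast
    then show False using one_minus_power_nz[OF q, of n] by (simp add: mult.commute)
  qed
  ultimately show ?thesis by simp
qed

lemma quasi_periodic_zero:
  assumes "l \<in> lattice \<tau>" "F 0 = (0::complex)"
    and 1: "\<And>z. F (z + 1) = F z" and 2: "\<And>z. F (z + \<tau>) = M z * F z" "\<And>z. M z \<noteq> 0"
  shows "F l = 0"
  using assms(1)
proof (induction rule: lattice_induct)
  case (minus_one x) then show ?case using 1[of "x - 1"] by simp
next
  case (minus_tau x) then show ?case using 2(1)[of "x - \<tau>"] 2(2) by simp
qed (use assms in simp_all)

lemma quasi_periodic_deriv:
  assumes F: "F holomorphic_on UNIV" and M: "M holomorphic_on UNIV"
    and 2: "\<And>z. F (z + l) = M z * F z" and z: "F z = (0::complex)"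
  shows "deriv F (z + l) = M z * deriv F z"
proof -
  have dF: "(F has_field_derivative deriv F z) (at z)" for z
    using F by (meson UNIV_I holomorphic_derivI open_UNIV)
  have dM: "(M has_field_derivative deriv M z) (at z)" for z
    using M by (meson UNIV_I holomorphic_derivI open_UNIV)
  have "((\<lambda>z. F (z + l)) has_field_derivative deriv F (z + l)) (at z)"
    using dF[of "z + l"] by (simp add: DERIV_shift)
  moreover have "((\<lambda>z. M z * F z) has_field_derivative M z * deriv F z) (at z)"
    using DERIV_mult[OF dM[of z] dF[of z]] z by (simp add: mult.commute)
  ultimately show ?thesis using DERIV_unique unfolding 2 by blast
qed

text \<open>Both conclusions go through one induction: the derivative picks up just the multiplier
  \<open>M\<close> only at points where \<open>F\<close> vanishes, since the term with the
  derivative of \<open>M\<close> must drop out.\<close>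

lemma quasi_periodic_deriv_nonzero:
  assumes "l \<in> lattice \<tau>" and F: "F holomorphic_on UNIV" and "F 0 = (0::complex)" "deriv F 0 \<noteq> 0"
    and 1: "\<And>z. F (z + 1) = F z" and 2: "\<And>z. F (z + \<tau>) = M z * F z" "\<And>z. M z \<noteq> 0" "M holomorphic_on UNIV"
  shows "F l = 0 \<and> deriv F l \<noteq> 0"
  using assms(1)
proof -
  have dF: "(F has_field_derivative deriv F z) (at z)" for z
    using F by (meson UNIV_I holomorphic_derivI open_UNIV)
  have d1: "deriv F (z + 1) = deriv F z" for z
  proof -
    have "((\<lambda>z. F (z + 1)) has_field_derivative deriv F (z + 1)) (at z)"
      using dF[of "z + 1"] by (simp add: DERIV_shift)
    then show ?thesis using dF[of z] DERIV_unique unfolding 1 by blast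
  qed
  have d2: "deriv F (z + \<tau>) = M z * deriv F z" if "F z = 0" for z
    using quasi_periodic_deriv[OF F 2(3,1) that] .
  show ?thesis
    using assms(1)
  proof (induction rule: lattice_induct)
    case (one x) then show ?case using 1[of x] d1[of x] by simp
  next
    case (minus_one x) then show ?case using 1[of "x - 1"] d1[of "x - 1"] by simp
  next
    case (tau x) then show ?case using 2(1)[of x] d2[of x] 2(2) by simp
  next
    case (minus_tau x)
    then have "F (x - \<tau>) = 0" using 2(1)[of "x - \<tau>"] 2(2) by simp
    then show ?case using minus_tau d2[of "x - \<tau>"] by simp
  qed (use assms in simp_all)
qed

section \<open>The Theta series as an entire function\<close>

lemma summable_gauss:
  assumes Q: "norm Q < 1" shows "summable (\<lambda>n. Q ^ (n\<^sup>2) * (x::complex) ^ n)"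
proof (rule summable_ratio_tendsto_0[where r = "\<lambda>n. norm (Q ^ (2 * n + 1) * x)"])
  have "(\<lambda>n. Q ^ n) \<longlonglongrightarrow> 0" using Q by (rule LIMSEQ_power_zero)
  then have "(\<lambda>n. Q ^ (2 * n + 1)) \<longlonglongrightarrow> 0"
    by (rule LIMSEQ_subseq_LIMSEQ[unfolded o_def]) (simp add: strict_mono_def)
  then have "(\<lambda>n. Q ^ (2 * n + 1) * x) \<longlonglongrightarrow> 0 * x" by (rule tendsto_mult_right)
  then show "(\<lambda>n. norm (Q ^ (2 * n + 1) * x)) \<longlonglongrightarrow> 0" using tendsto_norm_zero by force
  fix n
  have "(Suc n)\<^sup>2 = (2 * n + 1) + n\<^sup>2" by (simp add: power2_eq_square)
  then show "Q ^ ((Suc n)\<^sup>2) * x ^ Suc n = norm (Q ^ (2 * n + 1) * x) *\<^sub>R (Q ^ (n\<^sup>2) * x ^ n)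
    \<or> norm (Q ^ ((Suc n)\<^sup>2) * x ^ Suc n) \<le> \<bar>norm (Q ^ (2 * n + 1) * x)\<bar> * norm (Q ^ (n\<^sup>2) * x ^ n)"
    by (simp only: power_add) (simp add: norm_mult norm_power)
qed

text \<open>One half of the Theta series: with Q = exp(pi i \<tau>) and x = exp(2 pi i z) it
  collects the indices m \<ge> 0. The indices m \<le> 0 give the same series at -z, and the term m =
  0, counted twice, explains the \<open>- 1\<close> in \<open>Theta_eq\<close>.\<close>

definition gauss_sum_series :: "complex \<Rightarrow> complex \<Rightarrow> complex" where
  "gauss_sum_series Q x = (\<Sum>n. Q ^ (n\<^sup>2) * x ^ n)"

lemma gauss_holomorphic: "norm Q < 1 \<Longrightarrow> gauss_sum_series Q holomorphic_on UNIV"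
  using termdiffs_strong_converges_everywhere[OF summable_gauss, of Q]
  unfolding gauss_sum_series_def holomorphic_on_def field_differentiable_def by auto

lemma summable_on_gauss:
  assumes Q: "norm Q < 1"
  shows "((\<lambda>n::nat. Q ^ (n\<^sup>2) * x ^ n) has_sum gauss_sum_series Q x) UNIV"
proof -
  have "summable (\<lambda>n. norm (Q ^ (n\<^sup>2) * x ^ n))"
    using summable_gauss[of "of_real (norm Q)" "of_real (norm x)"] Q
    by (simp add: norm_mult norm_power flip: of_real_power of_real_mult add: summable_of_real_iff)
  then show ?thesis
    unfolding gauss_sum_series_def
    by (rule norm_summable_imp_has_sum[OF _ summable_sums[OF summable_gauss[OF Q]]])
qed

abbreviation "theta_term \<tau> z m \<equiv>
  exp (of_real pi * \<i> * (of_int m)\<^sup>2 * \<tau>) * exp (2 * of_real pi * \<i> * of_int m * z)"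

lemma theta_term_nat:
  "theta_term \<tau> z (int n) = exp (of_real pi * \<i> * \<tau>) ^ (n\<^sup>2) * exp (2 * of_real pi * \<i> * z) ^ n"
  by (simp add: exp_of_nat_mult[symmetric] algebra_simps power2_eq_square)

lemma theta_term_minus: "theta_term \<tau> z (- m) = theta_term \<tau> (- z) m"
  by simp

lemma theta_has_sum:
  assumes t: "Im \<tau> > 0"
  shows "(theta_term \<tau> z has_sum
    (gauss_sum_series (exp (of_real pi * \<i> * \<tau>)) (exp (2 * of_real pi * \<i> * z))
     + (gauss_sum_series (exp (of_real pi * \<i> * \<tau>)) (exp (2 * of_real pi * \<i> * (- z))) - 1))) UNIV"
proof -
  let ?Q = "exp (of_real pi * \<i> * \<tau>)"
  have Q: "norm ?Q < 1" using norm_exp_pi_less_1[OF t] .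
  have nat: "((\<lambda>n. theta_term \<tau> z (int n)) has_sum gauss_sum_series ?Q (exp (2 * of_real pi * \<i> * z))) UNIV" for z
    unfolding theta_term_nat by (rule summable_on_gauss[OF Q])
  have 1: "(theta_term \<tau> z has_sum gauss_sum_series ?Q (exp (2 * of_real pi * \<i> * z))) (range int)"
    using nat[of z] by (subst has_sum_reindex) (auto simp: o_def)
  have s0: "((\<lambda>n. theta_term \<tau> (- z) (int n)) has_sum theta_term \<tau> (- z) (int 0)) {0}"
    using has_sum_finite[of "{0::nat}" "\<lambda>n. theta_term \<tau> (- z) (int n)"] by simp
  have "((\<lambda>n. theta_term \<tau> (- z) (int n)) has_sum (gauss_sum_series ?Q (exp (2 * of_real pi * \<i> * (- z))) - 1)) (UNIV - {0})"
    using has_sum_Diff[OF nat[of "- z"] s0] by simp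
  then have "((\<lambda>n. theta_term \<tau> z (- int n)) has_sum (gauss_sum_series ?Q (exp (2 * of_real pi * \<i> * (- z))) - 1)) (UNIV - {0})"
    unfolding theta_term_minus .
  then have 2: "(theta_term \<tau> z has_sum (gauss_sum_series ?Q (exp (2 * of_real pi * \<i> * (- z))) - 1)) ((\<lambda>n. - int n) ` (UNIV - {0}))"
    by (subst has_sum_reindex) (auto simp: o_def inj_on_def)
  have U: "range int \<union> (\<lambda>n. - int n) ` (UNIV - {0}) = UNIV"
  proof -
    have "x \<in> range int \<union> (\<lambda>n. - int n) ` (UNIV - {0})" for x
    proof (cases "x \<ge> 0")
      case True
      then show ?thesis by (intro UnI1 range_eqI[of _ _ "nat x"]) simp
    next
      case False
      then show ?thesis by (intro UnI2 image_eqI[of _ _ "nat (- x)"]) auto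
    qed
    then show ?thesis by (rule UNIV_eq_I[symmetric])
  qed
  have "range int \<inter> (\<lambda>n. - int n) ` (UNIV - {0}) = {}" by fastforce
  from has_sum_Un_disjoint[OF 1 2 this] show ?thesis unfolding U .
qed

lemma Theta_eq:
  assumes t: "Im \<tau> > 0"
  shows "Theta \<tau> z = gauss_sum_series (exp (of_real pi * \<i> * \<tau>)) (exp (2 * of_real pi * \<i> * z))
     + gauss_sum_series (exp (of_real pi * \<i> * \<tau>)) (exp (2 * of_real pi * \<i> * (- z))) - 1"
  unfolding Theta_def using infsumI[OF theta_has_sum[OF t, of z]] by simp

lemma Theta_holomorphic: assumes t: "Im \<tau> > 0" shows "Theta \<tau> holomorphic_on UNIV"
proof -
  have *: "(\<lambda>z. gauss_sum_series (exp (of_real pi * \<i> * \<tau>)) (h z)) holomorphic_on UNIV" if "h holomorphic_on UNIV" for h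
    using holomorphic_on_compose[OF that holomorphic_on_subset[OF gauss_holomorphic[OF norm_exp_pi_less_1[OF t]]]]
    by (simp add: o_def)
  show ?thesis
    unfolding Theta_eq[OF t, abs_def] by (intro holomorphic_intros *)
qed

lemma Theta_add_1: "Im \<tau> > 0 \<Longrightarrow> Theta \<tau> (z + 1) = Theta \<tau> z"
  unfolding Theta_eq exp_2pi_add_1 using exp_2pi_diff_1[of "- z"] by simp

lemma Theta_minus: "Im \<tau> > 0 \<Longrightarrow> Theta \<tau> (- z) = Theta \<tau> z"
  by (simp add: Theta_eq)

text \<open>Completing the square, m^2 \<tau> + 2 m \<tau> = (m + 1)^2 \<tau> - \<tau>, turns the
  translation by \<tau> into the index shift m \<mapsto> m + 1.\<close>

lemma Theta_add_tau:
  assumes t: "Im \<tau> > 0"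
  shows "Theta \<tau> (z + \<tau>) = exp (- (of_real pi * \<i> * \<tau>) - 2 * of_real pi * \<i> * z) * Theta \<tau> z"
proof -
  have eq: "theta_term \<tau> (z + \<tau>) m = exp (- (of_real pi * \<i> * \<tau>) - 2 * of_real pi * \<i> * z) * theta_term \<tau> z (m + 1)" for m
    unfolding exp_add[symmetric] mult_exp_exp by (simp add: algebra_simps power2_eq_square)
  have "Theta \<tau> (z + \<tau>) = exp (- (of_real pi * \<i> * \<tau>) - 2 * of_real pi * \<i> * z) * (\<Sum>\<^sub>\<infinity>m. theta_term \<tau> z (m + 1))"
    unfolding Theta_def eq by (rule infsum_cmult_right')
  also have "(\<Sum>\<^sub>\<infinity>m. theta_term \<tau> z (m + 1)) = Theta \<tau> z"
    unfolding Theta_def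
    by (rule infsum_reindex_bij_betw[where g = "\<lambda>m. m + 1"]) (rule bij_betwI[where g = "\<lambda>m. m - 1"], auto)
  finally show ?thesis .
qed

text \<open>If Theta vanished, the half series \<open>B\<close> would satisfy B(w) = 1 - B(1/w) for
  w \<noteq> 0. It would then tend to 1 - B(0) = 0 at infinity and be constantly 0 by Liouville,
  against B(0) = 1.\<close>

lemma Theta_not_identically_0: assumes t: "Im \<tau> > 0" shows "\<exists>z. Theta \<tau> z \<noteq> 0"
proof (rule ccontr)
  assume "\<not> ?thesis"
  then have 0: "\<And>z. Theta \<tau> z = 0" by blast
  define B where "B = gauss_sum_series (exp (of_real pi * \<i> * \<tau>))"
  have B: "B holomorphic_on UNIV" unfolding B_def by (rule gauss_holomorphic[OF norm_exp_pi_less_1[OF t]])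
  have B0: "B 0 = 1"
  proof -
    have "B 0 = (\<Sum>n. if n = 0 then 1 else 0 :: complex)"
      unfolding B_def gauss_sum_series_def by (rule suminf_cong) auto
    also have "\<dots> = (\<Sum>n\<in>{0::nat}. if n = 0 then 1 else 0 :: complex)"
      by (rule suminf_finite) auto
    finally show ?thesis by simp
  qed
  have eq: "B w = 1 - B (1 / w)" if "w \<noteq> 0" for w
  proof -
    define z where "z = Ln w / (2 * of_real pi * \<i>)"
    have "exp (2 * of_real pi * \<i> * z) = w" using that by (simp add: z_def)
    moreover from this have "exp (2 * of_real pi * \<i> * (- z)) = 1 / w" by (simp add: exp_minus field_simps)
    ultimately show ?thesis using 0[of z] unfolding Theta_eq[OF t] B_def by (simp add: algebra_simps)
  qed
  have "(\<lambda>w. B (inverse w)) \<midarrow>0\<rightarrow> 1 - B 0"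
  proof (rule Lim_transform_eventually)
    have "B \<midarrow>0\<rightarrow> B 0"
      using B holomorphic_on_imp_continuous_on continuous_on_eq_continuous_at isCont_def by blast
    then show "(\<lambda>w. 1 - B w) \<midarrow>0\<rightarrow> 1 - B 0" by (intro tendsto_intros)
    have ev: "1 - B w = B (inverse w)" if "w \<noteq> 0" for w
      using that arg_cong[OF eq[of w], of "\<lambda>x. 1 - x"] by (simp add: inverse_eq_divide)
    show "\<forall>\<^sub>F w in at 0. 1 - B w = B (inverse w)"
      unfolding eventually_at_filter by (intro always_eventually allI impI ev)
  qed
  then have "(B \<longlongrightarrow> 1 - B 0) at_infinity" by (simp add: lim_at_infinity_0 o_def)
  then have "\<And>z. B z = 1 - B 0" using Liouville_weak[OF B] by blast
  from this[of 0] show False using B0 by simp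
qed

section \<open>The zeros of the translated Theta function\<close>

text \<open>Up to the factor \<open>exp (pi * \<i> * z)\<close> this is an odd function.\<close>

definition odd_theta :: "complex \<Rightarrow> complex \<Rightarrow> complex" where
  "odd_theta \<tau> z = Theta \<tau> (z + theta_zero \<tau>)"

lemma odd_theta_holomorphic: "Im \<tau> > 0 \<Longrightarrow> odd_theta \<tau> holomorphic_on UNIV"
proof -
  assume t: "Im \<tau> > 0"
  have "(\<lambda>z. z + theta_zero \<tau>) holomorphic_on UNIV" by (intro holomorphic_intros)
  from holomorphic_on_compose[OF this holomorphic_on_subset[OF Theta_holomorphic[OF t]]]
  show ?thesis by (simp add: o_def odd_theta_def[abs_def])
qed

lemma deriv_odd_theta: "deriv (odd_theta \<tau>) z = deriv (Theta \<tau>) (z + theta_zero \<tau>)"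
  unfolding deriv_def odd_theta_def[abs_def] DERIV_shift ..

lemma odd_theta_add_1: "Im \<tau> > 0 \<Longrightarrow> odd_theta \<tau> (z + 1) = odd_theta \<tau> z"
  unfolding odd_theta_def using Theta_add_1[of \<tau> "z + theta_zero \<tau>"] by (simp add: algebra_simps)

abbreviation "theta_mult \<tau> z \<equiv> - exp (- 2 * of_real pi * \<i> * \<tau> - 2 * of_real pi * \<i> * z)"

lemma odd_theta_add_tau:
  assumes t: "Im \<tau> > 0" shows "odd_theta \<tau> (z + \<tau>) = theta_mult \<tau> z * odd_theta \<tau> z"
proof -
  have "exp (- (of_real pi * \<i> * \<tau>) - 2 * of_real pi * \<i> * (z + theta_zero \<tau>))
    = exp (- 2 * of_real pi * \<i> * \<tau> - 2 * of_real pi * \<i> * z - of_real pi * \<i>)"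
    by (rule arg_cong[of _ _ exp]) (simp add: theta_zero_def field_simps)
  also have "\<dots> = theta_mult \<tau> z"
    by (subst exp_diff) (simp add: mult.commute[of _ \<i>])
  finally show ?thesis
    unfolding odd_theta_def using Theta_add_tau[OF t, of "z + theta_zero \<tau>"] by (simp add: add_ac)
qed

text \<open>Theta is even and \<open>theta_zero\<close> equals its negative plus \<tau> + 1, so the
  two translation laws give Theta(\<open>theta_zero\<close>) =
  -Theta(\<open>theta_zero\<close>).\<close>

lemma odd_theta_0: assumes t: "Im \<tau> > 0" shows "odd_theta \<tau> 0 = 0"
proof -
  let ?z = "theta_zero \<tau>"
  have "Theta \<tau> ?z = Theta \<tau> (- ?z + \<tau> + 1)" by (rule arg_cong) (simp add: theta_zero_def field_simps)
  also have "\<dots> = exp (- (of_real pi * \<i> * \<tau>) - 2 * of_real pi * \<i> * (- ?z)) * Theta \<tau> (- ?z)"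
    unfolding Theta_add_1[OF t] Theta_add_tau[OF t] ..
  also have "exp (- (of_real pi * \<i> * \<tau>) - 2 * of_real pi * \<i> * (- ?z)) = exp (of_real pi * \<i>)"
    by (rule arg_cong[of _ _ exp]) (simp add: theta_zero_def field_simps)
  finally show ?thesis by (simp add: odd_theta_def Theta_minus[OF t] mult.commute[of _ \<i>])
qed

text \<open>After multiplication by exp(2 pi i z) the function has the same multipliers as
  \<open>qprod\<close>. It vanishes on the lattice, where \<open>qprod\<close> has its only zeros,
  all simple. The quotient \<open>E\<close> is therefore entire and doubly periodic, hence a
  constant, and the constant is nonzero because Theta is not identically 0. Zeros and simplicity are
  inherited from \<open>qprod\<close>.\<close>

lemma odd_theta_zeros:
  assumes t: "Im \<tau> > 0"
  shows "odd_theta \<tau> z = 0 \<longleftrightarrow> z \<in> lattice \<tau>"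
    and "z \<in> lattice \<tau> \<Longrightarrow> deriv (odd_theta \<tau>) z \<noteq> 0"
proof -
  let ?P = "qprod \<tau>" and ?e = "\<lambda>z. exp (2 * of_real pi * \<i> * z)"
  define F where "F = (\<lambda>z. odd_theta \<tau> z * ?e z)"
  have F: "F holomorphic_on UNIV" unfolding F_def
    by (intro holomorphic_intros odd_theta_holomorphic t)
  have F0: "F 0 = 0" by (simp add: F_def odd_theta_0[OF t])
  have F1: "F (z + 1) = F z" for z by (simp only: F_def odd_theta_add_1[OF t] exp_2pi_add_1)
  have Ft: "F (z + \<tau>) = - exp (- 2 * of_real pi * \<i> * z) * F z" for z
  proof -
    have "theta_mult \<tau> z * ?e (z + \<tau>) = - 1"
      by (simp add: mult_exp_exp algebra_simps)
    then have "F (z + \<tau>) = - odd_theta \<tau> z"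
      unfolding F_def odd_theta_add_tau[OF t] by (metis mult.commute mult.left_commute mult_minus1_right)
    then show ?thesis by (simp add: F_def exp_minus)
  qed
  have P: "?P holomorphic_on UNIV" by (rule qprod_holomorphic[OF t])
  have Pl: "?P z = 0 \<and> deriv ?P z \<noteq> 0" if "z \<in> lattice \<tau>" for z
    by (rule quasi_periodic_deriv_nonzero[OF that P qprod_0[OF t] deriv_qprod_0[OF t] qprod_add_1 qprod_add_tau[OF t]])
       (auto intro!: holomorphic_intros)
  have Fl: "F z = 0" if "z \<in> lattice \<tau>" for z
    by (rule quasi_periodic_zero[OF that F0 F1 Ft]) auto
  define E where "E = (\<lambda>z. if ?P z = 0 then deriv F z / deriv ?P z else F z / ?P z)"
  have E: "E holomorphic_on UNIV"
    unfolding E_def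
    by (rule holomorphic_divide_simple_zeros[OF open_UNIV F P]) (use Pl Fl qprod_zeroD[OF t] in auto)
  have FE: "F z = E z * ?P z" for z
    using Fl[of z] qprod_zeroD[OF t, of z] by (auto simp: E_def)
  \<comment> \<open>On the lattice \<open>E\<close> is a quotient of derivatives; at a common zero
    these transform with the same factor \<open>c\<close> as the functions, so the factor cancels
    there too.\<close>
  have per: "E (z + l) = E z" if ev: "\<And>z. F (z + l) = c z * F z" "\<And>z. ?P (z + l) = c z * ?P z" "\<And>z. c z \<noteq> 0"
    and c: "c holomorphic_on UNIV" for z l c
  proof (cases "?P z = 0")
    case True
    then have "F z = 0" using Fl qprod_zeroD[OF t] by blast
    then show ?thesis
      using quasi_periodic_deriv[OF F c ev(1)] quasi_periodic_deriv[OF P c ev(2)] True ev by (simp add: E_def)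
  next
    case False
    then show ?thesis using ev by (simp add: E_def)
  qed
  have dtheta: "E (z + 1) = E z" for z
    by (rule per[where c = "\<lambda>_. 1"]) (simp_all add: F1 qprod_add_1)
  have Et: "E (z + \<tau>) = E z" for z
    by (rule per[where c = "\<lambda>z. - exp (- 2 * of_real pi * \<i> * z)"])
       (use Ft qprod_add_tau[OF t] in \<open>auto intro!: holomorphic_intros\<close>)
  obtain c where c: "\<And>z. E z = c"
    using doubly_periodic_entire_constant[OF t E dtheta Et] by blast
  have "c \<noteq> 0"
  proof
    assume "c = 0"
    then have "F z = 0" for z using FE c by simp
    then have "odd_theta \<tau> z = 0" for z by (simp add: F_def)
    then have "Theta \<tau> z = 0" for z
      unfolding odd_theta_def by (metis diff_add_cancel)
    then show False using Theta_not_identically_0[OF t] by simp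
  qed
  have eq: "odd_theta \<tau> z = c * (?P z * exp (- 2 * of_real pi * \<i> * z))" for z
    using FE[of z] c by (simp add: F_def exp_minus field_simps)
  show "odd_theta \<tau> z = 0 \<longleftrightarrow> z \<in> lattice \<tau>"
    using eq[of z] Pl[of z] qprod_zeroD[OF t, of z] \<open>c \<noteq> 0\<close> by auto
  show "deriv (odd_theta \<tau>) z \<noteq> 0" if z: "z \<in> lattice \<tau>"
  proof -
    have dP: "(?P has_field_derivative deriv ?P z) (at z)"
      using P by (meson UNIV_I holomorphic_derivI open_UNIV)
    have "((\<lambda>z. c * (?P z * exp (- 2 * of_real pi * \<i> * z))) has_field_derivative
      c * (deriv ?P z * exp (- 2 * of_real pi * \<i> * z))) (at z)"
      by (rule derivative_eq_intros dP refl | simp add: Pl z)+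
    then have "deriv (odd_theta \<tau>) z = c * (deriv ?P z * exp (- 2 * of_real pi * \<i> * z))"
      unfolding eq[abs_def] by (rule DERIV_imp_deriv)
    then show ?thesis using Pl[OF z] \<open>c \<noteq> 0\<close> by simp
  qed
qed

section \<open>Regularised theta kernels\<close>

text \<open>\<open>P\<close> and \<open>Q\<close> are the Wirtinger derivatives of \<open>f\<close>
  with respect to z and to its conjugate, read off from the real differential.\<close>

definition has_wirt :: "(complex \<Rightarrow> complex) \<Rightarrow> complex \<Rightarrow> complex \<Rightarrow> complex \<Rightarrow> bool" where
  "has_wirt f P Q z \<longleftrightarrow> (f has_derivative (\<lambda>h. P * h + Q * cnj h)) (at z)"

definition dz :: "(complex \<Rightarrow> complex) \<Rightarrow> complex \<Rightarrow> complex" where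
  "dz f z = (frechet_derivative f (at z) 1 - \<i> * frechet_derivative f (at z) \<i>) / 2"

definition dzb :: "(complex \<Rightarrow> complex) \<Rightarrow> complex \<Rightarrow> complex" where
  "dzb f z = (frechet_derivative f (at z) 1 + \<i> * frechet_derivative f (at z) \<i>) / 2"

definition C1c :: "(complex \<Rightarrow> complex) \<Rightarrow> bool" where
  "C1c f \<longleftrightarrow> (\<forall>z. f differentiable (at z)) \<and> continuous_on UNIV (dz f) \<and> continuous_on UNIV (dzb f)"

lemma has_wirt_unique:
  assumes "has_wirt f P Q z" shows "dz f z = P" "dzb f z = Q"
proof -
  have "frechet_derivative f (at z) = (\<lambda>h. P * h + Q * cnj h)"
    using assms unfolding has_wirt_def by (metis frechet_derivative_at)
  then show "dz f z = P" "dzb f z = Q" by (simp_all add: dz_def dzb_def algebra_simps)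
qed

lemma has_wirt_differentiable: "has_wirt f P Q z \<Longrightarrow> f differentiable (at z)"
  unfolding has_wirt_def by (rule differentiableI)

lemma differentiable_has_wirt:
  assumes "f differentiable (at z)" shows "has_wirt f (dz f z) (dzb f z) z"
proof -
  let ?D = "frechet_derivative f (at z)"
  have D: "(f has_derivative ?D) (at z)" using assms by (simp add: frechet_derivative_works)
  interpret D: bounded_linear ?D using D by (rule has_derivative_bounded_linear)
  have "?D h = dz f z * h + dzb f z * cnj h" for h
  proof -
    have "?D h = ?D (Re h *\<^sub>R 1 + Im h *\<^sub>R \<i>)"
      by (rule arg_cong) (simp add: complex_eq_iff)
    also have "\<dots> = Re h *\<^sub>R ?D 1 + Im h *\<^sub>R ?D \<i>" by (simp only: D.add D.scaleR)
    also have "\<dots> = dz f z * h + dzb f z * cnj h"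
    proof -
      define x y where "x = Re h" and "y = Im h"
      have h: "h = of_real x + \<i> * of_real y" "cnj h = of_real x - \<i> * of_real y"
        by (simp_all add: complex_eq_iff x_def y_def)
      have i: "\<i> * (\<i> * x) = - x" for x by (simp add: mult.assoc[symmetric])
      show ?thesis
        unfolding x_def[symmetric] y_def[symmetric] dz_def dzb_def h(2) scaleR_conv_of_real
        unfolding h(1) by (simp add: field_simps i)
    qed
    finally show ?thesis .
  qed
  then have eq: "?D = (\<lambda>h. dz f z * h + dzb f z * cnj h)" by (rule ext)
  show ?thesis unfolding has_wirt_def eq[symmetric] by (rule D)
qed

lemma C1c_has_wirt: "C1c f \<Longrightarrow> has_wirt f (dz f z) (dzb f z) z"
  by (auto simp: C1c_def intro: differentiable_has_wirt)

text \<open>The formulas for the derivatives may change with the ball. For the theta kernels they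
  involve the finitely many lattice points near that ball and a remainder holomorphic only on
  it.\<close>

lemma C1cI_local:
  assumes "\<And>M. \<exists>P Q. continuous_on (ball 0 M) P \<and> continuous_on (ball 0 M) Q
     \<and> (\<forall>z\<in>ball 0 M. has_wirt f (P z) (Q z) z)"
  shows "C1c f"
proof -
  have cont: "isCont (dz f) z \<and> isCont (dzb f) z \<and> f differentiable (at z)" for z
  proof -
    obtain P Q where PQ: "continuous_on (ball 0 (norm z + 1)) P" "continuous_on (ball 0 (norm z + 1)) Q"
     "\<And>w. w\<in>ball 0 (norm z + 1) \<Longrightarrow> has_wirt f (P w) (Q w) w" using assms[of "norm z + 1"] by blast
    have z: "z \<in> ball 0 (norm z + 1)" by simp
    have "isCont P z" "isCont Q z"
      using PQ(1,2) z by (auto simp: continuous_on_eq_continuous_at)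
    moreover have "eventually (\<lambda>w. w \<in> ball 0 (norm z + 1)) (nhds z)"
      using z by (intro eventually_nhds_in_open) auto
    then have "eventually (\<lambda>w. dz f w = P w) (nhds z)" "eventually (\<lambda>w. dzb f w = Q w) (nhds z)"
      using has_wirt_unique[OF PQ(3)] by (auto elim!: eventually_mono)
    ultimately show ?thesis
      using has_wirt_differentiable[OF PQ(3)[OF z]] isCont_cong by blast
  qed
  then show ?thesis unfolding C1c_def by (auto intro!: continuous_at_imp_continuous_on)
qed

lemma C1cI:
  assumes "\<And>z. has_wirt f (P z) (Q z) z" "continuous_on UNIV P" "continuous_on UNIV Q"
  shows "C1c f"
  using assms by (intro C1cI_local) (meson continuous_on_subset subset_UNIV)

lemma C1c_continuous: "C1c f \<Longrightarrow> continuous_on UNIV f"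
  unfolding C1c_def by (auto intro!: continuous_at_imp_continuous_on differentiable_imp_continuous_within)

lemma has_wirt_const: "has_wirt (\<lambda>_. c) 0 0 z"
  unfolding has_wirt_def by simp

lemma has_wirt_holo: "(f has_field_derivative D) (at z) \<Longrightarrow> has_wirt f D 0 z"
  unfolding has_wirt_def has_field_derivative_def by simp

lemma has_wirt_add: "has_wirt f P Q z \<Longrightarrow> has_wirt g P' Q' z \<Longrightarrow> has_wirt (\<lambda>z. f z + g z) (P + P') (Q + Q') z"
  unfolding has_wirt_def by (auto intro!: derivative_eq_intros simp: algebra_simps)

lemma has_wirt_diff: "has_wirt f P Q z \<Longrightarrow> has_wirt g P' Q' z \<Longrightarrow> has_wirt (\<lambda>z. f z - g z) (P - P') (Q - Q') z"
  unfolding has_wirt_def by (auto intro!: derivative_eq_intros simp: algebra_simps)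

lemma has_wirt_mult: "has_wirt f P Q z \<Longrightarrow> has_wirt g P' Q' z \<Longrightarrow>
    has_wirt (\<lambda>z. f z * g z) (P * g z + f z * P') (Q * g z + f z * Q') z"
  unfolding has_wirt_def by (auto intro!: derivative_eq_intros simp: algebra_simps)

lemma has_wirt_compose_holo:
  assumes "has_wirt f P Q z" "(g has_field_derivative D) (at (f z))"
  shows "has_wirt (\<lambda>z. g (f z)) (D * P) (D * Q) z"
proof -
  have "(g \<circ> f has_derivative (\<lambda>h. D * h) \<circ> (\<lambda>h. P * h + Q * cnj h)) (at z)"
    using assms unfolding has_wirt_def has_field_derivative_def by (intro diff_chain_at)
  then show ?thesis unfolding has_wirt_def by (simp add: o_def algebra_simps)
qed

lemma has_wirt_cmult: "has_wirt f P Q z \<Longrightarrow> has_wirt (\<lambda>z. c * f z) (c * P) (c * Q) z"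
  using has_wirt_mult[OF has_wirt_const, of f P Q z c] by simp

lemma has_wirt_shift:
  assumes "has_wirt f P Q (z + c)" shows "has_wirt (\<lambda>z. f (z + c)) P Q z"
proof -
  have "(f \<circ> (\<lambda>z. z + c) has_derivative (\<lambda>h. P * h + Q * cnj h) \<circ> (\<lambda>h. h)) (at z)"
    using assms unfolding has_wirt_def by (intro diff_chain_at) (auto intro!: derivative_eq_intros)
  then show ?thesis unfolding has_wirt_def by (simp add: o_def)
qed

lemma has_wirt_sum:
  "(\<And>i. i \<in> I \<Longrightarrow> has_wirt (f i) (P i) (Q i) z) \<Longrightarrow> has_wirt (\<lambda>z. \<Sum>i\<in>I. f i z) (\<Sum>i\<in>I. P i) (\<Sum>i\<in>I. Q i) z"
  by (induction I rule: infinite_finite_induct) (auto intro: has_wirt_const has_wirt_add)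

lemma has_wirt_cong:
  assumes "has_wirt f P Q z" "eventually (\<lambda>w. f w = g w) (nhds z)"
  shows "has_wirt g P Q z"
  using assms unfolding has_wirt_def eventually_nhds_conv_at
  by (auto intro: has_derivative_transform_eventually)

lemma C1c_shift: assumes "C1c k" shows "C1c (\<lambda>z. k (z - c))" "dzb (\<lambda>z. k (z - c)) z = dzb k (z - c)"
proof -
  have W: "has_wirt (\<lambda>z. k (z - c)) (dz k (z - c)) (dzb k (z - c)) z" for z
    using has_wirt_shift[OF C1c_has_wirt[OF assms], where c = "- c" and z = z] by simp
  have c1: "continuous_on UNIV (\<lambda>z. g (z - c))" if "continuous_on UNIV g" for g :: "complex \<Rightarrow> complex"
    by (rule continuous_on_compose2[OF that _ subset_UNIV]) (intro continuous_intros)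
  show "C1c (\<lambda>z. k (z - c))"
    using assms by (intro C1cI[OF W] c1) (auto simp: C1c_def)
  show "dzb (\<lambda>z. k (z - c)) z = dzb k (z - c)" by (rule has_wirt_unique(2)[OF W])
qed

lemma C1cD: assumes "C1c f" shows "continuous_on UNIV (dz f)" "continuous_on UNIV (dzb f)"
  using assms unfolding C1c_def by auto

lemma C1c_mult:
  assumes f: "C1c f" and g: "C1c g"
  shows "C1c (\<lambda>z. f z * g z)" "dzb (\<lambda>z. f z * g z) z = dzb f z * g z + f z * dzb g z"
proof -
  note W = has_wirt_mult[OF C1c_has_wirt[OF f] C1c_has_wirt[OF g]]
  show "C1c (\<lambda>z. f z * g z)"
    by (rule C1cI[OF W]; intro continuous_intros C1cD f g C1c_continuous)
  show "dzb (\<lambda>z. f z * g z) z = dzb f z * g z + f z * dzb g z"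
    using has_wirt_unique(2)[OF W] by simp
qed

lemma C1c_holomorphic:
  assumes f: "f holomorphic_on UNIV" shows "C1c f" "dzb f z = 0"
proof -
  have W: "has_wirt f (deriv f z) 0 z" for z
    by (rule has_wirt_holo) (use f in \<open>auto simp: holomorphic_derivI\<close>)
  have "continuous_on UNIV (deriv f)" using f by (intro holomorphic_on_imp_continuous_on holomorphic_deriv) auto
  then show "C1c f" by (intro C1cI[OF W]) auto
  show "dzb f z = 0" by (rule has_wirt_unique(2)[OF W])
qed

lemma C1c_lipschitz:
  assumes k: "C1c k"
  obtains L where "L \<ge> 0" "\<And>z z'. norm z \<le> r \<Longrightarrow> norm z' \<le> r \<Longrightarrow> norm (k z - k z') \<le> L * norm (z - z')"
proof -
  have "bounded (dz k ` cball 0 r)" "bounded (dzb k ` cball 0 r)"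
    using k unfolding C1c_def by (intro compact_imp_bounded compact_continuous_image; auto intro: continuous_on_subset)+
  then obtain b1 b2 where "\<forall>z\<in>cball 0 r. norm (dz k z) \<le> b1" "\<forall>z\<in>cball 0 r. norm (dzb k z) \<le> b2"
    by (auto simp: bounded_iff)
  then have b: "\<And>z. norm z \<le> r \<Longrightarrow> norm (dz k z) \<le> b1" "\<And>z. norm z \<le> r \<Longrightarrow> norm (dzb k z) \<le> b2" by auto
  have "norm (k z - k z') \<le> (\<bar>b1\<bar> + \<bar>b2\<bar>) * norm (z - z')" if "norm z \<le> r" "norm z' \<le> r" for z z'
  proof (rule differentiable_bound[where S = "cball 0 r"])
    fix x :: complex assume x: "x \<in> cball 0 r"
    show "(k has_derivative (\<lambda>h. dz k x * h + dzb k x * cnj h)) (at x within cball 0 r)"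
      by (rule has_derivative_at_withinI[OF C1c_has_wirt[OF k, unfolded has_wirt_def]])
    show "onorm (\<lambda>h. dz k x * h + dzb k x * cnj h) \<le> \<bar>b1\<bar> + \<bar>b2\<bar>"
    proof (rule onorm_bound)
      fix h
      have "norm (dz k x * h + dzb k x * cnj h) \<le> norm (dz k x) * norm h + norm (dzb k x) * norm h"
        by (rule norm_triangle_le) (simp add: norm_mult)
      also have "\<dots> \<le> \<bar>b1\<bar> * norm h + \<bar>b2\<bar> * norm h"
        using b[of x] x by (intro add_mono mult_right_mono) auto
      finally show "norm (dz k x * h + dzb k x * cnj h) \<le> (\<bar>b1\<bar> + \<bar>b2\<bar>) * norm h" by (simp add: algebra_simps)
    qed simp
  qed (use that in auto)
  then show thesis using that[of "\<bar>b1\<bar> + \<bar>b2\<bar>"] by auto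
qed

section \<open>A C^1 regularisation of the Cauchy kernel\<close>

lemma DERIV_max0_square: "((\<lambda>x::real. (max 0 x)\<^sup>2) has_real_derivative 2 * max 0 x) (at x)"
proof -
  consider "x < 0" | "x > 0" | "x = 0" by linarith
  then show ?thesis
  proof cases
    case 1
    have "eventually (\<lambda>y. y < 0) (nhds x)" using eventually_nhds_in_open[of "{..<0}" x] 1 by simp
    then have ev: "eventually (\<lambda>y. 0 = (max 0 y)\<^sup>2) (nhds x)" by eventually_elim auto
    show ?thesis using DERIV_cong_ev[OF refl ev refl, of 0] 1 by simp
  next
    case 2
    have "eventually (\<lambda>y. y > 0) (nhds x)" using eventually_nhds_in_open[of "{0<..}" x] 2 by simp
    then have ev: "eventually (\<lambda>y. y\<^sup>2 = (max 0 y)\<^sup>2) (nhds x)" by eventually_elim auto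
    moreover have "((\<lambda>x. x\<^sup>2) has_real_derivative 2 * x) (at x)" by (auto intro!: derivative_eq_intros)
    ultimately show ?thesis using DERIV_cong_ev[OF refl ev refl, of "2 * x"] 2 by simp
  next
    case 3
    have "(\<lambda>h. (max 0 h)\<^sup>2 / h) \<midarrow>0\<rightarrow> (0::real)"
    proof (rule Lim_null_comparison)
      show "eventually (\<lambda>h. norm ((max 0 h)\<^sup>2 / h) \<le> \<bar>h\<bar>) (at (0::real))"
        by (intro always_eventually) (auto simp: max_def power2_eq_square)
      show "(\<lambda>h. \<bar>h\<bar>) \<midarrow>0\<rightarrow> (0::real)" using tendsto_rabs_zero[OF tendsto_ident_at] by simp
    qed
    then show ?thesis using 3 by (simp add: DERIV_def)
  qed
qed

text \<open>It enters the kernel through its square: the positive part is only Lipschitz, its square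
  is C^1. The form 1 - |z|^2/\<epsilon>^2 makes everything a polynomial in z and its conjugate
  inside the disc.\<close>

definition bump :: "real \<Rightarrow> complex \<Rightarrow> real" where
  "bump \<epsilon> z = max 0 (1 - (norm z / \<epsilon>)\<^sup>2)"

text \<open>The regularisation of \<open>1/z\<close>. It equals \<open>1/z\<close> for \<open>|z| \<ge> \<epsilon>\<close>, and its derivative with
  respect to the conjugate variable is \<open>\<pi>\<close> times a probability density.\<close>

definition cauchy_reg :: "real \<Rightarrow> complex \<Rightarrow> complex" where
  "cauchy_reg \<epsilon> z = (1 - of_real ((bump \<epsilon> z)\<^sup>2)) / z"

text \<open>At the origin division by zero gives the value 0, which is also the value of the
  polynomial in \<open>cauchy_reg_dz_inside\<close>; the formula is thus correct at every
  point.\<close>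

definition cauchy_reg_dz :: "real \<Rightarrow> complex \<Rightarrow> complex" where
  "cauchy_reg_dz \<epsilon> z = of_real (2 * bump \<epsilon> z / \<epsilon>\<^sup>2) * cnj z / z - (1 - of_real ((bump \<epsilon> z)\<^sup>2)) / z\<^sup>2"

definition delta_reg :: "real \<Rightarrow> complex \<Rightarrow> real" where
  "delta_reg \<epsilon> z = 2 * bump \<epsilon> z / \<epsilon>\<^sup>2"

lemma bump_nonneg: "0 \<le> bump \<epsilon> z" and bump_le_1: "bump \<epsilon> z \<le> 1"
  by (auto simp: bump_def)

lemma bump_eq_0: "\<epsilon> > 0 \<Longrightarrow> \<epsilon> \<le> norm z \<Longrightarrow> bump \<epsilon> z = 0"
  by (auto simp: bump_def field_simps intro!: max_absorb1 power_mono)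

lemma bump_inside: "\<epsilon> > 0 \<Longrightarrow> norm z < \<epsilon> \<Longrightarrow> bump \<epsilon> z = 1 - (norm z / \<epsilon>)\<^sup>2"
  by (auto simp: bump_def power_le_one)

lemma delta_reg_nonneg: "0 \<le> delta_reg \<epsilon> z"
  by (simp add: delta_reg_def bump_nonneg)

lemma delta_reg_eq_0: "\<epsilon> > 0 \<Longrightarrow> \<epsilon> \<le> norm z \<Longrightarrow> delta_reg \<epsilon> z = 0"
  by (simp add: delta_reg_def bump_eq_0)

lemma continuous_bump [continuous_intros]: "continuous_on S f \<Longrightarrow> continuous_on S (\<lambda>x. bump \<epsilon> (f x))"
  unfolding bump_def divide_inverse by (intro continuous_intros)

lemma has_derivative_bump2:
  assumes "\<epsilon> > 0"
  shows "((\<lambda>z. (bump \<epsilon> z)\<^sup>2) has_derivative (\<lambda>h. 2 * bump \<epsilon> z * (- (2 * (z \<bullet> h)) / \<epsilon>\<^sup>2))) (at z)"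
proof -
  have "((\<lambda>z. 1 - (z \<bullet> z) / \<epsilon>\<^sup>2) has_derivative (\<lambda>h. - (2 * (z \<bullet> h)) / \<epsilon>\<^sup>2)) (at z)"
    using assms by (auto intro!: derivative_eq_intros simp: inner_commute field_simps)
  then have u: "((\<lambda>z. 1 - (norm z / \<epsilon>)\<^sup>2) has_derivative (\<lambda>h. - (2 * (z \<bullet> h)) / \<epsilon>\<^sup>2)) (at z)"
    by (simp add: power_divide power2_norm_eq_inner)
  have "((\<lambda>x. (max 0 x)\<^sup>2) \<circ> (\<lambda>z. 1 - (norm z / \<epsilon>)\<^sup>2) has_derivative
     (\<lambda>x. 2 * max 0 (1 - (norm z / \<epsilon>)\<^sup>2) * x) \<circ> (\<lambda>h. - (2 * (z \<bullet> h)) / \<epsilon>\<^sup>2)) (at z)"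
    by (rule diff_chain_at[OF u]) (use DERIV_max0_square in \<open>simp add: has_field_derivative_def\<close>)
  then show ?thesis by (simp add: o_def bump_def)
qed

lemma has_wirt_bump2:
  assumes "\<epsilon> > 0"
  shows "has_wirt (\<lambda>z. of_real ((bump \<epsilon> z)\<^sup>2)) (- of_real (delta_reg \<epsilon> z) * cnj z) (- of_real (delta_reg \<epsilon> z) * z) z"
proof -
  have "complex_of_real (z \<bullet> h) = (cnj z * h + z * cnj h) / 2" for h
    by (simp add: complex_eq_iff inner_complex_def)
  then have *: "complex_of_real (2 * bump \<epsilon> z * (- (2 * (z \<bullet> h)) / \<epsilon>\<^sup>2)) =
    - of_real (delta_reg \<epsilon> z) * cnj z * h + - of_real (delta_reg \<epsilon> z) * z * cnj h" for h
    by (simp add: delta_reg_def add_divide_distrib algebra_simps)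
  have "((\<lambda>z. complex_of_real ((bump \<epsilon> z)\<^sup>2)) has_derivative
     (\<lambda>h. complex_of_real (2 * bump \<epsilon> z * (- (2 * (z \<bullet> h)) / \<epsilon>\<^sup>2)))) (at z)"
    by (rule has_derivative_of_real[OF has_derivative_bump2[OF assms]])
  then show ?thesis unfolding has_wirt_def * .
qed

text \<open>With t = |z|^2/\<epsilon>^2 one has 1 - (1 - t)^2 = 2t - t^2, which is divisible by z,
  so the pole cancels.\<close>

lemma cauchy_reg_inside:
  assumes "\<epsilon> > 0" "norm z < \<epsilon>"
  shows "cauchy_reg \<epsilon> z = (2 * cnj z - z * (cnj z)\<^sup>2 / of_real (\<epsilon>\<^sup>2)) / of_real (\<epsilon>\<^sup>2)"
proof (cases "z = 0")
  case False
  have "(complex_of_real (norm z))\<^sup>2 = z * cnj z" using complex_norm_square[of z] by simp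
  then have b: "of_real (bump \<epsilon> z) = 1 - z * cnj z / of_real (\<epsilon>\<^sup>2)"
    unfolding bump_inside[OF assms] by (simp add: power_divide)
  show ?thesis
    unfolding cauchy_reg_def of_real_power b using assms False by (simp add: field_simps power2_eq_square)
qed (simp add: cauchy_reg_def)

lemma cauchy_reg_dz_inside:
  assumes "\<epsilon> > 0" "norm z < \<epsilon>"
  shows "cauchy_reg_dz \<epsilon> z = - (cnj z)\<^sup>2 / of_real (\<epsilon> ^ 4)"
proof (cases "z = 0")
  case False
  have "(complex_of_real (norm z))\<^sup>2 = z * cnj z" using complex_norm_square[of z] by simp
  then have b: "of_real (bump \<epsilon> z) = 1 - z * cnj z / of_real (\<epsilon>\<^sup>2)"
    unfolding bump_inside[OF assms] by (simp add: power_divide)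
  show ?thesis
    unfolding cauchy_reg_dz_def of_real_power of_real_mult of_real_divide b
    using assms False by (simp add: field_simps power2_eq_square eval_nat_numeral)
qed (simp add: cauchy_reg_dz_def)

lemma cauchy_reg_eq: "\<epsilon> > 0 \<Longrightarrow> \<epsilon> \<le> norm z \<Longrightarrow> cauchy_reg \<epsilon> z = 1 / z"
  by (simp add: cauchy_reg_def bump_eq_0)

lemma norm_cauchy_reg_diff_le: "norm (1 / z - cauchy_reg \<epsilon> z) \<le> 1 / norm z"
proof -
  have "1 / z - cauchy_reg \<epsilon> z = of_real ((bump \<epsilon> z)\<^sup>2) / z"
    by (simp add: cauchy_reg_def diff_divide_distrib)
  then have "norm (1 / z - cauchy_reg \<epsilon> z) = (bump \<epsilon> z)\<^sup>2 / norm z"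
    by (simp add: norm_divide norm_power)
  then show ?thesis
    using bump_nonneg[of \<epsilon> z] bump_le_1[of \<epsilon> z] by (simp add: divide_right_mono power_le_one)
qed

lemma has_wirt_cauchy_reg:
  assumes e: "\<epsilon> > 0"
  shows "has_wirt (cauchy_reg \<epsilon>) (cauchy_reg_dz \<epsilon> z) (of_real (delta_reg \<epsilon> z)) z"
proof (cases "norm z < \<epsilon>")
  case True
  let ?g = "\<lambda>z. (2 * cnj z - z * (cnj z)\<^sup>2 / of_real (\<epsilon>\<^sup>2)) / of_real (\<epsilon>\<^sup>2)"
  have "eventually (\<lambda>w. w \<in> ball 0 \<epsilon>) (nhds z)" using True by (intro eventually_nhds_in_open) auto
  then have ev: "eventually (\<lambda>w. ?g w = cauchy_reg \<epsilon> w) (nhds z)"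
    by eventually_elim (use cauchy_reg_inside[OF e] in auto)
  have "(complex_of_real (norm z))\<^sup>2 = z * cnj z" using complex_norm_square[of z] by simp
  then have b: "of_real (bump \<epsilon> z) = 1 - z * cnj z / of_real (\<epsilon>\<^sup>2)"
    unfolding bump_inside[OF assms True] by (simp add: power_divide)
  have "has_wirt ?g (- (cnj z)\<^sup>2 / of_real (\<epsilon> ^ 4)) (of_real (delta_reg \<epsilon> z)) z"
    unfolding has_wirt_def delta_reg_def using e
    by (auto intro!: derivative_eq_intros simp: b field_simps power2_eq_square eval_nat_numeral)
  then show ?thesis using has_wirt_cong[OF _ ev] cauchy_reg_dz_inside[OF e True] by simp
next
  case False
  then have z: "z \<noteq> 0" using e by auto
  have inv: "has_wirt (\<lambda>z. 1 / z) (- 1 / z\<^sup>2) 0 z"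
    by (rule has_wirt_holo) (use z in \<open>auto intro!: derivative_eq_intros simp: power2_eq_square\<close>)
  have "has_wirt (\<lambda>z. (1 - of_real ((bump \<epsilon> z)\<^sup>2)) * (1 / z))
     ((0 - (- of_real (delta_reg \<epsilon> z) * cnj z)) * (1 / z) + (1 - of_real ((bump \<epsilon> z)\<^sup>2)) * (- 1 / z\<^sup>2))
     ((0 - (- of_real (delta_reg \<epsilon> z) * z)) * (1 / z) + (1 - of_real ((bump \<epsilon> z)\<^sup>2)) * 0) z"
    by (rule has_wirt_mult[OF has_wirt_diff[OF has_wirt_const has_wirt_bump2[OF e]] inv])
  then show ?thesis
    using z by (simp add: cauchy_reg_def[abs_def] cauchy_reg_dz_def delta_reg_def)
qed

lemma continuous_delta_reg: "continuous_on UNIV (\<lambda>z. complex_of_real (delta_reg \<epsilon> z))"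
  unfolding delta_reg_def divide_inverse by (intro continuous_intros)

lemma continuous_cauchy_reg_dz:
  assumes e: "\<epsilon> > 0" shows "continuous_on UNIV (cauchy_reg_dz \<epsilon>)"
proof (rule continuous_at_imp_continuous_on, rule ballI)
  fix z :: complex
  show "isCont (cauchy_reg_dz \<epsilon>) z"
  proof (cases "z = 0")
    case True
    have "eventually (\<lambda>w. w \<in> ball 0 \<epsilon>) (nhds z)" using True e by (intro eventually_nhds_in_open) auto
    then have ev: "eventually (\<lambda>w. cauchy_reg_dz \<epsilon> w = - (cnj w)\<^sup>2 / of_real (\<epsilon> ^ 4)) (nhds z)"
      by eventually_elim (use cauchy_reg_dz_inside[OF e] in auto)
    have "isCont (\<lambda>w. - (cnj w)\<^sup>2 / of_real (\<epsilon> ^ 4)) z" using e by (intro continuous_intros) auto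
    then show ?thesis using isCont_cong[OF ev] by blast
  next
    case False
    have "continuous_on (- {0}) (cauchy_reg_dz \<epsilon>)"
      unfolding cauchy_reg_dz_def using e by (intro continuous_intros) auto
    then show ?thesis using False by (simp add: continuous_on_eq_continuous_at open_Compl)
  qed
qed

section \<open>Regularised quotients by the theta function\<close>

lemma finite_lattice_ball:
  assumes t: "Im \<tau> > 0" shows "finite (lattice \<tau> \<inter> cball c M)"
proof (rule finite_subset)
  define B where "B = norm c + M"
  define n0 where "n0 = \<lceil>B / Im \<tau>\<rceil>"
  define m0 where "m0 = \<lceil>B + of_int n0 * norm \<tau>\<rceil>"
  show "lattice \<tau> \<inter> cball c M \<subseteq> (\<lambda>(m, n). of_int m + of_int n * \<tau>) ` ({-m0..m0} \<times> {-n0..n0})"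
  proof
    fix z assume z: "z \<in> lattice \<tau> \<inter> cball c M"
    then obtain m n where mn: "z = of_int m + of_int n * \<tau>" by (auto simp: lattice_def)
    have "norm z \<le> B" using z norm_triangle_ineq2[of z c] by (simp add: B_def dist_norm norm_minus_commute)
    have "\<bar>of_int n\<bar> * Im \<tau> = \<bar>Im z\<bar>" using t by (simp add: mn abs_mult)
    also have "\<dots> \<le> B" using abs_Im_le_cmod[of z] \<open>norm z \<le> B\<close> by linarith
    finally have "\<bar>of_int n\<bar> \<le> B / Im \<tau>" using t by (simp add: field_simps)
    then have n: "\<bar>n\<bar> \<le> n0" unfolding n0_def by linarith
    have "norm (complex_of_int m) \<le> norm z + norm (complex_of_int n * \<tau>)"
      using norm_triangle_ineq4[of z "of_int n * \<tau>"] by (simp add: mn)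
    also have "\<dots> \<le> B + of_int n0 * norm \<tau>"
      using \<open>norm z \<le> B\<close> n by (intro add_mono) (auto simp: norm_mult intro!: mult_right_mono)
    finally have "\<bar>m\<bar> \<le> m0" unfolding m0_def norm_of_int by linarith
    then show "z \<in> (\<lambda>(m, n). of_int m + of_int n * \<tau>) ` ({-m0..m0} \<times> {-n0..n0})"
      using n mn by (auto intro!: image_eqI[of _ _ "(m, n)"])
  qed
qed auto

lemma lattice_eventually_notin:
  assumes t: "Im \<tau> > 0" shows "eventually (\<lambda>w. w \<notin> lattice \<tau>) (at z)"
proof -
  have "finite (lattice \<tau> \<inter> cball z 1 - {z})" using finite_lattice_ball[OF t] by blast
  then have "open (ball z 1 - (lattice \<tau> \<inter> cball z 1 - {z}))" by (intro open_Diff finite_imp_closed) auto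
  then have "eventually (\<lambda>w. w \<in> ball z 1 - (lattice \<tau> \<inter> cball z 1 - {z})) (nhds z)"
    by (intro eventually_nhds_in_open) auto
  then show ?thesis unfolding eventually_at_filter by eventually_elim auto
qed

lemma eq_off_lattice_imp_eq:
  fixes f g :: "complex \<Rightarrow> complex"
  assumes t: "Im \<tau> > 0" and "continuous_on UNIV f" "continuous_on UNIV g"
    and "\<And>z. z \<notin> lattice \<tau> \<Longrightarrow> f z = g z"
  shows "f z = g z"
proof -
  have "isCont f z" "isCont g z" using assms(2,3) by (auto simp: continuous_on_eq_continuous_at)
  then have "f \<midarrow>z\<rightarrow> f z" "g \<midarrow>z\<rightarrow> g z" by (auto simp: isCont_def)
  moreover have "eventually (\<lambda>w. f w = g w) (at z)"
    using lattice_eventually_notin[OF t] by eventually_elim (use assms(4) in auto)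
  ultimately have "g \<midarrow>z\<rightarrow> f z" using Lim_transform_eventually by blast
  then show ?thesis using \<open>g \<midarrow>z\<rightarrow> g z\<close> LIM_unique by blast
qed

definition theta_quot :: "complex \<Rightarrow> (complex \<Rightarrow> complex) \<Rightarrow> complex \<Rightarrow> complex" where
  "theta_quot \<tau> E z = E z / odd_theta \<tau> z"

text \<open>The residue of \<open>theta_quot \<tau> E\<close> at a lattice point \<open>l\<close>,
  where the denominator has a simple zero.\<close>

definition theta_res :: "complex \<Rightarrow> (complex \<Rightarrow> complex) \<Rightarrow> complex \<Rightarrow> complex" where
  "theta_res \<tau> E l = E l / deriv (odd_theta \<tau>) l"

text \<open>The principal parts are removed in the numerator. The function \<open>g l\<close> is
  \<open>odd_theta\<close> divided by z - l, hence entire, and \<open>Nm\<close> vanishes at each of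
  the finitely many poles in the ball: at a pole only its own term of the sum survives and equals
  \<open>E\<close>. So \<open>Nm\<close> over \<open>odd_theta\<close> is holomorphic on the
  ball.\<close>

lemma theta_quot_decomposition:
  assumes t: "Im \<tau> > 0" and E: "E holomorphic_on UNIV"
  obtains R where "R holomorphic_on ball 0 M"
    "\<And>z. z \<in> ball 0 M \<Longrightarrow> z \<notin> lattice \<tau> \<Longrightarrow>
      theta_quot \<tau> E z = (\<Sum>l\<in>lattice \<tau> \<inter> ball 0 M. theta_res \<tau> E l / (z - l)) + R z"
proof -
  let ?f = "odd_theta \<tau>"
  define F where "F = lattice \<tau> \<inter> ball 0 M"
  have fin: "finite F" unfolding F_def by (rule finite_subset[OF _ finite_lattice_ball[OF t, of 0 M]]) auto
  define g where "g = (\<lambda>l z. if z = l then deriv ?f l else (?f z - ?f l) / (z - l))"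
  have g: "g l holomorphic_on UNIV" for l
    unfolding g_def by (rule pole_lemma_open[OF odd_theta_holomorphic[OF t] open_UNIV])
  have f0: "?f l = 0" "deriv ?f l \<noteq> 0" if "l \<in> F" for l
    using that odd_theta_zeros[OF t] by (auto simp: F_def)
  define Nm where "Nm = (\<lambda>z. E z - (\<Sum>l\<in>F. theta_res \<tau> E l * g l z))"
  have Nm: "Nm holomorphic_on UNIV" unfolding Nm_def by (intro holomorphic_intros E g)
  have Nm0: "Nm z = 0" if z: "z \<in> F" for z
  proof -
    have "(\<Sum>l\<in>F. theta_res \<tau> E l * g l z) = (\<Sum>l\<in>F. if l = z then E z else 0)"
      using f0 z by (intro sum.cong) (auto simp: g_def theta_res_def)
    then show ?thesis using fin z by (simp add: Nm_def)
  qed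
  define R where "R = (\<lambda>z. if ?f z = 0 then deriv Nm z / deriv ?f z else Nm z / ?f z)"
  have "R holomorphic_on ball 0 M"
    unfolding R_def
  proof (rule holomorphic_divide_simple_zeros)
    show "Nm holomorphic_on ball 0 M" "?f holomorphic_on ball 0 M"
      using Nm odd_theta_holomorphic[OF t] by (auto intro: holomorphic_on_subset)
    fix z assume "z \<in> ball 0 M" "?f z = 0"
    then have "z \<in> F" using odd_theta_zeros(1)[OF t] by (auto simp: F_def)
    then show "Nm z = 0 \<and> deriv ?f z \<noteq> 0" using Nm0 f0 by blast
  qed auto
  moreover have "theta_quot \<tau> E z = (\<Sum>l\<in>F. theta_res \<tau> E l / (z - l)) + R z"
    if "z \<in> ball 0 M" "z \<notin> lattice \<tau>" for z
  proof -
    have fz: "?f z \<noteq> 0" using that odd_theta_zeros(1)[OF t] by simp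
    have "(\<Sum>l\<in>F. theta_res \<tau> E l * g l z) = (\<Sum>l\<in>F. theta_res \<tau> E l / (z - l) * ?f z)"
      using f0 that by (intro sum.cong) (auto simp: g_def F_def)
    also have "\<dots> = (\<Sum>l\<in>F. theta_res \<tau> E l / (z - l)) * ?f z" by (simp add: sum_distrib_right)
    finally show ?thesis using fz by (simp add: R_def Nm_def theta_quot_def field_simps)
  qed
  ultimately show thesis using that unfolding F_def by blast
qed

definition pole_corr :: "complex \<Rightarrow> (complex \<Rightarrow> complex) \<Rightarrow> real \<Rightarrow> complex \<Rightarrow> complex" where
  "pole_corr \<tau> E \<epsilon> z = (\<Sum>l\<in>lattice \<tau> \<inter> ball z \<epsilon>. theta_res \<tau> E l * (of_real ((bump \<epsilon> (z - l))\<^sup>2) / (z - l)))"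

text \<open>Both terms are singular at lattice points but their difference extends continuously when
  0 < \<epsilon> \<le> 1; the limit supplies the missing values. At distance at least \<epsilon>
  from the lattice the correction is an empty sum, and the meromorphic quotient itself
  remains.\<close>

definition theta_reg :: "complex \<Rightarrow> (complex \<Rightarrow> complex) \<Rightarrow> real \<Rightarrow> complex \<Rightarrow> complex" where
  "theta_reg \<tau> E \<epsilon> z = (if z \<in> lattice \<tau> then Lim (at z) (\<lambda>w. theta_quot \<tau> E w - pole_corr \<tau> E \<epsilon> w)
     else theta_quot \<tau> E z - pole_corr \<tau> E \<epsilon> z)"

definition theta_delta :: "complex \<Rightarrow> (complex \<Rightarrow> complex) \<Rightarrow> real \<Rightarrow> complex \<Rightarrow> complex" where
  "theta_delta \<tau> E \<epsilon> z = (\<Sum>l\<in>lattice \<tau> \<inter> ball z \<epsilon>. theta_res \<tau> E l * of_real (delta_reg \<epsilon> (z - l)))"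

text \<open>Differentiation in z needs an index set that does not move with z. Since \<epsilon>
  \<le> 1, the lattice points of the larger ball include all relevant ones, and the additional ones
  contribute 0.\<close>

lemma pole_corr_eq:
  assumes t: "Im \<tau> > 0" and e: "0 < \<epsilon>" "\<epsilon> \<le> 1" and z: "z \<in> ball 0 M"
  shows "pole_corr \<tau> E \<epsilon> z = (\<Sum>l\<in>lattice \<tau> \<inter> ball 0 (M + 1). theta_res \<tau> E l * (of_real ((bump \<epsilon> (z - l))\<^sup>2) / (z - l)))"
    and "theta_delta \<tau> E \<epsilon> z = (\<Sum>l\<in>lattice \<tau> \<inter> ball 0 (M + 1). theta_res \<tau> E l * of_real (delta_reg \<epsilon> (z - l)))"
proof -
  have fin: "finite (lattice \<tau> \<inter> ball 0 (M + 1))"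
    by (rule finite_subset[OF _ finite_lattice_ball[OF t, of 0 "M + 1"]]) auto
  have far: "\<epsilon> \<le> norm (z - l)" if "l \<in> lattice \<tau> \<inter> ball 0 (M + 1) - lattice \<tau> \<inter> ball z \<epsilon>" for l
    using that by (auto simp: dist_norm)
  have sub: "lattice \<tau> \<inter> ball z \<epsilon> \<subseteq> lattice \<tau> \<inter> ball 0 (M + 1)"
  proof
    fix l assume "l \<in> lattice \<tau> \<inter> ball z \<epsilon>"
    then show "l \<in> lattice \<tau> \<inter> ball 0 (M + 1)"
      using z e norm_triangle_ineq2[of l z] by (auto simp: dist_norm norm_minus_commute)
  qed
  show "pole_corr \<tau> E \<epsilon> z = (\<Sum>l\<in>lattice \<tau> \<inter> ball 0 (M + 1). theta_res \<tau> E l * (of_real ((bump \<epsilon> (z - l))\<^sup>2) / (z - l)))"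
    unfolding pole_corr_def using fin sub bump_eq_0[OF e(1)] far
    by (intro sum.mono_neutral_left) auto
  show "theta_delta \<tau> E \<epsilon> z = (\<Sum>l\<in>lattice \<tau> \<inter> ball 0 (M + 1). theta_res \<tau> E l * of_real (delta_reg \<epsilon> (z - l)))"
    unfolding theta_delta_def using fin sub delta_reg_eq_0[OF e(1)] far
    by (intro sum.mono_neutral_left) auto
qed

text \<open>The same \<open>R\<close> serves the meromorphic kernel and all its regularisations. In
  a comparison of the two only 1/z and \<open>cauchy_reg\<close> are left.\<close>

lemma theta_reg_local:
  assumes t: "Im \<tau> > 0" and E: "E holomorphic_on UNIV"
  obtains R where "R holomorphic_on ball 0 M"
    "\<And>z. z \<in> ball 0 M \<Longrightarrow> z \<notin> lattice \<tau> \<Longrightarrow>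
      theta_quot \<tau> E z = (\<Sum>l\<in>lattice \<tau> \<inter> ball 0 (M + 1). theta_res \<tau> E l / (z - l)) + R z"
    "\<And>z \<epsilon>. z \<in> ball 0 M \<Longrightarrow> 0 < \<epsilon> \<Longrightarrow> \<epsilon> \<le> 1 \<Longrightarrow>
      theta_reg \<tau> E \<epsilon> z = (\<Sum>l\<in>lattice \<tau> \<inter> ball 0 (M + 1). theta_res \<tau> E l * cauchy_reg \<epsilon> (z - l)) + R z"
proof -
  define F where "F = lattice \<tau> \<inter> ball 0 (M + 1)"
  obtain R where R: "R holomorphic_on ball 0 (M + 1)"
    "\<And>z. z \<in> ball 0 (M + 1) \<Longrightarrow> z \<notin> lattice \<tau> \<Longrightarrow>
      theta_quot \<tau> E z = (\<Sum>l\<in>F. theta_res \<tau> E l / (z - l)) + R z"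
    using theta_quot_decomposition[OF t E, of "M + 1"] unfolding F_def by blast
  have sub: "ball 0 M \<subseteq> ball (0::complex) (M + 1)" by (simp add: subset_ball)
  have off: "theta_quot \<tau> E z - pole_corr \<tau> E \<epsilon> z = (\<Sum>l\<in>F. theta_res \<tau> E l * cauchy_reg \<epsilon> (z - l)) + R z"
    if z: "z \<in> ball 0 M" "z \<notin> lattice \<tau>" and e: "0 < \<epsilon>" "\<epsilon> \<le> 1" for z \<epsilon>
  proof -
    have "theta_quot \<tau> E z - pole_corr \<tau> E \<epsilon> z = (\<Sum>l\<in>F. theta_res \<tau> E l / (z - l)
      - theta_res \<tau> E l * (of_real ((bump \<epsilon> (z - l))\<^sup>2) / (z - l))) + R z"
      unfolding pole_corr_eq(1)[OF t e z(1)] F_def[symmetric] using R(2)[OF subsetD[OF sub z(1)] z(2)]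
      by (simp add: sum_subtractf)
    also have "(\<Sum>l\<in>F. theta_res \<tau> E l / (z - l) - theta_res \<tau> E l * (of_real ((bump \<epsilon> (z - l))\<^sup>2) / (z - l)))
      = (\<Sum>l\<in>F. theta_res \<tau> E l * cauchy_reg \<epsilon> (z - l))"
      by (intro sum.cong refl) (simp add: cauchy_reg_def diff_divide_distrib right_diff_distrib)
    finally show ?thesis .
  qed
  have "theta_reg \<tau> E \<epsilon> z = (\<Sum>l\<in>F. theta_res \<tau> E l * cauchy_reg \<epsilon> (z - l)) + R z"
    if z: "z \<in> ball 0 M" and e: "0 < \<epsilon>" "\<epsilon> \<le> 1" for z \<epsilon>
  proof (cases "z \<in> lattice \<tau>")
    case False
    then show ?thesis using off[OF z False e] by (simp add: theta_reg_def)
  next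
    case True
    let ?g = "\<lambda>z. (\<Sum>l\<in>F. theta_res \<tau> E l * cauchy_reg \<epsilon> (z - l)) + R z"
    have "continuous_on UNIV (cauchy_reg \<epsilon>)"
      by (rule C1c_continuous[OF C1cI[OF has_wirt_cauchy_reg[OF e(1)] continuous_cauchy_reg_dz[OF e(1)] continuous_delta_reg]])
    then have c: "continuous_on (ball 0 M) (\<lambda>z. cauchy_reg \<epsilon> (z - l))" for l
      by (rule continuous_on_compose2[OF _ _ subset_UNIV]) (intro continuous_intros)
    have "continuous_on (ball 0 M) R"
      by (intro holomorphic_on_imp_continuous_on holomorphic_on_subset[OF R(1) sub])
    then have "continuous_on (ball 0 M) ?g" by (intro continuous_intros c)
    then have "isCont ?g z" using z by (simp add: continuous_on_eq_continuous_at)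
    then have "?g \<midarrow>z\<rightarrow> ?g z" by (simp add: isCont_def)
    moreover have "eventually (\<lambda>w. w \<in> ball 0 M) (at z)"
      using z by (intro eventually_at_in_open') auto
    with lattice_eventually_notin[OF t, of z]
    have "eventually (\<lambda>w. ?g w = theta_quot \<tau> E w - pole_corr \<tau> E \<epsilon> w) (at z)"
      by eventually_elim (rule off[OF _ _ e, symmetric])
    ultimately have "(\<lambda>w. theta_quot \<tau> E w - pole_corr \<tau> E \<epsilon> w) \<midarrow>z\<rightarrow> ?g z"
      by (rule Lim_transform_eventually)
    then have "Lim (at z) (\<lambda>w. theta_quot \<tau> E w - pole_corr \<tau> E \<epsilon> w) = ?g z"
      by (intro tendsto_Lim) auto
    then show ?thesis using True by (simp add: theta_reg_def)
  qed
  note reg = this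
  show thesis
  proof (rule that)
    show "R holomorphic_on ball 0 M" by (rule holomorphic_on_subset[OF R(1) sub])
  qed (use R(2)[OF subsetD[OF sub]] reg in \<open>unfold F_def, blast+\<close>)
qed

lemma theta_reg_C1:
  assumes t: "Im \<tau> > 0" and E: "E holomorphic_on UNIV" and e: "0 < \<epsilon>" "\<epsilon> \<le> 1"
  shows "C1c (theta_reg \<tau> E \<epsilon>)" and "dzb (theta_reg \<tau> E \<epsilon>) z = theta_delta \<tau> E \<epsilon> z"
proof -
  have loc: "\<exists>P. continuous_on (ball 0 M) P \<and> continuous_on (ball 0 M) (theta_delta \<tau> E \<epsilon>) \<and>
    (\<forall>z\<in>ball 0 M. has_wirt (theta_reg \<tau> E \<epsilon>) (P z) (theta_delta \<tau> E \<epsilon> z) z)" for M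
  proof -
    define F where "F = lattice \<tau> \<inter> ball 0 (M + 1)"
    obtain R where R: "R holomorphic_on ball 0 M" "\<And>z. z \<in> ball 0 M \<Longrightarrow>
      theta_reg \<tau> E \<epsilon> z = (\<Sum>l\<in>F. theta_res \<tau> E l * cauchy_reg \<epsilon> (z - l)) + R z"
      using theta_reg_local[OF t E, of M] e unfolding F_def by metis
    have D: "theta_delta \<tau> E \<epsilon> z = (\<Sum>l\<in>F. theta_res \<tau> E l * of_real (delta_reg \<epsilon> (z - l)))" if "z \<in> ball 0 M" for z
      unfolding F_def by (rule pole_corr_eq(2)[OF t e that])
    define P where "P = (\<lambda>z. (\<Sum>l\<in>F. theta_res \<tau> E l * cauchy_reg_dz \<epsilon> (z - l)) + deriv R z)"
    have "continuous_on (ball 0 M) (\<lambda>z. complex_of_real (delta_reg \<epsilon> (z - l)))" for l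
      by (rule continuous_on_compose2[OF continuous_delta_reg _ subset_UNIV]) (intro continuous_intros)
    then have "continuous_on (ball 0 M) (\<lambda>z. \<Sum>l\<in>F. theta_res \<tau> E l * of_real (delta_reg \<epsilon> (z - l)))"
      by (intro continuous_on_sum continuous_on_mult continuous_on_const)
    then have cD: "continuous_on (ball 0 M) (theta_delta \<tau> E \<epsilon>)"
      by (rule continuous_on_eq) (simp add: D)
    have c1: "continuous_on (ball 0 M) (\<lambda>z. cauchy_reg_dz \<epsilon> (z - l))" for l
      by (rule continuous_on_compose2[OF continuous_cauchy_reg_dz[OF e(1)] _ subset_UNIV]) (intro continuous_intros)
    have "continuous_on (ball 0 M) (deriv R)"
      by (intro holomorphic_on_imp_continuous_on holomorphic_deriv R(1) open_ball)
    then have cP: "continuous_on (ball 0 M) P"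
      unfolding P_def by (intro continuous_intros c1)
    have "has_wirt (theta_reg \<tau> E \<epsilon>) (P z) (theta_delta \<tau> E \<epsilon> z) z" if z: "z \<in> ball 0 M" for z
    proof -
      have c: "has_wirt (\<lambda>z. theta_res \<tau> E l * cauchy_reg \<epsilon> (z - l))
         (theta_res \<tau> E l * cauchy_reg_dz \<epsilon> (z - l)) (theta_res \<tau> E l * of_real (delta_reg \<epsilon> (z - l))) z" for l
        using has_wirt_mult[OF has_wirt_const has_wirt_shift[OF has_wirt_cauchy_reg[OF e(1)], where c = "- l"]]
        by simp
      have "(R has_field_derivative deriv R z) (at z)"
        using R(1) z by (intro holomorphic_derivI[of _ "ball 0 M"]) auto
      then have "has_wirt (\<lambda>z. (\<Sum>l\<in>F. theta_res \<tau> E l * cauchy_reg \<epsilon> (z - l)) + R z) (P z) (theta_delta \<tau> E \<epsilon> z) z"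
        unfolding P_def D[OF z] using has_wirt_add[OF has_wirt_sum[OF c] has_wirt_holo] by force
      moreover have "eventually (\<lambda>w. w \<in> ball 0 M) (nhds z)"
        using z by (intro eventually_nhds_in_open) auto
      then have "eventually (\<lambda>w. (\<Sum>l\<in>F. theta_res \<tau> E l * cauchy_reg \<epsilon> (w - l)) + R w = theta_reg \<tau> E \<epsilon> w) (nhds z)"
        by eventually_elim (use R(2) in simp)
      ultimately show ?thesis by (rule has_wirt_cong)
    qed
    then show ?thesis using cP cD by blast
  qed
  then show "C1c (theta_reg \<tau> E \<epsilon>)" by (intro C1cI_local) blast
  show "dzb (theta_reg \<tau> E \<epsilon>) z = theta_delta \<tau> E \<epsilon> z"
    using loc[of "norm z + 1"] has_wirt_unique(2)[of "theta_reg \<tau> E \<epsilon>"] by force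
qed

lemma theta_reg_off_lattice:
  "z \<notin> lattice \<tau> \<Longrightarrow> theta_reg \<tau> E \<epsilon> z = theta_quot \<tau> E z - pole_corr \<tau> E \<epsilon> z"
  by (simp add: theta_reg_def)

lemma theta_sum_shift:
  assumes l: "l \<in> lattice \<tau>" and r: "\<And>x. x \<in> lattice \<tau> \<Longrightarrow> theta_res \<tau> E (x + l) = k * theta_res \<tau> E x"
  shows "(\<Sum>x\<in>lattice \<tau> \<inter> ball (z + l) \<epsilon>. theta_res \<tau> E x * g (z + l - x)) = k * (\<Sum>x\<in>lattice \<tau> \<inter> ball z \<epsilon>. theta_res \<tau> E x * g (z - x))"
proof -
  have "(\<Sum>x\<in>lattice \<tau> \<inter> ball (z + l) \<epsilon>. theta_res \<tau> E x * g (z + l - x))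
    = (\<Sum>x\<in>lattice \<tau> \<inter> ball z \<epsilon>. theta_res \<tau> E (x + l) * g (z - x))"
    by (rule sum.reindex_bij_witness[where i = "\<lambda>x. x + l" and j = "\<lambda>x. x - l"])
       (auto simp: lattice_add lattice_diff l dist_norm algebra_simps)
  also have "\<dots> = (\<Sum>x\<in>lattice \<tau> \<inter> ball z \<epsilon>. k * (theta_res \<tau> E x * g (z - x)))"
    by (intro sum.cong) (auto simp: r)
  finally show ?thesis by (simp add: sum_distrib_left)
qed

text \<open>The affine form covers both kernels: \<open>k = 1\<close> with an additive jump
  \<open>b\<close> for the logarithmic derivative, and \<open>b = 0\<close> with a constant
  multiplier \<open>k\<close> for the Szego kernel. Off the lattice the correction term scales like
  the residues; continuity extends the identity to the lattice.\<close>

lemma theta_reg_shift: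
  assumes t: "Im \<tau> > 0" and E: "E holomorphic_on UNIV" and e: "0 < \<epsilon>" "\<epsilon> \<le> 1"
    and l: "l \<in> lattice \<tau>" and r: "\<And>x. x \<in> lattice \<tau> \<Longrightarrow> theta_res \<tau> E (x + l) = k * theta_res \<tau> E x"
    and q: "\<And>z. z \<notin> lattice \<tau> \<Longrightarrow> theta_quot \<tau> E (z + l) = k * theta_quot \<tau> E z + b"
  shows "theta_reg \<tau> E \<epsilon> (z + l) = k * theta_reg \<tau> E \<epsilon> z + b"
proof (rule eq_off_lattice_imp_eq[OF t, where f = "\<lambda>z. theta_reg \<tau> E \<epsilon> (z + l)"])
  have c: "continuous_on UNIV (theta_reg \<tau> E \<epsilon>)" by (rule C1c_continuous[OF theta_reg_C1(1)[OF t E e]])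
  show "continuous_on UNIV (\<lambda>z. theta_reg \<tau> E \<epsilon> (z + l))"
    by (intro continuous_on_compose2[OF c] continuous_intros) auto
  show "continuous_on UNIV (\<lambda>z. k * theta_reg \<tau> E \<epsilon> z + b)" by (intro continuous_intros c)
  fix z assume z: "z \<notin> lattice \<tau>"
  then have zl: "z + l \<notin> lattice \<tau>" using lattice_add_cancel[OF l] by simp
  have pc: "pole_corr \<tau> E \<epsilon> (z + l) = k * pole_corr \<tau> E \<epsilon> z"
    unfolding pole_corr_def
    by (rule theta_sum_shift[OF l r, where g = "\<lambda>w. of_real ((bump \<epsilon> w)\<^sup>2) / w"])
  show "theta_reg \<tau> E \<epsilon> (z + l) = k * theta_reg \<tau> E \<epsilon> z + b"
    unfolding theta_reg_off_lattice[OF z] theta_reg_off_lattice[OF zl] q[OF z] pc by (simp add: algebra_simps)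
qed

section \<open>Multipliers of the logarithmic derivative and of the Szego kernel\<close>

lemma odd_theta_field_derivative:
  "Im \<tau> > 0 \<Longrightarrow> (odd_theta \<tau> has_field_derivative deriv (odd_theta \<tau>) z) (at z)"
  using odd_theta_holomorphic by (meson UNIV_I holomorphic_derivI open_UNIV)

lemma theta_mult_has_derivative:
  "(theta_mult \<tau> has_field_derivative - 2 * of_real pi * \<i> * theta_mult \<tau> z) (at z)"
  by (rule derivative_eq_intros refl | simp)+

lemma deriv_odd_theta_add_1:
  assumes t: "Im \<tau> > 0" shows "deriv (odd_theta \<tau>) (z + 1) = deriv (odd_theta \<tau>) z"
proof -
  have "((\<lambda>z. odd_theta \<tau> (z + 1)) has_field_derivative deriv (odd_theta \<tau>) (z + 1)) (at z)"
    using odd_theta_field_derivative[OF t, of "z + 1"] by (simp add: DERIV_shift)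
  then show ?thesis using odd_theta_field_derivative[OF t, of z] DERIV_unique unfolding odd_theta_add_1[OF t] by blast
qed

lemma deriv_odd_theta_add_tau:
  assumes t: "Im \<tau> > 0"
  shows "deriv (odd_theta \<tau>) (z + \<tau>) = theta_mult \<tau> z * (deriv (odd_theta \<tau>) z - 2 * of_real pi * \<i> * odd_theta \<tau> z)"
proof -
  have "((\<lambda>z. odd_theta \<tau> (z + \<tau>)) has_field_derivative deriv (odd_theta \<tau>) (z + \<tau>)) (at z)"
    using odd_theta_field_derivative[OF t, of "z + \<tau>"] by (simp add: DERIV_shift)
  moreover have "((\<lambda>z. theta_mult \<tau> z * odd_theta \<tau> z) has_field_derivative
      theta_mult \<tau> z * (deriv (odd_theta \<tau>) z - 2 * of_real pi * \<i> * odd_theta \<tau> z)) (at z)"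
    by (rule DERIV_cong[OF DERIV_mult[OF theta_mult_has_derivative odd_theta_field_derivative[OF t]]])
       (simp add: algebra_simps)
  ultimately show ?thesis using DERIV_unique unfolding odd_theta_add_tau[OF t] by blast
qed

lemma log_deriv_theta:
  assumes t: "Im \<tau> > 0"
  shows "l \<in> lattice \<tau> \<Longrightarrow> theta_res \<tau> (deriv (odd_theta \<tau>)) l = 1"
    and "theta_quot \<tau> (deriv (odd_theta \<tau>)) (z + 1) = theta_quot \<tau> (deriv (odd_theta \<tau>)) z"
    and "z \<notin> lattice \<tau> \<Longrightarrow> theta_quot \<tau> (deriv (odd_theta \<tau>)) (z + \<tau>) = theta_quot \<tau> (deriv (odd_theta \<tau>)) z - 2 * of_real pi * \<i>"
    and "deriv (odd_theta \<tau>) holomorphic_on UNIV"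
proof -
  show "l \<in> lattice \<tau> \<Longrightarrow> theta_res \<tau> (deriv (odd_theta \<tau>)) l = 1"
    using odd_theta_zeros(2)[OF t] by (simp add: theta_res_def)
  show "theta_quot \<tau> (deriv (odd_theta \<tau>)) (z + 1) = theta_quot \<tau> (deriv (odd_theta \<tau>)) z"
    unfolding theta_quot_def odd_theta_add_1[OF t] deriv_odd_theta_add_1[OF t] ..
  assume "z \<notin> lattice \<tau>"
  then have "odd_theta \<tau> z \<noteq> 0" using odd_theta_zeros(1)[OF t] by simp
  then show "theta_quot \<tau> (deriv (odd_theta \<tau>)) (z + \<tau>) = theta_quot \<tau> (deriv (odd_theta \<tau>)) z - 2 * of_real pi * \<i>"
    unfolding theta_quot_def odd_theta_add_tau[OF t] deriv_odd_theta_add_tau[OF t]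
    by (simp add: diff_divide_distrib)
qed (rule holomorphic_deriv[OF odd_theta_holomorphic[OF t] open_UNIV])

text \<open>Numerator of the Szego kernel \<open>\<theta> (z + c) \<theta>' 0 / (\<theta> z \<theta> c)\<close>, whose multiplier under \<open>z \<mapsto> z + \<tau>\<close> is
  the constant \<open>exp (- 2 * pi * \<i> * c)\<close>.\<close>

definition szego_num :: "complex \<Rightarrow> complex \<Rightarrow> complex \<Rightarrow> complex" where
  "szego_num \<tau> c z = odd_theta \<tau> (z + c) * (deriv (odd_theta \<tau>) 0 / odd_theta \<tau> c)"

lemma theta_mult_add: "theta_mult \<tau> (z + c) = exp (- 2 * of_real pi * \<i> * c) * theta_mult \<tau> z"
  by (simp add: mult_exp_exp algebra_simps)

lemma szego:
  assumes t: "Im \<tau> > 0" and c: "c \<notin> lattice \<tau>"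
  shows "theta_res \<tau> (szego_num \<tau> c) 0 = 1"
    and "theta_res \<tau> (szego_num \<tau> c) (z + 1) = theta_res \<tau> (szego_num \<tau> c) z"
    and "z \<in> lattice \<tau> \<Longrightarrow> theta_res \<tau> (szego_num \<tau> c) (z + \<tau>) = exp (- 2 * of_real pi * \<i> * c) * theta_res \<tau> (szego_num \<tau> c) z"
    and "theta_quot \<tau> (szego_num \<tau> c) (z + 1) = theta_quot \<tau> (szego_num \<tau> c) z"
    and "theta_quot \<tau> (szego_num \<tau> c) (z + \<tau>) = exp (- 2 * of_real pi * \<i> * c) * theta_quot \<tau> (szego_num \<tau> c) z"
    and "szego_num \<tau> c holomorphic_on UNIV"
proof -
  have s1: "szego_num \<tau> c (z + 1) = szego_num \<tau> c z" for z
    using odd_theta_add_1[OF t, of "z + c"] by (simp add: szego_num_def add_ac)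
  have st: "szego_num \<tau> c (z + \<tau>) = exp (- 2 * of_real pi * \<i> * c) * theta_mult \<tau> z * szego_num \<tau> c z" for z
  proof -
    have "szego_num \<tau> c (z + \<tau>) = theta_mult \<tau> (z + c) * szego_num \<tau> c z"
      using odd_theta_add_tau[OF t, of "z + c"] by (simp only: szego_num_def add_ac mult_ac)
    then show ?thesis by (simp only: theta_mult_add)
  qed
  have m: "theta_mult \<tau> z \<noteq> 0" by simp
  show "theta_res \<tau> (szego_num \<tau> c) 0 = 1"
    using odd_theta_zeros[OF t] lattice_0 c by (simp add: theta_res_def szego_num_def)
  show "theta_res \<tau> (szego_num \<tau> c) (z + 1) = theta_res \<tau> (szego_num \<tau> c) z"
    unfolding theta_res_def s1 deriv_odd_theta_add_1[OF t] ..
  show "theta_quot \<tau> (szego_num \<tau> c) (z + 1) = theta_quot \<tau> (szego_num \<tau> c) z"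
    unfolding theta_quot_def s1 odd_theta_add_1[OF t] ..
  show "theta_quot \<tau> (szego_num \<tau> c) (z + \<tau>) = exp (- 2 * of_real pi * \<i> * c) * theta_quot \<tau> (szego_num \<tau> c) z"
    unfolding theta_quot_def st odd_theta_add_tau[OF t] using m by (simp add: mult_ac)
  show "theta_res \<tau> (szego_num \<tau> c) (z + \<tau>) = exp (- 2 * of_real pi * \<i> * c) * theta_res \<tau> (szego_num \<tau> c) z"
    if "z \<in> lattice \<tau>"
    unfolding theta_res_def st deriv_odd_theta_add_tau[OF t] using m that odd_theta_zeros(1)[OF t, of z]
    by (simp add: mult_ac)
  have "(\<lambda>z. z + c) holomorphic_on UNIV" by (intro holomorphic_intros)
  from holomorphic_on_compose[OF this holomorphic_on_subset[OF odd_theta_holomorphic[OF t]]]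
  show "szego_num \<tau> c holomorphic_on UNIV"
    unfolding szego_num_def o_def by (intro holomorphic_intros) auto
qed

section \<open>Calculus on the torus\<close>

abbreviation "sq \<equiv> lebesgue_on unit_square"

lemma unit_square_cbox: "unit_square = cbox (0, 0) (1, 1)"
  by (auto simp: unit_square_def cbox_Pair_eq)

lemma unit_square_lebesgue [simp]: "unit_square \<in> sets lebesgue"
  by (simp add: unit_square_cbox)

lemma sq_integrable_continuous:
  fixes f :: "real \<times> real \<Rightarrow> 'b::euclidean_space"
  assumes "continuous_on UNIV f" shows "integrable sq f"
  unfolding unit_square_cbox by (rule continuous_imp_integrable[OF continuous_on_subset[OF assms]]) auto

lemma sq_measurable_continuous:
  fixes f :: "real \<times> real \<Rightarrow> 'b::euclidean_space"
  assumes "continuous_on UNIV f" shows "f \<in> borel_measurable sq"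
  using sq_integrable_continuous[OF assms] by auto

lemma measure_sq: "emeasure sq (space sq) = 1"
proof -
  have "emeasure sq unit_square = emeasure lborel (cbox (0::real, 0::real) (1, 1))"
    by (subst emeasure_restrict_space) (auto simp: unit_square_cbox)
  also have "\<dots> = 1" by (subst emeasure_lborel_cbox) (auto simp: Basis_prod_def)
  finally show ?thesis by simp
qed

lemma finite_measure_sq: "finite_measure sq"
  by (rule finite_measureI) (simp only: measure_sq, simp)

lemma sq_integral_iterated:
  fixes f :: "real \<times> real \<Rightarrow> 'b::euclidean_space"
  assumes f: "continuous_on UNIV f"
  shows "(LINT P|sq. f P) = integral {0..1} (\<lambda>x. integral {0..1} (\<lambda>y. f (x, y)))"
    and "(LINT P|sq. f P) = integral {0..1} (\<lambda>y. integral {0..1} (\<lambda>x. f (x, y)))"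
proof -
  have *: "(LINT P|sq. f P) = integral (cbox (0, 0) (1, 1)) f"
    using lebesgue_integral_eq_integral[OF sq_integrable_continuous[OF f]] by (simp add: unit_square_cbox)
  have c: "continuous_on (cbox (0, 0) (1, 1)) f" by (rule continuous_on_subset[OF f]) auto
  show 1: "(LINT P|sq. f P) = integral {0..1} (\<lambda>x. integral {0..1} (\<lambda>y. f (x, y)))"
    unfolding * integral_prod_continuous[OF c] by simp
  have "(\<lambda>(x, y). f (x, y)) = f" by auto
  then show "(LINT P|sq. f P) = integral {0..1} (\<lambda>y. integral {0..1} (\<lambda>x. f (x, y)))"
    unfolding 1 using integral_swap_continuous[of 0 0 1 1 "\<lambda>x y. f (x, y)"] c by simp
qed

lemma pd_eq:
  assumes "(g has_derivative D) (at P)" shows "pdx g P = D (1, 0)" "pdy g P = D (0, 1)"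
  using frechet_derivative_at[OF assms] by (simp_all add: pdx_def pdy_def)

lemma pd_has_derivative:
  assumes "g differentiable (at P)"
  shows "(g has_derivative (\<lambda>h. fst h *\<^sub>R pdx g P + snd h *\<^sub>R pdy g P)) (at P)"
proof -
  let ?D = "frechet_derivative g (at P)"
  have D: "(g has_derivative ?D) (at P)" using assms by (simp add: frechet_derivative_works)
  interpret D: bounded_linear ?D using D by (rule has_derivative_bounded_linear)
  have "?D h = fst h *\<^sub>R pdx g P + snd h *\<^sub>R pdy g P" for h
  proof -
    have "?D h = ?D (fst h *\<^sub>R (1, 0) + snd h *\<^sub>R (0, 1))" by (rule arg_cong) (simp add: prod_eq_iff)
    then show ?thesis by (simp only: D.add D.scaleR pdx_def pdy_def)
  qed
  then have eq: "?D = (\<lambda>h. fst h *\<^sub>R pdx g P + snd h *\<^sub>R pdy g P)" by (rule ext)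
  show ?thesis using D unfolding eq .
qed

lemma C1_on_UNIV_D:
  assumes "C1_on UNIV g"
  shows "(g has_derivative (\<lambda>h. fst h *\<^sub>R pdx g P + snd h *\<^sub>R pdy g P)) (at P)"
    "continuous_on UNIV (pdx g)" "continuous_on UNIV (pdy g)" "continuous_on UNIV g"
proof -
  have d: "g differentiable at P" for P using assms unfolding C1_on_def by blast
  show "(g has_derivative (\<lambda>h. fst h *\<^sub>R pdx g P + snd h *\<^sub>R pdy g P)) (at P)"
    by (rule pd_has_derivative[OF d])
  show "continuous_on UNIV (pdx g)" "continuous_on UNIV (pdy g)" using assms unfolding C1_on_def by blast+
  show "continuous_on UNIV g"
    by (rule continuous_at_imp_continuous_on) (blast intro: differentiable_imp_continuous_within d)
qed

lemma C1_on_UNIV_I: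
  assumes "\<And>P. (g has_derivative (\<lambda>h. fst h *\<^sub>R X P + snd h *\<^sub>R Y P)) (at P)"
    "continuous_on UNIV X" "continuous_on UNIV Y"
  shows "C1_on UNIV g" "pdx g = X" "pdy g = Y"
proof -
  show *: "pdx g = X" "pdy g = Y" using pd_eq[OF assms(1)] by auto
  show "C1_on UNIV g" unfolding C1_on_def * using assms by (auto intro: differentiableI)
qed

lemma smooth_plane_C1: assumes "smooth_plane f" shows "C1_on UNIV f"
proof -
  obtain D where D: "D 0 0 = f" "\<And>i j P. (D i j has_derivative (\<lambda>h. fst h *\<^sub>R D (Suc i) j P + snd h *\<^sub>R D i (Suc j) P)) (at P)"
    using assms unfolding smooth_plane_def by blast
  have "continuous_on UNIV (D i j)" for i j
    using has_derivative_continuous[OF D(2)] by (intro continuous_at_imp_continuous_on) auto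
  then show ?thesis using C1_on_UNIV_I(1)[OF D(2)[of 0 0]] unfolding D(1) by blast
qed

lemma C1_on_mult:
  fixes f g :: "real \<times> real \<Rightarrow> complex"
  assumes f: "C1_on UNIV f" and g: "C1_on UNIV g"
  shows "C1_on UNIV (\<lambda>P. f P * g P)" "pdx (\<lambda>P. f P * g P) = (\<lambda>P. pdx f P * g P + f P * pdx g P)"
    "pdy (\<lambda>P. f P * g P) = (\<lambda>P. pdy f P * g P + f P * pdy g P)"
proof -
  have "((\<lambda>P. f P * g P) has_derivative (\<lambda>h. fst h *\<^sub>R (pdx f P * g P + f P * pdx g P) + snd h *\<^sub>R (pdy f P * g P + f P * pdy g P))) (at P)" for P
    by (rule has_derivative_eq_rhs[OF has_derivative_mult[OF C1_on_UNIV_D(1)[OF f] C1_on_UNIV_D(1)[OF g]]])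
       (auto simp: algebra_simps scaleR_conv_of_real)
  note * = C1_on_UNIV_I[OF this]
  show "C1_on UNIV (\<lambda>P. f P * g P)" "pdx (\<lambda>P. f P * g P) = (\<lambda>P. pdx f P * g P + f P * pdx g P)"
    "pdy (\<lambda>P. f P * g P) = (\<lambda>P. pdy f P * g P + f P * pdy g P)"
    by (rule *; intro continuous_intros C1_on_UNIV_D f g)+
qed

lemma sq_integral_pdx:
  fixes g :: "real \<times> real \<Rightarrow> complex"
  assumes g: "C1_on UNIV g"
  shows "(LINT P|sq. pdx g P) = integral {0..1} (\<lambda>y. g (1, y) - g (0, y))"
proof -
  have "integral {0..1} (\<lambda>x. pdx g (x, y)) = g (1, y) - g (0, y)" for y
  proof (rule integral_unique, rule fundamental_theorem_of_calculus)
    fix x :: real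
    have "(g \<circ> (\<lambda>x. (x, y)) has_derivative (\<lambda>h. fst h *\<^sub>R pdx g (x, y) + snd h *\<^sub>R pdy g (x, y)) \<circ> (\<lambda>h. (h, 0))) (at x)"
      by (rule diff_chain_at[OF has_derivative_Pair[OF has_derivative_ident has_derivative_const] C1_on_UNIV_D(1)[OF g]])
    then show "((\<lambda>x. g (x, y)) has_vector_derivative pdx g (x, y)) (at x within {0..1})"
      unfolding has_vector_derivative_def using has_derivative_at_withinI by (force simp: o_def)
  qed simp
  then show ?thesis by (subst sq_integral_iterated(2)[OF C1_on_UNIV_D(2)[OF g]]) simp
qed

lemma sq_integral_pdy:
  fixes g :: "real \<times> real \<Rightarrow> complex"
  assumes g: "C1_on UNIV g"
  shows "(LINT P|sq. pdy g P) = integral {0..1} (\<lambda>x. g (x, 1) - g (x, 0))"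
proof -
  have "integral {0..1} (\<lambda>y. pdy g (x, y)) = g (x, 1) - g (x, 0)" for x
  proof (rule integral_unique, rule fundamental_theorem_of_calculus)
    fix y :: real
    have "(g \<circ> (\<lambda>y. (x, y)) has_derivative (\<lambda>h. fst h *\<^sub>R pdx g (x, y) + snd h *\<^sub>R pdy g (x, y)) \<circ> (\<lambda>h. (0, h))) (at y)"
      by (rule diff_chain_at[OF has_derivative_Pair[OF has_derivative_const has_derivative_ident] C1_on_UNIV_D(1)[OF g]])
    then show "((\<lambda>y. g (x, y)) has_vector_derivative pdy g (x, y)) (at y within {0..1})"
      unfolding has_vector_derivative_def using has_derivative_at_withinI by (force simp: o_def)
  qed simp
  then show ?thesis by (subst sq_integral_iterated(1)[OF C1_on_UNIV_D(3)[OF g]]) simp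
qed

definition per2 :: "(real \<times> real \<Rightarrow> 'b) \<Rightarrow> bool" where
  "per2 f \<longleftrightarrow> (\<forall>x y. f (x + 1, y) = f (x, y) \<and> f (x, y + 1) = f (x, y))"

text \<open>Closedness puts the integrand into divergence form, (B g)_x - (A g)_y. Integration over
  the square leaves boundary terms that cancel by periodicity, except for the jump \<beta> of
  \<open>g\<close>, which is integrated against \<open>A\<close> along the lower edge.\<close>

lemma green_square:
  fixes A B g :: "real \<times> real \<Rightarrow> complex"
  assumes A: "C1_on UNIV A" and B: "C1_on UNIV B" and g: "C1_on UNIV g"
    and cl: "\<And>P. pdx B P = pdy A P" and per: "per2 A" "per2 B"
    and gx: "\<And>y. g (1, y) = g (0, y)" and gy: "\<And>x. g (x, 1) = g (x, 0) + \<beta>"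
  shows "(LINT P|sq. B P * pdx g P - A P * pdy g P) = - \<beta> * integral {0..1} (\<lambda>x. A (x, 0))"
proof -
  note growth_const = C1_on_mult[OF B g] and Ag = C1_on_mult[OF A g]
  have A1: "A (x, 1) = A (x, 0)" and B1: "B (1, y) = B (0, y)" for x y
    using per unfolding per2_def by (metis add_0)+
  have i: "integrable sq (pdx (\<lambda>P. B P * g P))" "integrable sq (pdy (\<lambda>P. A P * g P))"
    by (intro sq_integrable_continuous C1_on_UNIV_D growth_const Ag)+
  have "(LINT P|sq. B P * pdx g P - A P * pdy g P) =
    (LINT P|sq. pdx (\<lambda>P. B P * g P) P - pdy (\<lambda>P. A P * g P) P)"
    unfolding growth_const(2) Ag(3) using cl by (simp add: algebra_simps)
  also have "\<dots> = (LINT P|sq. pdx (\<lambda>P. B P * g P) P) - (LINT P|sq. pdy (\<lambda>P. A P * g P) P)"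
    by (rule Bochner_Integration.integral_diff[OF i])
  also have "\<dots> = - integral {0..1} (\<lambda>x. \<beta> * A (x, 0))"
    unfolding sq_integral_pdx[OF growth_const(1)] sq_integral_pdy[OF Ag(1)] using gx gy A1 B1
    by (simp add: algebra_simps)
  finally show ?thesis by simp
qed

lemma per2_int:
  assumes "per2 f" shows "f (x + of_int m, y + of_int n) = f (x, y)"
proof -
  have 1: "f (x + of_int m, y) = f (x, y)" for x y
  proof (induction m rule: int_induct[where k = 0])
    case (step1 i) then show ?case using assms unfolding per2_def by (metis add.assoc of_int_1 of_int_add)
  next
    case (step2 i) then show ?case using assms unfolding per2_def
      by (metis add.assoc diff_add_cancel of_int_1 of_int_add)
  qed simp
  have 2: "f (x, y + of_int n) = f (x, y)" for x y
  proof (induction n rule: int_induct[where k = 0])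
    case (step1 i) then show ?case using assms unfolding per2_def by (metis add.assoc of_int_1 of_int_add)
  next
    case (step2 i) then show ?case using assms unfolding per2_def
      by (metis add.assoc diff_add_cancel of_int_1 of_int_add)
  qed simp
  show ?thesis by (simp add: 1 2)
qed

lemma unit_square_representative:
  obtains Q m n where "Q \<in> unit_square" "P = (fst Q + of_int m, snd Q + of_int n)"
proof (rule that)
  show "(frac (fst P), frac (snd P)) \<in> unit_square" by (simp add: unit_square_def less_imp_le[OF frac_lt_1])
  show "P = (fst (frac (fst P), frac (snd P)) + of_int \<lfloor>fst P\<rfloor>, snd (frac (fst P), frac (snd P)) + of_int \<lfloor>snd P\<rfloor>)"
    by (simp add: frac_def)
qed

lemma per2_eqI:
  assumes "per2 f" "per2 g" "\<And>P. P \<in> unit_square \<Longrightarrow> f P = g P" shows "f P = g P"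
proof -
  obtain Q m n where Q: "Q \<in> unit_square" "P = (fst Q + of_int m, snd Q + of_int n)" by (rule unit_square_representative)
  show ?thesis using per2_int[OF assms(1)] per2_int[OF assms(2)] assms(3)[OF Q(1)] unfolding Q(2) by simp
qed

section \<open>Trigonometric polynomials and approximation on the torus\<close>

definition tE :: "real \<Rightarrow> real \<Rightarrow> real \<times> real \<Rightarrow> complex" where
  "tE j l P = cis (2 * pi * (j * fst P + l * snd P))"

lemma tE_has_derivative:
  "(tE j l has_derivative (\<lambda>h. fst h *\<^sub>R (2 * of_real pi * \<i> * of_real j * tE j l P)
      + snd h *\<^sub>R (2 * of_real pi * \<i> * of_real l * tE j l P))) (at P)"
proof -
  have "((\<lambda>P. exp (\<i> * of_real (2 * pi * (j * fst P + l * snd P)))) has_derivative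
    (\<lambda>h. fst h *\<^sub>R (2 * of_real pi * \<i> * of_real j * exp (\<i> * of_real (2 * pi * (j * fst P + l * snd P))))
      + snd h *\<^sub>R (2 * of_real pi * \<i> * of_real l * exp (\<i> * of_real (2 * pi * (j * fst P + l * snd P)))))) (at P)"
  proof (rule has_derivative_eq_rhs)
    have 1: "((\<lambda>P. \<i> * of_real (2 * pi * (j * fst P + l * snd P))) has_derivative
      (\<lambda>h. \<i> * of_real (2 * pi * (j * fst h + l * snd h)))) (at P)"
      by (intro has_derivative_mult_right has_derivative_of_real has_derivative_add has_derivative_fst has_derivative_snd has_derivative_ident)
    show "((\<lambda>P. exp (\<i> * of_real (2 * pi * (j * fst P + l * snd P)))) has_derivative
      (\<lambda>h. exp (\<i> * of_real (2 * pi * (j * fst P + l * snd P))) * (\<i> * of_real (2 * pi * (j * fst h + l * snd h))))) (at P)"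
      by (rule has_derivative_compose[OF 1 DERIV_exp[unfolded has_field_derivative_def]])
  qed (simp add: fun_eq_iff scaleR_conv_of_real algebra_simps)
  then show ?thesis by (simp only: tE_def[abs_def] cis_conv_exp)
qed

lemma continuous_tE: "continuous_on S (tE j l)"
  unfolding tE_def cis_conv_exp by (intro continuous_intros)

lemma tE_C1: "C1_on UNIV (tE j l)" "pdx (tE j l) = (\<lambda>P. 2 * of_real pi * \<i> * of_real j * tE j l P)"
  "pdy (tE j l) = (\<lambda>P. 2 * of_real pi * \<i> * of_real l * tE j l P)"
  by (rule C1_on_UNIV_I[OF tE_has_derivative]; intro continuous_intros continuous_tE)+

lemma per2_tE: assumes "j \<in> \<int>" "l \<in> \<int>" shows "per2 (tE j l)"
proof -
  have *: "cis (2 * pi * j + t) = cis t" if "j \<in> \<int>" for j t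
    using that by (simp add: cis_mult[symmetric] cis_multiple_2pi)
  have "tE j l (x + 1, y) = tE j l (x, y)" "tE j l (x, y + 1) = tE j l (x, y)" for x y
    using *[OF assms(1), of "2 * pi * (j * x + l * y)"] *[OF assms(2), of "2 * pi * (j * x + l * y)"]
    by (simp_all add: tE_def algebra_simps)
  then show ?thesis by (simp add: per2_def)
qed

lemma smooth_plane_tE_sum:
  fixes J L :: "nat \<Rightarrow> real"
  shows "smooth_plane (\<lambda>P. \<Sum>k\<in>K. c k * tE (J k) (L k) P)"
  unfolding smooth_plane_def
proof -
  let ?D = "\<lambda>i j P. \<Sum>k\<in>K. c k * (2 * of_real pi * \<i> * of_real (J k)) ^ i * (2 * of_real pi * \<i> * of_real (L k)) ^ j * tE (J k) (L k) P"
  have 1: "?D 0 0 = (\<lambda>P. \<Sum>k\<in>K. c k * tE (J k) (L k) P)" by simp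
  have 2: "(?D i j has_derivative (\<lambda>h. fst h *\<^sub>R ?D (Suc i) j P + snd h *\<^sub>R ?D i (Suc j) P)) (at P)" for i j P
    by (rule has_derivative_eq_rhs, rule has_derivative_sum,
        rule has_derivative_mult_right[OF tE_has_derivative], rule ext,
        simp only: scaleR_sum_right sum.distrib[symmetric], rule sum.cong[OF refl])
       (simp add: scaleR_conv_of_real algebra_simps)
  show "\<exists>D. D 0 0 = (\<lambda>P. \<Sum>k\<in>K. c k * tE (J k) (L k) P) \<and>
    (\<forall>i j P. (D i j has_derivative (\<lambda>h. fst h *\<^sub>R D (Suc i) j P + snd h *\<^sub>R D i (Suc j) P)) (at P))"
    by (rule exI[of _ ?D]) (use 1 2 in blast)
qed

definition trig_coeff :: "(real \<times> real \<Rightarrow> complex) \<Rightarrow> real \<Rightarrow> real \<Rightarrow> complex" where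
  "trig_coeff f j l = (LINT Q|sq. f Q * tE (- j) (- l) Q)"

lemma per2_mult: "per2 f \<Longrightarrow> per2 g \<Longrightarrow> per2 (\<lambda>P. f P * g P :: complex)"
  by (simp add: per2_def)

text \<open>Integration by parts; the boundary terms cancel by periodicity. This is what makes
  \<open>vp_conv\<close> commute with the partial derivatives.\<close>

lemma trig_coeff_pd:
  assumes f: "C1_on UNIV f" and p: "per2 f" and jl: "j \<in> \<int>" "l \<in> \<int>"
  shows "trig_coeff (pdx f) j l = 2 * of_real pi * \<i> * of_real j * trig_coeff f j l"
    "trig_coeff (pdy f) j l = 2 * of_real pi * \<i> * of_real l * trig_coeff f j l"
proof -
  note fE = C1_on_mult[OF f tE_C1(1)[of "- j" "- l"]]
  have per: "per2 (\<lambda>P. f P * tE (- j) (- l) P)"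
    using jl by (intro per2_mult p per2_tE) auto
  have e: "f (1, y) * tE (- j) (- l) (1, y) = f (0, y) * tE (- j) (- l) (0, y)"
    "f (x, 1) * tE (- j) (- l) (x, 1) = f (x, 0) * tE (- j) (- l) (x, 0)" for x y
    using per unfolding per2_def by (metis add_0)+
  have i: "integrable sq (\<lambda>P. pdx f P * tE (- j) (- l) P)" "integrable sq (\<lambda>P. pdy f P * tE (- j) (- l) P)"
     "integrable sq (\<lambda>P. f P * tE (- j) (- l) P)"
    by (intro sq_integrable_continuous continuous_intros C1_on_UNIV_D[OF f] continuous_tE)+
  have "0 = (LINT P|sq. pdx f P * tE (- j) (- l) P - 2 * of_real pi * \<i> * of_real j * (f P * tE (- j) (- l) P))"
    using sq_integral_pdx[OF fE(1)] unfolding fE(2) tE_C1 e by (simp add: algebra_simps)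
  also have "\<dots> = trig_coeff (pdx f) j l - 2 * of_real pi * \<i> * of_real j * trig_coeff f j l"
    unfolding trig_coeff_def using i by (subst Bochner_Integration.integral_diff) auto
  finally show "trig_coeff (pdx f) j l = 2 * of_real pi * \<i> * of_real j * trig_coeff f j l" by simp
  have "0 = (LINT P|sq. pdy f P * tE (- j) (- l) P - 2 * of_real pi * \<i> * of_real l * (f P * tE (- j) (- l) P))"
    using sq_integral_pdy[OF fE(1)] unfolding fE(3) tE_C1 e by (simp add: algebra_simps)
  also have "\<dots> = trig_coeff (pdy f) j l - 2 * of_real pi * \<i> * of_real l * trig_coeff f j l"
    unfolding trig_coeff_def using i by (subst Bochner_Integration.integral_diff) auto
  finally show "trig_coeff (pdy f) j l = 2 * of_real pi * \<i> * of_real l * trig_coeff f j l" by simp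
qed

text \<open>Since 1 + exp(2 pi i x) = 2 cos(pi x) exp(pi i x), the binomial theorem gives (2 cos(pi
  x))^(2n) the frequencies k - n with binomial coefficients. The normalisation makes the constant
  term k = n equal to 1, so the kernel has integral 1.\<close>

definition vp_coeff :: "nat \<Rightarrow> nat \<Rightarrow> real" where
  "vp_coeff n k = real ((2 * n) choose k) / real ((2 * n) choose n)"

definition vp_kernel :: "nat \<Rightarrow> real \<Rightarrow> real" where
  "vp_kernel n x = 4 ^ n / real ((2 * n) choose n) * (cos (pi * x))\<^sup>2 ^ n"

text \<open>Convolution with the de la Vallee-Poussin kernel, written as a trigonometric polynomial.\<close>

definition vp_conv :: "nat \<Rightarrow> (real \<times> real \<Rightarrow> complex) \<Rightarrow> real \<times> real \<Rightarrow> complex" where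
  "vp_conv n f P = (\<Sum>k\<le>2*n. \<Sum>l\<le>2*n. of_real (vp_coeff n k * vp_coeff n l)
     * trig_coeff f (real k - real n) (real l - real n) * tE (real k - real n) (real l - real n) P)"

lemma vp_kernel_eq:
  "complex_of_real (vp_kernel n x) = (\<Sum>k\<le>2*n. of_real (vp_coeff n k) * cis (2 * pi * (real k - real n) * x))"
proof -
  have 1: "1 + cis (2 * pi * x) = of_real (2 * cos (pi * x)) * cis (pi * x)"
    using cos_double_cos[of "pi * x"] sin_double[of "pi * x"]
    by (simp add: complex_eq_iff power2_eq_square algebra_simps)
  have "(\<Sum>k\<le>2*n. of_real (vp_coeff n k) * cis (2 * pi * (real k - real n) * x))
    = (\<Sum>k\<le>2*n. of_nat ((2*n) choose k) * cis (2 * pi * x) ^ k * 1 ^ (2 * n - k)) * (cis (- (2 * pi * real n * x)) / of_nat ((2*n) choose n))"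
    unfolding sum_distrib_right
  proof (rule sum.cong[OF refl])
    fix k
    have "cis (2 * pi * (real k - real n) * x) = cis (2 * pi * x) ^ k * cis (- (2 * pi * real n * x))"
      unfolding Complex.DeMoivre cis_mult by (rule arg_cong[where f = cis]) (simp add: algebra_simps)
    then show "of_real (vp_coeff n k) * cis (2 * pi * (real k - real n) * x)
      = of_nat ((2*n) choose k) * cis (2 * pi * x) ^ k * 1 ^ (2 * n - k) * (cis (- (2 * pi * real n * x)) / of_nat ((2*n) choose n))"
      by (simp add: vp_coeff_def)
  qed
  also have "\<dots> = (cis (2 * pi * x) + 1) ^ (2 * n) * (cis (- (2 * pi * real n * x)) / of_nat ((2*n) choose n))"
    by (simp only: binomial_ring)
  also have "\<dots> = (of_real (2 * cos (pi * x)) * cis (pi * x)) ^ (2 * n) * (cis (- (2 * pi * real n * x)) / of_nat ((2*n) choose n))"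
    using 1 by (simp add: add.commute)
  also have "\<dots> = of_real ((2 * cos (pi * x)) ^ (2 * n)) / of_nat ((2*n) choose n) * (cis (pi * x) ^ (2 * n) * cis (- (2 * pi * real n * x)))"
    by (simp add: power_mult_distrib)
  also have "cis (pi * x) ^ (2 * n) * cis (- (2 * pi * real n * x)) = 1"
    unfolding Complex.DeMoivre cis_mult by (simp add: algebra_simps)
  also have "(2 * cos (pi * x)) ^ (2 * n) = 4 ^ n * (cos (pi * x))\<^sup>2 ^ n"
    by (simp add: power_mult power_mult_distrib)
  finally show ?thesis by (simp add: vp_kernel_def)
qed

lemma vp_kernel_nonneg: "0 \<le> vp_kernel n x"
  by (simp add: vp_kernel_def)

text \<open>The central binomial coefficient is at least 4^n/(2n). The normalisation thus costs only
  a factor linear in n, which the geometric decay of the cosine power away from the integers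
  absorbs.\<close>

lemma vp_kernel_le: "n > 0 \<Longrightarrow> vp_kernel n x \<le> 2 * real n * (cos (pi * x))\<^sup>2 ^ n"
proof -
  assume n: "n > 0"
  have "4 ^ n / (2 * real n) \<le> real ((2 * n) choose n)" by (rule central_binomial_lower_bound[OF n])
  moreover have "real ((2 * n) choose n) > 0" by simp
  ultimately have "4 ^ n / real ((2 * n) choose n) \<le> 2 * real n" using n by (simp add: field_simps)
  then show ?thesis unfolding vp_kernel_def by (rule mult_right_mono) simp
qed

lemma vp_kernel_continuous [continuous_intros]: "continuous_on S (f :: 'a::metric_space \<Rightarrow> real) \<Longrightarrow> continuous_on S (\<lambda>x. vp_kernel n (f x))"
  unfolding vp_kernel_def by (intro continuous_intros)

lemma integral_cis:
  assumes "j \<in> \<int>"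
  shows "((\<lambda>t. cis (2 * pi * j * (x - t))) has_integral (if j = 0 then 1 else 0)) {0..1}"
proof (cases "j = 0")
  case True
  then show ?thesis using has_integral_const_real[of "1::complex" 0 1] by simp
next
  case False
  let ?F = "\<lambda>t. 1 / (- 2 * of_real pi * \<i> * of_real j) * exp (\<i> * of_real (2 * pi * j * (x - t)))"
  have "((\<lambda>t. exp (\<i> * of_real (2 * pi * j * (x - t)))) has_integral (?F 1 - ?F 0)) {0..1}"
  proof (rule fundamental_theorem_of_calculus)
    fix t :: real
    have "((\<lambda>t. exp (\<i> * of_real (2 * pi * j * (x - t)))) has_derivative
      (\<lambda>h. exp (\<i> * of_real (2 * pi * j * (x - t))) * (\<i> * of_real (2 * pi * j * (- h))))) (at t within {0..1})"
    proof -
      have 1: "((\<lambda>t. \<i> * of_real (2 * pi * j * (x - t))) has_derivative (\<lambda>h. \<i> * of_real (2 * pi * j * (0 - h)))) (at t within {0..1})"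
        by (intro has_derivative_mult_right has_derivative_of_real has_derivative_diff has_derivative_const has_derivative_ident)
      show ?thesis
        using has_derivative_compose[OF 1 DERIV_exp[unfolded has_field_derivative_def]] by simp
    qed
    then have "(?F has_derivative
      (\<lambda>h. 1 / (- 2 * of_real pi * \<i> * of_real j) * (exp (\<i> * of_real (2 * pi * j * (x - t))) * (\<i> * of_real (2 * pi * j * (- h)))))) (at t within {0..1})"
      by (rule has_derivative_mult_right)
    then show "(?F has_vector_derivative exp (\<i> * of_real (2 * pi * j * (x - t)))) (at t within {0..1})"
      unfolding has_vector_derivative_def using False by (simp add: scaleR_conv_of_real mult.commute)
  qed simp
  moreover have "?F 1 = ?F 0"
  proof -
    have "cis (2 * pi * j * (x - 0)) = cis (2 * pi * j * (x - 1)) * cis (2 * pi * j)"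
      by (simp add: cis_mult algebra_simps)
    then have "cis (2 * pi * j * (x - 0)) = cis (2 * pi * j * (x - 1))"
      using cis_multiple_2pi[OF assms] by simp
    then show ?thesis by (simp add: cis_conv_exp)
  qed
  ultimately show ?thesis using False by (simp add: cis_conv_exp)
qed

lemma integral_vp_kernel: "((\<lambda>t. vp_kernel n (x - t)) has_integral 1) {0..1}"
proof -
  have "((\<lambda>t. (\<Sum>k\<le>2*n. of_real (vp_coeff n k) * cis (2 * pi * (real k - real n) * (x - t)))) has_integral
    (\<Sum>k\<le>2*n. of_real (vp_coeff n k) * (if real k - real n = 0 then 1 else 0))) {0..1}"
    by (intro has_integral_sum has_integral_mult_right integral_cis) auto
  moreover have "(\<Sum>k\<le>2*n. of_real (vp_coeff n k) * (if real k - real n = 0 then 1 else 0 :: complex)) = 1"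
    by (simp add: if_distrib[of "(*) _"] vp_coeff_def cong: if_cong)
  ultimately have "((\<lambda>t. complex_of_real (vp_kernel n (x - t))) has_integral 1) {0..1}"
    unfolding vp_kernel_eq by simp
  from has_integral_linear[OF this bounded_linear_Re] show ?thesis by (simp add: o_def)
qed

abbreviation "vp2 n P Q \<equiv> vp_kernel n (fst P - fst Q) * vp_kernel n (snd P - snd Q)"

lemma vp_conv_eq:
  assumes f: "continuous_on UNIV f"
  shows "vp_conv n f P = (LINT Q|sq. f Q * of_real (vp2 n P Q))"
proof -
  have i: "integrable sq (\<lambda>Q. of_real (vp_coeff n k * vp_coeff n l) * (f Q * tE (- (real k - real n)) (- (real l - real n)) Q) * tE (real k - real n) (real l - real n) P)" for k l
    by (intro sq_integrable_continuous continuous_intros f continuous_tE)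
  have "f Q * of_real (vp2 n P Q) = (\<Sum>k\<le>2*n. \<Sum>l\<le>2*n. of_real (vp_coeff n k * vp_coeff n l) * (f Q * tE (- (real k - real n)) (- (real l - real n)) Q) * tE (real k - real n) (real l - real n) P)" for Q
  proof -
    have "cis (2 * pi * j * (fst P - fst Q)) * cis (2 * pi * l * (snd P - snd Q)) = tE (- j) (- l) Q * tE j l P" for j l
      by (simp add: tE_def cis_mult algebra_simps)
    note A = this
    have *: "f Q * ((of_real (vp_coeff n k) * cis (2 * pi * j * (fst P - fst Q))) * (of_real (vp_coeff n m) * cis (2 * pi * l * (snd P - snd Q))))
      = of_real (vp_coeff n k * vp_coeff n m) * (f Q * tE (- j) (- l) Q) * tE j l P" for j l k m
    proof -
      have "f Q * ((of_real (vp_coeff n k) * cis (2 * pi * j * (fst P - fst Q))) * (of_real (vp_coeff n m) * cis (2 * pi * l * (snd P - snd Q))))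
        = of_real (vp_coeff n k) * of_real (vp_coeff n m) * f Q * (cis (2 * pi * j * (fst P - fst Q)) * cis (2 * pi * l * (snd P - snd Q)))"
        by (simp only: mult_ac)
      then show ?thesis unfolding A of_real_mult by (simp only: mult_ac)
    qed
    show ?thesis
      unfolding of_real_mult[of "vp_kernel n _"] vp_kernel_eq sum_product
      unfolding sum_distrib_left * ..
  qed
  then have "(LINT Q|sq. f Q * of_real (vp2 n P Q)) = (\<Sum>k\<le>2*n. \<Sum>l\<le>2*n. LINT Q|sq. of_real (vp_coeff n k * vp_coeff n l) * (f Q * tE (- (real k - real n)) (- (real l - real n)) Q) * tE (real k - real n) (real l - real n) P)"
    using i by (simp add: Bochner_Integration.integral_sum Bochner_Integration.integrable_sum)
  then show ?thesis unfolding vp_conv_def trig_coeff_def by simp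
qed

lemma vp_conv_pd:
  assumes f: "C1_on UNIV f" and p: "per2 f"
  shows "smooth_plane (vp_conv n f)" "per2 (vp_conv n f)"
    "pdx (vp_conv n f) = vp_conv n (pdx f)" "pdy (vp_conv n f) = vp_conv n (pdy f)"
proof -
  have "smooth_plane (\<lambda>P. \<Sum>m\<in>{..(2*n)} \<times> {..(2*n)}. of_real (vp_coeff n (fst m) * vp_coeff n (snd m))
     * trig_coeff f (real (fst m) - real n) (real (snd m) - real n) * tE (real (fst m) - real n) (real (snd m) - real n) P)"
  proof -
    define g :: "nat \<Rightarrow> nat \<times> nat" where "g = from_nat_into ({..(2*n)} \<times> {..(2*n)})"
    obtain g :: "nat \<Rightarrow> nat \<times> nat" and K where g: "bij_betw g K ({..(2*n)} \<times> {..(2*n)})"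
      using ex_bij_betw_nat_finite[of "{..(2*n)} \<times> {..(2*n)}"] by auto
    show ?thesis
      by (subst sum.reindex_bij_betw[OF g, symmetric]) (rule smooth_plane_tE_sum)
  qed
  then show "smooth_plane (vp_conv n f)"
    unfolding vp_conv_def[abs_def] by (simp add: sum.cartesian_product case_prod_unfold)
  have I: "real k - real n \<in> \<int>" for k n by auto
  show "per2 (vp_conv n f)"
    using per2_tE[OF I I] unfolding per2_def vp_conv_def by simp
  have "(vp_conv n f has_derivative (\<lambda>h. fst h *\<^sub>R vp_conv n (pdx f) P + snd h *\<^sub>R vp_conv n (pdy f) P)) (at P)" for P
    unfolding vp_conv_def[abs_def] trig_coeff_pd[OF f p I I]
    by (rule has_derivative_eq_rhs, rule has_derivative_sum, rule has_derivative_sum,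
        rule has_derivative_mult_right[OF tE_has_derivative], rule ext,
        simp only: scaleR_sum_right sum.distrib[symmetric], rule sum.cong[OF refl], rule sum.cong[OF refl])
       (simp add: scaleR_conv_of_real algebra_simps)
  note D = pd_eq[OF this]
  show "pdx (vp_conv n f) = vp_conv n (pdx f)" "pdy (vp_conv n f) = vp_conv n (pdy f)"
    by (rule ext, simp add: D)+
qed

lemma integral_vp2:
  shows "(LINT Q|sq. vp2 n P Q) = 1" "(LINT Q|sq. vp_kernel n (fst P - fst Q)) = 1"
    "(LINT Q|sq. vp_kernel n (snd P - snd Q)) = 1"
proof -
  have 1: "integral {0..1} (\<lambda>t. vp_kernel n (x - t)) = 1" for x
    by (rule integral_unique[OF integral_vp_kernel])
  have c: "continuous_on UNIV (\<lambda>Q::real \<times> real. vp2 n P Q)"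
    "continuous_on UNIV (\<lambda>Q::real \<times> real. vp_kernel n (fst P - fst Q))"
    "continuous_on UNIV (\<lambda>Q::real \<times> real. vp_kernel n (snd P - snd Q))"
    by (intro continuous_intros)+
  show "(LINT Q|sq. vp2 n P Q) = 1" "(LINT Q|sq. vp_kernel n (fst P - fst Q)) = 1"
    "(LINT Q|sq. vp_kernel n (snd P - snd Q)) = 1"
    using sq_integral_iterated(1)[OF c(1)] sq_integral_iterated(1)[OF c(2)] sq_integral_iterated(1)[OF c(3)]
    by (simp_all add: 1)
qed

lemma integrable_vp2:
  "integrable sq (\<lambda>Q. vp2 n P Q)" "integrable sq (\<lambda>Q. vp_kernel n (fst P - fst Q))"
  "integrable sq (\<lambda>Q. vp_kernel n (snd P - snd Q))"
  by (intro sq_integrable_continuous continuous_intros)+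

lemma per2_bounded:
  fixes f :: "real \<times> real \<Rightarrow> 'b::real_normed_vector"
  assumes "continuous_on UNIV f" "per2 f"
  obtains B where "B > 0" "\<And>P. norm (f P) \<le> B"
proof -
  have "bounded (f ` cbox (0, 0) (1, 1))"
    by (intro compact_imp_bounded compact_continuous_image continuous_on_subset[OF assms(1)]) auto
  then obtain B where B: "B > 0" "\<And>P. P \<in> cbox (0, 0) (1, 1) \<Longrightarrow> norm (f P) \<le> B"
    by (auto simp: bounded_pos)
  have "norm (f P) \<le> B" for P
  proof -
    obtain x y where P: "P = (x, y)" by force
    have "f (x, y) = f (frac x + of_int \<lfloor>x\<rfloor>, frac y + of_int \<lfloor>y\<rfloor>)" by (simp add: frac_def)
    also have "\<dots> = f (frac x, frac y)" by (rule per2_int[OF assms(2)])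
    finally have "f P = f (frac x, frac y)" using P by simp
    moreover have "(frac x, frac y) \<in> cbox (0, 0) (1, 1)"
      by (auto simp: cbox_Pair_eq less_imp_le[OF frac_lt_1])
    ultimately show ?thesis using B(2) by metis
  qed
  then show thesis using that B(1) by blast
qed

lemma vp_conv_bound:
  assumes f: "continuous_on UNIV f" and B: "\<And>P. norm (f P) \<le> B"
  shows "norm (vp_conv n f P) \<le> B"
proof -
  have "norm (vp_conv n f P) \<le> (LINT Q|sq. B * vp2 n P Q)"
    unfolding vp_conv_eq[OF f]
  proof (rule Bochner_Integration.integral_norm_bound_integral)
    show "integrable sq (\<lambda>Q. f Q * of_real (vp2 n P Q))"
      by (intro sq_integrable_continuous continuous_intros f)
    show "integrable sq (\<lambda>Q. B * vp2 n P Q)" using integrable_vp2(1) by simp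
    fix Q
    have "norm (f Q * of_real (vp2 n P Q)) = norm (f Q) * vp2 n P Q"
      by (simp add: norm_mult vp_kernel_nonneg)
    then show "norm (f Q * of_real (vp2 n P Q)) \<le> B * vp2 n P Q"
      using B[of Q] by (simp add: mult_right_mono vp_kernel_nonneg del: of_real_mult)
  qed
  then show ?thesis by (simp add: integral_vp2)
qed

text \<open>The squared cosine of pi u has period 1 in u and decreases on [0, 1/2]. After
  subtraction of the nearest integer a distance of at least \<delta> would give a smaller
  value.\<close>

lemma cos_sq_concentration:
  assumes "0 < \<delta>" "\<delta> \<le> 1/2" "(cos (pi * u))\<^sup>2 > (cos (pi * \<delta>))\<^sup>2"
  shows "\<exists>m::int. \<bar>u - of_int m\<bar> < \<delta>"
proof (rule ccontr)
  assume neg: "\<not> ?thesis"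
  define m where "m = round u"
  define v where "v = u - of_int m"
  have v: "\<bar>v\<bar> \<le> 1/2" using of_int_round_abs_le[of u] by (simp add: v_def m_def abs_minus_commute)
  have "\<bar>v\<bar> \<ge> \<delta>" using neg unfolding v_def by (meson not_le)
  have "(cos (pi * u))\<^sup>2 = (cos (pi * v))\<^sup>2"
  proof -
    have "pi * u = pi * v + of_int m * pi" by (simp add: v_def algebra_simps)
    then have "cos (pi * u) = cos (pi * v) * cos (of_int m * pi) - sin (pi * v) * sin (of_int m * pi)"
      by (simp add: cos_add)
    then have "cos (pi * u) = cos (pi * v) * cos (of_int m * pi)" by (simp add: mult.commute[of _ pi])
    moreover have "(cos (of_int m * pi))\<^sup>2 = 1" by (simp add: cos_squared_eq mult.commute[of _ pi])
    ultimately show ?thesis by (simp add: power_mult_distrib)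
  qed
  also have "\<dots> = (cos (pi * \<bar>v\<bar>))\<^sup>2" by (cases "v \<ge> 0") (auto simp: abs_if)
  also have "\<dots> \<le> (cos (pi * \<delta>))\<^sup>2"
  proof (rule power_mono)
    have "0 \<le> pi * \<delta>" "pi * \<delta> \<le> pi * \<bar>v\<bar>" "pi * \<bar>v\<bar> \<le> pi"
      using assms(1) \<open>\<bar>v\<bar> \<ge> \<delta>\<close> v by auto
    then show "cos (pi * \<bar>v\<bar>) \<le> cos (pi * \<delta>)" by (rule cos_monotone_0_pi_le)
    have "0 \<le> pi * \<bar>v\<bar>" "pi * \<bar>v\<bar> \<le> pi / 2" using v by auto
    then show "0 \<le> cos (pi * \<bar>v\<bar>)" by (intro cos_ge_zero) linarith+
  qed
  finally show False using assms(3) by simp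
qed

text \<open>If both coordinates of P - Q are close to integers, periodicity replaces Q by a
  translate near P and continuity bounds the difference. Otherwise one of the two one-dimensional
  factors is at most 2 n \<rho>^n, while the other still has integral 1.\<close>

lemma vp_conv_tendsto:
  assumes f: "continuous_on UNIV f" and p: "per2 f"
  shows "(\<lambda>n. vp_conv n f P) \<longlonglongrightarrow> f P"
proof -
  obtain B where B: "B > 0" "\<And>P. norm (f P) \<le> B" using per2_bounded[OF f p] by blast
  have "\<exists>N. \<forall>n\<ge>N. norm (vp_conv n f P - f P) < \<eta>" if "\<eta> > 0" for \<eta>
  proof -
    obtain \<delta>0 where \<delta>0: "\<delta>0 > 0" "\<And>Q. dist Q P < \<delta>0 \<Longrightarrow> dist (f Q) (f P) < \<eta> / 2"
      using f \<open>\<eta> > 0\<close> unfolding continuous_on_iff by (metis UNIV_I half_gt_zero)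
    define \<delta> where "\<delta> = min (1/2) (\<delta>0 / 2)"
    have \<delta>: "0 < \<delta>" "\<delta> \<le> 1/2" "\<delta> \<le> \<delta>0 / 2" using \<delta>0(1) by (auto simp: \<delta>_def)
    define \<rho> where "\<rho> = (cos (pi * \<delta>))\<^sup>2"
    have pd: "0 < pi * \<delta>" "pi * \<delta> \<le> pi / 2" using \<delta> by (auto simp: field_simps)
    have "0 \<le> cos (pi * \<delta>)" using pd by (intro cos_ge_zero) linarith+
    moreover have "cos (pi * \<delta>) < cos 0" using pd by (intro cos_monotone_0_pi) linarith+
    ultimately have \<rho>: "0 \<le> \<rho>" "\<rho> < 1" unfolding \<rho>_def by (auto simp: abs_square_less_1)
    have "(\<lambda>n. of_nat n * \<rho> ^ n) \<longlonglongrightarrow> 0" using \<rho> by (intro powser_times_n_limit_0) auto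
    \<comment> \<open>The factor 8 B is 2 B, a bound for |f Q - f P|, times 2 from the kernel bound
      \<open>?t\<close>, times 2 for the two coordinates.\<close>
    then have "(\<lambda>n. 8 * B * (of_nat n * \<rho> ^ n)) \<longlonglongrightarrow> 8 * B * 0" by (rule tendsto_mult_left)
    then have "eventually (\<lambda>n. 8 * B * (of_nat n * \<rho> ^ n) < \<eta> / 2) sequentially"
      using \<open>\<eta> > 0\<close> by (intro order_tendstoD(2)[where y = "8 * B * 0"]) auto
    then obtain N where N: "\<And>n. n \<ge> N \<Longrightarrow> 8 * B * (of_nat n * \<rho> ^ n) < \<eta> / 2"
      by (auto simp: eventually_sequentially)
    have "norm (vp_conv n f P - f P) < \<eta>" if n: "n \<ge> max 1 N" for n
    proof -
      have n0: "n > 0" using n by auto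
      let ?t = "2 * real n * \<rho> ^ n"
      have pt: "norm (f Q - f P) * vp2 n P Q \<le> \<eta> / 2 * vp2 n P Q + 2 * B * (?t * (vp_kernel n (fst P - fst Q) + vp_kernel n (snd P - snd Q)))" for Q
      proof -
        have nn: "0 \<le> vp_kernel n (fst P - fst Q)" "0 \<le> vp_kernel n (snd P - snd Q)" by (rule vp_kernel_nonneg)+
        have 2: "norm (f Q - f P) \<le> 2 * B" using B(2)[of P] B(2)[of Q] norm_triangle_ineq4[of "f Q" "f P"] by linarith
        have t0: "0 \<le> ?t" using \<rho> by simp
        have small: "vp_kernel n u \<le> ?t" if "(cos (pi * u))\<^sup>2 \<le> \<rho>" for u
        proof -
          have "vp_kernel n u \<le> 2 * real n * (cos (pi * u))\<^sup>2 ^ n" by (rule vp_kernel_le[OF n0])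
          also have "\<dots> \<le> ?t" using that by (intro mult_left_mono power_mono) auto
          finally show ?thesis .
        qed
        consider "(cos (pi * (fst P - fst Q)))\<^sup>2 > \<rho>" "(cos (pi * (snd P - snd Q)))\<^sup>2 > \<rho>"
          | "(cos (pi * (fst P - fst Q)))\<^sup>2 \<le> \<rho>" | "(cos (pi * (snd P - snd Q)))\<^sup>2 \<le> \<rho>"
          by linarith
        then show ?thesis
        proof cases
          case 1
          obtain m l where ml: "\<bar>fst P - fst Q - of_int m\<bar> < \<delta>" "\<bar>snd P - snd Q - of_int l\<bar> < \<delta>"
            using cos_sq_concentration[OF \<delta>(1,2)] 1 unfolding \<rho>_def by meson
          define Q' where "Q' = (fst Q + of_int m, snd Q + of_int l)"
          have "dist Q' P \<le> \<bar>fst P - fst Q - of_int m\<bar> + \<bar>snd P - snd Q - of_int l\<bar>"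
            unfolding dist_prod_def Q'_def
            using sqrt_sum_squares_le_sum_abs[of "dist (fst Q + of_int m) (fst P)" "dist (snd Q + of_int l) (snd P)"]
            by (simp add: dist_real_def abs_minus_commute algebra_simps)
          then have "dist Q' P < \<delta>0" using ml \<delta> by linarith
          then have "dist (f Q') (f P) < \<eta> / 2" by (rule \<delta>0(2))
          moreover have "f Q' = f Q" unfolding Q'_def using per2_int[OF p, of "fst Q" m "snd Q" l] by simp
          ultimately have "norm (f Q - f P) \<le> \<eta> / 2" by (simp add: dist_norm)
          then have "norm (f Q - f P) * vp2 n P Q \<le> \<eta> / 2 * vp2 n P Q" using nn by (intro mult_right_mono) auto
          moreover have "0 \<le> 2 * B * (?t * (vp_kernel n (fst P - fst Q) + vp_kernel n (snd P - snd Q)))"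
            using B(1) nn \<rho> by (intro mult_nonneg_nonneg add_nonneg_nonneg) auto
          ultimately show ?thesis by linarith
        next
          case 2
          have "vp2 n P Q \<le> ?t * vp_kernel n (snd P - snd Q)"
            using small[OF 2] nn by (intro mult_right_mono) auto
          also have "\<dots> \<le> ?t * (vp_kernel n (fst P - fst Q) + vp_kernel n (snd P - snd Q))"
            using t0 nn by (intro mult_left_mono) auto
          finally have "norm (f Q - f P) * vp2 n P Q \<le> 2 * B * (?t * (vp_kernel n (fst P - fst Q) + vp_kernel n (snd P - snd Q)))"
            by (rule mult_mono[OF \<open>norm (f Q - f P) \<le> 2 * B\<close>]) (use nn B(1) in auto)
          moreover have "0 \<le> \<eta> / 2 * vp2 n P Q" using nn \<open>\<eta> > 0\<close> by auto
          ultimately show ?thesis by linarith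
        next
          case 3
          have "vp2 n P Q \<le> vp_kernel n (fst P - fst Q) * ?t"
            using small[OF 3] nn by (intro mult_left_mono) auto
          also have "\<dots> \<le> (vp_kernel n (fst P - fst Q) + vp_kernel n (snd P - snd Q)) * ?t"
            using t0 nn by (intro mult_right_mono) auto
          finally have "norm (f Q - f P) * vp2 n P Q \<le> 2 * B * ((vp_kernel n (fst P - fst Q) + vp_kernel n (snd P - snd Q)) * ?t)"
            by (rule mult_mono[OF \<open>norm (f Q - f P) \<le> 2 * B\<close>]) (use nn B(1) in auto)
          moreover have "0 \<le> \<eta> / 2 * vp2 n P Q" using nn \<open>\<eta> > 0\<close> by auto
          ultimately show ?thesis by (simp add: mult.commute)
        qed
      qed
      have if1: "integrable sq (\<lambda>Q. f Q * of_real (vp2 n P Q))" "integrable sq (\<lambda>Q. f P * of_real (vp2 n P Q))"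
        by (intro sq_integrable_continuous continuous_intros f)+
      have "f P = (LINT Q|sq. f P * of_real (vp2 n P Q))"
        using integral_vp2(1)[of n P] by (simp del: of_real_mult)
      then have "vp_conv n f P - f P = (LINT Q|sq. f Q * of_real (vp2 n P Q) - f P * of_real (vp2 n P Q))"
        unfolding vp_conv_eq[OF f] using Bochner_Integration.integral_diff[OF if1] by simp
      then have "norm (vp_conv n f P - f P) \<le> (LINT Q|sq. \<eta> / 2 * vp2 n P Q + 2 * B * (?t * (vp_kernel n (fst P - fst Q) + vp_kernel n (snd P - snd Q))))"
      proof (elim ssubst, intro Bochner_Integration.integral_norm_bound_integral)
        show "integrable sq (\<lambda>Q. f Q * of_real (vp2 n P Q) - f P * of_real (vp2 n P Q))" using if1 by simp
        show "integrable sq (\<lambda>Q. \<eta> / 2 * vp2 n P Q + 2 * B * (?t * (vp_kernel n (fst P - fst Q) + vp_kernel n (snd P - snd Q))))"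
          by (intro Bochner_Integration.integrable_add integrable_mult_right integrable_vp2)
        fix Q
        have "norm (f Q * of_real (vp2 n P Q) - f P * of_real (vp2 n P Q)) = norm (f Q - f P) * vp2 n P Q"
          by (simp add: left_diff_distrib[symmetric] norm_mult vp_kernel_nonneg)
        then show "norm (f Q * of_real (vp2 n P Q) - f P * of_real (vp2 n P Q)) \<le> \<eta> / 2 * vp2 n P Q + 2 * B * (?t * (vp_kernel n (fst P - fst Q) + vp_kernel n (snd P - snd Q)))"
          using pt[of Q] by linarith
      qed
      also have "\<dots> = \<eta> / 2 * 1 + 2 * B * (?t * (1 + 1))"
      proof -
        have "(LINT Q|sq. \<eta> / 2 * vp2 n P Q + 2 * B * (?t * (vp_kernel n (fst P - fst Q) + vp_kernel n (snd P - snd Q))))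
          = (LINT Q|sq. \<eta> / 2 * vp2 n P Q) + (LINT Q|sq. 2 * B * (?t * (vp_kernel n (fst P - fst Q) + vp_kernel n (snd P - snd Q))))"
          by (intro Bochner_Integration.integral_add integrable_mult_right Bochner_Integration.integrable_add integrable_vp2)
        also have "(LINT Q|sq. 2 * B * (?t * (vp_kernel n (fst P - fst Q) + vp_kernel n (snd P - snd Q))))
          = 2 * B * (?t * ((LINT Q|sq. vp_kernel n (fst P - fst Q)) + (LINT Q|sq. vp_kernel n (snd P - snd Q))))"
          by (simp only: integral_mult_right_zero Bochner_Integration.integral_add[OF integrable_vp2(2,3)])
        finally show ?thesis by (simp only: integral_mult_right_zero integral_vp2)
      qed
      also have "\<dots> = \<eta> / 2 + 8 * B * (of_nat n * \<rho> ^ n)" by simp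
      also have "\<dots> < \<eta>" using N[of n] n by simp
      finally show ?thesis .
    qed
    then show ?thesis by blast
  qed
  then show ?thesis by (auto intro: LIMSEQ_I)
qed

section \<open>Passage between torus and plane, and C^1 test functions\<close>

lemma per2_pd:
  assumes f: "C1_on UNIV f" and p: "per2 f" shows "per2 (pdx f)" "per2 (pdy f)"
proof -
  have "pdx f (P + c) = pdx f P \<and> pdy f (P + c) = pdy f P" if c: "\<And>P. f (P + c) = f P" for P c
  proof -
    have "(f \<circ> (\<lambda>P. P + c) has_derivative (\<lambda>h. fst h *\<^sub>R pdx f (P + c) + snd h *\<^sub>R pdy f (P + c)) \<circ> (\<lambda>h. h)) (at P)"
      by (rule diff_chain_at[OF _ C1_on_UNIV_D(1)[OF f]]) (auto intro!: derivative_eq_intros)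
    then have "(f has_derivative (\<lambda>h. fst h *\<^sub>R pdx f (P + c) + snd h *\<^sub>R pdy f (P + c))) (at P)"
      using c by (simp add: o_def)
    from pd_eq[OF this] show ?thesis by simp
  qed
  from this[of "(1, 0)"] this[of "(0, 1)"] show "per2 (pdx f)" "per2 (pdy f)"
    using p unfolding per2_def by auto
qed

lemma periodic_descends:
  assumes "per2 f" obtains \<phi> :: "torus \<Rightarrow> 'b" where "\<phi> \<circ> tproj = f"
proof (rule that)
  show "(f \<circ> rep_torus) \<circ> tproj = f"
  proof
    fix P :: "real \<times> real"
    have "tproj (rep_torus (tproj P)) = tproj P"
      unfolding tproj_def using Quotient3_abs_rep[OF Quotient3_torus] by metis
    then have "torus_rel (rep_torus (tproj P)) P" by (simp add: tproj_eq_iff)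
    then obtain m n where "fst (rep_torus (tproj P)) - fst P = of_int m" "snd (rep_torus (tproj P)) - snd P = of_int n"
      unfolding torus_rel_def by (auto elim!: Ints_cases)
    then have "rep_torus (tproj P) = (fst P + of_int m, snd P + of_int n)"
      by (simp add: prod_eq_iff algebra_simps)
    then show "((f \<circ> rep_torus) \<circ> tproj) P = f P" using per2_int[OF assms] by simp
  qed
qed

lemma tproj_per2: "per2 (f \<circ> tproj)"
proof -
  have "tproj (x + 1, y) = tproj (x, y)" "tproj (x, y + 1) = tproj (x, y)" for x y
    by (simp_all add: tproj_eq_iff torus_rel_def)
  then show ?thesis by (simp add: per2_def)
qed

text \<open>The definition tests with smooth functions only. The convolutions
  \<open>vp_conv n g\<close> are smooth and descend to the torus; they and their first derivatives
  converge pointwise and obey the sup bounds of \<open>g\<close> and its derivatives, so dominated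
  convergence gives the identity for \<open>g\<close>.\<close>

lemma weak_solution_C1:
  assumes ws: "weak_solution a b u f" and u: "continuous_on UNIV (u \<circ> tproj)"
    and a: "continuous_on UNIV (a \<circ> tproj)" and b: "continuous_on UNIV (b \<circ> tproj)"
    and f: "integrable sq (f \<circ> tproj)"
    and g: "C1_on UNIV g" and p: "per2 g"
  shows "- (LINT P|sq. u (tproj P) * (b (tproj P) * pdx g P - a (tproj P) * pdy g P)) = (LINT P|sq. f (tproj P) * g P)"
proof -
  have eq: "- (LINT P|sq. u (tproj P) * (b (tproj P) * vp_conv n (pdx g) P - a (tproj P) * vp_conv n (pdy g) P)) = (LINT P|sq. f (tproj P) * vp_conv n g P)" for n
  proof -
    obtain \<phi> where \<phi>: "\<phi> \<circ> tproj = vp_conv n g" using periodic_descends[OF vp_conv_pd(2)[OF g p]] by metis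
    then have "\<phi> (tproj P) = vp_conv n g P" for P by (metis comp_apply)
    then show ?thesis
      using ws vp_conv_pd(1)[OF g p, of n] unfolding weak_solution_def torus_integral_def \<phi>[symmetric]
      by (metis (no_types, lifting) \<phi> vp_conv_pd(3,4)[OF g p] Bochner_Integration.integral_cong)
  qed
  have pp: "per2 (pdx g)" "per2 (pdy g)" by (rule per2_pd[OF g p])+
  note cont = C1_on_UNIV_D[OF g]
  obtain B where B: "B > 0" "\<And>P. norm (g P) \<le> B" using per2_bounded[OF cont(4) p] by blast
  obtain Bx where Bx: "Bx > 0" "\<And>P. norm (pdx g P) \<le> Bx" using per2_bounded[OF cont(2) pp(1)] by blast
  obtain By where By: "By > 0" "\<And>P. norm (pdy g P) \<le> By" using per2_bounded[OF cont(3) pp(2)] by blast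
  have u': "continuous_on UNIV (\<lambda>P. u (tproj P))" and a': "continuous_on UNIV (\<lambda>P. a (tproj P))" and b': "continuous_on UNIV (\<lambda>P. b (tproj P))"
    using u a b by (simp_all add: o_def)
  have cc: "continuous_on UNIV (vp_conv n h)" for n h
    unfolding vp_conv_def[abs_def] by (intro continuous_intros continuous_tE)
  have f': "integrable sq (\<lambda>P. f (tproj P))" using f by (simp add: o_def)
  have "(\<lambda>n. LINT P|sq. u (tproj P) * (b (tproj P) * vp_conv n (pdx g) P - a (tproj P) * vp_conv n (pdy g) P))
    \<longlonglongrightarrow> (LINT P|sq. u (tproj P) * (b (tproj P) * pdx g P - a (tproj P) * pdy g P))"
  proof (rule integral_dominated_convergence[where w = "\<lambda>P. norm (u (tproj P)) * (norm (b (tproj P)) * Bx + norm (a (tproj P)) * By)"])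
    show "(\<lambda>P. u (tproj P) * (b (tproj P) * pdx g P - a (tproj P) * pdy g P)) \<in> borel_measurable sq"
      by (intro sq_measurable_continuous continuous_intros u' a' b' cont)
    show "(\<lambda>P. u (tproj P) * (b (tproj P) * vp_conv n (pdx g) P - a (tproj P) * vp_conv n (pdy g) P)) \<in> borel_measurable sq" for n
      by (intro sq_measurable_continuous continuous_intros u' a' b' cc)
    show "integrable sq (\<lambda>P. norm (u (tproj P)) * (norm (b (tproj P)) * Bx + norm (a (tproj P)) * By))"
      by (intro sq_integrable_continuous continuous_intros u' a' b')
    show "AE P in sq. (\<lambda>n. u (tproj P) * (b (tproj P) * vp_conv n (pdx g) P - a (tproj P) * vp_conv n (pdy g) P))
      \<longlonglongrightarrow> u (tproj P) * (b (tproj P) * pdx g P - a (tproj P) * pdy g P)"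
      by (intro AE_I2 tendsto_intros vp_conv_tendsto cont pp)
    show "AE P in sq. norm (u (tproj P) * (b (tproj P) * vp_conv n (pdx g) P - a (tproj P) * vp_conv n (pdy g) P))
       \<le> norm (u (tproj P)) * (norm (b (tproj P)) * Bx + norm (a (tproj P)) * By)" for n
    proof (intro AE_I2)
      fix P
      have "norm (b (tproj P) * vp_conv n (pdx g) P - a (tproj P) * vp_conv n (pdy g) P) \<le> norm (b (tproj P)) * norm (vp_conv n (pdx g) P) + norm (a (tproj P)) * norm (vp_conv n (pdy g) P)"
        using norm_triangle_ineq4[of "b (tproj P) * vp_conv n (pdx g) P" "a (tproj P) * vp_conv n (pdy g) P"] by (simp add: norm_mult)
      also have "\<dots> \<le> norm (b (tproj P)) * Bx + norm (a (tproj P)) * By"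
        by (intro add_mono mult_left_mono vp_conv_bound cont Bx By norm_ge_zero)
      finally show "norm (u (tproj P) * (b (tproj P) * vp_conv n (pdx g) P - a (tproj P) * vp_conv n (pdy g) P))
        \<le> norm (u (tproj P)) * (norm (b (tproj P)) * Bx + norm (a (tproj P)) * By)"
        by (simp only: norm_mult) (rule mult_left_mono, auto)
    qed
  qed
  note L1 = this
  have "(\<lambda>n. LINT P|sq. f (tproj P) * vp_conv n g P) \<longlonglongrightarrow> (LINT P|sq. f (tproj P) * g P)"
  proof (rule integral_dominated_convergence[where w = "\<lambda>P. norm (f (tproj P)) * B"])
    show "(\<lambda>P. f (tproj P) * g P) \<in> borel_measurable sq" "(\<lambda>P. f (tproj P) * vp_conv n g P) \<in> borel_measurable sq" for n
      by (intro borel_measurable_times borel_measurable_integrable[OF f'] sq_measurable_continuous cont cc)+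
    show "integrable sq (\<lambda>P. norm (f (tproj P)) * B)" using f' by (intro integrable_mult_left integrable_norm)
    show "AE P in sq. (\<lambda>n. f (tproj P) * vp_conv n g P) \<longlonglongrightarrow> f (tproj P) * g P"
      by (intro AE_I2 tendsto_intros vp_conv_tendsto cont p)
    show "AE P in sq. norm (f (tproj P) * vp_conv n g P) \<le> norm (f (tproj P)) * B" for n
      by (intro AE_I2) (simp add: norm_mult mult_left_mono vp_conv_bound cont B)
  qed
  note L2 = this
  show ?thesis by (rule LIMSEQ_unique[OF tendsto_minus[OF L1, unfolded eq] L2])
qed

section \<open>Area estimates, coverings and potentials\<close>

text \<open>Cramer's rule in the sum norm, with an explicit constant so that the later choices can
  refer to it.\<close>

lemma inverse_matrix_bound:
  fixes p q r s :: real
  assumes d: "p * s - q * r \<noteq> 0"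
  defines "k \<equiv> (\<bar>p\<bar> + \<bar>q\<bar> + \<bar>r\<bar> + \<bar>s\<bar>) / \<bar>p * s - q * r\<bar>"
  shows "\<bar>x\<bar> + \<bar>y\<bar> \<le> k * (\<bar>p * x + q * y\<bar> + \<bar>r * x + s * y\<bar>)" and "k > 0"
proof -
  let ?D = "p * s - q * r" and ?u = "p * x + q * y" and ?v = "r * x + s * y"
  have "\<bar>x\<bar> * \<bar>?D\<bar> = \<bar>s * ?u - q * ?v\<bar>" unfolding abs_mult[symmetric] by (rule arg_cong) (simp add: algebra_simps)
  also have "\<dots> \<le> \<bar>s\<bar> * \<bar>?u\<bar> + \<bar>q\<bar> * \<bar>?v\<bar>" using abs_triangle_ineq4[of "s * ?u" "q * ?v"] by (simp add: abs_mult)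
  finally have 1: "\<bar>x\<bar> * \<bar>?D\<bar> \<le> \<bar>s\<bar> * \<bar>?u\<bar> + \<bar>q\<bar> * \<bar>?v\<bar>" .
  have "\<bar>y\<bar> * \<bar>?D\<bar> = \<bar>p * ?v - r * ?u\<bar>" unfolding abs_mult[symmetric] by (rule arg_cong) (simp add: algebra_simps)
  also have "\<dots> \<le> \<bar>p\<bar> * \<bar>?v\<bar> + \<bar>r\<bar> * \<bar>?u\<bar>" using abs_triangle_ineq4[of "p * ?v" "r * ?u"] by (simp add: abs_mult)
  finally have 2: "\<bar>y\<bar> * \<bar>?D\<bar> \<le> \<bar>p\<bar> * \<bar>?v\<bar> + \<bar>r\<bar> * \<bar>?u\<bar>" .
  have "(\<bar>x\<bar> + \<bar>y\<bar>) * \<bar>?D\<bar> \<le> (\<bar>s\<bar> + \<bar>r\<bar>) * \<bar>?u\<bar> + (\<bar>q\<bar> + \<bar>p\<bar>) * \<bar>?v\<bar>"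
    using 1 2 by (simp add: algebra_simps)
  also have "\<dots> \<le> (\<bar>p\<bar> + \<bar>q\<bar> + \<bar>r\<bar> + \<bar>s\<bar>) * \<bar>?u\<bar> + (\<bar>p\<bar> + \<bar>q\<bar> + \<bar>r\<bar> + \<bar>s\<bar>) * \<bar>?v\<bar>"
    by (rule add_mono; rule mult_right_mono) auto
  finally have "(\<bar>x\<bar> + \<bar>y\<bar>) * \<bar>?D\<bar> \<le> (\<bar>p\<bar> + \<bar>q\<bar> + \<bar>r\<bar> + \<bar>s\<bar>) * (\<bar>?u\<bar> + \<bar>?v\<bar>)" by (simp add: algebra_simps)
  then show "\<bar>x\<bar> + \<bar>y\<bar> \<le> k * (\<bar>?u\<bar> + \<bar>?v\<bar>)"
    using d by (simp add: k_def field_simps)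
  have "p \<noteq> 0 \<or> q \<noteq> 0" using d by auto
  then have "\<bar>p\<bar> + \<bar>q\<bar> + \<bar>r\<bar> + \<bar>s\<bar> > 0" by linarith
  then show "k > 0" using d by (simp add: k_def)
qed

text \<open>Strict differentiability: the error estimate is uniform in both points, not only
  relative to \<open>P0\<close>. It is the mean value inequality for \<open>f\<close> minus its
  linear part at \<open>P0\<close>, whose gradient is small near \<open>P0\<close>.\<close>

lemma C1_remainder:
  fixes f :: "real \<times> real \<Rightarrow> real"
  assumes V: "open V" "P0 \<in> V" and f: "C1_on V f" and e: "\<eta> > 0"
  obtains \<delta> where "\<delta> > 0" "ball P0 \<delta> \<subseteq> V" "\<And>P Q. P \<in> ball P0 \<delta> \<Longrightarrow> Q \<in> ball P0 \<delta> \<Longrightarrow>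
    \<bar>f P - f Q - (pdx f P0 * (fst P - fst Q) + pdy f P0 * (snd P - snd Q))\<bar> \<le> \<eta> * (\<bar>fst P - fst Q\<bar> + \<bar>snd P - snd Q\<bar>)"
proof -
  have "isCont (pdx f) P0" "isCont (pdy f) P0"
    using f V by (auto simp: C1_on_def continuous_on_eq_continuous_at)
  then obtain \<delta>1 \<delta>2 where d12: "\<delta>1 > 0" "\<And>P. dist P P0 < \<delta>1 \<Longrightarrow> dist (pdx f P) (pdx f P0) < \<eta> / 2"
     "\<delta>2 > 0" "\<And>P. dist P P0 < \<delta>2 \<Longrightarrow> dist (pdy f P) (pdy f P0) < \<eta> / 2"
    using e unfolding continuous_at_eps_delta by (metis half_gt_zero)
  obtain \<delta>3 where d3: "\<delta>3 > 0" "ball P0 \<delta>3 \<subseteq> V" using V open_contains_ball by blast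
  define \<delta> where "\<delta> = min \<delta>1 (min \<delta>2 \<delta>3)"
  have sub: "ball P0 \<delta> \<subseteq> V" using d3 by (auto simp: \<delta>_def)
  have "\<bar>f P - f Q - (pdx f P0 * (fst P - fst Q) + pdy f P0 * (snd P - snd Q))\<bar> \<le> \<eta> * (\<bar>fst P - fst Q\<bar> + \<bar>snd P - snd Q\<bar>)"
    if PQ: "P \<in> ball P0 \<delta>" "Q \<in> ball P0 \<delta>" for P Q
  proof -
    define g where "g = (\<lambda>P. f P - (pdx f P0 * fst P + pdy f P0 * snd P))"
    have "norm (g P - g Q) \<le> \<eta> * norm (P - Q)"
    proof (rule differentiable_bound[where S = "ball P0 \<delta>"])
      fix R assume R: "R \<in> ball P0 \<delta>"
      have "f differentiable (at R)" using f sub R by (auto simp: C1_on_def)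
      from pd_has_derivative[OF this]
      have "(g has_derivative (\<lambda>h. (fst h *\<^sub>R pdx f R + snd h *\<^sub>R pdy f R) - (pdx f P0 * fst h + pdy f P0 * snd h))) (at R)"
        unfolding g_def by (intro has_derivative_diff has_derivative_add has_derivative_mult_right has_derivative_fst has_derivative_snd has_derivative_ident)
      then have "(g has_derivative (\<lambda>h. (pdx f R - pdx f P0) * fst h + (pdy f R - pdy f P0) * snd h)) (at R)"
        by (rule has_derivative_eq_rhs) (simp add: fun_eq_iff algebra_simps)
      then show "(g has_derivative (\<lambda>h. (pdx f R - pdx f P0) * fst h + (pdy f R - pdy f P0) * snd h)) (at R within ball P0 \<delta>)"
        by (rule has_derivative_at_withinI)
      show "onorm (\<lambda>h. (pdx f R - pdx f P0) * fst h + (pdy f R - pdy f P0) * snd h) \<le> \<eta>"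
      proof (rule onorm_bound)
        fix h :: "real \<times> real"
        have b: "\<bar>fst h\<bar> \<le> norm h" "\<bar>snd h\<bar> \<le> norm h"
          using norm_fst_le[of "fst h" "snd h"] norm_snd_le[of "snd h" "fst h"] by simp_all
        have c: "\<bar>pdx f R - pdx f P0\<bar> \<le> \<eta> / 2" "\<bar>pdy f R - pdy f P0\<bar> \<le> \<eta> / 2"
        proof -
          have "dist R P0 < \<delta>1" "dist R P0 < \<delta>2" using R by (auto simp: \<delta>_def dist_commute)
          from d12(2)[OF this(1)] d12(4)[OF this(2)]
          show "\<bar>pdx f R - pdx f P0\<bar> \<le> \<eta> / 2" "\<bar>pdy f R - pdy f P0\<bar> \<le> \<eta> / 2"
            by (simp_all add: dist_real_def)
        qed
        have "\<bar>(pdx f R - pdx f P0) * fst h + (pdy f R - pdy f P0) * snd h\<bar> \<le> \<bar>pdx f R - pdx f P0\<bar> * \<bar>fst h\<bar> + \<bar>pdy f R - pdy f P0\<bar> * \<bar>snd h\<bar>"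
          using abs_triangle_ineq by (metis abs_mult)
        also have "\<dots> \<le> \<eta> / 2 * norm h + \<eta> / 2 * norm h"
          using b c e by (intro add_mono mult_mono) auto
        finally show "norm ((pdx f R - pdx f P0) * fst h + (pdy f R - pdy f P0) * snd h) \<le> \<eta> * norm h" by simp
      qed (use e in auto)
    qed (use PQ in auto)
    also have "norm (P - Q) \<le> \<bar>fst P - fst Q\<bar> + \<bar>snd P - snd Q\<bar>"
      unfolding norm_prod_def using sqrt_sum_squares_le_sum_abs[of "fst (P - Q)" "snd (P - Q)"] by simp
    finally show ?thesis using e by (simp add: g_def algebra_simps)
  qed
  moreover have "\<delta> > 0" using d12 d3 by (simp add: \<delta>_def)
  ultimately show thesis using that sub by blast
qed

text \<open>\<open>W\<close> compares only points at equal height, so a thin slanted set is measured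
  correctly although its horizontal extent may far exceed \<open>W\<close>. Each slice lies within
  \<open>W\<close> of one of its points and the heights within \<open>H\<close> of one height,
  whence the factor 2 * 2.\<close>

lemma emeasure_slices:
  fixes E :: "(real \<times> real) set"
  assumes E: "E \<in> sets borel"
    and y: "\<And>P Q. P \<in> E \<Longrightarrow> Q \<in> E \<Longrightarrow> \<bar>snd P - snd Q\<bar> \<le> H"
    and x: "\<And>P Q. P \<in> E \<Longrightarrow> Q \<in> E \<Longrightarrow> snd P = snd Q \<Longrightarrow> \<bar>fst P - fst Q\<bar> \<le> W"
    and nn: "0 \<le> H" "0 \<le> W"
  shows "emeasure lborel E \<le> ennreal (4 * H * W)"
proof (cases "E = {}")
  case False
  then obtain P0 where P0: "P0 \<in> E" by blast
  have E': "E \<in> sets (lborel \<Otimes>\<^sub>M lborel)" using E by (simp only: lborel_prod sets_lborel)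
  have "emeasure lborel E = (\<integral>\<^sup>+ y. emeasure lborel ((\<lambda>x. (x, y)) -` E) \<partial>lborel)"
    using lborel_pair.emeasure_pair_measure_alt2[OF E'] by (simp only: lborel_prod)
  also have "\<dots> \<le> (\<integral>\<^sup>+ y. ennreal (2 * W) * indicator {snd P0 - H..snd P0 + H} y \<partial>lborel)"
  proof (rule nn_integral_mono)
    fix y :: real
    show "emeasure lborel ((\<lambda>x. (x, y)) -` E) \<le> ennreal (2 * W) * indicator {snd P0 - H..snd P0 + H} y"
    proof (cases "(\<lambda>x. (x, y)) -` E = {}")
      case False
      then obtain x0 where x0: "(x0, y) \<in> E" by blast
      have "(\<lambda>x. (x, y)) -` E \<subseteq> {x0 - W..x0 + W}"
      proof
        fix x' assume "x' \<in> (\<lambda>x. (x, y)) -` E"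
        then have "\<bar>x' - x0\<bar> \<le> W" using x[OF _ x0, of "(x', y)"] by simp
        then show "x' \<in> {x0 - W..x0 + W}" by auto
      qed
      then have "emeasure lborel ((\<lambda>x. (x, y)) -` E) \<le> emeasure lborel {x0 - W..x0 + W}" by (intro emeasure_mono) auto
      also have "\<dots> = ennreal (2 * W)" using nn by simp
      finally show ?thesis using y[OF x0 P0] by (auto simp: indicator_def)
    qed simp
  qed
  also have "\<dots> = ennreal (2 * W) * ennreal (2 * H)" using nn by (simp add: nn_integral_cmult)
  also have "\<dots> = ennreal (4 * H * W)" using nn by (simp add: ennreal_mult[symmetric] mult_ac)
  finally show ?thesis .
qed simp

lemma emeasure_slices':
  fixes E :: "(real \<times> real) set"
  assumes E: "E \<in> sets borel"
    and y: "\<And>P Q. P \<in> E \<Longrightarrow> Q \<in> E \<Longrightarrow> \<bar>fst P - fst Q\<bar> \<le> H"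
    and x: "\<And>P Q. P \<in> E \<Longrightarrow> Q \<in> E \<Longrightarrow> fst P = fst Q \<Longrightarrow> \<bar>snd P - snd Q\<bar> \<le> W"
    and nn: "0 \<le> H" "0 \<le> W"
  shows "emeasure lborel E \<le> ennreal (4 * H * W)"
proof (cases "E = {}")
  case False
  then obtain P0 where P0: "P0 \<in> E" by blast
  have E': "E \<in> sets (lborel \<Otimes>\<^sub>M lborel)" using E by (simp only: lborel_prod sets_lborel)
  have "emeasure lborel E = (\<integral>\<^sup>+ x. emeasure lborel (Pair x -` E) \<partial>lborel)"
    using lborel.emeasure_pair_measure_alt[OF E'] by (simp only: lborel_prod)
  also have "\<dots> \<le> (\<integral>\<^sup>+ x. ennreal (2 * W) * indicator {fst P0 - H..fst P0 + H} x \<partial>lborel)"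
  proof (rule nn_integral_mono)
    fix y :: real
    show "emeasure lborel (Pair y -` E) \<le> ennreal (2 * W) * indicator {fst P0 - H..fst P0 + H} y"
    proof (cases "Pair y -` E = {}")
      case False
      then obtain x0 where x0: "(y, x0) \<in> E" by blast
      have "Pair y -` E \<subseteq> {x0 - W..x0 + W}"
      proof
        fix x' assume "x' \<in> Pair y -` E"
        then have "\<bar>x' - x0\<bar> \<le> W" using x[OF _ x0, of "(y, x')"] by simp
        then show "x' \<in> {x0 - W..x0 + W}" by auto
      qed
      then have "emeasure lborel (Pair y -` E) \<le> emeasure lborel {x0 - W..x0 + W}" by (intro emeasure_mono) auto
      also have "\<dots> = ennreal (2 * W)" using nn by simp
      finally show ?thesis using y[OF x0 P0] by (auto simp: indicator_def)
    qed simp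
  qed
  also have "\<dots> = ennreal (2 * W) * ennreal (2 * H)" using nn by (simp add: nn_integral_cmult)
  also have "\<dots> = ennreal (4 * H * W)" using nn by (simp add: ennreal_mult[symmetric] mult_ac)
  finally show ?thesis .
qed simp

text \<open>The area bound comes from slicing along the axis in whose direction the first coordinate varies.\<close>

lemma C1_chart_estimates:
  fixes s t :: "real \<times> real \<Rightarrow> real"
  assumes V: "open V" "P0 \<in> V" and s: "C1_on V s" and t: "C1_on V t"
    and det: "pdx s P0 * pdy t P0 - pdy s P0 * pdx t P0 \<noteq> 0"
  obtains \<delta> K where "\<delta> > 0" "K > 0" "ball P0 \<delta> \<subseteq> V"
    "\<And>P Q. P \<in> ball P0 \<delta> \<Longrightarrow> Q \<in> ball P0 \<delta> \<Longrightarrow> s P = s Q \<Longrightarrow> t P = t Q \<Longrightarrow> P = Q"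
    "\<And>E \<alpha> \<beta>. E \<in> sets borel \<Longrightarrow> E \<subseteq> ball P0 \<delta> \<Longrightarrow> 0 \<le> \<alpha> \<Longrightarrow> 0 \<le> \<beta> \<Longrightarrow>
      (\<And>P Q. P \<in> E \<Longrightarrow> Q \<in> E \<Longrightarrow> \<bar>s P - s Q\<bar> \<le> \<alpha> \<and> \<bar>t P - t Q\<bar> \<le> \<beta>) \<Longrightarrow>
      emeasure lborel E \<le> ennreal (K * \<alpha> * (\<alpha> + \<beta>))"
proof -
  define k where "k = (\<bar>pdx s P0\<bar> + \<bar>pdy s P0\<bar> + \<bar>pdx t P0\<bar> + \<bar>pdy t P0\<bar>) / \<bar>pdx s P0 * pdy t P0 - pdy s P0 * pdx t P0\<bar>"
  have k: "k > 0" "\<And>x y. \<bar>x\<bar> + \<bar>y\<bar> \<le> k * (\<bar>pdx s P0 * x + pdy s P0 * y\<bar> + \<bar>pdx t P0 * x + pdy t P0 * y\<bar>)"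
    using inverse_matrix_bound[OF det] by (simp_all add: k_def)
  define g where "g = max \<bar>pdx s P0\<bar> \<bar>pdy s P0\<bar>"
  have "pdx s P0 \<noteq> 0 \<or> pdy s P0 \<noteq> 0" using det by auto
  then have g: "g > 0" by (auto simp: g_def less_max_iff_disj)
  \<comment> \<open>The bound 1/(4k) lets half of the total displacement be absorbed in
    \<open>bi\<close>; the bound g/2 keeps the slope of \<open>s\<close> along the slicing axis at
    least half of its value at \<open>P0\<close>.\<close>
  define \<eta> where "\<eta> = min (1 / (4 * k)) (g / 2)"
  have \<eta>: "\<eta> > 0" "\<eta> \<le> 1 / (4 * k)" "\<eta> \<le> g / 2" using k g by (auto simp: \<eta>_def)
  obtain \<delta>1 where d1: "\<delta>1 > 0" "ball P0 \<delta>1 \<subseteq> V" "\<And>P Q. P \<in> ball P0 \<delta>1 \<Longrightarrow> Q \<in> ball P0 \<delta>1 \<Longrightarrow>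
    \<bar>s P - s Q - (pdx s P0 * (fst P - fst Q) + pdy s P0 * (snd P - snd Q))\<bar> \<le> \<eta> * (\<bar>fst P - fst Q\<bar> + \<bar>snd P - snd Q\<bar>)"
    using C1_remainder[OF V s \<eta>(1)] by blast
  obtain \<delta>2 where d2: "\<delta>2 > 0" "ball P0 \<delta>2 \<subseteq> V" "\<And>P Q. P \<in> ball P0 \<delta>2 \<Longrightarrow> Q \<in> ball P0 \<delta>2 \<Longrightarrow>
    \<bar>t P - t Q - (pdx t P0 * (fst P - fst Q) + pdy t P0 * (snd P - snd Q))\<bar> \<le> \<eta> * (\<bar>fst P - fst Q\<bar> + \<bar>snd P - snd Q\<bar>)"
    using C1_remainder[OF V t \<eta>(1)] by blast
  define \<delta> where "\<delta> = min \<delta>1 \<delta>2"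
  have bi: "\<bar>fst P - fst Q\<bar> + \<bar>snd P - snd Q\<bar> \<le> 2 * k * (\<bar>s P - s Q\<bar> + \<bar>t P - t Q\<bar>)"
    if PQ: "P \<in> ball P0 \<delta>" "Q \<in> ball P0 \<delta>" for P Q
  proof -
    let ?x = "fst P - fst Q" and ?y = "snd P - snd Q"
    have 1: "\<bar>s P - s Q - (pdx s P0 * ?x + pdy s P0 * ?y)\<bar> \<le> \<eta> * (\<bar>?x\<bar> + \<bar>?y\<bar>)"
      using d1(3)[of P Q] PQ by (simp add: \<delta>_def)
    have 2: "\<bar>t P - t Q - (pdx t P0 * ?x + pdy t P0 * ?y)\<bar> \<le> \<eta> * (\<bar>?x\<bar> + \<bar>?y\<bar>)"
      using d2(3)[of P Q] PQ by (simp add: \<delta>_def)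
    have "\<bar>?x\<bar> + \<bar>?y\<bar> \<le> k * (\<bar>pdx s P0 * ?x + pdy s P0 * ?y\<bar> + \<bar>pdx t P0 * ?x + pdy t P0 * ?y\<bar>)" by (rule k(2))
    also have "\<dots> \<le> k * (\<bar>s P - s Q\<bar> + \<bar>t P - t Q\<bar> + 2 * (\<eta> * (\<bar>?x\<bar> + \<bar>?y\<bar>)))"
      using 1 2 k(1) by (intro mult_left_mono) linarith+
    also have "\<dots> = k * (\<bar>s P - s Q\<bar> + \<bar>t P - t Q\<bar>) + (2 * k * \<eta>) * (\<bar>?x\<bar> + \<bar>?y\<bar>)" by (simp add: algebra_simps)
    also have "\<dots> \<le> k * (\<bar>s P - s Q\<bar> + \<bar>t P - t Q\<bar>) + (1/2) * (\<bar>?x\<bar> + \<bar>?y\<bar>)"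
      using \<eta>(2) k(1) by (intro add_mono mult_right_mono) (auto simp: field_simps)
    finally show ?thesis by (simp add: algebra_simps)
  qed
  define K where "K = 4 * (2 * k) * (2 / g)"
  have "K > 0" using k g by (simp add: K_def)
  have meas: "emeasure lborel E \<le> ennreal (K * \<alpha> * (\<alpha> + \<beta>))"
    if E: "E \<in> sets borel" "E \<subseteq> ball P0 \<delta>" and nn: "0 \<le> \<alpha>" "0 \<le> \<beta>"
    and osc: "\<And>P Q. P \<in> E \<Longrightarrow> Q \<in> E \<Longrightarrow> \<bar>s P - s Q\<bar> \<le> \<alpha> \<and> \<bar>t P - t Q\<bar> \<le> \<beta>" for E \<alpha> \<beta>
  proof -
    have tot: "\<bar>fst P - fst Q\<bar> + \<bar>snd P - snd Q\<bar> \<le> 2 * k * (\<alpha> + \<beta>)" if "P \<in> E" "Q \<in> E" for P Q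
    proof -
      have "\<bar>fst P - fst Q\<bar> + \<bar>snd P - snd Q\<bar> \<le> 2 * k * (\<bar>s P - s Q\<bar> + \<bar>t P - t Q\<bar>)" using bi E that by blast
      also have "\<dots> \<le> 2 * k * (\<alpha> + \<beta>)" using osc[OF that] k(1) by (intro mult_left_mono) auto
      finally show ?thesis .
    qed
    have rem: "\<bar>s P - s Q - (pdx s P0 * (fst P - fst Q) + pdy s P0 * (snd P - snd Q))\<bar> \<le> g / 2 * (\<bar>fst P - fst Q\<bar> + \<bar>snd P - snd Q\<bar>)"
      if "P \<in> E" "Q \<in> E" for P Q
    proof -
      have "\<bar>s P - s Q - (pdx s P0 * (fst P - fst Q) + pdy s P0 * (snd P - snd Q))\<bar> \<le> \<eta> * (\<bar>fst P - fst Q\<bar> + \<bar>snd P - snd Q\<bar>)"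
      proof (rule d1(3))
        show "P \<in> ball P0 \<delta>1" "Q \<in> ball P0 \<delta>1" using subsetD[OF E(2)] that by (auto simp: \<delta>_def)
      qed
      also have "\<dots> \<le> g / 2 * (\<bar>fst P - fst Q\<bar> + \<bar>snd P - snd Q\<bar>)" using \<eta>(3) by (intro mult_right_mono) auto
      finally show ?thesis .
    qed
    have abs_le: "\<bar>X\<bar> \<le> \<bar>d\<bar> + h" if "\<bar>d - X\<bar> \<le> h" for X d h :: real
      using that by linarith
    have "emeasure lborel E \<le> ennreal (4 * (2 * k * (\<alpha> + \<beta>)) * (2 / g * \<alpha>))"
    proof (cases "\<bar>pdx s P0\<bar> = g")
      case True
      show ?thesis
      proof (rule emeasure_slices[OF E(1)])
        fix P Q assume PQ: "P \<in> E" "Q \<in> E"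
        show "\<bar>snd P - snd Q\<bar> \<le> 2 * k * (\<alpha> + \<beta>)" using tot[OF PQ] by linarith
        assume eq: "snd P = snd Q"
        have "\<bar>pdx s P0 * (fst P - fst Q)\<bar> \<le> \<bar>s P - s Q\<bar> + g / 2 * \<bar>fst P - fst Q\<bar>"
          by (rule abs_le) (use rem[OF PQ] eq in simp)
        then have "g * \<bar>fst P - fst Q\<bar> \<le> \<alpha> + g / 2 * \<bar>fst P - fst Q\<bar>"
          using osc[OF PQ] by (simp add: abs_mult True)
        then show "\<bar>fst P - fst Q\<bar> \<le> 2 / g * \<alpha>" using g by (simp add: field_simps)
      qed (use k g nn in auto)
    next
      case False
      then have gy: "\<bar>pdy s P0\<bar> = g" by (auto simp: g_def)
      show ?thesis
      proof (rule emeasure_slices'[OF E(1)])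
        fix P Q assume PQ: "P \<in> E" "Q \<in> E"
        show "\<bar>fst P - fst Q\<bar> \<le> 2 * k * (\<alpha> + \<beta>)" using tot[OF PQ] by linarith
        assume eq: "fst P = fst Q"
        have "\<bar>pdy s P0 * (snd P - snd Q)\<bar> \<le> \<bar>s P - s Q\<bar> + g / 2 * \<bar>snd P - snd Q\<bar>"
          by (rule abs_le) (use rem[OF PQ] eq in simp)
        then have "g * \<bar>snd P - snd Q\<bar> \<le> \<alpha> + g / 2 * \<bar>snd P - snd Q\<bar>"
          using osc[OF PQ] by (simp add: abs_mult gy)
        then show "\<bar>snd P - snd Q\<bar> \<le> 2 / g * \<alpha>" using g by (simp add: field_simps)
      qed (use k g nn in auto)
    qed
    then show ?thesis by (simp add: K_def mult_ac)
  qed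
  show thesis
  proof (rule that)
    show "\<delta> > 0" "K > 0" "ball P0 \<delta> \<subseteq> V" using d1 d2 \<open>K > 0\<close> by (auto simp: \<delta>_def)
    show "P = Q" if "P \<in> ball P0 \<delta>" "Q \<in> ball P0 \<delta>" "s P = s Q" "t P = t Q" for P Q
      using bi[OF that(1,2)] that(3,4) by (simp add: prod_eq_iff) linarith
  qed (fact meas)
qed

section \<open>The model function of the normal form\<close>

text \<open>A mean value inequality with a comparison function \<psi> in place of the identity. With
  \<psi> = \<open>spow \<sigma>\<close> it measures increments along the t-axis, where the
  derivative of the first integral degenerates like |t|^\<sigma>.\<close>

lemma variation_bound:
  fixes f :: "real \<Rightarrow> complex"
  assumes I: "is_interval I" "u \<in> I" "v \<in> I"
    and f: "\<And>x. x \<in> I \<Longrightarrow> (f has_vector_derivative f' x) (at x)"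
    and \<psi>: "\<And>x. x \<in> I \<Longrightarrow> (\<psi> has_real_derivative \<psi>' x) (at x)"
    and bnd: "\<And>x. x \<in> I \<Longrightarrow> norm (f' x) \<le> c * \<psi>' x" and c: "c \<ge> 0"
  shows "norm (f u - f v) \<le> c * \<bar>\<psi> u - \<psi> v\<bar>"
proof -
  have *: "norm (f u - f v) \<le> c * (\<psi> u - \<psi> v)" if uv: "u \<in> I" "v \<in> I" "v < u" for u v
  proof -
    have sub: "x \<in> I" if "v \<le> x" "x \<le> u" for x
      using I(1) uv that unfolding is_interval_1 by blast
    have "norm (f u - f v) \<le> c * \<psi> u - c * \<psi> v"
    proof (rule differentiable_bound_general[OF uv(3)])
      show "continuous_on {v..u} f"
        using sub has_vector_derivative_continuous[OF f] by (intro continuous_at_imp_continuous_on) auto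
      show "continuous_on {v..u} (\<lambda>x. c * \<psi> x)"
        using sub DERIV_isCont[OF \<psi>] by (intro continuous_on_mult continuous_on_const continuous_at_imp_continuous_on) auto
      fix x assume "v < x" "x < u"
      then have x: "x \<in> I" using sub by simp
      show "(f has_vector_derivative f' x) (at x)" using f[OF x] .
      show "((\<lambda>x. c * \<psi> x) has_vector_derivative c * \<psi>' x) (at x)"
        using DERIV_cmult[OF \<psi>[OF x], of c] by (simp add: has_real_derivative_iff_has_vector_derivative)
      show "norm (f' x) \<le> c * \<psi>' x" by (rule bnd[OF x])
    qed
    then show ?thesis by (simp add: algebra_simps)
  qed
  consider "u = v" | "v < u" | "u < v" by linarith
  then show ?thesis
  proof cases
    case 2
    have "c * (\<psi> u - \<psi> v) \<le> c * \<bar>\<psi> u - \<psi> v\<bar>" using c by (intro mult_left_mono) auto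
    then show ?thesis using *[OF I(2,3) 2] by linarith
  next
    case 3
    have "c * (\<psi> v - \<psi> u) \<le> c * \<bar>\<psi> u - \<psi> v\<bar>" using c by (intro mult_left_mono) auto
    then show ?thesis using *[OF I(3,2) 3] by (simp add: norm_minus_commute)
  qed simp
qed

text \<open>The odd primitive of |x|^\<sigma>: the form ds + i |t|^\<sigma> dt is the differential
  of s + i \<open>spow \<sigma> t\<close>.\<close>

definition spow :: "real \<Rightarrow> real \<Rightarrow> real" where
  "spow \<sigma> x = x * \<bar>x\<bar> powr \<sigma> / (1 + \<sigma>)"

lemma spow_minus: "spow \<sigma> (- x) = - spow \<sigma> x"
  by (simp add: spow_def)

lemma spow_nonneg: "x \<ge> 0 \<Longrightarrow> \<sigma> > 0 \<Longrightarrow> spow \<sigma> x = x powr (1 + \<sigma>) / (1 + \<sigma>)"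
  by (cases "x = 0") (auto simp: spow_def powr_add)

lemma spow_derivative:
  assumes "\<sigma> > 0" shows "(spow \<sigma> has_real_derivative \<bar>x\<bar> powr \<sigma>) (at x)"
proof -
  have pos: "(spow \<sigma> has_real_derivative \<bar>x\<bar> powr \<sigma>) (at x)" if "x > 0" for x
  proof -
    have "eventually (\<lambda>y. y > 0) (nhds x)" using eventually_nhds_in_open[of "{0<..}" x] that by simp
    then have ev: "eventually (\<lambda>y. y powr (1 + \<sigma>) / (1 + \<sigma>) = spow \<sigma> y) (nhds x)"
      by eventually_elim (use assms spow_nonneg in auto)
    have "((\<lambda>y. y powr (1 + \<sigma>) / (1 + \<sigma>)) has_real_derivative (1 + \<sigma>) * x powr (1 + \<sigma> - 1) / (1 + \<sigma>)) (at x)"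
      using that by (intro DERIV_cdivide has_real_derivative_powr) auto
    then show ?thesis using DERIV_cong_ev[OF refl ev refl] that assms by simp
  qed
  consider "x > 0" | "x = 0" | "x < 0" by linarith
  then show ?thesis
  proof cases
    case 1 then show ?thesis by (rule pos)
  next
    case 2
    have "((\<lambda>h. \<bar>h\<bar> powr \<sigma> / (1 + \<sigma>)) \<longlongrightarrow> 0 powr \<sigma> / (1 + \<sigma>)) (at 0)"
      using assms by (intro tendsto_divide tendsto_powr' tendsto_rabs_zero tendsto_ident_at tendsto_const) auto
    then have "((\<lambda>h. \<bar>h\<bar> powr \<sigma> / (1 + \<sigma>)) \<longlongrightarrow> 0) (at 0)" by simp
    moreover have "eventually (\<lambda>h. \<bar>h\<bar> powr \<sigma> / (1 + \<sigma>) = (spow \<sigma> (0 + h) - spow \<sigma> 0) / h) (at 0)"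
      by (auto simp: eventually_at_filter spow_def intro!: always_eventually)
    ultimately have "((\<lambda>h. (spow \<sigma> (0 + h) - spow \<sigma> 0) / h) \<longlongrightarrow> 0) (at 0)"
      by (rule Lim_transform_eventually)
    then show ?thesis using 2 by (simp add: DERIV_def)
  next
    case 3
    have "((\<lambda>y. - spow \<sigma> (- y)) has_real_derivative - (\<bar>- x\<bar> powr \<sigma> * - 1)) (at x)"
      using 3 by (intro DERIV_minus DERIV_chain2[OF pos]) (auto intro!: derivative_eq_intros)
    then show ?thesis by (simp add: spow_minus)
  qed
qed

text \<open>It says that the inverse of \<open>spow \<sigma>\<close> is Hoelder with exponent
  1/(1+\<sigma>). For arguments of equal sign this is superadditivity of x^(1+\<sigma>), from
  (1-s)^p + s^p \<le> 1 for p \<ge> 1; for opposite signs the distance is at most twice the larger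
  absolute value, which produces the factor 2^(1+\<sigma>).\<close>

lemma spow_lower:
  assumes s: "\<sigma> > 0" shows "\<bar>x - y\<bar> powr (1 + \<sigma>) \<le> (1 + \<sigma>) * 2 powr (1 + \<sigma>) * \<bar>spow \<sigma> x - spow \<sigma> y\<bar>"
proof -
  have super: "(x - y) powr (1 + \<sigma>) \<le> x powr (1 + \<sigma>) - y powr (1 + \<sigma>)" if xy: "0 \<le> y" "y \<le> x" for x y :: real
  proof (cases "x = 0")
    case False
    then have x: "x > 0" using xy by simp
    have "((x - y) / x) powr (1 + \<sigma>) \<le> ((x - y) / x) powr 1" "(y / x) powr (1 + \<sigma>) \<le> (y / x) powr 1"
      using xy x s by (intro powr_mono'; simp add: divide_le_eq_1)+
    then have "(x - y) powr (1 + \<sigma>) / x powr (1 + \<sigma>) + y powr (1 + \<sigma>) / x powr (1 + \<sigma>) \<le> (x - y) / x + y / x"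
      using xy x by (simp add: powr_divide)
    also have "\<dots> = 1" using x by (simp add: add_divide_distrib[symmetric])
    finally have "((x - y) powr (1 + \<sigma>) + y powr (1 + \<sigma>)) / x powr (1 + \<sigma>) \<le> 1" by (simp add: add_divide_distrib)
    then show ?thesis using x by (simp add: divide_le_eq_1)
  qed (use xy in auto)
  have two: "1 \<le> 2 powr (1 + \<sigma>)" using s by (simp add: ge_one_powr_ge_zero)
  have pp: "\<bar>x - y\<bar> powr (1 + \<sigma>) \<le> (1 + \<sigma>) * 2 powr (1 + \<sigma>) * \<bar>spow \<sigma> x - spow \<sigma> y\<bar>"
    if xy: "0 \<le> y" "y \<le> x" for x y
  proof -
    have le: "(x - y) powr (1 + \<sigma>) \<le> (1 + \<sigma>) * (spow \<sigma> x - spow \<sigma> y)"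
      using super[OF xy] xy s by (simp add: spow_nonneg right_diff_distrib)
    then have "0 \<le> spow \<sigma> x - spow \<sigma> y" using s by (smt (verit) powr_ge_zero zero_le_mult_iff)
    then have "1 * ((1 + \<sigma>) * (spow \<sigma> x - spow \<sigma> y)) \<le> 2 powr (1 + \<sigma>) * ((1 + \<sigma>) * (spow \<sigma> x - spow \<sigma> y))"
      using s two by (intro mult_right_mono) auto
    then show ?thesis using le xy \<open>0 \<le> spow \<sigma> x - spow \<sigma> y\<close> by (simp add: mult_ac)
  qed
  have pm: "\<bar>x - y\<bar> powr (1 + \<sigma>) \<le> (1 + \<sigma>) * 2 powr (1 + \<sigma>) * \<bar>spow \<sigma> x - spow \<sigma> y\<bar>"
    if xy: "y \<le> 0" "0 \<le> x" for x y
  proof -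
    have sx: "0 \<le> spow \<sigma> x" "0 \<le> - spow \<sigma> y" using xy s by (auto simp: spow_def mult_nonpos_nonneg divide_nonpos_pos)
    define z where "z = max x (- y)"
    have z: "0 \<le> z" "\<bar>x - y\<bar> \<le> 2 * z" using xy by (auto simp: z_def)
    have "\<bar>x - y\<bar> powr (1 + \<sigma>) \<le> (2 * z) powr (1 + \<sigma>)" using z s by (intro powr_mono2) auto
    also have "\<dots> = 2 powr (1 + \<sigma>) * ((1 + \<sigma>) * spow \<sigma> z)" using z s by (simp add: powr_mult spow_nonneg)
    also have "\<dots> \<le> 2 powr (1 + \<sigma>) * ((1 + \<sigma>) * \<bar>spow \<sigma> x - spow \<sigma> y\<bar>)"
    proof (intro mult_left_mono)
      show "spow \<sigma> z \<le> \<bar>spow \<sigma> x - spow \<sigma> y\<bar>" using sx by (auto simp: z_def max_def spow_minus)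
    qed (use s in auto)
    finally show ?thesis by (simp add: mult_ac)
  qed
  consider "0 \<le> y" "y \<le> x" | "0 \<le> x" "x \<le> y" | "y \<le> 0" "0 \<le> x" | "x \<le> 0" "0 \<le> y"
    | "x \<le> y" "y \<le> 0" | "y \<le> x" "x \<le> 0" by linarith
  then show ?thesis
  proof cases
    case 1 then show ?thesis by (rule pp)
  next
    case 2 from pp[OF this] show ?thesis by (simp add: abs_minus_commute)
  next
    case 3 then show ?thesis by (rule pm)
  next
    case 4 from pm[OF this] show ?thesis by (simp add: abs_minus_commute)
  next
    case 5 from pp[of "- y" "- x"] 5 show ?thesis by (simp add: spow_minus abs_minus_commute)
  next
    case 6 from pp[of "- x" "- y"] 6 show ?thesis by (simp add: spow_minus abs_minus_commute)
  qed
qed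

section \<open>Proper local homeomorphisms are injective\<close>

lemma closed_image_proper:
  fixes f :: "'a::euclidean_space \<Rightarrow> 'b::real_normed_vector"
  assumes f: "continuous_on UNIV f" and pr: "\<And>r. bounded (f -` cball 0 r)" and S: "closed S"
  shows "closed (f ` S)"
  unfolding closed_sequential_limits
proof (intro allI impI, elim conjE)
  fix y l assume y: "\<forall>n. y n \<in> f ` S" and l: "y \<longlonglongrightarrow> l"
  then have "\<forall>n. \<exists>s. s \<in> S \<and> y n = f s" by blast
  then obtain x where "\<forall>n. x n \<in> S \<and> y n = f (x n)" by (rule choice[THEN exE])
  then have x: "\<And>n. x n \<in> S" "\<And>n. y n = f (x n)" by auto
  have "Bseq y" using l by (rule convergent_imp_Bseq[OF convergentI])
  then obtain r where "\<And>n. norm (y n) \<le> r" by (auto simp: Bseq_def)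
  then have "range x \<subseteq> f -` cball 0 r" using x(2) by auto
  then have "bounded (range x)" using pr bounded_subset by blast
  then obtain l' and k :: "nat \<Rightarrow> nat" where k: "strict_mono k" "(x \<circ> k) \<longlonglongrightarrow> l'"
    using bounded_imp_convergent_subsequence by blast
  have "l' \<in> S" using S k(2) x(1) unfolding closed_sequential_limits by (metis comp_apply)
  have "isCont f l'" using f by (simp add: continuous_on_eq_continuous_at)
  then have "(\<lambda>n. f ((x \<circ> k) n)) \<longlonglongrightarrow> f l'" using k(2) by (rule isCont_tendsto_compose)
  moreover have "(\<lambda>n. f ((x \<circ> k) n)) \<longlonglongrightarrow> l"
    using LIMSEQ_subseq_LIMSEQ[OF l k(1)] x(2) by (simp add: o_def)
  ultimately have "l = f l'" using LIMSEQ_unique by blast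
  then show "l \<in> f ` S" using \<open>l' \<in> S\<close> by blast
qed

text \<open>A fibre is compact by properness and discrete by local injectivity, hence finite, and
  its points have disjoint neighbourhoods on which the map is injective. Over a small enough
  \<open>T\<close> these are the sheets.\<close>

lemma proper_local_homeomorphism_covering:
  fixes f :: "'a::euclidean_space \<Rightarrow> 'b::euclidean_space"
  assumes f: "continuous_on UNIV f" and pr: "\<And>r. bounded (f -` cball 0 r)"
    and op: "\<And>S. open S \<Longrightarrow> open (f ` S)"
    and inj: "\<And>x. \<exists>U. open U \<and> x \<in> U \<and> inj_on f U"
  shows "covering_space UNIV f UNIV"
proof
  show "continuous_on UNIV f" by (rule f)
  have "closed (range f)" "open (range f)"
    using closed_image_proper[OF f pr] op by auto
  then show "range f = UNIV" using clopen[of "range f"] by auto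
  fix z :: 'b
  define F where "F = f -` {z}"
  obtain U where U: "\<And>x. open (U x)" "\<And>x. x \<in> U x" "\<And>x. inj_on f (U x)" using inj by metis
  have "closed F" unfolding F_def by (rule closed_vimage[OF _ f]) auto
  moreover have "bounded F" using pr[of "norm z"] unfolding F_def by (rule bounded_subset) auto
  ultimately have "compact F" by (simp add: compact_eq_bounded_closed)
  moreover have "F \<subseteq> (\<Union>x\<in>F. U x)" using U(2) by blast
  ultimately obtain D where D: "D \<subseteq> F" "finite D" "F \<subseteq> (\<Union>x\<in>D. U x)"
    using U(1) by (meson compactE_image)
  have "F \<subseteq> D"
  proof
    fix x assume "x \<in> F"
    then obtain d where "d \<in> D" "x \<in> U d" using D by blast
    then have "x = d" using U(2,3)[of d] D(1) \<open>x \<in> F\<close> by (auto simp: F_def inj_on_def)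
    then show "x \<in> D" using \<open>d \<in> D\<close> by simp
  qed
  then have finF: "finite F" using D(2) finite_subset by blast
  have "\<exists>r>0. \<forall>x\<in>F. \<forall>y\<in>F. x \<noteq> y \<longrightarrow> r \<le> dist x y"
  proof -
    define A where "A = insert 1 ((\<lambda>(x, y). dist x y) ` {(x, y). x \<in> F \<and> y \<in> F \<and> x \<noteq> y})"
    have "{(x, y). x \<in> F \<and> y \<in> F \<and> x \<noteq> y} \<subseteq> F \<times> F" by auto
    then have fin: "finite A" unfolding A_def using finF finite_subset by blast
    have "Min A > 0" using fin by (subst Min_gr_iff) (auto simp: A_def)
    moreover have "Min A \<le> dist x y" if "x \<in> F" "y \<in> F" "x \<noteq> y" for x y
      using fin that by (intro Min_le) (auto simp: A_def)
    ultimately show ?thesis by blast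
  qed
  then obtain r where r: "r > 0" "\<And>x y. x \<in> F \<Longrightarrow> y \<in> F \<Longrightarrow> x \<noteq> y \<Longrightarrow> r \<le> dist x y" by blast
  define V where "V x = U x \<inter> ball x (r / 2)" for x
  have V: "open (V x)" "x \<in> V x" "inj_on f (V x)" for x
    using U r(1) by (auto simp: V_def inj_on_def open_Int)
  have disj: "V x \<inter> V y = {}" if "x \<in> F" "y \<in> F" "x \<noteq> y" for x y
  proof -
    have "r \<le> dist x y" using r(2) that by blast
    then show ?thesis
      using dist_triangle_half_l[of x _ r y] by (force simp: V_def dist_commute)
  qed
  define W where "W = (\<Union>x\<in>F. V x)"
  have W: "open W" "F \<subseteq> W" using V by (auto simp: W_def)
  \<comment> \<open>The intersection makes every sheet surject onto \<open>T\<close>. Removing the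
    image of the complement of the sheets, which is closed by properness, ensures that no further
    preimages occur.\<close>
  define T where "T = (\<Inter>x\<in>F. f ` V x) - f ` (- W)"
  have "open T"
    unfolding T_def using W(1) closed_image_proper[OF f pr, of "- W"] V(1)
    by (intro open_Diff open_INT finF ballI op) (auto simp: closed_Compl)
  have "z \<in> T" using V(2) W(2) by (force simp: T_def F_def)
  have TW: "f -` T \<subseteq> W" by (auto simp: T_def)
  show "\<exists>T. z \<in> T \<and> openin (top_of_set UNIV) T \<and>
     (\<exists>v. \<Union> v = UNIV \<inter> f -` T \<and> (\<forall>u\<in>v. openin (top_of_set UNIV) u) \<and>
          pairwise disjnt v \<and> (\<forall>u\<in>v. \<exists>q. homeomorphism u T f q))"
  proof (rule exI[of _ T], intro conjI)
    let ?v = "(\<lambda>x. V x \<inter> f -` T) ` F"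
    show "z \<in> T" by fact
    show "openin (top_of_set UNIV) T" using \<open>open T\<close> by simp
    show "\<exists>v. \<Union> v = UNIV \<inter> f -` T \<and> (\<forall>u\<in>v. openin (top_of_set UNIV) u) \<and>
          pairwise disjnt v \<and> (\<forall>u\<in>v. \<exists>q. homeomorphism u T f q)"
    proof (rule exI[of _ ?v], intro conjI ballI)
    show "\<Union> ?v = UNIV \<inter> f -` T" using TW by (auto simp: W_def)
    have opu: "open (V x \<inter> f -` T)" for x
      using V(1) \<open>open T\<close> f by (intro open_Int open_vimage) auto
    then show "openin (top_of_set UNIV) u" if "u \<in> ?v" for u using that by auto
    show "pairwise disjnt ?v" unfolding pairwise_def disjnt_def using disj by blast
    fix u assume "u \<in> ?v"
    then obtain x where x: "x \<in> F" "u = V x \<inter> f -` T" by blast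
    have "\<exists>q. homeomorphism u T f q"
    proof (rule homeomorphism_injective_open_map)
      show "continuous_on u f" using f continuous_on_subset by blast
      show "f ` u = T"
      proof
        show "T \<subseteq> f ` u"
        proof
          fix y assume y: "y \<in> T"
          then obtain w where "w \<in> V x" "y = f w" using x(1) by (auto simp: T_def)
          then show "y \<in> f ` u" using y by (auto simp: x(2))
        qed
      qed (auto simp: x(2))
      show "inj_on f u" using V(3) by (auto simp: x(2) inj_on_def)
      fix S assume "openin (top_of_set u) S"
      then have "open S" "S \<subseteq> u" using opu x(2) by (auto simp: openin_open_eq)
      then show "openin (top_of_set T) (f ` S)"
        using op \<open>open T\<close> \<open>f ` u = T\<close> by (auto simp: openin_open_eq)
    qed blast
    then show "\<exists>q. homeomorphism u T f q" .
    qed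
  qed
qed

text \<open>The target is simply connected, so its identity lifts to a section \<open>g\<close> of
  the covering. The range of \<open>g\<close> is closed as the set where g(f x) = x and open by
  local injectivity; by connectedness it is everything, and \<open>g\<close> is a two-sided
  inverse.\<close>

lemma proper_local_homeomorphism_inj:
  fixes f :: "'a::euclidean_space \<Rightarrow> 'b::euclidean_space"
  assumes f: "continuous_on UNIV f" and pr: "\<And>r. bounded (f -` cball 0 r)"
    and op: "\<And>S. open S \<Longrightarrow> open (f ` S)"
    and inj: "\<And>x. \<exists>U. open U \<and> x \<in> U \<and> inj_on f U"
  shows "inj f"
proof -
  have cov: "covering_space UNIV f UNIV" by (rule proper_local_homeomorphism_covering[OF assms])
  have sc: "simply_connected (UNIV :: 'b set)" by (intro convex_imp_simply_connected) auto
  have lpc: "locally path_connected (UNIV :: 'b set)" by (intro convex_imp_locally_path_connected) auto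
  obtain g where g: "continuous_on UNIV g" "\<And>y. f (g y) = y"
    using covering_space_lift[OF cov sc lpc, of "\<lambda>x. x"] by (auto simp: continuous_on_id)
  have "closed (range g)"
  proof -
    have "range g = {x. g (f x) = x}" by (auto simp: g(2)) (metis rangeI)
    moreover have "closed {x. g (f x) = x}"
      by (intro closed_Collect_eq continuous_on_compose2[OF g(1) f] continuous_intros) auto
    ultimately show ?thesis by simp
  qed
  moreover have "open (range g)"
  proof (subst open_subopen, intro ballI)
    fix x assume "x \<in> range g"
    then obtain y where y: "x = g y" by blast
    obtain U where U: "open U" "x \<in> U" "inj_on f U" using inj by blast
    define O' where "O' = U \<inter> f -` (g -` U)"
    have "open (g -` U)" using g(1) U(1) by (simp add: open_vimage)
    then have "open O'" unfolding O'_def by (intro open_Int U(1) open_vimage[OF _ f])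
    moreover have "x \<in> O'" using U(2) y g(2) by (simp add: O'_def)
    moreover have "O' \<subseteq> range g"
    proof
      fix w assume "w \<in> O'"
      then have "w = g (f w)" using U(3) g(2) by (auto simp: O'_def inj_on_def)
      then show "w \<in> range g" by (metis rangeI)
    qed
    ultimately show "\<exists>T. open T \<and> x \<in> T \<and> T \<subseteq> range g" by blast
  qed
  ultimately have "range g = UNIV" using clopen[of "range g"] by auto
  then show ?thesis unfolding inj_def by (metis g(2) rangeE UNIV_I)
qed

text \<open>Under the integral sign closedness turns each partial derivative of the integrand into
  d/dv of v A(vP) or v B(vP), so the fundamental theorem evaluates it (\<open>ftc\<close>).
  Continuity of the partial derivatives then yields the full differential.\<close>

lemma poincare_potential:
  fixes A B :: "real \<times> real \<Rightarrow> complex"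
  assumes A: "C1_on UNIV A" and B: "C1_on UNIV B" and cl: "\<And>P. pdx B P = pdy A P"
  shows "((\<lambda>P. integral {0..1} (\<lambda>v. fst P *\<^sub>R A (v *\<^sub>R P) + snd P *\<^sub>R B (v *\<^sub>R P))) has_derivative
    (\<lambda>h. fst h *\<^sub>R A P + snd h *\<^sub>R B P)) (at P)"
proof -
  let ?F = "\<lambda>x y. integral (cbox 0 1) (\<lambda>v. x *\<^sub>R A (v * x, v * y) + y *\<^sub>R B (v * x, v * y))"
  have chain: "((\<lambda>x. H (v * x, v * y)) has_vector_derivative v *\<^sub>R pdx H (v * x, v * y)) (at x)"
    "((\<lambda>y. H (v * x, v * y)) has_vector_derivative v *\<^sub>R pdy H (v * x, v * y)) (at y)"
    "((\<lambda>v. H (v * x, v * y)) has_vector_derivative x *\<^sub>R pdx H (v * x, v * y) + y *\<^sub>R pdy H (v * x, v * y)) (at v)"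
    if H: "C1_on UNIV H" for H :: "real \<times> real \<Rightarrow> complex" and v x y
  proof -
    have 1: "((\<lambda>x. (v * x, v * y)) has_derivative (\<lambda>h. (v * h, 0))) (at x)"
      by (intro has_derivative_Pair has_derivative_mult_right has_derivative_ident has_derivative_const)
    have 2: "((\<lambda>y. (v * x, v * y)) has_derivative (\<lambda>h. (0, v * h))) (at y)"
      by (intro has_derivative_Pair has_derivative_mult_right has_derivative_ident has_derivative_const)
    have 3: "((\<lambda>v. (v * x, v * y)) has_derivative (\<lambda>h. (h * x, h * y))) (at v)"
      by (intro has_derivative_Pair has_derivative_mult_left has_derivative_ident)
    show "((\<lambda>x. H (v * x, v * y)) has_vector_derivative v *\<^sub>R pdx H (v * x, v * y)) (at x)"
      using has_derivative_compose[OF 1 C1_on_UNIV_D(1)[OF H]] by (simp add: has_vector_derivative_def mult.commute)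
    show "((\<lambda>y. H (v * x, v * y)) has_vector_derivative v *\<^sub>R pdy H (v * x, v * y)) (at y)"
      using has_derivative_compose[OF 2 C1_on_UNIV_D(1)[OF H]] by (simp add: has_vector_derivative_def mult.commute)
    show "((\<lambda>v. H (v * x, v * y)) has_vector_derivative x *\<^sub>R pdx H (v * x, v * y) + y *\<^sub>R pdy H (v * x, v * y)) (at v)"
      using has_derivative_compose[OF 3 C1_on_UNIV_D(1)[OF H]]
      by (simp add: has_vector_derivative_def scaleR_add_right)
  qed
  have cont: "continuous_on S (\<lambda>z. H (p z * q z, p z * r z))"
    if "continuous_on UNIV H" "continuous_on S p" "continuous_on S q" "continuous_on S r"
    for H :: "real \<times> real \<Rightarrow> complex" and S :: "'c::metric_space set" and p q r :: "'c \<Rightarrow> real"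
    by (rule continuous_on_compose2[OF that(1)]) (auto intro!: continuous_intros that)
  have ftc: "integral (cbox 0 1) (\<lambda>v. H (v * x, v * y) + v *\<^sub>R (x *\<^sub>R pdx H (v * x, v * y) + y *\<^sub>R pdy H (v * x, v * y))) = H (x, y)"
    if H: "C1_on UNIV H" for H :: "real \<times> real \<Rightarrow> complex" and x y
  proof -
    have "((\<lambda>v. H (v * x, v * y) + v *\<^sub>R (x *\<^sub>R pdx H (v * x, v * y) + y *\<^sub>R pdy H (v * x, v * y))) has_integral
      (1 *\<^sub>R H (1 * x, 1 * y) - 0 *\<^sub>R H (0 * x, 0 * y))) {0..1}"
    proof (rule fundamental_theorem_of_calculus)
      fix v :: real
      have "((\<lambda>v. v *\<^sub>R H (v * x, v * y)) has_vector_derivative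
        v *\<^sub>R (x *\<^sub>R pdx H (v * x, v * y) + y *\<^sub>R pdy H (v * x, v * y)) + 1 *\<^sub>R H (v * x, v * y)) (at v)"
        by (rule has_vector_derivative_scaleR[OF DERIV_ident chain(3)[OF H]])
      then show "((\<lambda>v. v *\<^sub>R H (v * x, v * y)) has_vector_derivative
        H (v * x, v * y) + v *\<^sub>R (x *\<^sub>R pdx H (v * x, v * y) + y *\<^sub>R pdy H (v * x, v * y))) (at v within {0..1})"
        using has_vector_derivative_at_within by (force simp: add.commute)
    qed simp
    then show ?thesis by (simp add: integral_unique)
  qed
  have dx: "((\<lambda>x. ?F x y) has_vector_derivative A (x, y)) (at x)" for x y
  proof -
    have "((\<lambda>x. ?F x y) has_vector_derivative integral (cbox 0 1)
      (\<lambda>v. A (v * x, v * y) + v *\<^sub>R (x *\<^sub>R pdx A (v * x, v * y) + y *\<^sub>R pdy A (v * x, v * y)))) (at x within UNIV)"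
    proof (rule leibniz_rule_vector_derivative)
      fix x v :: real
      have "((\<lambda>x. x *\<^sub>R A (v * x, v * y) + y *\<^sub>R B (v * x, v * y)) has_vector_derivative
        (x *\<^sub>R (v *\<^sub>R pdx A (v * x, v * y)) + 1 *\<^sub>R A (v * x, v * y)) + y *\<^sub>R (v *\<^sub>R pdx B (v * x, v * y))) (at x)"
        by (intro has_vector_derivative_add has_vector_derivative_scaleR DERIV_ident chain(1)[OF A]
          bounded_linear.has_vector_derivative[OF bounded_linear_scaleR_right] chain(1)[OF B])
      then show "((\<lambda>x. x *\<^sub>R A (v * x, v * y) + y *\<^sub>R B (v * x, v * y)) has_vector_derivative
        A (v * x, v * y) + v *\<^sub>R (x *\<^sub>R pdx A (v * x, v * y) + y *\<^sub>R pdy A (v * x, v * y))) (at x within UNIV)"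
        by (simp add: cl algebra_simps)
    next
      fix x :: real
      show "(\<lambda>v. x *\<^sub>R A (v * x, v * y) + y *\<^sub>R B (v * x, v * y)) integrable_on cbox 0 1"
        by (intro integrable_continuous continuous_intros cont C1_on_UNIV_D A B)
    next
      show "continuous_on (UNIV \<times> cbox 0 1) (\<lambda>(x, v). A (v * x, v * y) + v *\<^sub>R (x *\<^sub>R pdx A (v * x, v * y) + y *\<^sub>R pdy A (v * x, v * y)))"
        unfolding case_prod_unfold by (intro continuous_intros cont C1_on_UNIV_D A B)
    qed auto
    then show ?thesis using ftc[OF A] by simp
  qed
  have dy: "((\<lambda>y. ?F x y) has_vector_derivative B (x, y)) (at y)" for x y
  proof -
    have "((\<lambda>y. ?F x y) has_vector_derivative integral (cbox 0 1)
      (\<lambda>v. B (v * x, v * y) + v *\<^sub>R (x *\<^sub>R pdx B (v * x, v * y) + y *\<^sub>R pdy B (v * x, v * y)))) (at y within UNIV)"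
    proof (rule leibniz_rule_vector_derivative)
      fix y v :: real
      have "((\<lambda>y. x *\<^sub>R A (v * x, v * y) + y *\<^sub>R B (v * x, v * y)) has_vector_derivative
        x *\<^sub>R (v *\<^sub>R pdy A (v * x, v * y)) + (y *\<^sub>R (v *\<^sub>R pdy B (v * x, v * y)) + 1 *\<^sub>R B (v * x, v * y))) (at y)"
        by (intro has_vector_derivative_add has_vector_derivative_scaleR DERIV_ident chain(2)[OF A]
          bounded_linear.has_vector_derivative[OF bounded_linear_scaleR_right] chain(2)[OF B])
      then show "((\<lambda>y. x *\<^sub>R A (v * x, v * y) + y *\<^sub>R B (v * x, v * y)) has_vector_derivative
        B (v * x, v * y) + v *\<^sub>R (x *\<^sub>R pdx B (v * x, v * y) + y *\<^sub>R pdy B (v * x, v * y))) (at y within UNIV)"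
        by (simp add: cl algebra_simps)
    next
      fix y :: real
      show "(\<lambda>v. x *\<^sub>R A (v * x, v * y) + y *\<^sub>R B (v * x, v * y)) integrable_on cbox 0 1"
        by (intro integrable_continuous continuous_intros cont C1_on_UNIV_D A B)
    next
      show "continuous_on (UNIV \<times> cbox 0 1) (\<lambda>(y, v). B (v * x, v * y) + v *\<^sub>R (x *\<^sub>R pdx B (v * x, v * y) + y *\<^sub>R pdy B (v * x, v * y)))"
        unfolding case_prod_unfold by (intro continuous_intros cont C1_on_UNIV_D A B)
    qed auto
    then show ?thesis using ftc[OF B] by simp
  qed
  obtain x y where P: "P = (x, y)" by force
  have "((\<lambda>(x, y). ?F x y) has_derivative (\<lambda>(tx, ty). tx *\<^sub>R A (x, y) + blinfun_scaleR_left (B (x, y)) ty)) (at (x, y) within UNIV \<times> UNIV)"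
  proof (rule has_derivative_partialsI)
    show "((\<lambda>x. ?F x y) has_derivative (\<lambda>tx. tx *\<^sub>R A (x, y))) (at x within UNIV)"
      using dx[of y x] by (simp add: has_vector_derivative_def)
    show "((\<lambda>y. ?F x y) has_derivative blinfun_apply (blinfun_scaleR_left (B (x, y)))) (at y within UNIV)" for x y
      using dy[of x y] by (simp add: has_vector_derivative_def)
    have "isCont B (x, y)" using C1_on_UNIV_D(4)[OF B] by (simp add: continuous_on_eq_continuous_at)
    then have "isCont (\<lambda>P. blinfun_scaleR_left (B P)) (x, y)"
      by (intro bounded_linear.isCont[OF bounded_linear_blinfun_scaleR_left]) auto
    then show "continuous (at (x, y) within UNIV \<times> UNIV) (\<lambda>(x, y). blinfun_scaleR_left (B (x, y)))"
      by (simp add: case_prod_unfold)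
  qed auto
  then have "((\<lambda>P. ?F (fst P) (snd P)) has_derivative (\<lambda>h. fst h *\<^sub>R A P + snd h *\<^sub>R B P)) (at P)"
    by (simp add: P case_prod_unfold)
  moreover have "?F (fst P) (snd P) = integral {0..1} (\<lambda>v. fst P *\<^sub>R A (v *\<^sub>R P) + snd P *\<^sub>R B (v *\<^sub>R P))" for P
    by (simp add: scaleR_prod_def)
  ultimately show ?thesis by simp
qed

section \<open>The first integral\<close>

lemma holder_on_continuous:
  assumes "holder_on e S f" "e > 0" shows "continuous_on S f"
proof -
  obtain K where K: "\<And>P Q. P \<in> S \<Longrightarrow> Q \<in> S \<Longrightarrow> dist (f P) (f Q) \<le> K * dist P Q powr e"
    using assms(1) unfolding holder_on_def by blast
  show ?thesis
    unfolding continuous_on_def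
  proof (intro ballI)
    fix P assume P: "P \<in> S"
    show "(f \<longlongrightarrow> f P) (at P within S)"
    proof (rule tendsto_dist_iff[THEN iffD2], rule Lim_null_comparison)
      have "((\<lambda>Q. K * dist Q P powr e) \<longlongrightarrow> K * 0 powr e) (at P within S)"
        using assms(2) by (intro tendsto_mult tendsto_const tendsto_powr' tendsto_dist_iff[THEN iffD1] tendsto_ident_at) auto
      then show "((\<lambda>Q. K * dist Q P powr e) \<longlongrightarrow> 0) (at P within S)" by simp
      show "\<forall>\<^sub>F Q in at P within S. norm (dist (f Q) (f P)) \<le> K * dist Q P powr e"
        unfolding eventually_at_filter using K P by (intro always_eventually) auto
    qed
  qed
qed

lemma C1_holder_on_C1: "C1_holder_on e UNIV f \<Longrightarrow> e > 0 \<Longrightarrow> C1_on UNIV f"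
  unfolding C1_holder_on_def C1_on_def using holder_on_continuous by blast

context hypocomplex_form
begin

abbreviation "Z \<equiv> Zint a b"
abbreviation "dtheta \<equiv> deriv (odd_theta \<tau>)"
abbreviation "ap P \<equiv> a (tproj P)"
abbreviation "bp P \<equiv> b (tproj P)"

text \<open>The Jacobian determinant of \<open>Z\<close> as a real map, because the partial
  derivatives of \<open>Z\<close> are \<open>a\<close> and \<open>b\<close>. It is
  \<open>wedge_cnj\<close> up to the factor -2i, so its zeros form the degeneracy set.\<close>

definition Jac :: "real \<times> real \<Rightarrow> real" where
  "Jac P = Im (cnj (a (tproj P)) * b (tproj P))"

lemma coeff_C1: "C1_on UNIV (a \<circ> tproj)" "C1_on UNIV (b \<circ> tproj)"
  using regular eps by (auto intro: C1_holder_on_C1)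

lemma coeff_continuous: "continuous_on S (\<lambda>P. a (tproj P))" "continuous_on S (\<lambda>P. b (tproj P))"
  using C1_on_UNIV_D(4)[OF coeff_C1(1)] C1_on_UNIV_D(4)[OF coeff_C1(2)]
  by (auto simp: o_def intro: continuous_on_subset)

lemma Jac_continuous: "continuous_on S Jac"
  unfolding Jac_def by (intro continuous_intros coeff_continuous)

lemma Z_has_derivative: "(Z has_derivative (\<lambda>h. fst h *\<^sub>R a (tproj P) + snd h *\<^sub>R b (tproj P))) (at P)"
  using poincare_potential[OF coeff_C1 closed_form, of P] unfolding Zint_def[abs_def] by simp

lemma Z_C1: "C1_on UNIV Z" "pdx Z = (\<lambda>P. a (tproj P))" "pdy Z = (\<lambda>P. b (tproj P))"
  by (rule C1_on_UNIV_I[OF Z_has_derivative coeff_continuous])+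

lemma Z_continuous: "continuous_on S Z"
  using C1_on_UNIV_D(4)[OF Z_C1(1)] by (rule continuous_on_subset) auto

text \<open>\<open>Z\<close> minus the linear map x + y \<tau> is periodic. The same observation
  bounds the distance between the two in \<open>Z_linear_bound\<close>.\<close>

lemma Z_int: "Z (x + of_int m, y + of_int n) = Z (x, y) + of_int m + of_int n * \<tau>"
proof -
  define f where "f = (\<lambda>P. Z P - (of_real (fst P) + of_real (snd P) * \<tau>))"
  have "per2 f" unfolding per2_def f_def using period_x period_y by (auto simp: algebra_simps)
  from per2_int[OF this, of x m y n] show ?thesis by (simp add: f_def algebra_simps)
qed

lemma Z_linear_bound:
  obtains M where "M > 0" "\<And>P. norm (Z P - (of_real (fst P) + of_real (snd P) * \<tau>)) \<le> M"
proof -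
  define f where "f = (\<lambda>P. Z P - (of_real (fst P) + of_real (snd P) * \<tau>))"
  have "per2 f" unfolding per2_def f_def using period_x period_y by (auto simp: algebra_simps)
  moreover have "continuous_on UNIV f" unfolding f_def by (intro continuous_intros Z_continuous)
  ultimately obtain B where "B > 0" "\<And>P. norm (f P) \<le> B" using per2_bounded by blast
  then show thesis using that unfolding f_def by blast
qed

text \<open>\<open>Z\<close> stays at bounded distance from x + y \<tau>, which is a linear
  isomorphism because Im \<tau> > 0.\<close>

lemma Z_proper: "bounded (Z -` cball c r)"
proof -
  obtain M where M: "M > 0" "\<And>P. norm (Z P - (of_real (fst P) + of_real (snd P) * \<tau>)) \<le> M"
    using Z_linear_bound by blast
  define B where "B = norm c + r + M"
  define Y where "Y = B / Im \<tau>"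
  define X where "X = B + Y * norm \<tau>"
  have "Z -` cball c r \<subseteq> cbox (- X, - Y) (X, Y)"
  proof
    fix P assume "P \<in> Z -` cball c r"
    then have "norm (Z P) \<le> norm c + r"
      using norm_triangle_ineq2[of "Z P" c] by (simp add: dist_norm norm_minus_commute)
    then have l: "norm (of_real (fst P) + of_real (snd P) * \<tau>) \<le> B"
      using M(2)[of P] norm_triangle_ineq3[of "Z P" "of_real (fst P) + of_real (snd P) * \<tau>"] by (simp add: B_def)
    have "\<bar>snd P\<bar> * Im \<tau> = \<bar>Im (of_real (fst P) + of_real (snd P) * \<tau>)\<bar>" using tau by (simp add: abs_mult)
    also have "\<dots> \<le> B" using l abs_Im_le_cmod order_trans by blast
    finally have y: "\<bar>snd P\<bar> \<le> Y" using tau by (simp add: Y_def field_simps)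
    have "norm (complex_of_real (fst P)) \<le> norm (of_real (fst P) + of_real (snd P) * \<tau>) + norm (of_real (snd P) * \<tau>)"
      using norm_triangle_ineq4[of "of_real (fst P) + of_real (snd P) * \<tau>" "of_real (snd P) * \<tau>"] by simp
    also have "\<dots> \<le> B + Y * norm \<tau>"
      using l y by (intro add_mono) (auto simp: norm_mult intro!: mult_right_mono)
    finally have "\<bar>fst P\<bar> \<le> X" by (simp add: X_def)
    then show "P \<in> cbox (- X, - Y) (X, Y)" using y by (cases P) (auto simp: cbox_Pair_eq)
  qed
  then show ?thesis using bounded_subset bounded_cbox by blast
qed

section \<open>The degeneracy set and the sign of the Jacobian\<close>

definition sigma_max :: real where "sigma_max = Max (sg ` {1..N})"

lemma sg_le_sigma_max: "i \<in> {1..N} \<Longrightarrow> sg i \<le> sigma_max"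
  unfolding sigma_max_def by (rule Max_ge) auto

lemma sigma_max_pos: "sigma_max > 0"
proof -
  have "1 \<in> {1..N}" using comps(1) by simp
  from exponent_pos[OF this] sg_le_sigma_max[OF this] show ?thesis by linarith
qed

lemma degenerate_component:
  assumes "Jac P = 0" obtains i where "i \<in> {1..N}" "tproj P \<in> C i"
proof -
  have "wedge_cnj a b (tproj P) = - 2 * \<i> * of_real (Jac P)"
    unfolding wedge_cnj_def Jac_def by (simp add: complex_eq_iff algebra_simps)
  then have "tproj P \<in> degeneracy_set a b" using assms by (simp add: degeneracy_set_def)
  then have "tproj P \<in> \<Union> (components (degeneracy_set a b))" by (simp add: Union_components)
  then show thesis using comps(2) that unfolding bij_betw_def by blast
qed

text \<open>The normal form pulled back to the plane. The last conclusion is the gain: up to a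
  nonnegative factor \<open>Jac\<close> is the determinant of the coordinates, so it does not change
  sign across the curve.\<close>

lemma degenerate_normal_form:
  assumes "Jac P0 = 0"
  obtains V s t m \<sigma> where "open V" "P0 \<in> V" "C1_on V s" "C1_on V t"
    "\<And>P. P \<in> V \<Longrightarrow> pdx s P * pdy t P - pdy s P * pdx t P \<noteq> 0" "0 < \<sigma>" "\<sigma> \<le> sigma_max"
    "\<And>P. P \<in> V \<Longrightarrow> m P \<noteq> (0::complex)"
    "\<And>P. P \<in> V \<Longrightarrow> a (tproj P) = m P * (of_real (pdx s P) + \<i> * of_real (\<bar>t P\<bar> powr \<sigma> * pdx t P))"
    "\<And>P. P \<in> V \<Longrightarrow> b (tproj P) = m P * (of_real (pdy s P) + \<i> * of_real (\<bar>t P\<bar> powr \<sigma> * pdy t P))"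
    "\<And>P. P \<in> V \<Longrightarrow> Jac P = (norm (m P))\<^sup>2 * \<bar>t P\<bar> powr \<sigma> * (pdx s P * pdy t P - pdy s P * pdx t P)"
proof -
  obtain i where i: "i \<in> {1..N}" "tproj P0 \<in> C i" using degenerate_component[OF assms] by blast
  from normal_form[OF i] obtain U s t m where U: "tproj P0 \<in> U" "C1_coords U s t"
     "\<And>P. P \<in> tproj -` U \<Longrightarrow> m (tproj P) \<noteq> (0::complex)
             \<and> a (tproj P) = m (tproj P) * (complex_of_real (pdx (s \<circ> tproj) P)
                 + \<i> * complex_of_real (\<bar>t (tproj P)\<bar> powr sg i * pdx (t \<circ> tproj) P))
             \<and> b (tproj P) = m (tproj P) * (complex_of_real (pdy (s \<circ> tproj) P)
                 + \<i> * complex_of_real (\<bar>t (tproj P)\<bar> powr sg i * pdy (t \<circ> tproj) P))"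
    by blast
  show thesis
  proof (rule that[of "tproj -` U" "s \<circ> tproj" "t \<circ> tproj" "sg i" "m \<circ> tproj"])
    show "open (tproj -` U)" using U(2) by (simp add: C1_coords_def open_torus_def)
    show "P0 \<in> tproj -` U" using U(1) by simp
    show "C1_on (tproj -` U) (s \<circ> tproj)" "C1_on (tproj -` U) (t \<circ> tproj)"
      using U(2) by (simp_all add: C1_coords_def)
    show "0 < sg i" "sg i \<le> sigma_max" using exponent_pos[OF i(1)] sg_le_sigma_max[OF i(1)] by auto
    fix P assume P: "P \<in> tproj -` U"
    show "pdx (s \<circ> tproj) P * pdy (t \<circ> tproj) P - pdy (s \<circ> tproj) P * pdx (t \<circ> tproj) P \<noteq> 0"
      using U(2) P by (auto simp: C1_coords_def)
    show "(m \<circ> tproj) P \<noteq> 0"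
      "a (tproj P) = (m \<circ> tproj) P * (complex_of_real (pdx (s \<circ> tproj) P) + \<i> * complex_of_real (\<bar>(t \<circ> tproj) P\<bar> powr sg i * pdx (t \<circ> tproj) P))"
      "b (tproj P) = (m \<circ> tproj) P * (complex_of_real (pdy (s \<circ> tproj) P) + \<i> * complex_of_real (\<bar>(t \<circ> tproj) P\<bar> powr sg i * pdy (t \<circ> tproj) P))"
      using U(3)[OF P] by auto
    note ab = this(2,3)
    show "Jac P = (norm ((m \<circ> tproj) P))\<^sup>2 * \<bar>(t \<circ> tproj) P\<bar> powr sg i * (pdx (s \<circ> tproj) P * pdy (t \<circ> tproj) P - pdy (s \<circ> tproj) P * pdx (t \<circ> tproj) P)"
      unfolding Jac_def ab cmod_power2 by (simp add: power2_eq_square algebra_simps)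
  qed
qed

text \<open>If \<open>Jac\<close> vanished on a neighbourhood, so would the coordinate
  \<open>t\<close> of a normal form, and its gradient with it. But then the coordinate determinant
  would be 0.\<close>

lemma Jac_nonzero_somewhere:
  assumes "open S" "P0 \<in> S" shows "\<exists>P\<in>S. Jac P \<noteq> 0"
proof (rule ccontr)
  assume neg: "\<not> ?thesis"
  then have "Jac P0 = 0" using assms by blast
  then obtain V s t m \<sigma> where V: "open V" "P0 \<in> V" "C1_on V s" "C1_on V t"
    "\<And>P. P \<in> V \<Longrightarrow> pdx s P * pdy t P - pdy s P * pdx t P \<noteq> 0" "0 < \<sigma>"
    "\<And>P. P \<in> V \<Longrightarrow> m P \<noteq> (0::complex)"
    "\<And>P. P \<in> V \<Longrightarrow> Jac P = (norm (m P))\<^sup>2 * \<bar>t P\<bar> powr \<sigma> * (pdx s P * pdy t P - pdy s P * pdx t P)"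
    using degenerate_normal_form by (metis (no_types, lifting))
  have t0: "t P = 0" if "P \<in> S \<inter> V" for P
    using neg V(5,7,8)[of P] that by auto
  have "eventually (\<lambda>P. P \<in> S \<inter> V) (nhds P0)"
    using assms V(1,2) by (intro eventually_nhds_in_open) auto
  then have "eventually (\<lambda>P. 0 = t P) (at P0)"
    unfolding eventually_at_filter by eventually_elim (use t0 in auto)
  moreover have "((\<lambda>P. 0) has_derivative (\<lambda>h. 0)) (at P0)" by simp
  ultimately have "(t has_derivative (\<lambda>h. 0)) (at P0)"
    using has_derivative_transform_eventually[of "\<lambda>P. 0" "\<lambda>h. 0" P0 UNIV t] t0[of P0] assms V(2) by auto
  from pd_eq[OF this] V(5)[OF V(2)] show False by simp
qed

text \<open>Near each point \<open>Jac\<close> has a weak sign: by continuity where it is nonzero,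
  by the normal form elsewhere. The two open sets \<open>Pos\<close> and \<open>Neg\<close> cannot
  meet, since \<open>Jac\<close> is nonzero somewhere in every nonempty open set; connectedness of
  the plane leaves only one of them.\<close>

lemma Jac_sign: "(\<forall>P. 0 \<le> Jac P) \<or> (\<forall>P. Jac P \<le> 0)"
proof -
  define Pos where "Pos = \<Union> {S. open S \<and> (\<forall>P\<in>S. 0 \<le> Jac P)}"
  define Neg where "Neg = \<Union> {S. open S \<and> (\<forall>P\<in>S. Jac P \<le> 0)}"
  have o: "open Pos" "open Neg" by (auto simp: Pos_def Neg_def)
  have cover: "P0 \<in> Pos \<union> Neg" for P0
  proof (cases "Jac P0 = 0")
    case False
    have c: "isCont Jac P0" using Jac_continuous[of UNIV] continuous_on_eq_continuous_at[OF open_UNIV, of Jac] by blast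
    consider "Jac P0 > 0" | "Jac P0 < 0" using False by linarith
    then show ?thesis
    proof cases
      case 1
      have "open {P. Jac P > 0}" by (intro open_Collect_less continuous_on_const Jac_continuous)
      then have "P0 \<in> Pos" using 1 unfolding Pos_def by (intro UnionI[of "{P. Jac P > 0}"]) auto
      then show ?thesis by blast
    next
      case 2
      have "open {P. Jac P < 0}" by (intro open_Collect_less continuous_on_const Jac_continuous)
      then have "P0 \<in> Neg" using 2 unfolding Neg_def by (intro UnionI[of "{P. Jac P < 0}"]) auto
      then show ?thesis by blast
    qed
  next
    case True
    obtain V s t m \<sigma> where V: "open V" "P0 \<in> V" "C1_on V s" "C1_on V t"
      "\<And>P. P \<in> V \<Longrightarrow> pdx s P * pdy t P - pdy s P * pdx t P \<noteq> 0" "0 < \<sigma>"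
      "\<And>P. P \<in> V \<Longrightarrow> Jac P = (norm (m P :: complex))\<^sup>2 * \<bar>t P\<bar> powr \<sigma> * (pdx s P * pdy t P - pdy s P * pdx t P)"
      by (rule degenerate_normal_form[OF True]) blast
    define d where "d = (\<lambda>P. pdx s P * pdy t P - pdy s P * pdx t P)"
    have dc: "continuous_on V d" using V(3,4) unfolding d_def C1_on_def by (intro continuous_intros) auto
    have J: "Jac P = (norm (m P))\<^sup>2 * \<bar>t P\<bar> powr \<sigma> * d P" if "P \<in> V" for P using V(7)[OF that] by (simp add: d_def)
    have nn: "0 \<le> (norm (m P))\<^sup>2 * \<bar>t P\<bar> powr \<sigma>" for P by simp
    consider "d P0 > 0" | "d P0 < 0" using V(5)[OF V(2)] by (fastforce simp: d_def)
    then show ?thesis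
    proof cases
      case 1
      have "open {P \<in> V. d P > 0}"
        using continuous_open_preimage[OF dc V(1), of "{0<..}"] by (simp add: vimage_def Int_def)
      then have "P0 \<in> Pos" using 1 V(2) J mult_nonneg_nonneg[OF nn] unfolding Pos_def
        by (intro UnionI[of "{P \<in> V. d P > 0}"]) (auto simp: less_imp_le)
      then show ?thesis by blast
    next
      case 2
      have "open {P \<in> V. d P < 0}"
        using continuous_open_preimage[OF dc V(1), of "{..<0}"] by (simp add: vimage_def Int_def)
      then have "P0 \<in> Neg" using 2 V(2) J mult_nonneg_nonpos[OF nn] unfolding Neg_def
        by (intro UnionI[of "{P \<in> V. d P < 0}"]) (auto simp: less_imp_le)
      then show ?thesis by blast
    qed
  qed
  have "Pos \<inter> Neg = {}"
  proof (rule ccontr)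
    assume "Pos \<inter> Neg \<noteq> {}"
    then obtain P where "P \<in> Pos \<inter> Neg" by blast
    with Jac_nonzero_somewhere[of "Pos \<inter> Neg" P] o obtain Q where "Q \<in> Pos \<inter> Neg" "Jac Q \<noteq> 0" by blast
    then have "0 \<le> Jac Q" "Jac Q \<le> 0" by (auto simp: Pos_def Neg_def)
    then show False using \<open>Jac Q \<noteq> 0\<close> by simp
  qed
  then have "Pos = {} \<or> Neg = {}"
    using connected_UNIV[unfolded connected_def] o cover by (metis Int_UNIV_right UNIV_eq_I subset_UNIV subsetI)
  then have "Neg = UNIV \<or> Pos = UNIV" using cover by blast
  then show ?thesis unfolding Pos_def Neg_def by blast
qed

section \<open>Coordinates controlled by the first integral\<close>

text \<open>Differences of \<open>Z\<close> control \<open>s\<close> linearly but \<open>t\<close>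
  only with exponent \<kappa>, which is 1 at regular points and 1/(1+\<sigma>) for the exponent
  \<sigma> of a degenerate point. Local injectivity of \<open>Z\<close> and the area estimate both
  follow from these two inequalities.\<close>

definition good_chart :: "real \<times> real \<Rightarrow> (real \<times> real) set \<Rightarrow> (real \<times> real \<Rightarrow> real) \<Rightarrow> (real \<times> real \<Rightarrow> real) \<Rightarrow> real \<Rightarrow> real \<Rightarrow> bool" where
  "good_chart P0 V s t c \<kappa> \<longleftrightarrow> open V \<and> P0 \<in> V \<and> C1_on V s \<and> C1_on V t
     \<and> pdx s P0 * pdy t P0 - pdy s P0 * pdx t P0 \<noteq> 0 \<and> c > 0 \<and> 1 / (1 + sigma_max) \<le> \<kappa> \<and> \<kappa> \<le> 1
     \<and> (\<forall>P\<in>V. \<forall>Q\<in>V. \<bar>s P - s Q\<bar> \<le> c * norm (Z P - Z Q) \<and> \<bar>t P - t Q\<bar> \<le> c * norm (Z P - Z Q) powr \<kappa>)"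

lemma regular_chart:
  assumes "Jac P0 \<noteq> 0" shows "good_chart P0 UNIV (\<lambda>P. Re (Z P)) (\<lambda>P. Im (Z P)) 1 1"
proof -
  have d1: "((\<lambda>P. Re (Z P)) has_derivative (\<lambda>h. fst h *\<^sub>R Re (a (tproj P)) + snd h *\<^sub>R Re (b (tproj P)))) (at P)"
   and d2: "((\<lambda>P. Im (Z P)) has_derivative (\<lambda>h. fst h *\<^sub>R Im (a (tproj P)) + snd h *\<^sub>R Im (b (tproj P)))) (at P)" for P
    using bounded_linear.has_derivative[OF bounded_linear_Re Z_has_derivative[of P]]
      bounded_linear.has_derivative[OF bounded_linear_Im Z_has_derivative[of P]] by simp_all
  have c: "continuous_on UNIV (\<lambda>P. Re (a (tproj P)))" "continuous_on UNIV (\<lambda>P. Re (b (tproj P)))"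
    "continuous_on UNIV (\<lambda>P. Im (a (tproj P)))" "continuous_on UNIV (\<lambda>P. Im (b (tproj P)))"
    by (intro continuous_intros coeff_continuous)+
  note C = C1_on_UNIV_I[OF d1 c(1,2)] C1_on_UNIV_I[OF d2 c(3,4)]
  have det: "pdx (\<lambda>P. Re (Z P)) P0 * pdy (\<lambda>P. Im (Z P)) P0 - pdy (\<lambda>P. Re (Z P)) P0 * pdx (\<lambda>P. Im (Z P)) P0 \<noteq> 0"
    unfolding C using assms by (simp add: Jac_def algebra_simps)
  have "1 / (1 + sigma_max) \<le> 1" using sigma_max_pos by simp
  moreover have "\<bar>Re (Z P) - Re (Z Q)\<bar> \<le> norm (Z P - Z Q)" "\<bar>Im (Z P) - Im (Z Q)\<bar> \<le> norm (Z P - Z Q)" for P Q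
    using abs_Re_le_cmod[of "Z P - Z Q"] abs_Im_le_cmod[of "Z P - Z Q"] by simp_all
  ultimately show ?thesis unfolding good_chart_def using C(1,4) det by simp
qed

text \<open>In the coordinates (s, t) the differential of \<open>Z\<close> is m (ds + i |t|^\<sigma>
  dt). With m frozen at \<open>M0 = m P0\<close> the primitive is M0 (s + i
  \<open>spow \<sigma> t\<close>), and the error is a fraction of the main term where m is close to
  \<open>M0\<close>. So \<open>Z\<close> separates points as the model does, and
  \<open>spow_lower\<close> inverts the t-component.\<close>

lemma degenerate_chart:
  assumes J0: "Jac P0 = 0" shows "\<exists>V s t c \<kappa>. good_chart P0 V s t c \<kappa>"
proof -
  obtain V s t m \<sigma> where V: "open V" "P0 \<in> V" "C1_on V s" "C1_on V t"
    "\<And>P. P \<in> V \<Longrightarrow> pdx s P * pdy t P - pdy s P * pdx t P \<noteq> 0" "0 < \<sigma>" "\<sigma> \<le> sigma_max"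
    "\<And>P. P \<in> V \<Longrightarrow> m P \<noteq> (0::complex)"
    "\<And>P. P \<in> V \<Longrightarrow> a (tproj P) = m P * (of_real (pdx s P) + \<i> * of_real (\<bar>t P\<bar> powr \<sigma> * pdx t P))"
    "\<And>P. P \<in> V \<Longrightarrow> b (tproj P) = m P * (of_real (pdy s P) + \<i> * of_real (\<bar>t P\<bar> powr \<sigma> * pdy t P))"
    by (rule degenerate_normal_form[OF J0]) blast
  have diff: "s differentiable at P" "t differentiable at P" if "P \<in> V" for P
    using V(3,4) that by (auto simp: C1_on_def)
  have pc: "continuous_on V (pdx s)" "continuous_on V (pdy s)" "continuous_on V (pdx t)" "continuous_on V (pdy t)"
    using V(3,4) by (auto simp: C1_on_def)
  have tc: "continuous_on V t"
    by (intro continuous_at_imp_continuous_on ballI differentiable_imp_continuous_within diff)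
  define \<Phi> where "\<Phi> = (\<lambda>P. (s P, t P))"
  define D where "D = (\<lambda>P h. (fst h *\<^sub>R pdx s P + snd h *\<^sub>R pdy s P, fst h *\<^sub>R pdx t P + snd h *\<^sub>R pdy t P))"
  have blD: "bounded_linear (D P)" for P
    unfolding D_def by (intro bounded_linear_Pair bounded_linear_add bounded_linear_scaleR_const bounded_linear_fst bounded_linear_snd)
  define D' where "D' = (\<lambda>P. Blinfun (D P))"
  have D': "blinfun_apply (D' P) = D P" for P
    unfolding D'_def by (rule bounded_linear_Blinfun_apply[OF blD])
  have derD: "(\<Phi> has_derivative blinfun_apply (D' P)) (at P)" if "P \<in> V" for P
    unfolding D' D_def \<Phi>_def by (intro has_derivative_Pair pd_has_derivative diff that)
  have contD: "continuous_on V D'"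
  proof (rule continuous_on_blinfun_componentwise)
    fix i :: "real \<times> real" assume "i \<in> Basis"
    show "continuous_on V (\<lambda>P. blinfun_apply (D' P) i)"
      unfolding D' D_def by (intro continuous_intros pc)
  qed
  define \<Delta> where "\<Delta> = pdx s P0 * pdy t P0 - pdy s P0 * pdx t P0"
  have \<Delta>: "\<Delta> \<noteq> 0" using V(2,5) by (simp add: \<Delta>_def)
  \<comment> \<open>The inverse of the differential at \<open>P0\<close> by Cramer's rule, as a
    witness for the inverse function theorem.\<close>
  define E where "E = (\<lambda>h. ((fst h * pdy t P0 - snd h * pdy s P0) / \<Delta>, (snd h * pdx s P0 - fst h * pdx t P0) / \<Delta>))"
  have blE: "bounded_linear E"
    unfolding E_def divide_inverse
    by (intro bounded_linear_Pair bounded_linear_mult_const bounded_linear_sub bounded_linear_fst bounded_linear_snd)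
  have inv: "Blinfun E o\<^sub>L D' P0 = id_blinfun"
  proof (rule blinfun_eqI)
    fix h :: "real \<times> real"
    have "(x * pdx s P0 + y * pdy s P0) * pdy t P0 - (x * pdx t P0 + y * pdy t P0) * pdy s P0 = x * \<Delta>"
      "(x * pdx t P0 + y * pdy t P0) * pdx s P0 - (x * pdx s P0 + y * pdy s P0) * pdx t P0 = y * \<Delta>" for x y
      by (simp_all add: \<Delta>_def algebra_simps)
    then show "blinfun_apply (Blinfun E o\<^sub>L D' P0) h = blinfun_apply id_blinfun h"
      unfolding blinfun_apply_blinfun_compose bounded_linear_Blinfun_apply[OF blE] D'
      using \<Delta> by (simp add: D_def E_def prod_eq_iff)
  qed
  obtain U V' g g' where U: "open U" "U \<subseteq> V" "P0 \<in> U" "open V'" "\<Phi> P0 \<in> V'" "homeomorphism U V' \<Phi> g"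
    "\<And>y. y \<in> V' \<Longrightarrow> (g has_derivative (g' y)) (at y)"
    "\<And>y. y \<in> V' \<Longrightarrow> g' y = inv (blinfun_apply (D' (g y)))"
    "\<And>y. y \<in> V' \<Longrightarrow> bij (blinfun_apply (D' (g y)))"
    by (rule inverse_function_theorem[OF V(1) derD contD V(2) inv], assumption) blast
  have gU: "g y \<in> U" "\<Phi> (g y) = y" if "y \<in> V'" for y
    using U(6) that by (auto simp: homeomorphism_def)
  have g\<Phi>: "g (\<Phi> P) = P" "\<Phi> P \<in> V'" if "P \<in> U" for P
    using U(6) that by (auto simp: homeomorphism_def)
  have tg: "t (g y) = snd y" if "y \<in> V'" for y using arg_cong[OF gU(2)[OF that], of snd] by (simp add: \<Phi>_def)
  have derF: "((\<lambda>y. Z (g y)) has_derivative (\<lambda>k. m (g y) * (of_real (fst k) + \<i> * of_real (\<bar>snd y\<bar> powr \<sigma> * snd k)))) (at y)"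
    if y: "y \<in> V'" for y
  proof -
    have gV: "g y \<in> V" using gU(1)[OF y] U(2) by blast
    have "((\<lambda>y. Z (g y)) has_derivative (\<lambda>k. fst (g' y k) *\<^sub>R a (tproj (g y)) + snd (g' y k) *\<^sub>R b (tproj (g y)))) (at y)"
      by (rule has_derivative_compose[OF U(7)[OF y] Z_has_derivative])
    moreover have "fst (g' y k) *\<^sub>R a (tproj (g y)) + snd (g' y k) *\<^sub>R b (tproj (g y)) =
      m (g y) * (of_real (fst k) + \<i> * of_real (\<bar>snd y\<bar> powr \<sigma> * snd k))" for k
    proof -
      have "D (g y) (g' y k) = k"
        using U(9)[OF y] unfolding U(8)[OF y] D' by (simp add: bij_is_surj surj_f_inv_f)
      then have k: "fst k = fst (g' y k) * pdx s (g y) + snd (g' y k) * pdy s (g y)"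
        "snd k = fst (g' y k) * pdx t (g y) + snd (g' y k) * pdy t (g y)"
        unfolding D_def by (auto simp: prod_eq_iff)
      show ?thesis
        unfolding k V(9)[OF gV] V(10)[OF gV] tg[OF y] by (simp add: scaleR_conv_of_real algebra_simps)
    qed
    ultimately show ?thesis by simp
  qed
  \<comment> \<open>The normal form says nothing about continuity of the factor \<open>m\<close>. It
    follows by division: one of the two continuous coefficients multiplied by \<open>m\<close> is
    nonzero at \<open>P0\<close>.\<close>
  have mcont: "isCont m P0"
  proof -
    define \<alpha> \<beta> where "\<alpha> = (\<lambda>P. complex_of_real (pdx s P) + \<i> * of_real (\<bar>t P\<bar> powr \<sigma> * pdx t P))"
      and "\<beta> = (\<lambda>P. complex_of_real (pdy s P) + \<i> * of_real (\<bar>t P\<bar> powr \<sigma> * pdy t P))"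
    have tp: "continuous_on V (\<lambda>P. \<bar>t P\<bar> powr \<sigma>)"
      using V(6) by (intro continuous_on_powr' continuous_intros tc) auto
    have "continuous_on V \<alpha>" "continuous_on V \<beta>"
      unfolding \<alpha>_def \<beta>_def by (intro continuous_intros pc tp)+
    then have ab: "isCont \<alpha> P0" "isCont \<beta> P0" using V(1,2) by (auto simp: continuous_on_eq_continuous_at)
    have *: "isCont m P0" if "isCont f P0" "f P0 \<noteq> 0" "isCont h P0" "\<And>P. P \<in> V \<Longrightarrow> h P = m P * f P" for f h
    proof -
      have "eventually (\<lambda>P. f P \<noteq> 0) (nhds P0)" by (rule isCont_eventually_nonzero[OF that(1,2)])
      moreover have "eventually (\<lambda>P. P \<in> V) (nhds P0)" using V(1,2) by (rule eventually_nhds_in_open)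
      ultimately have ev: "eventually (\<lambda>P. m P = h P / f P) (nhds P0)"
        by eventually_elim (use that(4) in auto)
      have "isCont (\<lambda>P. h P / f P) P0" using that(1-3) by (intro continuous_intros) auto
      then show ?thesis using isCont_cong[OF ev] by simp
    qed
    have ca: "isCont (\<lambda>P. a (tproj P)) P0" "isCont (\<lambda>P. b (tproj P)) P0"
      using coeff_continuous[of UNIV] continuous_on_eq_continuous_at[OF open_UNIV] by blast+
    have "\<alpha> P0 \<noteq> 0 \<or> \<beta> P0 \<noteq> 0"
    proof (rule ccontr)
      assume "\<not> ?thesis"
      then have "Re (\<alpha> P0) = 0" "Re (\<beta> P0) = 0" by simp_all
      then have "pdx s P0 = 0" "pdy s P0 = 0" by (simp_all add: \<alpha>_def \<beta>_def)
      then show False using V(5)[OF V(2)] by simp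
    qed
    then show ?thesis
    proof
      assume "\<alpha> P0 \<noteq> 0" then show ?thesis by (rule *[OF ab(1) _ ca(1)]) (simp add: V(9) \<alpha>_def)
    next
      assume "\<beta> P0 \<noteq> 0" then show ?thesis by (rule *[OF ab(2) _ ca(2)]) (simp add: V(10) \<beta>_def)
    qed
  qed
  define M0 where "M0 = m P0"
  have M0: "M0 \<noteq> 0" using V(2,8) by (simp add: M0_def)
  \<comment> \<open>A quarter for each of the two legs of the path below leaves half of the main
    term.\<close>
  obtain \<delta> where \<delta>: "\<delta> > 0" "\<And>P. dist P P0 < \<delta> \<Longrightarrow> dist (m P) M0 < norm M0 / 4"
    using mcont M0 unfolding continuous_at_eps_delta M0_def by (metis divide_pos_pos zero_less_norm_iff zero_less_numeral)
  have "open (V' \<inter> g -` ball P0 \<delta>)"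
    using U(4,6) by (intro continuous_open_preimage) (auto simp: homeomorphism_def)
  moreover have "(s P0, t P0) \<in> V' \<inter> g -` ball P0 \<delta>"
    using g\<Phi>[OF U(3)] \<delta>(1) by (simp add: \<Phi>_def)
  \<comment> \<open>A product neighbourhood is needed: two points are joined by a path along
    coordinate lines, and its corner must stay in the domain.\<close>
  ultimately obtain A B where AB0: "open A" "open B" "(s P0, t P0) \<in> A \<times> B" "A \<times> B \<subseteq> V' \<inter> g -` ball P0 \<delta>"
    by (rule open_prod_elim)
  then have AB: "open A" "open B" "s P0 \<in> A" "t P0 \<in> B" "A \<times> B \<subseteq> V' \<inter> g -` ball P0 \<delta>" by auto
  obtain r1 r2 where r: "r1 > 0" "ball (s P0) r1 \<subseteq> A" "r2 > 0" "ball (t P0) r2 \<subseteq> B"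
    using AB(1,3) AB(2,4) open_contains_ball[of A] open_contains_ball[of B] by blast
  define I1 I2 where "I1 = ball (s P0) r1" and "I2 = ball (t P0) r2"
  have I: "is_interval I1" "is_interval I2" unfolding I1_def I2_def by (simp_all add: is_interval_ball_real)
  have I12: "(x, y) \<in> V'" "norm (m (g (x, y)) - M0) \<le> norm M0 / 4" if "x \<in> I1" "y \<in> I2" for x y
  proof -
    have *: "(x, y) \<in> V' \<inter> g -` ball P0 \<delta>" using that r AB(5) unfolding I1_def I2_def by blast
    then show "(x, y) \<in> V'" by blast
    have "dist (m (g (x, y))) M0 < norm M0 / 4" using * by (intro \<delta>(2)) (simp add: dist_commute)
    then show "norm (m (g (x, y)) - M0) \<le> norm M0 / 4" by (simp add: dist_norm)
  qed
  define O' where "O' = U \<inter> \<Phi> -` (I1 \<times> I2)"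
  have "open O'"
    unfolding O'_def using U(1,6) by (intro continuous_open_preimage) (auto simp: homeomorphism_def I1_def I2_def intro: open_Times)
  moreover have "P0 \<in> O'" using U(3) r by (simp add: O'_def \<Phi>_def I1_def I2_def)
  moreover have sub: "O' \<subseteq> V" using U(2) by (auto simp: O'_def)
  define \<kappa> where "\<kappa> = 1 / (1 + \<sigma>)"
  define k where "k = (1 + \<sigma>) * 2 powr (1 + \<sigma>) * (2 / norm M0)"
  have k: "k > 0" using V(6) M0 by (simp add: k_def)
  define c where "c = max (2 / norm M0) (k powr \<kappa>)"
  have est: "\<bar>s P - s Q\<bar> \<le> c * norm (Z P - Z Q) \<and> \<bar>t P - t Q\<bar> \<le> c * norm (Z P - Z Q) powr \<kappa>"
    if PQ: "P \<in> O'" "Q \<in> O'" for P Q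
  proof -
    have in1: "s P \<in> I1" "s Q \<in> I1" "t P \<in> I2" "t Q \<in> I2" "P \<in> U" "Q \<in> U" using PQ by (auto simp: O'_def \<Phi>_def)
    have ZP: "Z (g (s P, t P)) = Z P" "Z (g (s Q, t Q)) = Z Q"
      using g\<Phi>(1)[OF in1(5)] g\<Phi>(1)[OF in1(6)] by (simp_all add: \<Phi>_def)
    \<comment> \<open>First leg, from (s Q, t Q) to (s P, t Q), compared with a linear function; the
      second leg \<open>?f2\<close> continues to (s P, t P) and is compared with
      \<open>spow\<close>.\<close>
    let ?f1 = "\<lambda>x. Z (g (x, t Q)) - M0 * of_real x"
    have l1: "norm (?f1 (s P) - ?f1 (s Q)) \<le> norm M0 / 4 * \<bar>s P - s Q\<bar>"
    proof (rule variation_bound[OF I(1) in1(1,2), where f' = "\<lambda>x. m (g (x, t Q)) - M0" and \<psi>' = "\<lambda>_. 1"])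
      fix x assume x: "x \<in> I1"
      have 1: "((\<lambda>x. (x, t Q)) has_derivative (\<lambda>h. (h, 0))) (at x)"
        by (intro has_derivative_Pair has_derivative_ident has_derivative_const)
      have "((\<lambda>x. Z (g (x, t Q)) - M0 * of_real x) has_derivative
        (\<lambda>h. m (g (x, t Q)) * (of_real (fst (h, 0::real)) + \<i> * of_real (\<bar>snd (x, t Q)\<bar> powr \<sigma> * snd (h, 0::real))) - M0 * of_real h)) (at x)"
        by (intro has_derivative_diff has_derivative_compose[OF 1 derF] I12 x in1 has_derivative_mult_right has_derivative_of_real has_derivative_ident)
      then show "(?f1 has_vector_derivative m (g (x, t Q)) - M0) (at x)"
        by (simp add: has_vector_derivative_def scaleR_conv_of_real algebra_simps)
      show "norm (m (g (x, t Q)) - M0) \<le> norm M0 / 4 * 1" using I12(2)[OF x in1(4)] by simp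
    qed auto
    let ?f2 = "\<lambda>y. Z (g (s P, y)) - M0 * \<i> * of_real (spow \<sigma> y)"
    have l2: "norm (?f2 (t P) - ?f2 (t Q)) \<le> norm M0 / 4 * \<bar>spow \<sigma> (t P) - spow \<sigma> (t Q)\<bar>"
    proof (rule variation_bound[OF I(2) in1(3,4), where f' = "\<lambda>y. (m (g (s P, y)) - M0) * (\<i> * of_real (\<bar>y\<bar> powr \<sigma>))" and \<psi>' = "\<lambda>y. \<bar>y\<bar> powr \<sigma>"])
      fix y assume y: "y \<in> I2"
      have 1: "((\<lambda>y. (s P, y)) has_derivative (\<lambda>h. (0, h))) (at y)"
        by (intro has_derivative_Pair has_derivative_ident has_derivative_const)
      show sd: "(spow \<sigma> has_real_derivative \<bar>y\<bar> powr \<sigma>) (at y)" by (rule spow_derivative[OF V(6)])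
      have "((\<lambda>y. Z (g (s P, y)) - M0 * \<i> * of_real (spow \<sigma> y)) has_derivative
        (\<lambda>h. m (g (s P, y)) * (of_real (fst (0::real, h)) + \<i> * of_real (\<bar>snd (s P, y)\<bar> powr \<sigma> * snd (0::real, h))) - M0 * \<i> * of_real (\<bar>y\<bar> powr \<sigma> * h))) (at y)"
        by (intro has_derivative_diff has_derivative_compose[OF 1 derF] I12 y in1 has_derivative_mult_right has_derivative_of_real sd[unfolded has_field_derivative_def])
      then show "(?f2 has_vector_derivative (m (g (s P, y)) - M0) * (\<i> * of_real (\<bar>y\<bar> powr \<sigma>))) (at y)"
        by (simp add: has_vector_derivative_def scaleR_conv_of_real algebra_simps)
      have nm: "norm ((m (g (s P, y)) - M0) * (\<i> * of_real (\<bar>y\<bar> powr \<sigma>))) = norm (m (g (s P, y)) - M0) * \<bar>y\<bar> powr \<sigma>"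
        by (simp add: norm_mult)
      show "norm ((m (g (s P, y)) - M0) * (\<i> * of_real (\<bar>y\<bar> powr \<sigma>))) \<le> norm M0 / 4 * \<bar>y\<bar> powr \<sigma>"
        unfolding nm by (rule mult_right_mono[OF I12(2)[OF in1(1) y]]) simp
    qed auto
    define x y where "x = s P - s Q" and "y = spow \<sigma> (t P) - spow \<sigma> (t Q)"
    define w where "w = complex_of_real x + \<i> * of_real y"
    have wx: "\<bar>x\<bar> \<le> norm w" "\<bar>y\<bar> \<le> norm w"
      using abs_Re_le_cmod[of w] abs_Im_le_cmod[of w] by (simp_all add: w_def)
    have zw: "Z P - Z Q - M0 * w = (?f2 (t P) - ?f2 (t Q)) + (?f1 (s P) - ?f1 (s Q))"
      unfolding ZP w_def x_def y_def by (simp add: algebra_simps)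
    have "norm (Z P - Z Q - M0 * w) \<le> norm M0 / 4 * \<bar>y\<bar> + norm M0 / 4 * \<bar>x\<bar>"
      unfolding zw unfolding x_def y_def by (rule norm_triangle_le[OF add_mono[OF l2 l1]])
    also have "\<dots> \<le> norm M0 / 4 * norm w + norm M0 / 4 * norm w"
      using wx by (intro add_mono mult_left_mono) auto
    finally have "norm (M0 * w) - norm (Z P - Z Q) \<le> norm M0 / 2 * norm w"
      using norm_triangle_ineq2[of "M0 * w" "Z P - Z Q"] by (simp add: norm_minus_commute)
    then have nw: "norm w \<le> 2 / norm M0 * norm (Z P - Z Q)"
      using M0 by (simp add: norm_mult field_simps)
    have "\<bar>s P - s Q\<bar> \<le> 2 / norm M0 * norm (Z P - Z Q)" using wx(1) nw by (simp add: x_def)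
    also have "\<dots> \<le> c * norm (Z P - Z Q)" by (intro mult_right_mono) (auto simp: c_def)
    finally have 1: "\<bar>s P - s Q\<bar> \<le> c * norm (Z P - Z Q)" .
    have "\<bar>t P - t Q\<bar> powr (1 + \<sigma>) \<le> (1 + \<sigma>) * 2 powr (1 + \<sigma>) * \<bar>y\<bar>"
      unfolding y_def by (rule spow_lower[OF V(6)])
    also have "\<dots> \<le> (1 + \<sigma>) * 2 powr (1 + \<sigma>) * (2 / norm M0 * norm (Z P - Z Q))"
      using wx(2) nw V(6) by (intro mult_left_mono) auto
    finally have le: "\<bar>t P - t Q\<bar> powr (1 + \<sigma>) \<le> k * norm (Z P - Z Q)" by (simp add: k_def mult_ac)
    have "\<bar>t P - t Q\<bar> = (\<bar>t P - t Q\<bar> powr (1 + \<sigma>)) powr \<kappa>"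
      using V(6) by (simp add: powr_powr \<kappa>_def)
    also have "\<dots> \<le> (k * norm (Z P - Z Q)) powr \<kappa>"
      using le V(6) by (intro powr_mono2) (auto simp: \<kappa>_def)
    also have "\<dots> = k powr \<kappa> * norm (Z P - Z Q) powr \<kappa>" using k by (simp add: powr_mult)
    also have "\<dots> \<le> c * norm (Z P - Z Q) powr \<kappa>" by (intro mult_right_mono) (auto simp: c_def)
    finally show ?thesis using 1 by blast
  qed
  have "c > 0" using M0 by (simp add: c_def less_max_iff_disj)
  moreover have "1 / (1 + sigma_max) \<le> \<kappa>" "\<kappa> \<le> 1"
    using V(6,7) by (auto simp: \<kappa>_def field_simps)
  moreover have "C1_on O' s" "C1_on O' t"
    using V(3,4) sub by (auto simp: C1_on_def intro: continuous_on_subset)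
  moreover have "pdx s P0 * pdy t P0 - pdy s P0 * pdx t P0 \<noteq> 0" using V(2,5) by blast
  ultimately have "good_chart P0 O' s t c \<kappa>" unfolding good_chart_def using est by blast
  then show ?thesis by blast
qed

lemma ex_good_chart: "\<exists>V s t c \<kappa>. good_chart P0 V s t c \<kappa>"
  using regular_chart[of P0] degenerate_chart[of P0] by blast

section \<open>Global injectivity of the first integral and its inverse\<close>

lemma Z_locally_injective: "\<exists>U. open U \<and> P0 \<in> U \<and> inj_on Z U"
proof -
  obtain V s t c \<kappa> where G: "good_chart P0 V s t c \<kappa>" using ex_good_chart by blast
  then have V: "open V" "P0 \<in> V" "C1_on V s" "C1_on V t" "pdx s P0 * pdy t P0 - pdy s P0 * pdx t P0 \<noteq> 0"
    and est: "\<And>P Q. P \<in> V \<Longrightarrow> Q \<in> V \<Longrightarrow> \<bar>s P - s Q\<bar> \<le> c * norm (Z P - Z Q) \<and> \<bar>t P - t Q\<bar> \<le> c * norm (Z P - Z Q) powr \<kappa>"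
    unfolding good_chart_def by blast+
  obtain \<delta> K where d: "\<delta> > 0" "ball P0 \<delta> \<subseteq> V"
    "\<And>P Q. P \<in> ball P0 \<delta> \<Longrightarrow> Q \<in> ball P0 \<delta> \<Longrightarrow> s P = s Q \<Longrightarrow> t P = t Q \<Longrightarrow> P = Q"
    by (rule C1_chart_estimates[OF V]) blast
  have "inj_on Z (ball P0 \<delta>)"
  proof (rule inj_onI)
    fix P Q assume PQ: "P \<in> ball P0 \<delta>" "Q \<in> ball P0 \<delta>" "Z P = Z Q"
    have "P \<in> V" "Q \<in> V" using PQ d(2) by blast+
    from est[OF this] PQ(3) have "\<bar>s P - s Q\<bar> \<le> 0" "\<bar>t P - t Q\<bar> \<le> 0" by auto
    then show "P = Q" using d(3)[OF PQ(1,2)] by auto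
  qed
  then show ?thesis using d(1) by (intro exI[of _ "ball P0 \<delta>"]) auto
qed

text \<open>The Jacobian may vanish, so openness comes from invariance of domain applied to the
  locally injective map.\<close>

lemma Z_open: assumes "open S" shows "open (Z ` S)"
proof (subst open_subopen, intro ballI)
  fix z assume "z \<in> Z ` S"
  then obtain P where P: "P \<in> S" "z = Z P" by blast
  obtain U where U: "open U" "P \<in> U" "inj_on Z U" using Z_locally_injective by blast
  have "open (Z ` (U \<inter> S))"
    using U assms by (intro invariance_of_domain_gen) (auto intro: Z_continuous inj_on_subset)
  then show "\<exists>T. open T \<and> z \<in> T \<and> T \<subseteq> Z ` S"
    using P U(2) by (intro exI[of _ "Z ` (U \<inter> S)"]) auto
qed

lemma Z_inj: "inj Z"
  by (rule proper_local_homeomorphism_inj[OF Z_continuous Z_proper Z_open Z_locally_injective])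

lemma lattice_eq_Z_shift:
  assumes "l \<in> lattice \<tau>" obtains m n :: int where "l = of_int m + of_int n * \<tau>" "\<And>x y. Z (x + of_int m, y + of_int n) = Z (x, y) + l"
  using assms Z_int unfolding lattice_def by (auto simp: add.assoc)

text \<open>Uniform continuity of the inverse of \<open>Z\<close>. Integer translations move P into
  the unit square; properness then bounds Q, and a limit of counterexamples would contradict
  injectivity.\<close>

lemma Z_inverse_close:
  assumes e: "\<eta> > 0"
  obtains d where "d > 0" "\<And>P Q. norm (Z P - Z Q) < d \<Longrightarrow> dist P Q < \<eta>"
proof (rule ccontr)
  assume neg: "\<not> thesis"
  have "\<exists>P Q. norm (Z P - Z Q) < inverse (real (Suc n)) \<and> \<eta> \<le> dist P Q \<and> P \<in> cbox (0,0) (1,1)" for n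
  proof -
    have "\<not> (\<forall>P Q. norm (Z P - Z Q) < inverse (real (Suc n)) \<longrightarrow> dist P Q < \<eta>)"
      using neg that[of "inverse (real (Suc n))"] by fastforce
    then obtain P Q where PQ: "norm (Z P - Z Q) < inverse (real (Suc n))" "\<eta> \<le> dist P Q" by (auto simp: not_less)
    define k l where "k = - \<lfloor>fst P\<rfloor>" and "l = - \<lfloor>snd P\<rfloor>"
    let ?P = "(fst P + of_int k, snd P + of_int l)" and ?Q = "(fst Q + of_int k, snd Q + of_int l)"
    have "Z ?P - Z ?Q = Z P - Z Q" using Z_int[of "fst P" k "snd P" l] Z_int[of "fst Q" k "snd Q" l] by simp
    moreover have "dist ?P ?Q = dist P Q" by (simp add: dist_prod_def dist_real_def)
    moreover have "?P = (frac (fst P), frac (snd P))" by (simp add: k_def l_def frac_def)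
    then have "?P \<in> cbox (0,0) (1,1)" by (simp add: cbox_Pair_eq less_imp_le[OF frac_lt_1])
    ultimately show ?thesis using PQ by metis
  qed
  then obtain P Q where PQ: "\<And>n. norm (Z (P n) - Z (Q n)) < inverse (real (Suc n))" "\<And>n. \<eta> \<le> dist (P n) (Q n)" "\<And>n. P n \<in> cbox (0,0) (1,1)"
    by metis
  have "bounded (Z ` cbox (0,0) (1,1))"
    by (intro compact_imp_bounded compact_continuous_image Z_continuous) auto
  then obtain B where B: "\<And>X. X \<in> cbox (0,0) (1,1) \<Longrightarrow> norm (Z X) \<le> B" by (auto simp: bounded_iff)
  have "norm (Z (Q n)) \<le> B + 1" for n
  proof -
    have "inverse (real (Suc n)) \<le> 1" by (simp add: inverse_le_1_iff)
    then show ?thesis using B[OF PQ(3)[of n]] PQ(1)[of n] norm_triangle_ineq2[of "Z (Q n)" "Z (P n)"] by (simp add: norm_minus_commute)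
  qed
  then have "range Q \<subseteq> Z -` cball 0 (B + 1)" by auto
  then have bQ: "bounded (range Q)" using Z_proper bounded_subset by blast
  have "range P \<subseteq> cbox (0,0) (1,1)" using PQ(3) by blast
  then have "bounded (range P)" using bounded_cbox bounded_subset by blast
  from bounded_Times[OF this bQ] have "bounded (range (\<lambda>n. (P n, Q n)))"
    by (rule bounded_subset) auto
  then obtain L r where r: "strict_mono (r :: nat \<Rightarrow> nat)" "((\<lambda>n. (P n, Q n)) \<circ> r) \<longlonglongrightarrow> L"
    using bounded_imp_convergent_subsequence by blast
  then have lim: "(\<lambda>n. P (r n)) \<longlonglongrightarrow> fst L" "(\<lambda>n. Q (r n)) \<longlonglongrightarrow> snd L"
    using tendsto_fst[OF r(2)] tendsto_snd[OF r(2)] by (simp_all add: o_def)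
  have cZ: "isCont Z X" for X using Z_continuous[of UNIV] continuous_on_eq_continuous_at[OF open_UNIV, of Z] by blast
  have "(\<lambda>n. Z (P (r n)) - Z (Q (r n))) \<longlonglongrightarrow> Z (fst L) - Z (snd L)"
    by (intro tendsto_diff isCont_tendsto_compose[OF cZ] lim)
  moreover have "(\<lambda>n. Z (P (r n)) - Z (Q (r n))) \<longlonglongrightarrow> 0"
  proof (rule Lim_null_comparison)
    show "eventually (\<lambda>n. norm (Z (P (r n)) - Z (Q (r n))) \<le> inverse (real (Suc (r n)))) sequentially"
      using PQ(1) by (intro always_eventually) (auto intro: less_imp_le)
    show "(\<lambda>n. inverse (real (Suc (r n)))) \<longlonglongrightarrow> 0"
      using LIMSEQ_subseq_LIMSEQ[OF LIMSEQ_inverse_real_of_nat r(1)] by (simp add: o_def)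
  qed
  ultimately have "Z (fst L) = Z (snd L)" using LIMSEQ_unique by fastforce
  then have "fst L = snd L" using Z_inj by (auto dest: injD)
  moreover have "(\<lambda>n. dist (P (r n)) (Q (r n))) \<longlonglongrightarrow> dist (fst L) (snd L)" by (intro tendsto_dist lim)
  then have "\<eta> \<le> dist (fst L) (snd L)" using PQ(2) by (intro LIMSEQ_le_const) auto
  ultimately show False using e by simp
qed

text \<open>The estimate behind the Hoelder exponent: \<open>1 + 1 / (1 + \<sigma>)\<close> is \<open>2 - \<mu>\<close>.\<close>

lemma area_preimage_disc:
  obtains K where "K \<ge> 1" "\<And>z \<rho>. \<rho> > 0 \<Longrightarrow>
    emeasure lborel (unit_square \<inter> Z -` ball z \<rho>) \<le> ennreal (K * \<rho> powr (1 + 1 / (1 + sigma_max)))"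
proof -
  define \<beta> where "\<beta> = 1 / (1 + sigma_max)"
  have \<beta>: "\<beta> > 0" "\<beta> \<le> 1" using sigma_max_pos by (auto simp: \<beta>_def)
  have "\<exists>\<delta> K. \<delta> > 0 \<and> K \<ge> 0 \<and> (\<forall>z \<rho>. 0 < \<rho> \<longrightarrow> \<rho> \<le> 1 \<longrightarrow> emeasure lborel (ball P0 \<delta> \<inter> Z -` ball z \<rho>) \<le> ennreal (K * \<rho> powr (1 + \<beta>)))" for P0
  proof -
    obtain V s t c \<kappa> where G: "good_chart P0 V s t c \<kappa>" using ex_good_chart by blast
    then have V: "open V" "P0 \<in> V" "C1_on V s" "C1_on V t" "pdx s P0 * pdy t P0 - pdy s P0 * pdx t P0 \<noteq> 0"
      and c: "c > 0" and \<kappa>: "\<beta> \<le> \<kappa>" "\<kappa> \<le> 1"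
      and est: "\<And>P Q. P \<in> V \<Longrightarrow> Q \<in> V \<Longrightarrow> \<bar>s P - s Q\<bar> \<le> c * norm (Z P - Z Q) \<and> \<bar>t P - t Q\<bar> \<le> c * norm (Z P - Z Q) powr \<kappa>"
      unfolding good_chart_def \<beta>_def by blast+
    obtain \<delta> K where d: "\<delta> > 0" "K > 0" "ball P0 \<delta> \<subseteq> V"
      and meas: "\<And>E \<alpha> \<beta>. E \<in> sets borel \<Longrightarrow> E \<subseteq> ball P0 \<delta> \<Longrightarrow> 0 \<le> \<alpha> \<Longrightarrow> 0 \<le> \<beta> \<Longrightarrow>
        (\<And>P Q. P \<in> E \<Longrightarrow> Q \<in> E \<Longrightarrow> \<bar>s P - s Q\<bar> \<le> \<alpha> \<and> \<bar>t P - t Q\<bar> \<le> \<beta>) \<Longrightarrow>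
        emeasure lborel E \<le> ennreal (K * \<alpha> * (\<alpha> + \<beta>))"
      by (rule C1_chart_estimates[OF V]) blast
    \<comment> \<open>For \<rho> \<le> 1 the oscillation of \<open>s\<close> is 2 c \<rho>, and the
      sum of both oscillations is at most a constant times \<rho>^\<beta>, because \<beta> \<le>
      \<kappa> \<le> 1.\<close>
    define K' where "K' = K * (2 * c) * (2 * c + c * 2 powr \<kappa>)"
    have K': "K' \<ge> 0" using d c by (simp add: K'_def)
    have "emeasure lborel (ball P0 \<delta> \<inter> Z -` ball z \<rho>) \<le> ennreal (K' * \<rho> powr (1 + \<beta>))" if \<rho>: "0 < \<rho>" "\<rho> \<le> 1" for z \<rho>
    proof -
      let ?E = "ball P0 \<delta> \<inter> Z -` ball z \<rho>"
      have "open ?E" by (intro open_Int open_vimage Z_continuous) auto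
      then have E: "?E \<in> sets borel" by simp
      have osc: "\<bar>s P - s Q\<bar> \<le> 2 * c * \<rho> \<and> \<bar>t P - t Q\<bar> \<le> c * (2 * \<rho>) powr \<kappa>" if PQ: "P \<in> ?E" "Q \<in> ?E" for P Q
      proof -
        have n: "norm (Z P - Z Q) \<le> 2 * \<rho>"
          using PQ dist_triangle2[of "Z P" "Z Q" z] by (simp add: dist_norm[symmetric] dist_commute)
        have "P \<in> V" "Q \<in> V" using PQ d(3) by auto
        from est[OF this] have e: "\<bar>s P - s Q\<bar> \<le> c * norm (Z P - Z Q)" "\<bar>t P - t Q\<bar> \<le> c * norm (Z P - Z Q) powr \<kappa>" by auto
        have "c * norm (Z P - Z Q) \<le> c * (2 * \<rho>)" using n c by (intro mult_left_mono) auto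
        moreover have "c * norm (Z P - Z Q) powr \<kappa> \<le> c * (2 * \<rho>) powr \<kappa>"
          using n c \<kappa> \<beta> by (intro mult_left_mono powr_mono2) auto
        ultimately show ?thesis using e by auto
      qed
      have "emeasure lborel ?E \<le> ennreal (K * (2 * c * \<rho>) * (2 * c * \<rho> + c * (2 * \<rho>) powr \<kappa>))"
        by (rule meas[OF E]) (use osc c \<rho> in auto)
      also have "\<dots> \<le> ennreal (K' * \<rho> powr (1 + \<beta>))"
      proof (rule ennreal_leI)
        have "\<rho> powr 1 \<le> \<rho> powr \<beta>" "\<rho> powr \<kappa> \<le> \<rho> powr \<beta>" using \<rho> \<kappa> \<beta> by (intro powr_mono'; simp)+
        then have "2 * c * \<rho> + c * (2 * \<rho>) powr \<kappa> \<le> 2 * c * \<rho> powr \<beta> + c * (2 powr \<kappa> * \<rho> powr \<beta>)"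
          using \<rho> c by (simp add: powr_mult add_mono mult_left_mono)
        then have "K * (2 * c * \<rho>) * (2 * c * \<rho> + c * (2 * \<rho>) powr \<kappa>) \<le> K * (2 * c * \<rho>) * (2 * c * \<rho> powr \<beta> + c * (2 powr \<kappa> * \<rho> powr \<beta>))"
          using d c \<rho> by (intro mult_left_mono) auto
        also have "\<dots> = K' * (\<rho> powr 1 * \<rho> powr \<beta>)" using \<rho> by (simp add: K'_def algebra_simps)
        finally show "K * (2 * c * \<rho>) * (2 * c * \<rho> + c * (2 * \<rho>) powr \<kappa>) \<le> K' * \<rho> powr (1 + \<beta>)"
          by (simp add: powr_add)
      qed
      finally show ?thesis .
    qed
    then show ?thesis using d(1) K' by blast
  qed
  then obtain \<delta> K where dK: "\<And>P0. \<delta> P0 > 0" "\<And>P0. K P0 \<ge> 0"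
    "\<And>P0 z \<rho>. 0 < \<rho> \<Longrightarrow> \<rho> \<le> 1 \<Longrightarrow> emeasure lborel (ball P0 (\<delta> P0) \<inter> Z -` ball z \<rho>) \<le> ennreal (K P0 * \<rho> powr (1 + \<beta>))"
    by metis
  have "compact unit_square" by (simp add: unit_square_cbox)
  moreover have "unit_square \<subseteq> (\<Union>P\<in>unit_square. ball P (\<delta> P))" using dK(1) by force
  ultimately obtain D where D: "D \<subseteq> unit_square" "finite D" "unit_square \<subseteq> (\<Union>P\<in>D. ball P (\<delta> P))"
    by (meson compactE_image open_ball)
  define L where "L = max 1 (\<Sum>P\<in>D. K P)"
  have L: "L \<ge> 1" by (simp add: L_def)
  have "emeasure lborel (unit_square \<inter> Z -` ball z \<rho>) \<le> ennreal (L * \<rho> powr (1 + \<beta>))" if \<rho>: "\<rho> > 0" for z \<rho>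
  proof (cases "\<rho> \<le> 1")
    case True
    have bo: "ball P (\<delta> P) \<inter> Z -` ball z \<rho> \<in> sets lborel" for P
      by simp (intro borel_open open_Int open_vimage Z_continuous; simp)
    have "emeasure lborel (unit_square \<inter> Z -` ball z \<rho>) \<le> emeasure lborel (\<Union>P\<in>D. ball P (\<delta> P) \<inter> Z -` ball z \<rho>)"
      using D bo by (intro emeasure_mono sets.finite_UN) auto
    also have "\<dots> \<le> (\<Sum>P\<in>D. emeasure lborel (ball P (\<delta> P) \<inter> Z -` ball z \<rho>))"
      using D bo by (intro emeasure_subadditive_finite) auto
    also have "\<dots> \<le> (\<Sum>P\<in>D. ennreal (K P * \<rho> powr (1 + \<beta>)))" by (intro sum_mono dK(3)[OF \<rho> True])
    also have "\<dots> = ennreal ((\<Sum>P\<in>D. K P) * \<rho> powr (1 + \<beta>))"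
      using dK(2) by (subst sum_ennreal) (auto simp: sum_distrib_right)
    also have "\<dots> \<le> ennreal (L * \<rho> powr (1 + \<beta>))" by (intro ennreal_leI mult_right_mono) (auto simp: L_def)
    finally show ?thesis .
  next
    \<comment> \<open>For large radii the bound is trivial: the square has area 1, and the constant
      was taken to be at least 1.\<close>
    case False
    have "emeasure lborel (unit_square \<inter> Z -` ball z \<rho>) \<le> emeasure lborel unit_square"
      by (intro emeasure_mono) (auto simp: unit_square_cbox)
    also have "\<dots> = 1" unfolding unit_square_cbox by (subst emeasure_lborel_cbox) (auto simp: Basis_prod_def)
    also have "\<dots> = ennreal 1" by simp
    also have "\<dots> \<le> ennreal (L * \<rho> powr (1 + \<beta>))"
    proof (intro ennreal_leI)
      have "1 * 1 \<le> L * \<rho> powr (1 + \<beta>)" using L False \<beta> by (intro mult_mono ge_one_powr_ge_zero) auto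
      then show "1 \<le> L * \<rho> powr (1 + \<beta>)" by simp
    qed
    finally show ?thesis .
  qed
  then show thesis using that[OF L] unfolding \<beta>_def by blast
qed

end

section \<open>Cauchy transforms of measures with power growth\<close>

text \<open>On the shell where d lies between \<rho>/2^(k+1) and \<rho>/2^k the factor 1/d is at
  most 2/r with r = \<rho>/2^k, while the mass is at most B r^(1+\<alpha>). The shells form a
  geometric series with ratio 2^(-\<alpha>), which converges because \<alpha> > 0.\<close>

lemma dyadic_near:
  fixes d f :: "'a \<Rightarrow> real"
  assumes [measurable]: "d \<in> borel_measurable M" "f \<in> borel_measurable M"
    and nn: "\<And>x. 0 \<le> f x" "\<And>x. 0 \<le> d x" and \<alpha>: "0 < \<alpha>" and B: "0 \<le> B"
    and g: "\<And>\<rho>. \<rho> > 0 \<Longrightarrow> (\<integral>\<^sup>+x. ennreal (f x) * indicator {x. d x < \<rho>} x \<partial>M) \<le> ennreal (B * \<rho> powr (1 + \<alpha>))"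
    and \<rho>: "\<rho> > 0"
  shows "(\<integral>\<^sup>+x. ennreal (f x / d x) * indicator {x. d x < \<rho>} x \<partial>M) \<le> ennreal (2 * B / (1 - 2 powr (- \<alpha>)) * \<rho> powr \<alpha>)"
proof -
  let ?r = "\<lambda>k::nat. \<rho> / 2 ^ k"
  have r0: "?r k > 0" for k using \<rho> by simp
  have "(\<integral>\<^sup>+x. ennreal (f x / d x) * indicator {x. d x < \<rho>} x \<partial>M)
    \<le> (\<integral>\<^sup>+x. (\<Sum>k. ennreal (2 / ?r k) * (ennreal (f x) * indicator {x. d x < ?r k} x)) \<partial>M)"
  proof (rule nn_integral_mono)
    fix x
    show "ennreal (f x / d x) * indicator {x. d x < \<rho>} x \<le> (\<Sum>k. ennreal (2 / ?r k) * (ennreal (f x) * indicator {x. d x < ?r k} x))"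
    proof (cases "d x < \<rho> \<and> d x > 0")
      case True
      have "(\<lambda>k. \<rho> * (1/2) ^ k) \<longlonglongrightarrow> \<rho> * 0" by (intro tendsto_mult_left LIMSEQ_realpow_zero) auto
      then have "eventually (\<lambda>k. \<rho> * (1/2) ^ k < d x) sequentially" using True by (intro order_tendstoD(2)[where y = "\<rho> * 0"]) auto
      then obtain n where "\<rho> * (1/2) ^ n < d x" by (auto simp: eventually_sequentially)
      then have ex: "?r n < d x" by (simp add: power_one_over)
      \<comment> \<open>The index of the shell containing \<open>x\<close>: by minimality the radius
        of index k is still larger than \<open>d x\<close>.\<close>
      define k where "k = (LEAST n. ?r (Suc n) \<le> d x)"
      have k1: "?r (Suc k) \<le> d x"
        unfolding k_def
      proof (rule LeastI[of _ n])
        have "?r (Suc n) \<le> ?r n" using \<rho> by (simp add: field_simps)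
        then show "?r (Suc n) \<le> d x" using ex by linarith
      qed
      have k2: "d x < ?r k"
      proof (cases k)
        case (Suc j)
        then have "\<not> ?r (Suc j) \<le> d x" unfolding k_def by (intro not_less_Least) simp
        then show ?thesis using Suc by simp
      qed (use True in simp)
      have "f x / d x \<le> 2 / ?r k * f x"
      proof -
        have "1 / d x \<le> 2 / ?r k" using k1 True \<rho> by (simp add: field_simps)
        from mult_right_mono[OF this nn(1)[of x]] show ?thesis by simp
      qed
      then have "ennreal (f x / d x) * indicator {x. d x < \<rho>} x \<le> ennreal (2 / ?r k) * (ennreal (f x) * indicator {x. d x < ?r k} x)"
        using True k2 \<rho> nn(1)[of x] by (simp add: ennreal_mult[symmetric] ennreal_leI)
      also have "\<dots> \<le> (\<Sum>k. ennreal (2 / ?r k) * (ennreal (f x) * indicator {x. d x < ?r k} x))"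
        using sum_le_suminf[of "\<lambda>k. ennreal (2 / ?r k) * (ennreal (f x) * indicator {x. d x < ?r k} x)" "{k}"] by simp
      finally show ?thesis .
    next
      case False
      \<comment> \<open>Where \<open>d x\<close> is 0, division by zero makes the integrand 0, so
        these points need no separate estimate.\<close>
      then have "d x = 0 \<or> \<not> d x < \<rho>" using nn(2)[of x] by force
      then show ?thesis by auto
    qed
  qed
  also have "\<dots> = (\<Sum>k. ennreal (2 / ?r k) * (\<integral>\<^sup>+x. ennreal (f x) * indicator {x. d x < ?r k} x \<partial>M))"
    by (subst nn_integral_suminf) (auto simp: nn_integral_cmult)
  also have "\<dots> \<le> (\<Sum>k. ennreal (2 * B * \<rho> powr \<alpha> * (2 powr (- \<alpha>)) ^ k))"
  proof (rule suminf_le)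
    fix k
    have "ennreal (2 / ?r k) * (\<integral>\<^sup>+x. ennreal (f x) * indicator {x. d x < ?r k} x \<partial>M) \<le> ennreal (2 / ?r k) * ennreal (B * ?r k powr (1 + \<alpha>))"
      by (intro mult_left_mono g r0) auto
    also have "\<dots> = ennreal (2 / ?r k * (B * ?r k powr (1 + \<alpha>)))" using \<rho> B by (intro ennreal_mult[symmetric]) auto
    also have "2 / ?r k * (B * ?r k powr (1 + \<alpha>)) = 2 * B * \<rho> powr \<alpha> * (2 powr (- \<alpha>)) ^ k"
    proof -
      have "?r k powr (1 + \<alpha>) = ?r k * ?r k powr \<alpha>" using r0[of k] \<rho> by (simp add: powr_add)
      moreover have "?r k powr \<alpha> = \<rho> powr \<alpha> * (2 powr (- \<alpha>)) ^ k"
      proof -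
        have "(2::real) ^ k = 2 powr (real k)" by (simp add: powr_realpow)
        then have "((2::real) ^ k) powr \<alpha> = 2 powr (real k * \<alpha>)" by (simp add: powr_powr)
        moreover have "(2 powr (- \<alpha>)) ^ k = 2 powr (- (real k * \<alpha>))"
          by (subst powr_realpow[symmetric]) (auto simp: powr_powr mult.commute)
        ultimately show ?thesis using \<rho> by (simp add: powr_divide powr_minus field_simps)
      qed
      ultimately show ?thesis using r0[of k] by (simp add: field_simps)
    qed
    finally show "ennreal (2 / ?r k) * (\<integral>\<^sup>+x. ennreal (f x) * indicator {x. d x < ?r k} x \<partial>M) \<le> ennreal (2 * B * \<rho> powr \<alpha> * (2 powr (- \<alpha>)) ^ k)" .
  qed auto
  also have "\<dots> = ennreal (\<Sum>k. 2 * B * \<rho> powr \<alpha> * (2 powr (- \<alpha>)) ^ k)"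
  proof (rule suminf_ennreal2)
    show "summable (\<lambda>k. 2 * B * \<rho> powr \<alpha> * (2 powr (- \<alpha>)) ^ k)"
      using \<alpha> by (intro summable_mult summable_geometric) (auto simp: powr_less_one)
  qed (use B in auto)
  also have "(\<Sum>k. 2 * B * \<rho> powr \<alpha> * (2 powr (- \<alpha>)) ^ k) = 2 * B * \<rho> powr \<alpha> * (1 / (1 - 2 powr (- \<alpha>)))"
  proof -
    have n: "norm (2 powr (- \<alpha>)) < 1" using \<alpha> by (auto simp: powr_less_one)
    show ?thesis using suminf_mult[OF summable_geometric[OF n]] suminf_geometric[OF n] by simp
  qed
  finally show ?thesis by (simp add: mult_ac)
qed

text \<open>The shells now double outwards: 1/d^2 is at most 1/r^2 and the mass at most B
  (2r)^(1+\<alpha>). The ratio is 2^(\<alpha>-1), so this time \<alpha> < 1 gives convergence; the 4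
  bounds 2^(1+\<alpha>).\<close>

lemma dyadic_far:
  fixes d f :: "'a \<Rightarrow> real"
  assumes [measurable]: "d \<in> borel_measurable M" "f \<in> borel_measurable M"
    and nn: "\<And>x. 0 \<le> f x" "\<And>x. 0 \<le> d x" and \<alpha>: "0 < \<alpha>" "\<alpha> < 1" and B: "0 \<le> B"
    and g: "\<And>\<rho>. \<rho> > 0 \<Longrightarrow> (\<integral>\<^sup>+x. ennreal (f x) * indicator {x. d x < \<rho>} x \<partial>M) \<le> ennreal (B * \<rho> powr (1 + \<alpha>))"
    and \<rho>: "\<rho> > 0"
  shows "(\<integral>\<^sup>+x. ennreal (f x / (d x)\<^sup>2) * indicator {x. \<rho> \<le> d x} x \<partial>M) \<le> ennreal (4 * B / (1 - 2 powr (\<alpha> - 1)) * \<rho> powr (\<alpha> - 1))"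
proof -
  let ?r = "\<lambda>k::nat. \<rho> * 2 ^ k"
  have r0: "?r k > 0" for k using \<rho> by simp
  have "(\<integral>\<^sup>+x. ennreal (f x / (d x)\<^sup>2) * indicator {x. \<rho> \<le> d x} x \<partial>M)
    \<le> (\<integral>\<^sup>+x. (\<Sum>k. ennreal (1 / (?r k)\<^sup>2) * (ennreal (f x) * indicator {x. d x < ?r (Suc k)} x)) \<partial>M)"
  proof (rule nn_integral_mono)
    fix x
    show "ennreal (f x / (d x)\<^sup>2) * indicator {x. \<rho> \<le> d x} x \<le> (\<Sum>k. ennreal (1 / (?r k)\<^sup>2) * (ennreal (f x) * indicator {x. d x < ?r (Suc k)} x))"
    proof (cases "\<rho> \<le> d x")
      case True
      obtain n where "d x / \<rho> < 2 ^ n" using real_arch_pow[of 2 "d x / \<rho>"] by auto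
      then have ex: "d x < ?r n" using \<rho> by (simp add: field_simps)
      define k where "k = (LEAST n. d x < ?r (Suc n))"
      have k1: "d x < ?r (Suc k)"
        unfolding k_def
      proof (rule LeastI[of _ n])
        have "?r n \<le> ?r (Suc n)" using \<rho> by simp
        then show "d x < ?r (Suc n)" using ex by linarith
      qed
      have k2: "?r k \<le> d x"
      proof (cases k)
        case (Suc j)
        then have "\<not> d x < ?r (Suc j)" unfolding k_def by (intro not_less_Least) simp
        then show ?thesis using Suc by simp
      qed (use True in simp)
      have "f x / (d x)\<^sup>2 \<le> 1 / (?r k)\<^sup>2 * f x"
      proof -
        have "(?r k)\<^sup>2 \<le> (d x)\<^sup>2" using k2 r0[of k] by (intro power_mono) auto
        then have "1 / (d x)\<^sup>2 \<le> 1 / (?r k)\<^sup>2" using r0[of k] True \<rho> by (intro divide_left_mono mult_pos_pos zero_less_power) auto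
        from mult_right_mono[OF this nn(1)[of x]] show ?thesis by simp
      qed
      then have "ennreal (f x / (d x)\<^sup>2) * indicator {x. \<rho> \<le> d x} x \<le> ennreal (1 / (?r k)\<^sup>2) * (ennreal (f x) * indicator {x. d x < ?r (Suc k)} x)"
        using True k1 nn(1)[of x] by (simp add: ennreal_mult[symmetric] ennreal_leI)
      also have "\<dots> \<le> (\<Sum>k. ennreal (1 / (?r k)\<^sup>2) * (ennreal (f x) * indicator {x. d x < ?r (Suc k)} x))"
        using sum_le_suminf[of "\<lambda>k. ennreal (1 / (?r k)\<^sup>2) * (ennreal (f x) * indicator {x. d x < ?r (Suc k)} x)" "{k}"] by simp
      finally show ?thesis .
    qed simp
  qed
  also have "\<dots> = (\<Sum>k. ennreal (1 / (?r k)\<^sup>2) * (\<integral>\<^sup>+x. ennreal (f x) * indicator {x. d x < ?r (Suc k)} x \<partial>M))"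
    by (subst nn_integral_suminf) (auto simp: nn_integral_cmult)
  also have "\<dots> \<le> (\<Sum>k. ennreal (4 * B * \<rho> powr (\<alpha> - 1) * (2 powr (\<alpha> - 1)) ^ k))"
  proof (rule suminf_le)
    fix k
    have "ennreal (1 / (?r k)\<^sup>2) * (\<integral>\<^sup>+x. ennreal (f x) * indicator {x. d x < ?r (Suc k)} x \<partial>M) \<le> ennreal (1 / (?r k)\<^sup>2) * ennreal (B * ?r (Suc k) powr (1 + \<alpha>))"
      by (intro mult_left_mono g r0) auto
    also have "\<dots> = ennreal (1 / (?r k)\<^sup>2 * (B * ?r (Suc k) powr (1 + \<alpha>)))" using B by (intro ennreal_mult[symmetric]) auto
    also have "\<dots> \<le> ennreal (4 * B * \<rho> powr (\<alpha> - 1) * (2 powr (\<alpha> - 1)) ^ k)"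
    proof (rule ennreal_leI)
      have "?r (Suc k) powr (1 + \<alpha>) = 2 powr (1 + \<alpha>) * ?r k powr (1 + \<alpha>)"
      proof -
        have "?r (Suc k) = 2 * ?r k" by simp
        then show ?thesis using r0[of k] by (simp only: powr_mult)
      qed
      also have "?r k powr (1 + \<alpha>) = ?r k powr (\<alpha> - 1) * (?r k)\<^sup>2"
      proof -
        have "?r k powr (1 + \<alpha>) = ?r k powr ((\<alpha> - 1) + 2)" by (simp add: add.commute)
        also have "\<dots> = ?r k powr (\<alpha> - 1) * ?r k powr 2" by (rule powr_add)
        finally show ?thesis using r0[of k] by (simp add: powr_numeral)
      qed
      also have "?r k powr (\<alpha> - 1) = \<rho> powr (\<alpha> - 1) * (2 powr (\<alpha> - 1)) ^ k"
      proof -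
        have "((2::real) ^ k) powr (\<alpha> - 1) = (2 powr (\<alpha> - 1)) ^ k"
          by (simp add: powr_realpow[symmetric] powr_powr mult.commute)
        then show ?thesis using \<rho> by (simp add: powr_mult)
      qed
      finally have "1 / (?r k)\<^sup>2 * (B * ?r (Suc k) powr (1 + \<alpha>)) = 2 powr (1 + \<alpha>) * (B * (\<rho> powr (\<alpha> - 1) * (2 powr (\<alpha> - 1)) ^ k))"
        using r0[of k] by (simp add: field_simps)
      also have "\<dots> \<le> 4 * (B * (\<rho> powr (\<alpha> - 1) * (2 powr (\<alpha> - 1)) ^ k))"
      proof (rule mult_right_mono)
        have "2 powr (1 + \<alpha>) \<le> 2 powr (2::real)" using \<alpha> by (intro powr_mono) auto
        then show "2 powr (1 + \<alpha>) \<le> (4::real)" by simp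
      qed (use B in auto)
      finally show "1 / (?r k)\<^sup>2 * (B * ?r (Suc k) powr (1 + \<alpha>)) \<le> 4 * B * \<rho> powr (\<alpha> - 1) * (2 powr (\<alpha> - 1)) ^ k"
        by (simp add: mult_ac)
    qed
    finally show "ennreal (1 / (?r k)\<^sup>2) * (\<integral>\<^sup>+x. ennreal (f x) * indicator {x. d x < ?r (Suc k)} x \<partial>M) \<le> ennreal (4 * B * \<rho> powr (\<alpha> - 1) * (2 powr (\<alpha> - 1)) ^ k)" .
  qed auto
  also have "\<dots> = ennreal (\<Sum>k. 4 * B * \<rho> powr (\<alpha> - 1) * (2 powr (\<alpha> - 1)) ^ k)"
  proof (rule suminf_ennreal2)
    show "summable (\<lambda>k. 4 * B * \<rho> powr (\<alpha> - 1) * (2 powr (\<alpha> - 1)) ^ k)"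
      using \<alpha> by (intro summable_mult summable_geometric) (auto simp: powr_less_one)
  qed (use B in auto)
  also have "(\<Sum>k. 4 * B * \<rho> powr (\<alpha> - 1) * (2 powr (\<alpha> - 1)) ^ k) = 4 * B * \<rho> powr (\<alpha> - 1) * (1 / (1 - 2 powr (\<alpha> - 1)))"
  proof -
    have n: "norm (2 powr (\<alpha> - 1)) < 1" using \<alpha> by (auto simp: powr_less_one)
    show ?thesis using suminf_mult[OF summable_geometric[OF n]] suminf_geometric[OF n] by simp
  qed
  finally show ?thesis by (simp add: mult_ac)
qed

text \<open>The measure in question is the one with density \<open>A\<close>, pushed forward to the plane by \<open>Zm\<close>.\<close>

locale frostman =
  fixes M :: "'a measure" and Zm :: "'a \<Rightarrow> complex" and A :: "'a \<Rightarrow> complex" and \<alpha> B :: real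
  assumes Zm [measurable]: "Zm \<in> borel_measurable M" and A: "integrable M A"
    and bdd: "bounded (range Zm)"
    and \<alpha>: "0 < \<alpha>" "\<alpha> < 1" and B: "0 \<le> B"
    and growth: "\<And>z \<rho>. \<rho> > 0 \<Longrightarrow> (\<integral>\<^sup>+x. ennreal (norm (A x)) * indicator {x. norm (z - Zm x) < \<rho>} x \<partial>M) \<le> ennreal (B * \<rho> powr (1 + \<alpha>))"
begin

lemma A_measurable [measurable]: "A \<in> borel_measurable M"
  using A by (rule borel_measurable_integrable)

definition "C1 = 2 * B / (1 - 2 powr (- \<alpha>))"
definition "C2 = 4 * B / (1 - 2 powr (\<alpha> - 1))"

lemma C_nonneg: "0 \<le> C1" "0 \<le> C2"
proof -
  have "2 powr (- \<alpha>) \<le> 1" "2 powr (\<alpha> - 1) \<le> 1" using \<alpha> by (auto simp: powr_less_one less_imp_le)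
  then show "0 \<le> C1" "0 \<le> C2" using B by (auto simp: C1_def C2_def)
qed

lemma near: "\<rho> > 0 \<Longrightarrow> (\<integral>\<^sup>+x. ennreal (norm (A x) / norm (z - Zm x)) * indicator {x. norm (z - Zm x) < \<rho>} x \<partial>M) \<le> ennreal (C1 * \<rho> powr \<alpha>)"
  unfolding C1_def by (rule dyadic_near) (use \<alpha> B growth in auto)

lemma far: "\<rho> > 0 \<Longrightarrow> (\<integral>\<^sup>+x. ennreal (norm (A x) / (norm (z - Zm x))\<^sup>2) * indicator {x. \<rho> \<le> norm (z - Zm x)} x \<partial>M) \<le> ennreal (C2 * \<rho> powr (\<alpha> - 1))"
  unfolding C2_def by (rule dyadic_far) (use \<alpha> B growth in auto)

lemma cauchy_integrable: "integrable M (\<lambda>x. A x / (z - Zm x))"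
proof (rule integrableI_bounded)
  obtain r where r: "\<And>x. norm (Zm x) \<le> r" using bdd by (auto simp: bounded_iff)
  define \<rho> where "\<rho> = norm z + \<bar>r\<bar> + 1"
  have "norm (z - Zm x) < \<rho>" for x
    using norm_triangle_ineq4[of z "Zm x"] r[of x] by (simp add: \<rho>_def)
  then have "(\<integral>\<^sup>+x. ennreal (norm (A x / (z - Zm x))) \<partial>M) = (\<integral>\<^sup>+x. ennreal (norm (A x) / norm (z - Zm x)) * indicator {x. norm (z - Zm x) < \<rho>} x \<partial>M)"
    by (intro nn_integral_cong) (simp add: norm_divide)
  also have "\<dots> \<le> ennreal (C1 * \<rho> powr \<alpha>)" by (rule near) (simp add: \<rho>_def add_nonneg_pos)
  also have "\<dots> < \<infinity>" by simp
  finally show "(\<integral>\<^sup>+x. ennreal (norm (A x / (z - Zm x))) \<partial>M) < \<infinity>" .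
qed measurable

lemma norm_integral_le_nn:
  fixes f :: "'a \<Rightarrow> complex"
  assumes "integrable M f" "(\<integral>\<^sup>+x. ennreal (norm (f x)) \<partial>M) \<le> ennreal C" "0 \<le> C"
  shows "norm (\<integral>x. f x \<partial>M) \<le> C"
proof -
  have "ennreal (norm (\<integral>x. f x \<partial>M)) \<le> (\<integral>\<^sup>+x. ennreal (norm (f x)) \<partial>M)"
    by (rule integral_norm_bound_ennreal[OF assms(1)])
  also note assms(2)
  finally show ?thesis using assms(3) by simp
qed

text \<open>Meant for the difference between the Cauchy kernel and its regularisation, which
  vanishes outside a disc and is bounded by the kernel itself inside.\<close>

lemma near_integral:
  fixes f :: "'a \<Rightarrow> complex"
  assumes f: "f \<in> borel_measurable M" and \<rho>: "\<rho> > 0"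
    and b: "\<And>x. norm (f x) \<le> (if norm (z - Zm x) < \<rho> then norm (A x) / norm (z - Zm x) else 0)"
  shows "norm (\<integral>x. f x \<partial>M) \<le> C1 * \<rho> powr \<alpha>"
proof -
  have "(\<integral>\<^sup>+x. ennreal (norm (f x)) \<partial>M) \<le> (\<integral>\<^sup>+x. ennreal (norm (A x) / norm (z - Zm x)) * indicator {x. norm (z - Zm x) < \<rho>} x \<partial>M)"
  proof (rule nn_integral_mono)
    fix x
    show "ennreal (norm (f x)) \<le> ennreal (norm (A x) / norm (z - Zm x)) * indicator {x. norm (z - Zm x) < \<rho>} x"
      using b[of x] by (cases "norm (z - Zm x) < \<rho>") (auto intro!: ennreal_leI)
  qed
  also have "\<dots> \<le> ennreal (C1 * \<rho> powr \<alpha>)" by (rule near[OF \<rho>])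
  finally have le: "(\<integral>\<^sup>+x. ennreal (norm (f x)) \<partial>M) \<le> ennreal (C1 * \<rho> powr \<alpha>)" .
  then have "integrable M f" using f by (intro integrableI_bounded) (auto simp: le_less_trans)
  then show ?thesis by (rule norm_integral_le_nn[OF _ le]) (use C_nonneg in auto)
qed

text \<open>Split at distance 2\<delta> from z, where \<delta> = |z - z'|. Nearby, each kernel is
  integrated by itself, the one at z' over a disc of radius 3\<delta>. Farther out the kernels
  differ by at most 2\<delta>/|z - Zm x|^2, and \<delta> times the bound from \<open>far\<close> is
  again of order \<delta>^\<alpha>.\<close>

lemma cauchy_hoelder:
  "norm ((\<integral>x. A x / (z - Zm x) \<partial>M) - (\<integral>x. A x / (z' - Zm x) \<partial>M)) \<le> (C1 * 2 powr \<alpha> + C1 * 3 powr \<alpha> + 2 * C2) * norm (z - z') powr \<alpha>"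
proof (cases "z = z'")
  case False
  define \<delta> where "\<delta> = norm (z - z')"
  have \<delta>: "\<delta> > 0" using False by (simp add: \<delta>_def)
  let ?f = "\<lambda>x. A x / (z - Zm x) - A x / (z' - Zm x)"
  have pt: "ennreal (norm (?f x)) \<le> ennreal (norm (A x) / norm (z - Zm x)) * indicator {x. norm (z - Zm x) < 2 * \<delta>} x
    + ennreal (norm (A x) / norm (z' - Zm x)) * indicator {x. norm (z' - Zm x) < 3 * \<delta>} x
    + ennreal (2 * \<delta>) * (ennreal (norm (A x) / (norm (z - Zm x))\<^sup>2) * indicator {x. 2 * \<delta> \<le> norm (z - Zm x)} x)" for x
  proof (cases "norm (z - Zm x) < 2 * \<delta>")
    case True
    have "norm (z' - Zm x) < 3 * \<delta>"
      using True norm_triangle_ineq[of "z' - z" "z - Zm x"] by (simp add: \<delta>_def norm_minus_commute)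
    then have "ennreal (norm (A x) / norm (z - Zm x)) * indicator {x. norm (z - Zm x) < 2 * \<delta>} x
      + ennreal (norm (A x) / norm (z' - Zm x)) * indicator {x. norm (z' - Zm x) < 3 * \<delta>} x
      = ennreal (norm (A x) / norm (z - Zm x) + norm (A x) / norm (z' - Zm x))"
      using True by (simp add: ennreal_plus)
    moreover have "norm (?f x) \<le> norm (A x) / norm (z - Zm x) + norm (A x) / norm (z' - Zm x)"
      using norm_triangle_ineq4[of "A x / (z - Zm x)" "A x / (z' - Zm x)"] by (simp add: norm_divide)
    ultimately show ?thesis by (metis (no_types, lifting) add.right_neutral add_mono ennreal_leI zero_le)
  next
    case far: False
    define u u' where "u = z - Zm x" and "u' = z' - Zm x"
    have u: "2 * \<delta> \<le> norm u" using far by (simp add: u_def)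
    have "norm u - \<delta> \<le> norm u'"
      using norm_triangle_ineq2[of u u'] norm_triangle_ineq[of u' "z - z'"] by (simp add: u_def u'_def \<delta>_def)
    then have u': "norm u / 2 \<le> norm u'" using u by linarith
    have nz: "norm u > 0" "norm u' > 0" using u u' \<delta> by linarith+
    then have "u \<noteq> 0" "u' \<noteq> 0" by auto
    then have "?f x = A x * (z' - z) / (u * u')"
      unfolding u_def[symmetric] u'_def[symmetric] by (simp add: field_simps) (simp add: u_def u'_def algebra_simps)
    then have "norm (?f x) = norm (A x) * \<delta> / (norm u * norm u')"
      by (simp add: norm_mult norm_divide \<delta>_def norm_minus_commute)
    also have "\<dots> \<le> norm (A x) * \<delta> / (norm u * (norm u / 2))"
      using u' nz \<delta> by (intro divide_left_mono mult_left_mono mult_pos_pos) auto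
    also have "\<dots> = 2 * \<delta> * (norm (A x) / (norm u)\<^sup>2)" using nz by (simp add: power2_eq_square field_simps)
    finally have "ennreal (norm (?f x)) \<le> ennreal (2 * \<delta>) * (ennreal (norm (A x) / (norm (z - Zm x))\<^sup>2) * indicator {x. 2 * \<delta> \<le> norm (z - Zm x)} x)"
      using far \<delta> by (simp add: u_def ennreal_mult[symmetric] ennreal_leI)
    then show ?thesis by (simp add: add_increasing)
  qed
  have "(\<integral>\<^sup>+x. ennreal (norm (?f x)) \<partial>M) \<le> (\<integral>\<^sup>+x. ennreal (norm (A x) / norm (z - Zm x)) * indicator {x. norm (z - Zm x) < 2 * \<delta>} x
    + ennreal (norm (A x) / norm (z' - Zm x)) * indicator {x. norm (z' - Zm x) < 3 * \<delta>} x
    + ennreal (2 * \<delta>) * (ennreal (norm (A x) / (norm (z - Zm x))\<^sup>2) * indicator {x. 2 * \<delta> \<le> norm (z - Zm x)} x) \<partial>M)"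
    by (intro nn_integral_mono pt)
  also have "\<dots> = (\<integral>\<^sup>+x. ennreal (norm (A x) / norm (z - Zm x)) * indicator {x. norm (z - Zm x) < 2 * \<delta>} x \<partial>M)
    + (\<integral>\<^sup>+x. ennreal (norm (A x) / norm (z' - Zm x)) * indicator {x. norm (z' - Zm x) < 3 * \<delta>} x \<partial>M)
    + ennreal (2 * \<delta>) * (\<integral>\<^sup>+x. ennreal (norm (A x) / (norm (z - Zm x))\<^sup>2) * indicator {x. 2 * \<delta> \<le> norm (z - Zm x)} x \<partial>M)"
    by (simp add: nn_integral_add nn_integral_cmult)
  also have "\<dots> \<le> ennreal (C1 * (2 * \<delta>) powr \<alpha>) + ennreal (C1 * (3 * \<delta>) powr \<alpha>) + ennreal (2 * \<delta>) * ennreal (C2 * (2 * \<delta>) powr (\<alpha> - 1))"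
    using \<delta> by (intro add_mono mult_left_mono near far) auto
  also have "\<dots> = ennreal (C1 * (2 * \<delta>) powr \<alpha> + C1 * (3 * \<delta>) powr \<alpha> + 2 * \<delta> * (C2 * (2 * \<delta>) powr (\<alpha> - 1)))"
    using \<delta> C_nonneg by (simp add: ennreal_plus ennreal_mult)
  also have "\<dots> \<le> ennreal ((C1 * 2 powr \<alpha> + C1 * 3 powr \<alpha> + 2 * C2) * \<delta> powr \<alpha>)"
  proof (rule ennreal_leI)
    have "2 * \<delta> * (C2 * (2 * \<delta>) powr (\<alpha> - 1)) = C2 * ((2 * \<delta>) powr 1 * (2 * \<delta>) powr (\<alpha> - 1))" using \<delta> by simp
    also have "\<dots> = C2 * (2 * \<delta>) powr \<alpha>" unfolding powr_add[symmetric] by simp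
    also have "\<dots> = 2 powr \<alpha> * (C2 * \<delta> powr \<alpha>)" using \<delta> by (simp add: powr_mult)
    also have "\<dots> \<le> 2 * (C2 * \<delta> powr \<alpha>)"
    proof (rule mult_right_mono)
      have "2 powr \<alpha> \<le> 2 powr (1::real)" using \<alpha> by (intro powr_mono) auto
      then show "2 powr \<alpha> \<le> (2::real)" by simp
    qed (use C_nonneg in auto)
    finally show "C1 * (2 * \<delta>) powr \<alpha> + C1 * (3 * \<delta>) powr \<alpha> + 2 * \<delta> * (C2 * (2 * \<delta>) powr (\<alpha> - 1)) \<le> (C1 * 2 powr \<alpha> + C1 * 3 powr \<alpha> + 2 * C2) * \<delta> powr \<alpha>"
      using \<delta> by (simp add: powr_mult algebra_simps)
  qed
  finally have le: "(\<integral>\<^sup>+x. ennreal (norm (?f x)) \<partial>M) \<le> ennreal ((C1 * 2 powr \<alpha> + C1 * 3 powr \<alpha> + 2 * C2) * \<delta> powr \<alpha>)" .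
  have "norm (\<integral>x. ?f x \<partial>M) \<le> (C1 * 2 powr \<alpha> + C1 * 3 powr \<alpha> + 2 * C2) * \<delta> powr \<alpha>"
    by (rule norm_integral_le_nn[OF _ le]) (use cauchy_integrable C_nonneg in auto)
  then show ?thesis
    unfolding \<delta>_def[symmetric] by (simp add: Bochner_Integration.integral_diff[OF cauchy_integrable cauchy_integrable])
qed simp

section \<open>Convolution with continuous and with C^1 kernels\<close>

lemma kernel_integrable:
  fixes k :: "complex \<Rightarrow> complex"
  assumes "continuous_on UNIV k" shows "integrable M (\<lambda>x. k (z - Zm x) * A x)"
proof -
  obtain r where r: "\<And>x. norm (Zm x) \<le> r" using bdd by (auto simp: bounded_iff)
  have "bounded (k ` cball 0 (norm z + r))"
    by (intro compact_imp_bounded compact_continuous_image continuous_on_subset[OF assms]) auto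
  then obtain b where "\<forall>w\<in>cball 0 (norm z + r). norm (k w) \<le> b" by (auto simp: bounded_iff)
  then have b: "\<And>w. norm w \<le> norm z + r \<Longrightarrow> norm (k w) \<le> b" by simp
  have bz: "norm (k (z - Zm x)) \<le> b" for x
    using b[of "z - Zm x"] norm_triangle_ineq4[of z "Zm x"] r[of x] by linarith
  have [measurable]: "k \<in> borel_measurable borel" using assms by (rule borel_measurable_continuous_onI)
  show ?thesis
  proof (rule Bochner_Integration.integrable_bound[OF integrable_mult_right[OF A, of "of_real b"]])
    show "AE x in M. norm (k (z - Zm x) * A x) \<le> norm (complex_of_real b * A x)"
    proof (intro AE_I2)
      fix x
      have "norm (k (z - Zm x)) * norm (A x) \<le> \<bar>b\<bar> * norm (A x)" using bz[of x] by (intro mult_right_mono) auto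
      then show "norm (k (z - Zm x) * A x) \<le> norm (complex_of_real b * A x)" by (simp add: norm_mult)
    qed
  qed measurable
qed

definition conv :: "(complex \<Rightarrow> complex) \<Rightarrow> complex \<Rightarrow> complex" where
  "conv k z = (\<integral>x. k (z - Zm x) * A x \<partial>M)"

lemma uniformly_continuous_cball:
  fixes P :: "complex \<Rightarrow> complex"
  assumes "continuous_on UNIV P" "e > 0"
  shows "\<exists>d>0. \<forall>w h. norm w \<le> r \<longrightarrow> norm h < d \<longrightarrow> norm (P (w + h) - P w) < e"
proof -
  have "uniformly_continuous_on (cball 0 (r + 1)) P"
    by (intro compact_uniformly_continuous continuous_on_subset[OF assms(1)]) auto
  then obtain d where d: "d > 0" "\<And>x y. x \<in> cball 0 (r + 1) \<Longrightarrow> y \<in> cball 0 (r + 1) \<Longrightarrow> dist y x < d \<Longrightarrow> dist (P y) (P x) < e"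
    using assms(2) unfolding uniformly_continuous_on_def by meson
  show ?thesis
  proof (rule exI[of _ "min d 1"], intro conjI allI impI)
    fix w h :: complex assume *: "norm w \<le> r" "norm h < min d 1"
    then have "norm (w + h) \<le> r + 1" using norm_triangle_ineq[of w h] by simp
    then have "w \<in> cball 0 (r + 1)" "w + h \<in> cball 0 (r + 1)" "dist (w + h) w < d"
      using * by (simp_all add: dist_norm[of "w + h"])
    from d(2)[OF this] show "norm (P (w + h) - P w) < e" by (simp add: dist_norm)
  qed (use d(1) in auto)
qed

lemma conv_continuous:
  assumes k: "continuous_on UNIV k" shows "continuous_on UNIV (conv k)"
  unfolding continuous_on_iff
proof (intro ballI allI impI)
  fix z :: complex and e :: real assume e: "e > 0"
  obtain r where r: "\<And>x. norm (Zm x) \<le> r" using bdd by (auto simp: bounded_iff)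
  define a where "a = (\<integral>x. norm (A x) \<partial>M)"
  have a: "a \<ge> 0" by (simp add: a_def)
  have ea: "e / (a + 1) > 0" using e a by simp
  obtain d where d: "d > 0" "\<And>w h. norm w \<le> norm z + r \<Longrightarrow> norm h < d \<Longrightarrow> norm (k (w + h) - k w) < e / (a + 1)"
    using uniformly_continuous_cball[OF k ea, of "norm z + r"] by blast
  have "dist (conv k z') (conv k z) < e" if "dist z' z < d" for z'
  proof -
    have "norm (conv k z' - conv k z) = norm (\<integral>x. k (z' - Zm x) * A x - k (z - Zm x) * A x \<partial>M)"
      unfolding conv_def by (subst Bochner_Integration.integral_diff[OF kernel_integrable[OF k] kernel_integrable[OF k]]) simp
    also have "\<dots> \<le> (\<integral>x. norm (k (z' - Zm x) * A x - k (z - Zm x) * A x) \<partial>M)" by (rule integral_norm_bound)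
    also have "\<dots> \<le> (\<integral>x. e / (a + 1) * norm (A x) \<partial>M)"
    proof (rule integral_mono)
      fix x
      have "norm (z - Zm x) \<le> norm z + r" using norm_triangle_ineq4[of z "Zm x"] r[of x] by linarith
      from d(2)[OF this, of "z' - z"] that have "norm (k (z' - Zm x) - k (z - Zm x)) \<le> e / (a + 1)"
        by (simp add: dist_norm)
      then show "norm (k (z' - Zm x) * A x - k (z - Zm x) * A x) \<le> e / (a + 1) * norm (A x)"
        unfolding left_diff_distrib[symmetric] norm_mult by (rule mult_right_mono) simp
    qed (intro integrable_norm Bochner_Integration.integrable_diff kernel_integrable k integrable_mult_right A)+
    also have "\<dots> = e / (a + 1) * a" by (simp add: a_def)
    also have "\<dots> < e" using e a by (simp add: field_simps)
    finally show ?thesis by (simp add: dist_norm)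
  qed
  then show "\<exists>d>0. \<forall>x'\<in>UNIV. dist x' z < d \<longrightarrow> dist (conv k x') (conv k z) < e" using d(1) by blast
qed

text \<open>Differentiation under the integral. As \<open>Zm\<close> is bounded, only a compact set
  of arguments of the kernel occurs; uniform continuity of both derivatives there makes the Taylor
  remainder uniform in x.\<close>

lemma conv_C1:
  assumes k: "C1c k" shows "C1c (conv k)" "dzb (conv k) z = conv (dzb k) z"
proof -
  have kc: "continuous_on UNIV k" "continuous_on UNIV (dz k)" "continuous_on UNIV (dzb k)"
    using C1c_continuous[OF k] k unfolding C1c_def by blast+
  have W: "has_wirt (conv k) (conv (dz k) z) (conv (dzb k) z) z" for z
    unfolding has_wirt_def has_derivative_at_alt
  proof (intro conjI allI impI)
    show "bounded_linear (\<lambda>h. conv (dz k) z * h + conv (dzb k) z * cnj h)"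
      by (intro bounded_linear_add bounded_linear_mult_right bounded_linear_compose[OF bounded_linear_mult_right bounded_linear_cnj])
    fix e :: real assume e: "e > 0"
    obtain r where r: "\<And>x. norm (Zm x) \<le> r" using bdd by (auto simp: bounded_iff)
    define a where "a = (\<integral>x. norm (A x) \<partial>M)"
    have a: "a \<ge> 0" by (simp add: a_def)
    define e' where "e' = e / (2 * (a + 1))"
    have e': "e' > 0" using e a by (simp add: e'_def)
    obtain d1 where d1: "d1 > 0" "\<And>w h. norm w \<le> norm z + r \<Longrightarrow> norm h < d1 \<Longrightarrow> norm (dz k (w + h) - dz k w) < e'"
      using uniformly_continuous_cball[OF kc(2) e', of "norm z + r"] by blast
    obtain d2 where d2: "d2 > 0" "\<And>w h. norm w \<le> norm z + r \<Longrightarrow> norm h < d2 \<Longrightarrow> norm (dzb k (w + h) - dzb k w) < e'"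
      using uniformly_continuous_cball[OF kc(3) e', of "norm z + r"] by blast
    define d where "d = min d1 d2"
    have rem: "norm (k (w + h) - k w - (dz k w * h + dzb k w * cnj h)) \<le> 2 * e' * norm h"
      if w: "norm w \<le> norm z + r" and h: "norm h < d" for w h
    proof -
      define g where "g = (\<lambda>h. k (w + h) - (dz k w * h + dzb k w * cnj h))"
      have "norm (g h - g 0) \<le> 2 * e' * norm (h - 0)"
      proof (rule differentiable_bound[where S = "ball 0 d"])
        fix x :: complex assume x: "x \<in> ball 0 d"
        have "has_wirt (\<lambda>h. k (h + w)) (dz k (x + w)) (dzb k (x + w)) x"
          by (intro has_wirt_shift C1c_has_wirt k)
        then have "((\<lambda>h. k (w + h)) has_derivative (\<lambda>h. dz k (w + x) * h + dzb k (w + x) * cnj h)) (at x)"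
          unfolding has_wirt_def by (simp add: add.commute)
        then have "(g has_derivative (\<lambda>h. (dz k (w + x) * h + dzb k (w + x) * cnj h) - (dz k w * h + dzb k w * cnj h))) (at x)"
          unfolding g_def by (intro has_derivative_diff has_derivative_add has_derivative_mult_right has_derivative_cnj has_derivative_ident)
        then show "(g has_derivative (\<lambda>h. (dz k (w + x) * h + dzb k (w + x) * cnj h) - (dz k w * h + dzb k w * cnj h))) (at x within ball 0 d)"
          by (rule has_derivative_at_withinI)
        show "onorm (\<lambda>h. (dz k (w + x) * h + dzb k (w + x) * cnj h) - (dz k w * h + dzb k w * cnj h)) \<le> 2 * e'"
        proof (rule onorm_bound)
          fix h
          have "(dz k (w + x) * h + dzb k (w + x) * cnj h) - (dz k w * h + dzb k w * cnj h) = (dz k (w + x) - dz k w) * h + (dzb k (w + x) - dzb k w) * cnj h"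
            by (simp add: algebra_simps)
          also have "norm \<dots> \<le> norm (dz k (w + x) - dz k w) * norm h + norm (dzb k (w + x) - dzb k w) * norm h"
            by (rule norm_triangle_le) (simp add: norm_mult)
          also have "\<dots> \<le> e' * norm h + e' * norm h"
            using d1(2)[OF w, of x] d2(2)[OF w, of x] x by (intro add_mono mult_right_mono) (auto simp: d_def)
          finally show "norm ((dz k (w + x) * h + dzb k (w + x) * cnj h) - (dz k w * h + dzb k w * cnj h)) \<le> 2 * e' * norm h" by simp
        qed (use e' in auto)
      qed (use h d1(1) d2(1) in \<open>auto simp: d_def\<close>)
      then show ?thesis by (simp add: g_def algebra_simps)
    qed
    have "norm (conv k y - conv k z - (conv (dz k) z * (y - z) + conv (dzb k) z * cnj (y - z))) \<le> e * norm (y - z)"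
      if y: "norm (y - z) < d" for y
    proof -
      let ?h = "y - z"
      let ?F = "\<lambda>x. k (y - Zm x) * A x - k (z - Zm x) * A x - (dz k (z - Zm x) * A x * ?h + dzb k (z - Zm x) * A x * cnj ?h)"
      have iF: "integrable M ?F"
        by (intro Bochner_Integration.integrable_diff Bochner_Integration.integrable_add integrable_mult_left kernel_integrable kc)
      have "conv k y - conv k z - (conv (dz k) z * ?h + conv (dzb k) z * cnj ?h) = (\<integral>x. ?F x \<partial>M)"
        unfolding conv_def
        by (simp add: Bochner_Integration.integral_diff Bochner_Integration.integral_add Bochner_Integration.integrable_diff
            Bochner_Integration.integrable_add kernel_integrable kc del: complex_cnj_diff)
      then have "norm (conv k y - conv k z - (conv (dz k) z * ?h + conv (dzb k) z * cnj ?h)) \<le> (\<integral>x. norm (?F x) \<partial>M)"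
        using integral_norm_bound[of M ?F] by simp
      also have "\<dots> \<le> (\<integral>x. 2 * e' * norm ?h * norm (A x) \<partial>M)"
      proof (rule integral_mono)
        show "integrable M (\<lambda>x. norm (?F x))" using iF by (rule integrable_norm)
        show "integrable M (\<lambda>x. 2 * e' * norm ?h * norm (A x))" by (intro integrable_mult_right integrable_norm A)
        fix x
        have "norm (z - Zm x) \<le> norm z + r" using norm_triangle_ineq4[of z "Zm x"] r[of x] by linarith
        from rem[OF this y] have le: "norm (k (y - Zm x) - k (z - Zm x) - (dz k (z - Zm x) * ?h + dzb k (z - Zm x) * cnj ?h)) \<le> 2 * e' * norm ?h"
          by simp
        have "?F x = (k (y - Zm x) - k (z - Zm x) - (dz k (z - Zm x) * ?h + dzb k (z - Zm x) * cnj ?h)) * A x"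
          by (simp add: algebra_simps)
        then have "norm (?F x) = norm (k (y - Zm x) - k (z - Zm x) - (dz k (z - Zm x) * ?h + dzb k (z - Zm x) * cnj ?h)) * norm (A x)"
          by (simp only: norm_mult)
        then show "norm (?F x) \<le> 2 * e' * norm ?h * norm (A x)" using mult_right_mono[OF le norm_ge_zero[of "A x"]] by simp
      qed
      also have "\<dots> = 2 * e' * a * norm ?h" by (simp add: a_def)
      also have "\<dots> \<le> e * norm ?h"
        using e a by (intro mult_right_mono) (auto simp: e'_def field_simps)
      finally show ?thesis .
    qed
    then show "\<exists>d>0. \<forall>y. norm (y - z) < d \<longrightarrow> norm (conv k y - conv k z - (conv (dz k) z * (y - z) + conv (dzb k) z * cnj (y - z))) \<le> e * norm (y - z)"
      using d1(1) d2(1) by (intro exI[of _ d]) (auto simp: d_def)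
  qed
  show "C1c (conv k)" by (rule C1cI[OF W conv_continuous[OF kc(2)] conv_continuous[OF kc(3)]])
  show "dzb (conv k) z = conv (dzb k) z" by (rule has_wirt_unique(2)[OF W])
qed

end

section \<open>The potential of the coefficient\<close>

locale similarity = hypocomplex_form +
  fixes A :: "torus \<Rightarrow> complex" and q :: real
  assumes q: "q > 2 + sigma_max" and ALq: "A \<in> Lq_torus q"
begin

definition hoelder_exp :: real where
  "hoelder_exp = (2 - q / (q - 1) - sigma_max / (sigma_max + 1)) / (q / (q - 1))"

text \<open>This form shows the origin of the exponent: the first factor is the growth of areas, the
  second the loss in Hoelder's inequality for a function in L^q.\<close>

lemma hoelder_exp_eq: "1 + hoelder_exp = (1 + 1 / (1 + sigma_max)) * ((q - 1) / q)"
proof -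
  have "q > 1" "sigma_max > 0" using q sigma_max_pos by auto
  then have "2 - sigma_max / (sigma_max + 1) = 1 + 1 / (1 + sigma_max)" by (simp add: field_simps)
  then have "hoelder_exp = (1 + 1 / (1 + sigma_max) - q / (q - 1)) / (q / (q - 1))" by (simp add: hoelder_exp_def)
  also have "\<dots> = (1 + 1 / (1 + sigma_max)) / (q / (q - 1)) - q / (q - 1) / (q / (q - 1))" by (rule diff_divide_distrib)
  also have "q / (q - 1) / (q / (q - 1)) = 1" using \<open>q > 1\<close> by simp
  also have "(1 + 1 / (1 + sigma_max)) / (q / (q - 1)) = (1 + 1 / (1 + sigma_max)) * ((q - 1) / q)" by simp
  finally show ?thesis by simp
qed

text \<open>Positivity amounts to (q - 1)/(1 + \<sigma>) > 1, that is to q > 2 + \<sigma>. The upper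
  bound holds because the area exponent is below 2.\<close>

lemma hoelder_exp: "0 < hoelder_exp" "hoelder_exp < 1"
proof -
  define s where "s = sigma_max"
  have s: "s > 0" "q > 2 + s" using q sigma_max_pos by (auto simp: s_def)
  have q0: "q > 0" using s by simp
  have "(1 + 1 / (1 + s)) * ((q - 1) / q) > 1"
  proof -
    have "(1 + 1 / (1 + s)) * (q - 1) = q + ((q - 1) / (1 + s) - 1)" by (simp add: algebra_simps)
    moreover have "(q - 1) / (1 + s) > 1" using s by (simp add: field_simps)
    ultimately show ?thesis using q0 by (simp add: field_simps)
  qed
  then show "0 < hoelder_exp" using hoelder_exp_eq by (simp add: s_def)
  have "(1 + 1 / (1 + s)) * ((q - 1) / q) < 2 * 1"
    using s q0 by (intro mult_le_less_imp_less) (auto simp: field_simps)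
  then show "hoelder_exp < 1" using hoelder_exp_eq by (simp add: s_def)
qed

abbreviation "Am P \<equiv> A (tproj P)"

lemma Am_measurable: "Am \<in> borel_measurable sq"
  and Am_powr: "integrable sq (\<lambda>P. norm (Am P) powr q)"
  using ALq by (auto simp: Lq_torus_def o_def)

lemma Am_integrable: "integrable sq Am"
proof -
  interpret finite_measure sq by (rule finite_measure_sq)
  have "integrable sq (\<lambda>P. 1 + norm (Am P) powr q)" using Am_powr by (intro Bochner_Integration.integrable_add) auto
  then show ?thesis
  proof (rule Bochner_Integration.integrable_bound[OF _ Am_measurable], intro AE_I2)
    fix P
    have "norm (Am P) \<le> 1 + norm (Am P) powr q"
    proof (cases "norm (Am P) \<le> 1")
      case True then show ?thesis by (simp add: add_increasing2)
    next
      case False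
      have "norm (Am P) powr 1 \<le> norm (Am P) powr q" using False q sigma_max_pos by (intro powr_mono) auto
      then show ?thesis using False by simp
    qed
    then show "norm (Am P) \<le> norm (1 + norm (Am P) powr q)" by simp
  qed
qed

text \<open>\<open>frostman\<close> asks for a map with bounded range, which \<open>Z\<close> does
  not have. The value outside the square is arbitrary because the measure lives on the
  square.\<close>

definition Zs :: "real \<times> real \<Rightarrow> complex" where
  "Zs P = (if P \<in> unit_square then Z P else 0)"

lemma Zs_eq: "P \<in> unit_square \<Longrightarrow> Zs P = Z P" by (simp add: Zs_def)

lemma Zs_measurable: "Zs \<in> borel_measurable sq"
proof -
  have "Z \<in> borel_measurable sq" by (rule sq_measurable_continuous[OF Z_continuous])
  then show ?thesis by (rule measurable_cong[THEN iffD1, rotated]) (simp add: Zs_eq)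
qed

lemma Zs_bounded: "bounded (range Zs)"
proof -
  have "bounded (Z ` unit_square)"
    unfolding unit_square_cbox by (intro compact_imp_bounded compact_continuous_image Z_continuous) auto
  then have "bounded (insert 0 (Z ` unit_square))" by simp
  then show ?thesis by (rule bounded_subset) (auto simp: Zs_def)
qed

text \<open>Hoelder's inequality on the preimage of a disc, carried out by a threshold: where |A|
  \<le> T the integrand is at most T, elsewhere at most T^(1-q) |A|^q.\<close>

lemma growth_exists:
  "\<exists>B\<ge>0. \<forall>z \<rho>. \<rho> > 0 \<longrightarrow> (\<integral>\<^sup>+x. ennreal (norm (Am x)) * indicator {x. norm (z - Zs x) < \<rho>} x \<partial>sq) \<le> ennreal (B * \<rho> powr (1 + hoelder_exp))"
proof -
  obtain K where K: "K \<ge> 1" "\<And>z \<rho>. \<rho> > 0 \<Longrightarrow>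
    emeasure lborel (unit_square \<inter> Z -` ball z \<rho>) \<le> ennreal (K * \<rho> powr (1 + 1 / (1 + sigma_max)))"
    using area_preimage_disc by blast
  define I where "I = (LINT P|sq. norm (Am P) powr q)"
  have I: "I \<ge> 0" by (simp add: I_def)
  have q1: "q > 1" using q sigma_max_pos by simp
  define B where "B = (I + 1) * K powr ((q - 1) / q)"
  have "(\<integral>\<^sup>+x. ennreal (norm (Am x)) * indicator {x. norm (z - Zs x) < \<rho>} x \<partial>sq) \<le> ennreal (B * \<rho> powr (1 + hoelder_exp))"
    if \<rho>: "\<rho> > 0" for z \<rho>
  proof -
    define V where "V = K * \<rho> powr (1 + 1 / (1 + sigma_max))"
    have V: "V > 0" using K(1) \<rho> by (simp add: V_def)
    \<comment> \<open>This threshold balances the two parts: T * V and T^(1-q) are both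
      V^((q-1)/q).\<close>
    define T where "T = V powr (- 1 / q)"
    have T: "T > 0" using V by (simp add: T_def)
    define E where "E = unit_square \<inter> Z -` ball z \<rho>"
    have Eb: "E \<in> sets borel"
      unfolding E_def unit_square_cbox by (intro sets.Int borel_closed borel_open open_vimage Z_continuous closed_cbox open_ball)
    have Es: "E \<in> sets sq" using Eb by (auto simp: sets_restrict_space E_def intro!: image_eqI[of _ _ E])
    have "(\<integral>\<^sup>+x. ennreal (norm (Am x)) * indicator {x. norm (z - Zs x) < \<rho>} x \<partial>sq)
      \<le> (\<integral>\<^sup>+x. ennreal (T powr (1 - q)) * ennreal (norm (Am x) powr q) + ennreal T * indicator E x \<partial>sq)"
    proof (rule nn_integral_mono)
      fix x assume "x \<in> space sq"
      then have x: "x \<in> unit_square" by simp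
      show "ennreal (norm (Am x)) * indicator {x. norm (z - Zs x) < \<rho>} x \<le> ennreal (T powr (1 - q)) * ennreal (norm (Am x) powr q) + ennreal T * indicator E x"
      proof (cases "norm (z - Zs x) < \<rho>")
        case True
        then have xE: "x \<in> E" using x by (simp add: E_def Zs_eq dist_norm)
        have "norm (Am x) \<le> T powr (1 - q) * norm (Am x) powr q + T"
        proof (cases "norm (Am x) \<le> T")
          case True then show ?thesis by (simp add: add_increasing)
        next
          case False
          have "norm (Am x) = norm (Am x) powr (1 - q) * norm (Am x) powr q"
            using False T by (simp add: powr_add[symmetric])
          also have "\<dots> \<le> T powr (1 - q) * norm (Am x) powr q"
            using False T q1 by (intro mult_right_mono powr_mono2') auto
          finally show ?thesis using T by linarith
        qed
        then have "ennreal (norm (Am x)) \<le> ennreal (T powr (1 - q) * norm (Am x) powr q + T)" by (rule ennreal_leI)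
        also have "\<dots> = ennreal (T powr (1 - q)) * ennreal (norm (Am x) powr q) + ennreal T"
          using T by (simp add: ennreal_plus ennreal_mult)
        finally show ?thesis using True xE by simp
      qed simp
    qed
    also have "\<dots> = ennreal (T powr (1 - q)) * (\<integral>\<^sup>+x. ennreal (norm (Am x) powr q) \<partial>sq) + ennreal T * emeasure sq E"
    proof -
      have m: "(\<lambda>x. ennreal (norm (Am x) powr q)) \<in> borel_measurable sq"
        using Am_powr by (intro measurable_compose[OF borel_measurable_integrable measurable_ennreal])
      then show ?thesis using Es by (subst nn_integral_add) (auto simp: nn_integral_cmult)
    qed
    also have "(\<integral>\<^sup>+x. ennreal (norm (Am x) powr q) \<partial>sq) = ennreal I"
      unfolding I_def by (rule nn_integral_eq_integral[OF Am_powr]) simp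
    also have "emeasure sq E = emeasure lborel E"
      using Eb by (subst emeasure_restrict_space) (auto simp: E_def)
    also have "ennreal (T powr (1 - q)) * ennreal I + ennreal T * emeasure lborel E \<le> ennreal (T powr (1 - q)) * ennreal I + ennreal T * ennreal V"
      unfolding E_def V_def by (intro add_mono mult_left_mono K(2) \<rho>) auto
    also have "\<dots> = ennreal (T powr (1 - q) * I + T * V)" using I T V by (simp add: ennreal_mult ennreal_plus)
    also have "T powr (1 - q) * I + T * V = B * \<rho> powr (1 + hoelder_exp)"
    proof -
      have 1: "T powr (1 - q) = V powr ((q - 1) / q)" unfolding T_def powr_powr
        by (rule arg_cong[where f = "(powr) V"]) (use q1 in \<open>simp add: field_simps\<close>)
      have "T * V = V powr (- 1 / q) * V powr 1" using V by (simp add: T_def)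
      also have "\<dots> = V powr ((q - 1) / q)" unfolding powr_add[symmetric] using q1 by (simp add: field_simps)
      finally have 2: "T * V = V powr ((q - 1) / q)" .
      have "V powr ((q - 1) / q) = K powr ((q - 1) / q) * \<rho> powr (1 + hoelder_exp)"
        unfolding V_def hoelder_exp_eq using K(1) by (simp add: powr_mult powr_powr)
      then show ?thesis unfolding 1 2 B_def by (simp add: algebra_simps)
    qed
    finally show ?thesis .
  qed
  moreover have "B \<ge> 0" using I by (simp add: B_def)
  ultimately show ?thesis by blast
qed

text \<open>Fixed by choice, so that the interpretation of \<open>frostman\<close> has a definite
  parameter.\<close>

definition growth_const :: real where
  "growth_const = (SOME B. 0 \<le> B \<and> (\<forall>z \<rho>. \<rho> > 0 \<longrightarrow> (\<integral>\<^sup>+x. ennreal (norm (Am x)) * indicator {x. norm (z - Zs x) < \<rho>} x \<partial>sq) \<le> ennreal (B * \<rho> powr (1 + hoelder_exp))))"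

lemma growth_const: "0 \<le> growth_const" "\<rho> > 0 \<Longrightarrow> (\<integral>\<^sup>+x. ennreal (norm (Am x)) * indicator {x. norm (z - Zs x) < \<rho>} x \<partial>sq) \<le> ennreal (growth_const * \<rho> powr (1 + hoelder_exp))"
  using someI_ex[OF growth_exists] unfolding growth_const_def by blast+

sublocale F: frostman sq Zs Am hoelder_exp growth_const
  by unfold_locales (use Zs_measurable Am_integrable Zs_bounded hoelder_exp growth_const in auto)

section \<open>The theta potential and its regularisations\<close>

abbreviation "Kreg e \<equiv> theta_reg \<tau> dtheta e"
abbreviation "Kq \<equiv> theta_quot \<tau> dtheta"
abbreviation "V \<equiv> F.conv Kq"
abbreviation "Vr e \<equiv> F.conv (Kreg e)"

lemmas dtheta_holomorphic = log_deriv_theta(4)[OF tau]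

lemma Kreg_C1: "0 < e \<Longrightarrow> e \<le> 1 \<Longrightarrow> C1c (Kreg e)"
  by (rule theta_reg_C1(1)[OF tau dtheta_holomorphic])

lemma conv_Zs: "F.conv k z = (LINT s|sq. k (z - Z s) * Am s)"
  unfolding F.conv_def by (rule Bochner_Integration.integral_cong) (auto simp: Zs_eq)

lemma T_op_eq: "T_op a b \<tau> (A \<circ> tproj) P = 1 / (2 * of_real pi * \<i>) * V (Z P)"
  unfolding T_op_def conv_Zs theta_quot_def deriv_odd_theta odd_theta_def by simp

text \<open>The exceptional set is countable, because the lattice is countable and \<open>Z\<close>
  is injective.\<close>

lemma AE_off_lattice: "AE x in sq. z - Zs x \<notin> lattice \<tau>"
proof -
  have "countable (Z -` ((\<lambda>l. z - l) ` lattice \<tau>))"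
  proof (rule countable_image_inj_on)
    show "countable (Z ` Z -` ((\<lambda>l. z - l) ` lattice \<tau>))"
      by (rule countable_subset[OF _ countable_image[OF countable_lattice]]) auto
    show "inj_on Z (Z -` ((\<lambda>l. z - l) ` lattice \<tau>))" using Z_inj by (rule inj_on_subset) simp
  qed
  then have "Z -` ((\<lambda>l. z - l) ` lattice \<tau>) \<in> null_sets lborel" by (rule countable_imp_null_set_lborel)
  then have "AE x in lebesgue. x \<notin> Z -` ((\<lambda>l. z - l) ` lattice \<tau>)"
    using null_sets_completionI[of _ lborel] by (intro AE_not_in) auto
  then have "AE x in lebesgue. x \<in> unit_square \<longrightarrow> z - Zs x \<notin> lattice \<tau>"
  proof eventually_elim
    case (elim x)
    show ?case
    proof (intro impI notI)
      assume "x \<in> unit_square" "z - Zs x \<in> lattice \<tau>"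
      then have "Z x \<in> (\<lambda>l. z - l) ` lattice \<tau>" by (intro image_eqI[of _ _ "z - Z x"]) (auto simp: Zs_eq)
      then show False using elim by blast
    qed
  qed
  then show ?thesis by (simp add: AE_restrict_space_iff)
qed

text \<open>On a bounded set of z only finitely many poles of the kernel are met. Splitting them off
  leaves Cauchy transforms, to which the estimates in \<open>frostman\<close> apply, and a
  convolution with a C^1 kernel that does not depend on \<open>e\<close>.\<close>

lemma V_decomposition:
  obtains F k0 where "finite F" "C1c k0"
    "\<And>z. norm z \<le> M0 \<Longrightarrow> V z = (\<Sum>l\<in>F. LINT x|sq. Am x / (z - l - Zs x)) + F.conv k0 z"
    "\<And>z e. norm z \<le> M0 \<Longrightarrow> 0 < e \<Longrightarrow> e \<le> 1 \<Longrightarrow> Vr e z = (\<Sum>l\<in>F. LINT x|sq. cauchy_reg e (z - l - Zs x) * Am x) + F.conv k0 z"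
proof -
  obtain r where r: "\<And>x. norm (Zs x) \<le> r" using Zs_bounded by (auto simp: bounded_iff)
  define M where "M = M0 + r + 1"
  define F where "F = lattice \<tau> \<inter> ball 0 (M + 1)"
  have fin: "finite F" unfolding F_def by (rule finite_subset[OF _ finite_lattice_ball[OF tau, of 0 "M + 1"]]) auto
  have res: "theta_res \<tau> dtheta l = 1" if "l \<in> F" for l using log_deriv_theta(1)[OF tau] that by (auto simp: F_def)
  obtain R where R: "\<And>z. z \<in> ball 0 M \<Longrightarrow> z \<notin> lattice \<tau> \<Longrightarrow> Kq z = (\<Sum>l\<in>F. theta_res \<tau> dtheta l / (z - l)) + R z"
    "\<And>z e. z \<in> ball 0 M \<Longrightarrow> 0 < e \<Longrightarrow> e \<le> 1 \<Longrightarrow> Kreg e z = (\<Sum>l\<in>F. theta_res \<tau> dtheta l * cauchy_reg e (z - l)) + R z"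
    unfolding F_def by (rule theta_reg_local[OF tau dtheta_holomorphic, of M]) blast
  \<comment> \<open>\<open>conv_C1\<close> needs a kernel that is C^1 on the whole plane, whereas
    the holomorphic remainder \<open>R\<close> is controlled only on the ball. The regularised
    kernels at \<open>e = 1\<close> provide an extension that equals \<open>R\<close> there.\<close>
  define k0 where "k0 = (\<lambda>z. Kreg 1 z - (\<Sum>l\<in>F. cauchy_reg 1 (z - l)))"
  have cr: "C1c (cauchy_reg e)" if "e > 0" for e
    by (rule C1cI[OF has_wirt_cauchy_reg[OF that] continuous_cauchy_reg_dz[OF that] continuous_delta_reg])
  have crs: "has_wirt (\<lambda>z. cauchy_reg e (z - l)) (dz (cauchy_reg e) (z - l)) (dzb (cauchy_reg e) (z - l)) z" if "e > 0" for e l z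
    using has_wirt_shift[OF C1c_has_wirt[OF cr[OF that]], where c = "- l" and z = z] by simp
  have c1: "continuous_on UNIV (\<lambda>z. g (z - l))" if "continuous_on UNIV g" for g :: "complex \<Rightarrow> complex" and l
    by (rule continuous_on_compose2[OF that _ subset_UNIV]) (intro continuous_intros)
  have k0: "C1c k0"
  proof (rule C1cI)
    show "has_wirt k0 (dz (Kreg 1) z - (\<Sum>l\<in>F. dz (cauchy_reg 1) (z - l))) (dzb (Kreg 1) z - (\<Sum>l\<in>F. dzb (cauchy_reg 1) (z - l))) z" for z
      unfolding k0_def by (intro has_wirt_diff has_wirt_sum crs C1c_has_wirt Kreg_C1) auto
    have "C1c (Kreg 1)" "C1c (cauchy_reg 1)" by (intro Kreg_C1 cr; simp)+
    then show "continuous_on UNIV (\<lambda>z. dz (Kreg 1) z - (\<Sum>l\<in>F. dz (cauchy_reg 1) (z - l)))"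
      "continuous_on UNIV (\<lambda>z. dzb (Kreg 1) z - (\<Sum>l\<in>F. dzb (cauchy_reg 1) (z - l)))"
      unfolding C1c_def by (auto intro!: continuous_on_diff continuous_on_sum c1)
  qed
  have k0R: "k0 z = R z" if "z \<in> ball 0 M" for z
    using R(2)[OF that, of 1] res by (simp add: k0_def)
  have inM: "z - Zs x \<in> ball 0 M" if "norm z \<le> M0" for z x
    using norm_triangle_ineq4[of z "Zs x"] r[of x] that by (simp add: M_def)
  have ik0: "integrable sq (\<lambda>x. k0 (z - Zs x) * Am x)" for z by (rule F.kernel_integrable[OF C1c_continuous[OF k0]])
  have "V z = (\<Sum>l\<in>F. LINT x|sq. Am x / (z - l - Zs x)) + F.conv k0 z" if z: "norm z \<le> M0" for z
  proof -
    have iF: "integrable sq (\<lambda>x. \<Sum>l\<in>F. Am x / (z - l - Zs x))" by (intro Bochner_Integration.integrable_sum F.cauchy_integrable)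
    have "V z = (LINT x|sq. (\<Sum>l\<in>F. Am x / (z - l - Zs x)) + k0 (z - Zs x) * Am x)"
      unfolding F.conv_def
    proof (rule integral_cong_AE)
      have "Kq \<in> borel_measurable borel"
        unfolding theta_quot_def using dtheta_holomorphic odd_theta_holomorphic[OF tau]
        by (intro borel_measurable_divide borel_measurable_continuous_onI holomorphic_on_imp_continuous_on)
      then show "(\<lambda>x. Kq (z - Zs x) * Am x) \<in> borel_measurable sq"
        by (intro borel_measurable_times F.A_measurable measurable_compose[OF _ \<open>Kq \<in> borel_measurable borel\<close>] borel_measurable_diff borel_measurable_const F.Zm)
      show "(\<lambda>x. (\<Sum>l\<in>F. Am x / (z - l - Zs x)) + k0 (z - Zs x) * Am x) \<in> borel_measurable sq"
        using iF ik0 by (intro borel_measurable_add borel_measurable_integrable)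
      show "AE x in sq. Kq (z - Zs x) * Am x = (\<Sum>l\<in>F. Am x / (z - l - Zs x)) + k0 (z - Zs x) * Am x"
        using AE_off_lattice[of z]
      proof eventually_elim
        case (elim x)
        have "Kq (z - Zs x) = (\<Sum>l\<in>F. 1 / (z - l - Zs x)) + k0 (z - Zs x)"
          unfolding R(1)[OF inM[OF z] elim] k0R[OF inM[OF z]] using res by (simp add: algebra_simps)
        then show ?case by (simp add: distrib_right sum_distrib_right)
      qed
    qed
    also have "\<dots> = (LINT x|sq. (\<Sum>l\<in>F. Am x / (z - l - Zs x))) + F.conv k0 z"
      unfolding F.conv_def by (rule Bochner_Integration.integral_add[OF iF ik0])
    also have "(LINT x|sq. (\<Sum>l\<in>F. Am x / (z - l - Zs x))) = (\<Sum>l\<in>F. LINT x|sq. Am x / (z - l - Zs x))"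
      by (rule Bochner_Integration.integral_sum) (rule F.cauchy_integrable)
    finally show ?thesis .
  qed
  moreover have "Vr e z = (\<Sum>l\<in>F. LINT x|sq. cauchy_reg e (z - l - Zs x) * Am x) + F.conv k0 z"
    if z: "norm z \<le> M0" and e: "0 < e" "e \<le> 1" for z e
  proof -
    have ic: "integrable sq (\<lambda>x. cauchy_reg e (z - l - Zs x) * Am x)" for l
      by (rule F.kernel_integrable[OF C1c_continuous[OF cr[OF e(1)]]])
    have "Vr e z = (LINT x|sq. (\<Sum>l\<in>F. cauchy_reg e (z - l - Zs x) * Am x) + k0 (z - Zs x) * Am x)"
      unfolding F.conv_def
    proof (rule Bochner_Integration.integral_cong[OF refl])
      fix x
      have "Kreg e (z - Zs x) = (\<Sum>l\<in>F. cauchy_reg e (z - l - Zs x)) + k0 (z - Zs x)"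
        unfolding R(2)[OF inM[OF z] e] k0R[OF inM[OF z]] using res by (simp add: algebra_simps)
      then show "Kreg e (z - Zs x) * Am x = (\<Sum>l\<in>F. cauchy_reg e (z - l - Zs x) * Am x) + k0 (z - Zs x) * Am x"
        by (simp add: distrib_right sum_distrib_right)
    qed
    also have "\<dots> = (LINT x|sq. (\<Sum>l\<in>F. cauchy_reg e (z - l - Zs x) * Am x)) + F.conv k0 z"
      unfolding F.conv_def by (intro Bochner_Integration.integral_add Bochner_Integration.integrable_sum ic ik0)
    also have "(LINT x|sq. (\<Sum>l\<in>F. cauchy_reg e (z - l - Zs x) * Am x)) = (\<Sum>l\<in>F. LINT x|sq. cauchy_reg e (z - l - Zs x) * Am x)"
      by (rule Bochner_Integration.integral_sum) (rule ic)
    finally show ?thesis .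
  qed
  ultimately show thesis using that fin k0 by blast
qed

text \<open>In the decomposition only the Cauchy kernels change, and only within distance e of their
  poles, so \<open>near_integral\<close> with radius e applies to each.\<close>

lemma Vr_near_V:
  obtains K where "K \<ge> 0" "\<And>z e. norm z \<le> M0 \<Longrightarrow> 0 < e \<Longrightarrow> e \<le> 1 \<Longrightarrow> norm (Vr e z - V z) \<le> K * e powr hoelder_exp"
proof -
  obtain F k0 where D: "finite F"
    "\<And>z. norm z \<le> M0 \<Longrightarrow> V z = (\<Sum>l\<in>F. LINT x|sq. Am x / (z - l - Zs x)) + F.conv k0 z"
    "\<And>z e. norm z \<le> M0 \<Longrightarrow> 0 < e \<Longrightarrow> e \<le> 1 \<Longrightarrow> Vr e z = (\<Sum>l\<in>F. LINT x|sq. cauchy_reg e (z - l - Zs x) * Am x) + F.conv k0 z"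
    by (rule V_decomposition[of M0]) blast
  have "norm (Vr e z - V z) \<le> (card F * F.C1) * e powr hoelder_exp" if z: "norm z \<le> M0" and e: "0 < e" "e \<le> 1" for z e
  proof -
    have cr: "C1c (cauchy_reg e)"
      by (rule C1cI[OF has_wirt_cauchy_reg[OF e(1)] continuous_cauchy_reg_dz[OF e(1)] continuous_delta_reg])
    have ic: "integrable sq (\<lambda>x. cauchy_reg e (z - l - Zs x) * Am x)" for l
      by (rule F.kernel_integrable[OF C1c_continuous[OF cr]])
    have "Vr e z - V z = (\<Sum>l\<in>F. (LINT x|sq. cauchy_reg e (z - l - Zs x) * Am x) - (LINT x|sq. Am x / (z - l - Zs x)))"
      unfolding D(2)[OF z] D(3)[OF z e] by (simp add: sum_subtractf)
    also have "norm \<dots> \<le> (\<Sum>l\<in>F. F.C1 * e powr hoelder_exp)"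
    proof (rule sum_norm_le)
      fix l
      have "(LINT x|sq. cauchy_reg e (z - l - Zs x) * Am x) - (LINT x|sq. Am x / (z - l - Zs x))
        = (LINT x|sq. cauchy_reg e (z - l - Zs x) * Am x - Am x / (z - l - Zs x))"
        by (rule Bochner_Integration.integral_diff[OF ic F.cauchy_integrable, symmetric])
      also have "norm \<dots> \<le> F.C1 * e powr hoelder_exp"
      proof (rule F.near_integral[OF _ e(1)])
        show "(\<lambda>x. cauchy_reg e (z - l - Zs x) * Am x - Am x / (z - l - Zs x)) \<in> borel_measurable sq"
          by (intro borel_measurable_diff borel_measurable_integrable ic F.cauchy_integrable)
        fix x
        let ?u = "z - l - Zs x"
        have "cauchy_reg e ?u * Am x - Am x / ?u = - (1 / ?u - cauchy_reg e ?u) * Am x" by (simp add: algebra_simps)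
        then have n: "norm (cauchy_reg e ?u * Am x - Am x / ?u) = norm (1 / ?u - cauchy_reg e ?u) * norm (Am x)"
          by (simp only: norm_mult norm_minus_cancel)
        show "norm (cauchy_reg e ?u * Am x - Am x / ?u) \<le> (if norm ?u < e then norm (Am x) / norm ?u else 0)"
        proof (cases "norm ?u < e")
          case True
          then show ?thesis unfolding n using mult_right_mono[OF norm_cauchy_reg_diff_le[of ?u e] norm_ge_zero[of "Am x"]] by simp
        next
          case False
          then show ?thesis unfolding n using cauchy_reg_eq[OF e(1), of ?u] by simp
        qed
      qed
      finally show "norm ((LINT x|sq. cauchy_reg e (z - l - Zs x) * Am x) - (LINT x|sq. Am x / (z - l - Zs x))) \<le> F.C1 * e powr hoelder_exp" .
    qed
    finally show ?thesis by simp
  qed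
  moreover have "0 \<le> card F * F.C1" using F.C_nonneg by simp
  ultimately show thesis using that by blast
qed

lemma V_hoelder:
  obtains K L where "K \<ge> 0" "L \<ge> 0" "\<And>z z'. norm z \<le> M0 \<Longrightarrow> norm z' \<le> M0 \<Longrightarrow> norm (V z - V z') \<le> K * norm (z - z') powr hoelder_exp + L * norm (z - z')"
proof -
  obtain F k0 where D: "finite F" "C1c k0"
    "\<And>z. norm z \<le> M0 \<Longrightarrow> V z = (\<Sum>l\<in>F. LINT x|sq. Am x / (z - l - Zs x)) + F.conv k0 z"
    by (rule V_decomposition[of M0]) blast
  obtain L where L: "L \<ge> 0" "\<And>z z'. norm z \<le> M0 \<Longrightarrow> norm z' \<le> M0 \<Longrightarrow> norm (F.conv k0 z - F.conv k0 z') \<le> L * norm (z - z')"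
    using C1c_lipschitz[OF F.conv_C1(1)[OF D(2)]] by blast
  define c where "c = F.C1 * 2 powr hoelder_exp + F.C1 * 3 powr hoelder_exp + 2 * F.C2"
  have c: "c \<ge> 0" using F.C_nonneg by (simp add: c_def)
  have "norm (V z - V z') \<le> (card F * c) * norm (z - z') powr hoelder_exp + L * norm (z - z')" if z: "norm z \<le> M0" "norm z' \<le> M0" for z z'
  proof -
    have "V z - V z' = (\<Sum>l\<in>F. (LINT x|sq. Am x / (z - l - Zs x)) - (LINT x|sq. Am x / (z' - l - Zs x))) + (F.conv k0 z - F.conv k0 z')"
      unfolding D(3)[OF z(1)] D(3)[OF z(2)] by (simp add: sum_subtractf)
    also have "norm \<dots> \<le> card F * (c * norm (z - z') powr hoelder_exp) + L * norm (z - z')"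
    proof (rule norm_triangle_le, rule add_mono)
      have "norm (\<Sum>l\<in>F. (LINT x|sq. Am x / (z - l - Zs x)) - (LINT x|sq. Am x / (z' - l - Zs x))) \<le> (\<Sum>l\<in>F. c * norm (z - z') powr hoelder_exp)"
      proof (rule sum_norm_le)
        fix l
        show "norm ((LINT x|sq. Am x / (z - l - Zs x)) - (LINT x|sq. Am x / (z' - l - Zs x))) \<le> c * norm (z - z') powr hoelder_exp"
          using F.cauchy_hoelder[of "z - l" "z' - l"] by (simp add: c_def)
      qed
      then show "norm (\<Sum>l\<in>F. (LINT x|sq. Am x / (z - l - Zs x)) - (LINT x|sq. Am x / (z' - l - Zs x))) \<le> card F * (c * norm (z - z') powr hoelder_exp)" by simp
    qed (rule L(2)[OF z])
    finally show ?thesis by (simp add: mult.assoc)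
  qed
  moreover have "0 \<le> card F * c" using c by simp
  ultimately show thesis using that L(1) by blast
qed

end

section \<open>Concentration of the regularised kernels\<close>

context hypocomplex_form
begin

text \<open>L annihilates \<open>Z\<close>, so the chain rule leaves only the conjugate derivative,
  multiplied by L applied to the conjugate of \<open>Z\<close>; that is b cnj a - a cnj b = 2i
  \<open>Jac\<close>.\<close>

lemma compose_Z:
  assumes k: "C1c \<psi>"
  shows "C1_on UNIV (\<lambda>P. \<psi> (Z P))"
    "b (tproj P) * pdx (\<lambda>P. \<psi> (Z P)) P - a (tproj P) * pdy (\<lambda>P. \<psi> (Z P)) P = 2 * \<i> * of_real (Jac P) * dzb \<psi> (Z P)"
proof -
  have kc: "continuous_on UNIV (dz \<psi>)" "continuous_on UNIV (dzb \<psi>)" using k by (auto simp: C1c_def)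
  have D: "((\<lambda>P. \<psi> (Z P)) has_derivative (\<lambda>h. fst h *\<^sub>R (dz \<psi> (Z P) * a (tproj P) + dzb \<psi> (Z P) * cnj (a (tproj P)))
     + snd h *\<^sub>R (dz \<psi> (Z P) * b (tproj P) + dzb \<psi> (Z P) * cnj (b (tproj P))))) (at P)" for P
    by (rule has_derivative_eq_rhs[OF has_derivative_compose[OF Z_has_derivative C1c_has_wirt[OF k, unfolded has_wirt_def]]])
       (simp add: fun_eq_iff scaleR_conv_of_real algebra_simps)
  have c: "continuous_on UNIV (\<lambda>P. dz \<psi> (Z P))" "continuous_on UNIV (\<lambda>P. dzb \<psi> (Z P))"
    by (rule continuous_on_compose2[OF kc(1) Z_continuous]; simp) (rule continuous_on_compose2[OF kc(2) Z_continuous]; simp)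
  note R = C1_on_UNIV_I[OF D]
  show "C1_on UNIV (\<lambda>P. \<psi> (Z P))" by (rule R(1); intro continuous_intros c coeff_continuous)
  have px: "pdx (\<lambda>P. \<psi> (Z P)) = (\<lambda>P. dz \<psi> (Z P) * a (tproj P) + dzb \<psi> (Z P) * cnj (a (tproj P)))"
    by (rule R(2); intro continuous_intros c coeff_continuous)
  have py: "pdy (\<lambda>P. \<psi> (Z P)) = (\<lambda>P. dz \<psi> (Z P) * b (tproj P) + dzb \<psi> (Z P) * cnj (b (tproj P)))"
    by (rule R(3); intro continuous_intros c coeff_continuous)
  have "b (tproj P) * cnj (a (tproj P)) - a (tproj P) * cnj (b (tproj P)) = 2 * \<i> * of_real (Jac P)"
    by (simp add: Jac_def complex_eq_iff algebra_simps)
  then have "2 * \<i> * of_real (Jac P) * dzb \<psi> (Z P) = (b (tproj P) * cnj (a (tproj P)) - a (tproj P) * cnj (b (tproj P))) * dzb \<psi> (Z P)" by simp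
  then show "b (tproj P) * pdx (\<lambda>P. \<psi> (Z P)) P - a (tproj P) * pdy (\<lambda>P. \<psi> (Z P)) P = 2 * \<i> * of_real (Jac P) * dzb \<psi> (Z P)"
    unfolding px py by (simp add: algebra_simps)
qed

lemma continuous_compose_Z: "continuous_on UNIV \<psi> \<Longrightarrow> continuous_on UNIV (\<lambda>P. \<psi> (Z P :: complex))"
  by (rule continuous_on_compose2[OF _ Z_continuous]) auto

lemma Z_shift: "Z (x + 1, y) = Z (x, y) + 1" "Z (x, y + 1) = Z (x, y) + \<tau>"
  by (rule period_x, rule period_y)

text \<open>The lower edge of the square is the path from the origin to (1, 0), so the normalised
  period of \<open>Z\<close> is the edge integral in Green's formula.\<close>

lemma integral_a: "integral {0..1} (\<lambda>x. a (tproj (x, 0))) = 1"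
proof -
  have "Z (0, 0) = 0" by (simp add: Zint_def)
  then have "Z (1, 0) = 1" using period_x[of 0 0] by simp
  then show ?thesis by (simp add: Zint_def)
qed

lemma green_torus:
  fixes g :: "real \<times> real \<Rightarrow> complex"
  assumes g: "C1_on UNIV g" and gx: "\<And>y. g (1, y) = g (0, y)" and gy: "\<And>x. g (x, 1) = g (x, 0) + \<beta>"
  shows "(LINT P|sq. b (tproj P) * pdx g P - a (tproj P) * pdy g P) = - \<beta>"
  using green_square[OF coeff_C1 g closed_form tproj_per2 tproj_per2 gx gy] integral_a by simp

lemma theta_reg_period:
  assumes e: "0 < e" "e \<le> 1"
  shows "theta_reg \<tau> dtheta e (z + 1) = theta_reg \<tau> dtheta e z" "theta_reg \<tau> dtheta e (z + \<tau>) = theta_reg \<tau> dtheta e z - 2 * of_real pi * \<i>"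
proof -
  have res: "theta_res \<tau> dtheta (x + l) = 1 * theta_res \<tau> dtheta x" if "l \<in> lattice \<tau>" "x \<in> lattice \<tau>" for x l
    using log_deriv_theta(1)[OF tau] lattice_add[OF that(2,1)] that by simp
  show "theta_reg \<tau> dtheta e (z + 1) = theta_reg \<tau> dtheta e z"
    using theta_reg_shift[OF tau log_deriv_theta(4)[OF tau] e lattice_1 res[OF lattice_1], of 0] log_deriv_theta(2)[OF tau] by simp
  show "theta_reg \<tau> dtheta e (z + \<tau>) = theta_reg \<tau> dtheta e z - 2 * of_real pi * \<i>"
    using theta_reg_shift[OF tau log_deriv_theta(4)[OF tau] e lattice_tau res[OF lattice_tau], of "- 2 * of_real pi * \<i>"] log_deriv_theta(3)[OF tau] by simp
qed

lemma theta_delta_continuous: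
  assumes E: "E holomorphic_on UNIV" and e: "0 < e" "e \<le> 1"
  shows "continuous_on UNIV (theta_delta \<tau> E e)"
proof -
  have "dzb (theta_reg \<tau> E e) = theta_delta \<tau> E e" using theta_reg_C1(2)[OF tau E e] by (rule ext)
  then show ?thesis using theta_reg_C1(1)[OF tau E e] by (metis C1c_def)
qed

lemma theta_delta_continuous':
  assumes E: "E holomorphic_on UNIV" and e: "0 < e" "e \<le> 1"
  shows "continuous_on UNIV (\<lambda>P. theta_delta \<tau> E e (Z P - c))"
  by (rule continuous_on_compose2[OF theta_delta_continuous[OF E e] _ subset_UNIV]) (intro continuous_intros Z_continuous)

text \<open>By Green's formula only the jump of the kernel under \<open>z \<mapsto> z + \<tau>\<close> contributes to the mass. This holds
  without knowing the sign of \<open>Jac\<close>, and in turn decides it.\<close>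

lemma theta_delta_mass:
  assumes e: "0 < e" "e \<le> 1"
  shows "(LINT P|sq. 2 * \<i> * of_real (Jac P) * theta_delta \<tau> dtheta e (Z P - c)) = 2 * of_real pi * \<i>"
proof -
  let ?k = "theta_reg \<tau> dtheta e"
  note k = theta_reg_C1[OF tau log_deriv_theta(4)[OF tau] e]
  note ks = C1c_shift[OF k(1), of c]
  have s: "?k (z + 1 - c) = ?k (z - c)" "?k (z + \<tau> - c) = ?k (z - c) + - (2 * of_real pi * \<i>)" for z
    using theta_reg_period[OF e, of "z - c"] by (simp_all add: algebra_simps)
  have "(LINT P|sq. b (tproj P) * pdx (\<lambda>P. ?k (Z P - c)) P - a (tproj P) * pdy (\<lambda>P. ?k (Z P - c)) P) = - (- (2 * of_real pi * \<i>))"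
  proof (rule green_torus)
    show "C1_on UNIV (\<lambda>P. ?k (Z P - c))" by (rule compose_Z(1)[OF ks(1)])
    show "?k (Z (1, y) - c) = ?k (Z (0, y) - c)" for y using Z_shift(1)[of 0 y] s(1)[of "Z (0, y)"] by simp
    show "?k (Z (x, 1) - c) = ?k (Z (x, 0) - c) + - (2 * of_real pi * \<i>)" for x using Z_shift(2)[of x 0] s(2)[of "Z (x, 0)"] by simp
  qed
  then show ?thesis unfolding compose_Z(2)[OF ks(1)] ks(2) k(2) by simp
qed

text \<open>\<open>theta_delta\<close> for the logarithmic derivative, whose residues are all 1; as
  a real nonnegative density it can dominate other integrands.\<close>

definition lattice_density :: "real \<Rightarrow> complex \<Rightarrow> real" where
  "lattice_density e z = (\<Sum>l\<in>lattice \<tau> \<inter> ball z e. delta_reg e (z - l))"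

lemma lattice_density_nonneg: "0 \<le> lattice_density e z" unfolding lattice_density_def by (intro sum_nonneg delta_reg_nonneg)

lemma theta_delta_eq_lattice_density: "theta_delta \<tau> dtheta e z = of_real (lattice_density e z)"
  unfolding theta_delta_def lattice_density_def using log_deriv_theta(1)[OF tau] by simp

lemma continuous_lattice_density:
  assumes e: "0 < e" "e \<le> 1" shows "continuous_on UNIV (\<lambda>P. lattice_density e (Z P - c))"
proof -
  have "lattice_density e z = Re (theta_delta \<tau> dtheta e z)" for z by (simp add: theta_delta_eq_lattice_density)
  then show ?thesis
    using theta_delta_continuous'[OF log_deriv_theta(4)[OF tau] e, of c] by (simp add: continuous_on_Re)
qed

lemma lattice_density_mass:
  assumes e: "0 < e" "e \<le> 1" shows "(LINT P|sq. Jac P * lattice_density e (Z P - c)) = pi"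
proof -
  have "2 * \<i> * of_real (LINT P|sq. Jac P * lattice_density e (Z P - c)) = (LINT P|sq. 2 * \<i> * of_real (Jac P) * theta_delta \<tau> dtheta e (Z P - c))"
    unfolding theta_delta_eq_lattice_density by (simp add: mult.assoc flip: of_real_mult)
  also have "\<dots> = 2 * \<i> * of_real pi" unfolding theta_delta_mass[OF e] by simp
  finally show ?thesis by (simp del: of_real_mult)
qed

text \<open>The Jacobian has one sign, the lattice density is nonnegative, and their product has
  integral pi > 0.\<close>

lemma Jac_nonneg: "0 \<le> Jac P"
proof (rule ccontr)
  assume "\<not> 0 \<le> Jac P"
  then have neg: "\<And>P. Jac P \<le> 0" using Jac_sign by blast
  have "(LINT P|sq. Jac P * lattice_density 1 (Z P - 0)) \<le> (LINT P|sq. 0)"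
  proof (rule integral_mono)
    show "integrable sq (\<lambda>P. Jac P * lattice_density 1 (Z P - 0))"
      by (intro sq_integrable_continuous continuous_on_mult Jac_continuous continuous_lattice_density) auto
    show "Jac P * lattice_density 1 (Z P - 0) \<le> 0" for P using neg lattice_density_nonneg by (rule mult_nonpos_nonneg)
  qed simp
  then show False unfolding lattice_density_mass[OF zero_less_one order_refl] using pi_gt_zero by simp
qed

text \<open>Here h0 stands for the value of \<open>H\<close> at the point where \<open>Z\<close>
  equals c. The mass formula rewrites 2 pi i h0 as an integral; in the difference each lattice point
  l near Z P - c contributes at most \<eta> times its bump, and twice the total mass pi of these
  bumps gives 2 pi \<eta>. The residue inside \<open>close\<close> admits an \<open>H\<close> that
  is only quasi-periodic.\<close>

lemma concentration:
  assumes E: "E holomorphic_on UNIV" and e: "0 < e" "e \<le> 1" and H: "continuous_on UNIV H" and \<eta>: "0 \<le> \<eta>"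
    and close: "\<And>P l. P \<in> unit_square \<Longrightarrow> l \<in> lattice \<tau> \<Longrightarrow> norm (Z P - c - l) < e \<Longrightarrow> norm (H P * theta_res \<tau> E l - h0) \<le> \<eta>"
  shows "norm ((LINT P|sq. H P * (2 * \<i> * of_real (Jac P) * theta_delta \<tau> E e (Z P - c))) - 2 * of_real pi * \<i> * h0) \<le> 2 * pi * \<eta>"
proof -
  let ?f = "\<lambda>P. H P * (2 * \<i> * of_real (Jac P) * theta_delta \<tau> E e (Z P - c))"
  let ?g = "\<lambda>P. h0 * (2 * \<i> * of_real (Jac P) * theta_delta \<tau> dtheta e (Z P - c))"
  have cJ: "continuous_on UNIV (\<lambda>P. complex_of_real (Jac P))" by (intro continuous_intros Jac_continuous)
  have i: "integrable sq ?f" "integrable sq ?g"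
    by (intro sq_integrable_continuous continuous_on_mult continuous_on_const cJ H theta_delta_continuous' E e log_deriv_theta(4)[OF tau])+
  have "(LINT P|sq. ?f P) - 2 * of_real pi * \<i> * h0 = (LINT P|sq. ?f P) - (LINT P|sq. ?g P)"
    using theta_delta_mass[OF e, of c] by simp
  then have eq: "(LINT P|sq. ?f P) - 2 * of_real pi * \<i> * h0 = (LINT P|sq. ?f P - ?g P)"
    unfolding Bochner_Integration.integral_diff[OF i] .
  have "norm (LINT P|sq. ?f P - ?g P) \<le> (LINT P|sq. 2 * \<eta> * (Jac P * lattice_density e (Z P - c)))"
  proof (rule Bochner_Integration.integral_norm_bound_integral)
    show "integrable sq (\<lambda>P. ?f P - ?g P)" using i by simp
    show "integrable sq (\<lambda>P. 2 * \<eta> * (Jac P * lattice_density e (Z P - c)))"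
      by (intro sq_integrable_continuous continuous_on_mult continuous_on_const Jac_continuous continuous_lattice_density e)
    fix P assume "P \<in> space sq"
    then have P: "P \<in> unit_square" by simp
    let ?z = "Z P - c"
    have "?f P - ?g P = 2 * \<i> * of_real (Jac P) * (H P * theta_delta \<tau> E e ?z - h0 * of_real (lattice_density e ?z))"
      unfolding theta_delta_eq_lattice_density by (simp add: algebra_simps)
    also have "H P * theta_delta \<tau> E e ?z - h0 * of_real (lattice_density e ?z) = (\<Sum>l\<in>lattice \<tau> \<inter> ball ?z e. (H P * theta_res \<tau> E l - h0) * of_real (delta_reg e (?z - l)))"
      unfolding theta_delta_def lattice_density_def by (simp add: sum_distrib_left left_diff_distrib sum_subtractf mult.assoc)
    finally have "norm (?f P - ?g P) = 2 * Jac P * norm (\<Sum>l\<in>lattice \<tau> \<inter> ball ?z e. (H P * theta_res \<tau> E l - h0) * of_real (delta_reg e (?z - l)))"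
      using Jac_nonneg[of P] by (simp add: norm_mult)
    also have "\<dots> \<le> 2 * Jac P * (\<Sum>l\<in>lattice \<tau> \<inter> ball ?z e. \<eta> * delta_reg e (?z - l))"
    proof (intro mult_left_mono sum_norm_le)
      fix l assume "l \<in> lattice \<tau> \<inter> ball ?z e"
      then have "norm (H P * theta_res \<tau> E l - h0) \<le> \<eta>" using close[OF P, of l] by (simp add: dist_norm)
      then show "norm ((H P * theta_res \<tau> E l - h0) * of_real (delta_reg e (?z - l))) \<le> \<eta> * delta_reg e (?z - l)"
        using delta_reg_nonneg[of e "?z - l"] by (simp add: norm_mult mult_right_mono)
    qed (use Jac_nonneg in auto)
    also have "\<dots> = 2 * \<eta> * (Jac P * lattice_density e ?z)" by (simp add: lattice_density_def sum_distrib_left mult_ac)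
    finally show "norm (?f P - ?g P) \<le> 2 * \<eta> * (Jac P * lattice_density e ?z)" .
  qed
  moreover have "(LINT P|sq. 2 * \<eta> * (Jac P * lattice_density e (Z P - c))) = 2 * pi * \<eta>" using lattice_density_mass[OF e, of c] by simp
  ultimately show ?thesis unfolding eq by linarith
qed

end

context similarity
begin

section \<open>Limits of the regularised potentials\<close>

definition en :: "nat \<Rightarrow> real" where "en n = 1 / real (Suc n)"

lemma en: "0 < en n" "en n \<le> 1" by (auto simp: en_def)

lemma en_lim: "en \<longlonglongrightarrow> 0"
  unfolding en_def by (rule LIMSEQ_Suc[OF lim_1_over_n])

text \<open>The C^1 stand-ins for \<open>w\<close>, and w(Z P) is the value of \<open>T_op\<close>
  at P. They have exactly the periods of \<open>w\<close>, so all functions built from them are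
  doubly periodic before the limit is taken.\<close>

definition v :: "nat \<Rightarrow> complex \<Rightarrow> complex" where
  "v n z = 1 / (2 * of_real pi * \<i>) * Vr (en n) z"

definition w :: "complex \<Rightarrow> complex" where
  "w z = 1 / (2 * of_real pi * \<i>) * V z"

definition A_integral :: complex where "A_integral = (LINT P|sq. Am P)"

lemma v_C1: "C1c (v n)" "dzb (v n) z = 1 / (2 * of_real pi * \<i>) * F.conv (theta_delta \<tau> dtheta (en n)) z"
proof -
  note k = theta_reg_C1[OF tau dtheta_holomorphic en]
  note c = F.conv_C1[OF k(1)]
  have W: "has_wirt (v n) (1 / (2 * of_real pi * \<i>) * dz (Vr (en n)) z) (1 / (2 * of_real pi * \<i>) * dzb (Vr (en n)) z) z" for z n
    unfolding v_def[abs_def] by (intro has_wirt_cmult C1c_has_wirt c)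
  show "C1c (v n)"
    using c(1)[of n] by (intro C1cI[OF W] continuous_intros) (auto simp: C1c_def)
  have "dzb (Kreg (en n)) = theta_delta \<tau> dtheta (en n)" using k(2) by (rule ext)
  then show "dzb (v n) z = 1 / (2 * of_real pi * \<i>) * F.conv (theta_delta \<tau> dtheta (en n)) z"
    using has_wirt_unique(2)[OF W] c(2) by simp
qed

lemma v_period: "v n (z + 1) = v n z" "v n (z + \<tau>) = v n z - A_integral"
proof -
  have s: "Kreg (en n) (z + 1 - x) = Kreg (en n) (z - x)" "Kreg (en n) (z + \<tau> - x) = Kreg (en n) (z - x) - 2 * of_real pi * \<i>" for x
    using theta_reg_period[OF en, of n "z - x"] by (simp_all add: algebra_simps)
  show "v n (z + 1) = v n z" unfolding v_def F.conv_def s ..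
  have "Vr (en n) (z + \<tau>) = Vr (en n) z - 2 * of_real pi * \<i> * A_integral"
    unfolding F.conv_def s A_integral_def left_diff_distrib
    using F.kernel_integrable[OF C1c_continuous[OF Kreg_C1[OF en, of n]], of z] Am_integrable
    by (subst Bochner_Integration.integral_diff) auto
  then show "v n (z + \<tau>) = v n z - A_integral" by (simp add: v_def right_diff_distrib)
qed

lemma v_near_w:
  assumes "e > 0" shows "\<exists>N. \<forall>n\<ge>N. \<forall>z. norm z \<le> M0 \<longrightarrow> norm (v n z - w z) < e"
proof -
  obtain K where K: "K \<ge> 0" "\<And>z e. norm z \<le> M0 \<Longrightarrow> 0 < e \<Longrightarrow> e \<le> 1 \<Longrightarrow> norm (Vr e z - V z) \<le> K * e powr hoelder_exp"
    using Vr_near_V by blast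
  have "(\<lambda>n. K * en n powr hoelder_exp) \<longlonglongrightarrow> K * 0 powr hoelder_exp"
    using hoelder_exp en by (intro tendsto_mult_left tendsto_powr' en_lim tendsto_const) (auto intro: always_eventually less_imp_le)
  then have "(\<lambda>n. K * en n powr hoelder_exp) \<longlonglongrightarrow> 0" by simp
  then have "eventually (\<lambda>n. K * en n powr hoelder_exp < e) sequentially" using assms by (rule order_tendstoD(2))
  then obtain N where N: "\<And>n. n \<ge> N \<Longrightarrow> K * en n powr hoelder_exp < e" by (auto simp: eventually_sequentially)
  have "norm (v n z - w z) < e" if "n \<ge> N" "norm z \<le> M0" for n z
  proof -
    have "norm (v n z - w z) = norm (Vr (en n) z - V z) / (2 * pi)"
      unfolding v_def w_def right_diff_distrib[symmetric] by (simp add: norm_mult norm_divide)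
    also have "\<dots> \<le> norm (Vr (en n) z - V z) / 1" using pi_gt3 by (intro divide_left_mono) auto
    also have "\<dots> < e" using K(2)[OF that(2) en, of n] N[OF that(1)] by simp
    finally show ?thesis .
  qed
  then show ?thesis by blast
qed

lemma v_tendsto_w: "(\<lambda>n. v n z) \<longlonglongrightarrow> w z"
  unfolding LIMSEQ_def dist_norm using v_near_w[of _ "norm z"] by blast

lemma w_period: "w (z + 1) = w z" "w (z + \<tau>) = w z - A_integral"
proof -
  show "w (z + 1) = w z" using v_tendsto_w[of "z + 1"] v_tendsto_w[of z] LIMSEQ_unique unfolding v_period by blast
  have "(\<lambda>n. v n z - A_integral) \<longlonglongrightarrow> w z - A_integral" by (intro tendsto_diff v_tendsto_w tendsto_const)
  then show "w (z + \<tau>) = w z - A_integral" using v_tendsto_w[of "z + \<tau>"] LIMSEQ_unique unfolding v_period by blast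
qed

lemma w_continuous: "continuous_on UNIV w"
proof -
  have "isCont V z" for z
  proof -
    obtain K L where KL: "K \<ge> 0" "L \<ge> 0" "\<And>z' z''. norm z' \<le> norm z + 1 \<Longrightarrow> norm z'' \<le> norm z + 1 \<Longrightarrow> norm (V z' - V z'') \<le> K * norm (z' - z'') powr hoelder_exp + L * norm (z' - z'')"
      using V_hoelder[of "norm z + 1"] by blast
    have "((\<lambda>z'. V z' - V z) \<longlongrightarrow> 0) (at z)"
    proof (rule Lim_null_comparison)
      have n0: "((\<lambda>z'. norm (z' - z)) \<longlongrightarrow> 0) (at z)"
        using tendsto_norm_zero[of "\<lambda>z'. z' - z"] by (simp add: LIM_zero tendsto_ident_at)
      have "((\<lambda>z'. K * norm (z' - z) powr hoelder_exp + L * norm (z' - z)) \<longlongrightarrow> K * 0 powr hoelder_exp + L * 0) (at z)"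
        using hoelder_exp by (intro tendsto_add tendsto_mult_left tendsto_powr' n0 tendsto_const) auto
      then show "((\<lambda>z'. K * norm (z' - z) powr hoelder_exp + L * norm (z' - z)) \<longlongrightarrow> 0) (at z)" by simp
      have "eventually (\<lambda>z'. z' \<in> ball z 1) (at z)" by (rule eventually_at_in_open') auto
      then show "\<forall>\<^sub>F z' in at z. norm (V z' - V z) \<le> K * norm (z' - z) powr hoelder_exp + L * norm (z' - z)"
      proof eventually_elim
        case (elim z')
        then have "norm z' \<le> norm z + 1" using norm_triangle_ineq2[of z' z] by (simp add: dist_norm norm_minus_commute)
        then show ?case using KL(3)[of z' z] by simp
      qed
    qed
    then show ?thesis unfolding isCont_def using LIM_zero_cancel by blast
  qed
  then have "continuous_on UNIV V" by (intro continuous_at_imp_continuous_on) auto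
  then show ?thesis unfolding w_def[abs_def] by (intro continuous_intros)
qed

definition sq_uconv :: "(nat \<Rightarrow> real \<times> real \<Rightarrow> complex) \<Rightarrow> (real \<times> real \<Rightarrow> complex) \<Rightarrow> bool" where
  "sq_uconv f f0 \<longleftrightarrow> (\<forall>e>0. \<exists>N. \<forall>n\<ge>N. \<forall>P\<in>unit_square. norm (f n P - f0 P) < e)"

lemma sq_uconv_mult:
  assumes f: "sq_uconv f f0" and g: "continuous_on UNIV g"
  shows "sq_uconv (\<lambda>n P. g P * f n P) (\<lambda>P. g P * f0 P)"
  unfolding sq_uconv_def
proof (intro allI impI)
  fix e :: real assume e: "e > 0"
  have "bounded (g ` unit_square)"
    unfolding unit_square_cbox by (intro compact_imp_bounded compact_continuous_image continuous_on_subset[OF g]) auto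
  then obtain B where B: "B > 0" "\<And>P. P \<in> unit_square \<Longrightarrow> norm (g P) \<le> B" by (auto simp: bounded_pos)
  obtain N where N: "\<And>n P. n \<ge> N \<Longrightarrow> P \<in> unit_square \<Longrightarrow> norm (f n P - f0 P) < e / B"
    using f e B(1) unfolding sq_uconv_def by (meson divide_pos_pos)
  have "norm (g P * f n P - g P * f0 P) < e" if "n \<ge> N" "P \<in> unit_square" for n P
  proof -
    have "norm (g P * f n P - g P * f0 P) = norm (g P) * norm (f n P - f0 P)"
      unfolding right_diff_distrib[symmetric] by (rule norm_mult)
    also have "\<dots> \<le> B * norm (f n P - f0 P)" by (intro mult_right_mono B that norm_ge_zero)
    also have "\<dots> < B * (e / B)" using N[OF that] B(1) by (intro mult_strict_left_mono)
    finally show ?thesis using B(1) by simp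
  qed
  then show "\<exists>N. \<forall>n\<ge>N. \<forall>P\<in>unit_square. norm (g P * f n P - g P * f0 P) < e" by blast
qed

lemma exp_v_uconv: "sq_uconv (\<lambda>n P. exp (c * v n (Z P))) (\<lambda>P. exp (c * w (Z P)))"
  unfolding sq_uconv_def
proof (intro allI impI)
  fix e :: real assume e: "e > 0"
  have "bounded (Z ` unit_square)" "bounded ((\<lambda>P. w (Z P)) ` unit_square)"
    unfolding unit_square_cbox
    by (intro compact_imp_bounded compact_continuous_image Z_continuous continuous_on_compose2[OF w_continuous Z_continuous]; simp)+
  then obtain B1 B2 where "\<forall>P\<in>unit_square. norm (Z P) \<le> B1" "\<forall>P\<in>unit_square. norm (w (Z P)) \<le> B2"
    by (auto simp: bounded_iff)
  then have B: "\<And>P. P \<in> unit_square \<Longrightarrow> norm (Z P) \<le> B1" "\<And>P. P \<in> unit_square \<Longrightarrow> norm (w (Z P)) \<le> B2" by auto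
  have ex: "C1c (\<lambda>z. exp (c * z))"
  proof (rule C1cI)
    show "has_wirt (\<lambda>z. exp (c * z)) (exp (c * z) * c) 0 z" for z
      by (rule has_wirt_holo) (auto intro!: derivative_eq_intros)
  qed (intro continuous_intros)+
  obtain L where L: "L \<ge> 0" "\<And>z z'. norm z \<le> B2 + 1 \<Longrightarrow> norm z' \<le> B2 + 1 \<Longrightarrow> norm (exp (c * z) - exp (c * z')) \<le> L * norm (z - z')"
    using C1c_lipschitz[OF ex] by blast
  obtain N where N: "\<And>n z. n \<ge> N \<Longrightarrow> norm z \<le> B1 \<Longrightarrow> norm (v n z - w z) < min 1 (e / (L + 1))"
    using v_near_w[of "min 1 (e / (L + 1))" B1] e L(1) by auto
  have "norm (exp (c * v n (Z P)) - exp (c * w (Z P))) < e" if "n \<ge> N" "P \<in> unit_square" for n P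
  proof -
    have d: "norm (v n (Z P) - w (Z P)) < 1" "norm (v n (Z P) - w (Z P)) < e / (L + 1)" using N[OF that(1) B(1)[OF that(2)]] by auto
    have "norm (v n (Z P)) \<le> B2 + 1" using d(1) B(2)[OF that(2)] norm_triangle_ineq2[of "v n (Z P)" "w (Z P)"] by linarith
    then have "norm (exp (c * v n (Z P)) - exp (c * w (Z P))) \<le> L * norm (v n (Z P) - w (Z P))"
      using B(2)[OF that(2)] by (intro L(2)) auto
    also have "\<dots> \<le> L * (e / (L + 1))" using d(2) L(1) by (intro mult_left_mono) auto
    also have "\<dots> < e" using e L(1) by (simp add: field_simps)
    finally show ?thesis .
  qed
  then show "\<exists>N. \<forall>n\<ge>N. \<forall>P\<in>unit_square. norm (exp (c * v n (Z P)) - exp (c * w (Z P))) < e" by blast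
qed

lemma sq_integrable_mult:
  fixes g h :: "real \<times> real \<Rightarrow> complex"
  assumes g: "integrable sq g" and h: "continuous_on UNIV h"
  shows "integrable sq (\<lambda>P. g P * h P)"
proof -
  have "bounded (h ` unit_square)"
    unfolding unit_square_cbox by (intro compact_imp_bounded compact_continuous_image continuous_on_subset[OF h]) auto
  then obtain b where b: "b > 0" "\<And>P. P \<in> unit_square \<Longrightarrow> norm (h P) \<le> b" by (auto simp: bounded_pos)
  show ?thesis
  proof (rule Bochner_Integration.integrable_bound[OF integrable_mult_right[OF g, of "of_real b"]])
    show "(\<lambda>P. g P * h P) \<in> borel_measurable sq"
      by (intro borel_measurable_times borel_measurable_integrable[OF g] sq_measurable_continuous h)
    show "AE P in sq. norm (g P * h P) \<le> norm (of_real b * g P)"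
    proof (intro AE_I2)
      fix P assume "P \<in> space sq"
      then have "norm (g P) * norm (h P) \<le> norm (g P) * b" using b by (intro mult_left_mono) auto
      then show "norm (g P * h P) \<le> norm (of_real b * g P)" using b(1) by (simp add: norm_mult mult.commute)
    qed
  qed
qed

lemma sq_uconv_integral:
  fixes g :: "real \<times> real \<Rightarrow> complex"
  assumes f: "sq_uconv f f0" and c: "\<And>n. continuous_on UNIV (f n)" "continuous_on UNIV f0" and g: "integrable sq g"
  shows "(\<lambda>n. LINT P|sq. g P * f n P) \<longlonglongrightarrow> (LINT P|sq. g P * f0 P)"
proof (rule LIMSEQ_I)
  fix e :: real assume e: "e > 0"
  define B where "B = (LINT P|sq. norm (g P))"
  have B: "B \<ge> 0" by (simp add: B_def)
  obtain N where N: "\<And>n P. n \<ge> N \<Longrightarrow> P \<in> unit_square \<Longrightarrow> norm (f n P - f0 P) < e / (B + 1)"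
    using f e B unfolding sq_uconv_def by (metis add_nonneg_pos divide_pos_pos zero_less_one)
  have "norm ((LINT P|sq. g P * f n P) - (LINT P|sq. g P * f0 P)) < e" if n: "n \<ge> N" for n
  proof -
    have "(LINT P|sq. g P * f n P) - (LINT P|sq. g P * f0 P) = (LINT P|sq. g P * f n P - g P * f0 P)"
      by (rule Bochner_Integration.integral_diff[symmetric]) (intro sq_integrable_mult g c)+
    also have "norm \<dots> \<le> (LINT P|sq. e / (B + 1) * norm (g P))"
    proof (rule Bochner_Integration.integral_norm_bound_integral)
      show "integrable sq (\<lambda>P. g P * f n P - g P * f0 P)" by (intro Bochner_Integration.integrable_diff sq_integrable_mult g c)
      show "integrable sq (\<lambda>P. e / (B + 1) * norm (g P))" by (intro integrable_mult_right integrable_norm g)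
      fix P assume "P \<in> space sq"
      then have "norm (f n P - f0 P) \<le> e / (B + 1)" using N[OF n, of P] by simp
      then have "norm (g P) * norm (f n P - f0 P) \<le> norm (g P) * (e / (B + 1))" by (rule mult_left_mono) simp
      then show "norm (g P * f n P - g P * f0 P) \<le> e / (B + 1) * norm (g P)"
        unfolding right_diff_distrib[symmetric] norm_mult by (simp add: mult.commute)
    qed
    also have "\<dots> = e / (B + 1) * B" by (simp add: B_def)
    also have "\<dots> < e" using e B by (simp add: field_simps)
    finally show ?thesis .
  qed
  then show "\<exists>N. \<forall>n\<ge>N. norm ((LINT P|sq. g P * f n P) - (LINT P|sq. g P * f0 P)) < e" by blast
qed

text \<open>All arguments of \<open>k\<close> lie in one disc, because \<open>Z\<close> is bounded
  on the square and \<open>Zs\<close> everywhere; hence the double integrand is dominated by a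
  constant times |Am s|.\<close>

lemma sq_fubini:
  fixes g k :: "_ \<Rightarrow> complex"
  assumes g: "continuous_on UNIV g" and k: "continuous_on UNIV k"
  shows "(LINT P|sq. g P * (LINT s|sq. k (Z P - Zs s) * Am s)) = (LINT s|sq. Am s * (LINT P|sq. g P * k (Z P - Zs s)))"
    and "integrable sq (\<lambda>s. Am s * (LINT P|sq. g P * k (Z P - Zs s)))"
proof -
  interpret S: finite_measure sq by (rule finite_measure_sq)
  interpret PS: pair_sigma_finite sq sq ..
  define f where "f = (\<lambda>P s. g P * k (Z P - Zs s) * Am s)"
  have bg: "bounded (g ` unit_square)"
    unfolding unit_square_cbox by (intro compact_imp_bounded compact_continuous_image continuous_on_subset[OF g]) auto
  have "bounded (Z ` unit_square)"
    unfolding unit_square_cbox by (intro compact_imp_bounded compact_continuous_image Z_continuous) auto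
  then obtain r1 where "\<forall>P\<in>unit_square. norm (Z P) \<le> r1" by (auto simp: bounded_iff)
  then have r1: "\<And>P. P \<in> unit_square \<Longrightarrow> norm (Z P) \<le> r1" by blast
  obtain r2 where r2: "\<And>s. norm (Zs s) \<le> r2" using Zs_bounded by (auto simp: bounded_iff)
  have "bounded (k ` cball 0 (r1 + r2))"
    by (intro compact_imp_bounded compact_continuous_image continuous_on_subset[OF k]) auto
  then obtain bk where "bk > 0" "\<forall>x\<in>cball 0 (r1 + r2). norm (k x) \<le> bk" by (auto simp: bounded_pos)
  then have bk: "bk > 0" "\<And>x. norm x \<le> r1 + r2 \<Longrightarrow> norm (k x) \<le> bk" by auto
  obtain b where b: "b > 0" "\<And>P. P \<in> unit_square \<Longrightarrow> norm (g P) \<le> b" using bg by (auto simp: bounded_pos)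
  have mg: "g \<in> borel_measurable sq" and mZ: "Z \<in> borel_measurable sq" by (intro sq_measurable_continuous g Z_continuous)+
  have mk: "k \<in> borel_measurable borel" by (rule borel_measurable_continuous_onI[OF k])
  have mf: "(\<lambda>(P, s). f P s) \<in> borel_measurable (sq \<Otimes>\<^sub>M sq)"
    unfolding f_def case_prod_unfold
    by (intro borel_measurable_times measurable_compose[OF measurable_fst mg] measurable_compose[OF measurable_snd Am_measurable]
        measurable_compose[OF _ mk] borel_measurable_diff measurable_compose[OF measurable_fst mZ] measurable_compose[OF measurable_snd Zs_measurable])
  have nb: "norm (f P s) \<le> b * bk * norm (Am s)" if P: "P \<in> unit_square" for P s
  proof -
    have "norm (Z P - Zs s) \<le> r1 + r2" using norm_triangle_ineq4[of "Z P" "Zs s"] r1[OF P] r2[of s] by linarith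
    then have "norm (g P) * norm (k (Z P - Zs s)) \<le> b * bk" using b bk P by (intro mult_mono) auto
    then show ?thesis unfolding f_def norm_mult by (rule mult_right_mono) simp
  qed
  have "integrable (sq \<Otimes>\<^sub>M sq) (\<lambda>(P, s). f P s)"
  proof (rule integrableI_bounded[OF mf])
    have "(\<integral>\<^sup>+x. ennreal (norm (case x of (P, s) \<Rightarrow> f P s)) \<partial>(sq \<Otimes>\<^sub>M sq)) = (\<integral>\<^sup>+P. \<integral>\<^sup>+s. ennreal (norm (f P s)) \<partial>sq \<partial>sq)"
      using S.nn_integral_fst[of "\<lambda>x. ennreal (norm (case x of (P, s) \<Rightarrow> f P s))" sq] mf by simp
    also have "\<dots> \<le> (\<integral>\<^sup>+P. \<integral>\<^sup>+s. ennreal (b * bk * norm (Am s)) \<partial>sq \<partial>sq)"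
      using nb by (intro nn_integral_mono ennreal_leI) auto
    also have "(\<integral>\<^sup>+s. ennreal (b * bk * norm (Am s)) \<partial>sq) = ennreal (LINT s|sq. b * bk * norm (Am s))"
      using b bk Am_integrable by (intro nn_integral_eq_integral) auto
    also have "(\<integral>\<^sup>+P. ennreal (LINT s|sq. b * bk * norm (Am s)) \<partial>sq) = ennreal (LINT s|sq. b * bk * norm (Am s)) * emeasure sq (space sq)"
      by (rule nn_integral_const)
    also have "\<dots> < \<infinity>" unfolding measure_sq by simp
    finally show "(\<integral>\<^sup>+x. ennreal (norm (case x of (P, s) \<Rightarrow> f P s)) \<partial>(sq \<Otimes>\<^sub>M sq)) < \<infinity>" .
  qed
  note int = this
  have 1: "(LINT P|sq. f P s) = Am s * (LINT P|sq. g P * k (Z P - Zs s))" for s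
    unfolding f_def by simp
  have 2: "(LINT s|sq. f P s) = g P * (LINT s|sq. k (Z P - Zs s) * Am s)" for P
    unfolding f_def mult.assoc by simp
  show "(LINT P|sq. g P * (LINT s|sq. k (Z P - Zs s) * Am s)) = (LINT s|sq. Am s * (LINT P|sq. g P * k (Z P - Zs s)))"
    using PS.Fubini_integral[OF int] unfolding 1 2 by (rule sym)
  show "integrable sq (\<lambda>s. Am s * (LINT P|sq. g P * k (Z P - Zs s)))"
    using PS.integrable_snd[OF int] unfolding 1 .
qed

end

section \<open>Solutions\<close>

context hypocomplex_form
begin

text \<open>The hypothesis \<open>qp\<close> says that the multiplier of \<open>H\<close> under a
  lattice translation is inverse to the residue of the kernel there. Near any translate of Q the
  product of \<open>H\<close> and the residue is therefore a value of \<open>H\<close> near Q, which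
  is what \<open>concentration\<close> requires.\<close>

lemma quasi_periodic_close:
  assumes H: "continuous_on UNIV H"
    and qp: "\<And>x y m n. H (x + of_int m, y + of_int n) * theta_res \<tau> E (of_int m + of_int n * \<tau>) = H (x, y)"
    and \<eta>: "0 < \<eta>"
  obtains d where "d > 0" "\<And>P Q l. Q \<in> unit_square \<Longrightarrow> l \<in> lattice \<tau> \<Longrightarrow> norm (Z P - Z Q - l) < d \<Longrightarrow> norm (H P * theta_res \<tau> E l - H Q) < \<eta>"
proof -
  \<comment> \<open>The box contains every point at distance less than 1 from the unit
    square.\<close>
  have "uniformly_continuous_on (cbox (-1, -1) (2, 2)) H"
    by (rule compact_uniformly_continuous[OF continuous_on_subset[OF H]]) auto
  then obtain \<delta> where \<delta>: "\<delta> > 0" "\<And>P Q. P \<in> cbox (-1, -1) (2, 2) \<Longrightarrow> Q \<in> cbox (-1, -1) (2, 2) \<Longrightarrow> dist P Q < \<delta> \<Longrightarrow> dist (H P) (H Q) < \<eta>"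
    using \<eta> unfolding uniformly_continuous_on_def by metis
  obtain d where d: "d > 0" "\<And>P Q. norm (Z P - Z Q) < d \<Longrightarrow> dist P Q < min \<delta> 1"
    using Z_inverse_close[of "min \<delta> 1"] \<delta>(1) by auto
  have "norm (H P * theta_res \<tau> E l - H Q) < \<eta>" if Q: "Q \<in> unit_square" and l: "l \<in> lattice \<tau>" and near: "norm (Z P - Z Q - l) < d" for P Q l
  proof -
    obtain m n :: int where mn: "l = of_int m + of_int n * \<tau>" "\<And>x y. Z (x + of_int m, y + of_int n) = Z (x, y) + l"
      by (rule lattice_eq_Z_shift[OF l]) blast
    define P' where "P' = (fst P - of_int m, snd P - of_int n)"
    have "Z P = Z P' + l" using mn(2)[of "fst P'" "snd P'"] by (simp add: P'_def)
    then have "dist P' Q < min \<delta> 1" using near by (intro d(2)) (simp add: algebra_simps)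
    then have dd: "dist P' Q < \<delta>" "dist P' Q < 1" by auto
    have "\<bar>fst P' - fst Q\<bar> < 1" "\<bar>snd P' - snd Q\<bar> < 1"
      using dd(2) dist_fst_le[of P' Q] dist_snd_le[of P' Q] by (auto simp: dist_real_def)
    moreover have "0 \<le> fst Q" "fst Q \<le> 1" "0 \<le> snd Q" "snd Q \<le> 1" using Q by (auto simp: unit_square_def)
    ultimately have "P' \<in> cbox (-1, -1) (2, 2)" "Q \<in> cbox (-1, -1) (2, 2)"
      unfolding cbox_Pair_eq mem_Times_iff by auto
    then have "dist (H P') (H Q) < \<eta>" using dd(1) by (rule \<delta>(2))
    moreover have "H P * theta_res \<tau> E l = H P'" using qp[of "fst P'" m "snd P'" n] mn(1) by (simp add: P'_def)
    ultimately show ?thesis by (simp add: dist_norm)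
  qed
  then show thesis using that d(1) by blast
qed

lemma theta_res_dtheta: "theta_res \<tau> dtheta (of_int m + of_int n * \<tau>) = 1"
  by (rule log_deriv_theta(1)[OF tau latticeI])

lemma Z_lipschitz: obtains L where "L \<ge> 0" "\<And>P Q. norm (Z P - Z Q) \<le> L * dist P Q"
proof -
  obtain B1 where B1: "B1 > 0" "\<And>P. norm (ap P) \<le> B1"
    using per2_bounded[OF coeff_continuous(1) tproj_per2[unfolded o_def]] by blast
  obtain B2 where B2: "B2 > 0" "\<And>P. norm (bp P) \<le> B2"
    using per2_bounded[OF coeff_continuous(2) tproj_per2[unfolded o_def]] by blast
  have "norm (Z P - Z Q) \<le> (B1 + B2) * norm (P - Q)" for P Q
  proof (rule differentiable_bound[where S = UNIV])
    fix X
    show "(Z has_derivative (\<lambda>h. fst h *\<^sub>R ap X + snd h *\<^sub>R bp X)) (at X within UNIV)" by (rule Z_has_derivative)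
    show "onorm (\<lambda>h. fst h *\<^sub>R ap X + snd h *\<^sub>R bp X) \<le> B1 + B2"
    proof (rule onorm_bound)
      fix h :: "real \<times> real"
      have nh: "norm (fst h) \<le> norm h" "norm (snd h) \<le> norm h"
        using norm_fst_le[of "fst h" "snd h"] norm_snd_le[of "snd h" "fst h"] by simp_all
      have "norm (fst h *\<^sub>R ap X + snd h *\<^sub>R bp X) \<le> norm (fst h) * norm (ap X) + norm (snd h) * norm (bp X)"
        by (rule norm_triangle_le) simp
      also have "\<dots> \<le> norm h * B1 + norm h * B2"
        by (intro add_mono mult_mono B1 B2 nh) auto
      finally show "norm (fst h *\<^sub>R ap X + snd h *\<^sub>R bp X) \<le> (B1 + B2) * norm h" by (simp add: algebra_simps)
    qed (use B1 B2 in auto)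
  qed auto
  then show thesis using that[of "B1 + B2"] B1(1) B2(1) by (auto simp: dist_norm)
qed

end

context similarity
begin

text \<open>In the limit L(v n o Z) becomes A, although \<open>w\<close> has no derivatives. The
  conjugate derivative of \<open>v n\<close> is a convolution of A with approximate identities;
  Fubini moves them onto \<Phi>, where \<open>concentration\<close> evaluates them.\<close>

lemma weak_limit:
  assumes c: "\<And>n. continuous_on UNIV (\<Phi> n)" "continuous_on UNIV \<Phi>0" and per: "per2 \<Phi>0" and conv: "sq_uconv \<Phi> \<Phi>0"
  shows "(\<lambda>n. LINT P|sq. \<Phi> n P * (2 * \<i> * of_real (Jac P) * dzb (v n) (Z P))) \<longlonglongrightarrow> (LINT P|sq. Am P * \<Phi>0 P)"
proof (rule LIMSEQ_I)
  fix r :: real assume r: "r > 0"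
  define B where "B = (LINT P|sq. norm (Am P))"
  have B: "B \<ge> 0" by (simp add: B_def)
  define \<eta> where "\<eta> = r / (2 * (B + 1))"
  have \<eta>: "\<eta> > 0" using r B by (simp add: \<eta>_def)
  obtain d where d: "d > 0" "\<And>P Q l. Q \<in> unit_square \<Longrightarrow> l \<in> lattice \<tau> \<Longrightarrow> norm (Z P - Z Q - l) < d \<Longrightarrow> norm (\<Phi>0 P * theta_res \<tau> dtheta l - \<Phi>0 Q) < \<eta>"
  proof (rule quasi_periodic_close[OF c(2) _ \<eta>])
    show "\<Phi>0 (x + of_int m, y + of_int n) * theta_res \<tau> dtheta (of_int m + of_int n * \<tau>) = \<Phi>0 (x, y)" for x y m n
      unfolding theta_res_dtheta using per2_int[OF per] by simp
  qed blast
  obtain N1 where N1: "\<And>n. n \<ge> N1 \<Longrightarrow> en n < d"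
    using order_tendstoD(2)[OF en_lim d(1)] by (auto simp: eventually_sequentially)
  obtain N2 where N2: "\<And>n P. n \<ge> N2 \<Longrightarrow> P \<in> unit_square \<Longrightarrow> norm (\<Phi> n P - \<Phi>0 P) < \<eta>"
    using conv \<eta> unfolding sq_uconv_def by blast
  have "norm ((LINT P|sq. \<Phi> n P * (2 * \<i> * of_real (Jac P) * dzb (v n) (Z P))) - (LINT P|sq. Am P * \<Phi>0 P)) < r"
    if n: "n \<ge> max N1 N2" for n
  proof -
    let ?\<delta> = "theta_delta \<tau> dtheta (en n)"
    \<comment> \<open>The average of \<open>\<Phi> n\<close> around the point s. The factor
      \<open>Jac / pi\<close> is 2i \<open>Jac\<close> from \<open>compose_Z\<close> times 1/(2 pi
      i) from the definition of \<open>v\<close>.\<close>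
    define J where "J s = (LINT P|sq. (\<Phi> n P * of_real (Jac P) / of_real pi) * ?\<delta> (Z P - Zs s))" for s
    have cg: "continuous_on UNIV (\<lambda>P. \<Phi> n P * of_real (Jac P) / of_real pi)"
      by (intro continuous_intros c Jac_continuous) auto
    note fub = sq_fubini[OF cg theta_delta_continuous[OF dtheta_holomorphic en, of n], folded J_def]
    have *: "\<Phi> n P * (2 * \<i> * of_real (Jac P) * dzb (v n) (Z P)) = (\<Phi> n P * of_real (Jac P) / of_real pi) * (LINT s|sq. ?\<delta> (Z P - Zs s) * Am s)" for P
      unfolding v_C1(2) F.conv_def by simp
    have eq: "(LINT P|sq. \<Phi> n P * (2 * \<i> * of_real (Jac P) * dzb (v n) (Z P))) = (LINT s|sq. Am s * J s)"
      unfolding * by (rule fub(1))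
    have J: "norm (J s - \<Phi>0 s) \<le> 2 * \<eta>" if s: "s \<in> unit_square" for s
    proof -
      have "norm ((LINT P|sq. \<Phi> n P * (2 * \<i> * of_real (Jac P) * ?\<delta> (Z P - Z s))) - 2 * of_real pi * \<i> * \<Phi>0 s) \<le> 2 * pi * (2 * \<eta>)"
      proof (rule concentration[OF dtheta_holomorphic en c(1)])
        fix P l assume P: "P \<in> unit_square" and l: "l \<in> lattice \<tau>" and near: "norm (Z P - Z s - l) < en n"
        have "en n < d" using N1 n by simp
        then have "norm (\<Phi>0 P * theta_res \<tau> dtheta l - \<Phi>0 s) < \<eta>" using near by (intro d(2)[OF s l]) simp
        moreover have "theta_res \<tau> dtheta l = 1" by (rule log_deriv_theta(1)[OF tau l])
        moreover have "norm (\<Phi> n P - \<Phi>0 P) < \<eta>" using N2 n P by simp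
        ultimately show "norm (\<Phi> n P * theta_res \<tau> dtheta l - \<Phi>0 s) \<le> 2 * \<eta>"
          using norm_triangle_ineq[of "\<Phi> n P - \<Phi>0 P" "\<Phi>0 P - \<Phi>0 s"] by simp
      qed (use \<eta> in simp)
      moreover have "(LINT P|sq. \<Phi> n P * (2 * \<i> * of_real (Jac P) * ?\<delta> (Z P - Z s))) = 2 * of_real pi * \<i> * J s"
      proof -
        have "\<Phi> n P * (2 * \<i> * of_real (Jac P) * ?\<delta> (Z P - Z s)) = 2 * of_real pi * \<i> * (\<Phi> n P * of_real (Jac P) / of_real pi * ?\<delta> (Z P - Zs s))" for P
          using s by (simp add: Zs_eq)
        then show ?thesis unfolding J_def by (simp only: integral_mult_right_zero)
      qed
      ultimately have "norm (2 * of_real pi * \<i> * (J s - \<Phi>0 s)) \<le> 2 * pi * (2 * \<eta>)" by (simp only: right_diff_distrib)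
      then show ?thesis by (simp add: norm_mult)
    qed
    have i: "integrable sq (\<lambda>s. Am s * J s)" "integrable sq (\<lambda>s. Am s * \<Phi>0 s)"
      using fub(2) sq_integrable_mult[OF Am_integrable c(2)] by auto
    have "norm (LINT s|sq. Am s * J s - Am s * \<Phi>0 s) \<le> (LINT s|sq. 2 * \<eta> * norm (Am s))"
    proof (rule Bochner_Integration.integral_norm_bound_integral)
      show "integrable sq (\<lambda>s. Am s * J s - Am s * \<Phi>0 s)" using i by (rule Bochner_Integration.integrable_diff)
      show "integrable sq (\<lambda>s. 2 * \<eta> * norm (Am s))" using Am_integrable by simp
      fix s assume "s \<in> space sq"
      then have "norm (Am s) * norm (J s - \<Phi>0 s) \<le> norm (Am s) * (2 * \<eta>)" by (intro mult_left_mono J) auto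
      then show "norm (Am s * J s - Am s * \<Phi>0 s) \<le> 2 * \<eta> * norm (Am s)"
        unfolding right_diff_distrib[symmetric] norm_mult by (simp add: mult.commute)
    qed
    moreover have "(LINT s|sq. 2 * \<eta> * norm (Am s)) = 2 * \<eta> * B" by (simp add: B_def)
    moreover have "2 * \<eta> * B < r" using r B by (simp add: \<eta>_def field_simps)
    ultimately show ?thesis unfolding eq Bochner_Integration.integral_diff[OF i] by linarith
  qed
  then show "\<exists>N. \<forall>n\<ge>N. norm ((LINT P|sq. \<Phi> n P * (2 * \<i> * of_real (Jac P) * dzb (v n) (Z P))) - (LINT P|sq. Am P * \<Phi>0 P)) < r" by blast
qed

lemma C1c_exp_v: "C1c (\<lambda>z. exp (c * v n z))" "dzb (\<lambda>z. exp (c * v n z)) z = c * exp (c * v n z) * dzb (v n) z"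
proof -
  have W: "has_wirt (\<lambda>z. exp (c * v n z)) (exp (c * v n z) * (c * dz (v n) z)) (exp (c * v n z) * (c * dzb (v n) z)) z" for z
    by (rule has_wirt_compose_holo[OF has_wirt_cmult[OF C1c_has_wirt[OF v_C1(1)]]]) (rule DERIV_exp)
  show "C1c (\<lambda>z. exp (c * v n z))"
    by (rule C1cI[OF W]; intro continuous_intros C1cD v_C1(1) C1c_continuous)
  show "dzb (\<lambda>z. exp (c * v n z)) z = c * exp (c * v n z) * dzb (v n) z"
    using has_wirt_unique(2)[OF W] by simp
qed

text \<open>Testing the equation with \<open>exp (- v n) \<psi>\<close> turns \<open>exp (- w) u\<close> into a weak null solution of the
  adjoint equation; the conditions on \<open>\<psi>\<close> make the test functions doubly periodic.\<close>

lemma weak_solution_test: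
  assumes ws: "weak_solution a b u (\<lambda>p. A p * u p)" and u: "continuous_on UNIV (\<lambda>P. u (tproj P))"
    and \<psi>: "C1c \<psi>" "\<And>z. \<psi> (z + 1) = \<psi> z" "\<And>z. \<psi> (z + \<tau>) = exp (- A_integral) * \<psi> z"
  shows "(LINT P|sq. (u (tproj P) * (2 * \<i> * of_real (Jac P) * dzb \<psi> (Z P))) * exp (- w (Z P))) = 0"
proof -
  define \<Phi> where "\<Phi> n P = u (tproj P) * \<psi> (Z P) * exp (- v n (Z P))" for n P
  define \<Phi>0 where "\<Phi>0 P = u (tproj P) * \<psi> (Z P) * exp (- w (Z P))" for P
  have c\<psi>: "continuous_on UNIV (\<lambda>P. \<psi> (Z P))" "continuous_on UNIV (\<lambda>P. dzb \<psi> (Z P))"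
    by (intro continuous_compose_Z C1c_continuous C1cD \<psi>)+
  have cv: "continuous_on UNIV (\<lambda>P. v n (Z P))" "continuous_on UNIV (\<lambda>P. dzb (v n) (Z P))" "continuous_on UNIV (\<lambda>P. w (Z P))" for n
    by (intro continuous_compose_Z C1c_continuous C1cD v_C1 w_continuous)+
  have c\<Phi>: "continuous_on UNIV (\<Phi> n)" "continuous_on UNIV \<Phi>0" for n
    unfolding \<Phi>_def[abs_def] \<Phi>0_def[abs_def] by (intro continuous_intros c\<psi> cv u)+
  have uc: "sq_uconv (\<lambda>n P. exp (- v n (Z P))) (\<lambda>P. exp (- w (Z P)))"
    using exp_v_uconv[of "- 1"] by simp
  have conv: "sq_uconv \<Phi> \<Phi>0"
    unfolding \<Phi>_def[abs_def] \<Phi>0_def[abs_def] by (intro sq_uconv_mult uc continuous_intros c\<psi> u)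
  have upx: "u (tproj (x + 1, y)) = u (tproj (x, y))" "u (tproj (x, y + 1)) = u (tproj (x, y))" for x y
    using tproj_per2[of u] by (simp_all add: per2_def)
  have e: "exp (- (z - A_integral)) = exp A_integral * exp (- z)" "exp A_integral * exp (- A_integral) = 1" for z :: complex
    by (simp_all add: mult_exp_exp)
  have per: "per2 \<Phi>0"
    unfolding per2_def \<Phi>0_def Z_shift w_period \<psi>(2,3) upx e(1) using e(2) by (simp add: mult_ac)
  define J where "J n = (LINT P|sq. (u (tproj P) * (2 * \<i> * of_real (Jac P) * dzb \<psi> (Z P))) * exp (- v n (Z P)))" for n
  have eq: "(LINT P|sq. \<Phi> n P * (2 * \<i> * of_real (Jac P) * dzb (v n) (Z P))) - J n = (LINT P|sq. Am P * \<Phi> n P)" for n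
  proof -
    define X where "X = (\<lambda>z. exp (- 1 * v n z) * \<psi> z)"
    note X = C1c_mult[OF C1c_exp_v(1)[of "- 1" n] \<psi>(1), folded X_def]
    have dX: "dzb X z = exp (- v n z) * dzb \<psi> z - exp (- v n z) * dzb (v n) z * \<psi> z" for z
      unfolding X(2) C1c_exp_v(2) by simp
    have perX: "per2 (\<lambda>P. X (Z P))"
      unfolding per2_def X_def mult_minus1 Z_shift v_period \<psi>(2,3) e(1) using e(2) by (simp add: mult_ac)
    have "- (LINT P|sq. u (tproj P) * (b (tproj P) * pdx (\<lambda>P. X (Z P)) P - a (tproj P) * pdy (\<lambda>P. X (Z P)) P))
      = (LINT P|sq. A (tproj P) * u (tproj P) * X (Z P))"
    proof (rule weak_solution_C1[OF ws])
      show "integrable sq ((\<lambda>p. A p * u p) \<circ> tproj)"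
        unfolding o_def by (rule sq_integrable_mult[OF Am_integrable u])
    qed (use u coeff_continuous compose_Z(1)[OF X(1)] perX in \<open>auto simp: o_def\<close>)
    moreover have "u (tproj P) * (b (tproj P) * pdx (\<lambda>P. X (Z P)) P - a (tproj P) * pdy (\<lambda>P. X (Z P)) P)
      = (u (tproj P) * (2 * \<i> * of_real (Jac P) * dzb \<psi> (Z P))) * exp (- v n (Z P)) - \<Phi> n P * (2 * \<i> * of_real (Jac P) * dzb (v n) (Z P))" for P
      unfolding compose_Z(2)[OF X(1)] dX \<Phi>_def by (simp add: algebra_simps)
    moreover have "A (tproj P) * u (tproj P) * X (Z P) = Am P * \<Phi> n P" for P
      by (simp add: X_def \<Phi>_def)
    moreover have "(LINT P|sq. (u (tproj P) * (2 * \<i> * of_real (Jac P) * dzb \<psi> (Z P))) * exp (- v n (Z P)) - \<Phi> n P * (2 * \<i> * of_real (Jac P) * dzb (v n) (Z P)))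
      = J n - (LINT P|sq. \<Phi> n P * (2 * \<i> * of_real (Jac P) * dzb (v n) (Z P)))"
      unfolding J_def
      by (intro Bochner_Integration.integral_diff sq_integrable_continuous continuous_intros u c\<psi> cv c\<Phi> Jac_continuous)
    ultimately show ?thesis by simp
  qed
  \<comment> \<open>Both integrals tend to the same limit: one through \<open>weak_limit\<close>,
    the other through uniform convergence. So the terms with A cancel and the term with the
    derivative of \<psi> remains.\<close>
  have "(\<lambda>n. (LINT P|sq. \<Phi> n P * (2 * \<i> * of_real (Jac P) * dzb (v n) (Z P))) - (LINT P|sq. Am P * \<Phi> n P)) \<longlonglongrightarrow> (LINT P|sq. Am P * \<Phi>0 P) - (LINT P|sq. Am P * \<Phi>0 P)"
    by (intro tendsto_diff weak_limit sq_uconv_integral c\<Phi> per conv Am_integrable)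
  moreover have "(LINT P|sq. \<Phi> n P * (2 * \<i> * of_real (Jac P) * dzb (v n) (Z P))) - (LINT P|sq. Am P * \<Phi> n P) = J n" for n
    using eq[of n] by (simp add: algebra_simps)
  ultimately have "J \<longlonglongrightarrow> 0" by simp
  moreover have "J \<longlonglongrightarrow> (LINT P|sq. (u (tproj P) * (2 * \<i> * of_real (Jac P) * dzb \<psi> (Z P))) * exp (- w (Z P)))"
    unfolding J_def[abs_def]
    by (intro sq_uconv_integral uc sq_integrable_continuous continuous_intros u c\<psi> cv Jac_continuous)
  ultimately show ?thesis using LIMSEQ_unique by blast
qed

section \<open>Existence of a solution and its regularity\<close>

definition twist :: "int \<Rightarrow> complex \<Rightarrow> complex" where
  "twist k z = exp (2 * of_real pi * \<i> * of_int k * z)"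

lemma twist_holomorphic: "twist k holomorphic_on UNIV"
  unfolding twist_def[abs_def] by (intro holomorphic_intros)

lemma twist_period:
  assumes nu: "- A_integral = 2 * of_real pi * \<i> * (of_int j + of_int k * \<tau>)"
  shows "twist k (z + 1) = twist k z" "twist k (z + \<tau>) = exp (- A_integral) * twist k z"
proof -
  show "twist k (z + 1) = twist k z"
    unfolding twist_def distrib_left exp_add using exp_2pi_int[of k] by simp
  have "exp (- A_integral) = exp (2 * of_real pi * \<i> * of_int j) * exp (2 * of_real pi * \<i> * of_int k * \<tau>)"
    unfolding nu exp_add[symmetric] by (simp add: algebra_simps)
  then show "twist k (z + \<tau>) = exp (- A_integral) * twist k z"
    unfolding twist_def distrib_left exp_add exp_2pi_int by simp
qed

lemma twist_minus: "twist (- k) z = 1 / twist k z"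
  unfolding twist_def by (simp add: exp_minus inverse_eq_divide)

lemma twist_nonzero: "twist k z \<noteq> 0" by (simp add: twist_def)

text \<open>The nontrivial solution exp(w - 2 pi i k z) as a function of z. Under translation by
  \<tau> both exp w and \<open>twist k\<close> are multiplied by \<open>exp (- A_integral)\<close>,
  so their quotient is doubly periodic.\<close>

abbreviation "S k z \<equiv> exp (w z) * twist (- k) z"

lemma S_period:
  assumes nu: "- A_integral = 2 * of_real pi * \<i> * (of_int j + of_int k * \<tau>)"
  shows "S k (z + 1) = S k z" "S k (z + \<tau>) = S k z"
    "exp (v n (z + 1)) * twist (- k) (z + 1) = exp (v n z) * twist (- k) z" "exp (v n (z + \<tau>)) * twist (- k) (z + \<tau>) = exp (v n z) * twist (- k) z"
proof -
  have e: "exp (x - A_integral) * (1 / (exp (- A_integral) * y)) = exp x * (1 / y)" for x y :: complex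
    by (simp add: exp_diff exp_minus)
  show "S k (z + 1) = S k z" "S k (z + \<tau>) = S k z"
    "exp (v n (z + 1)) * twist (- k) (z + 1) = exp (v n z) * twist (- k) z" "exp (v n (z + \<tau>)) * twist (- k) (z + \<tau>) = exp (v n z) * twist (- k) z"
    unfolding w_period v_period twist_minus twist_period[OF nu] by (rule refl e)+
qed

text \<open>With \<open>v n\<close> in place of \<open>w\<close> the function is C^1 and already
  doubly periodic, so Green's formula holds without a jump; \<open>weak_limit\<close> identifies the
  limit of the term containing the conjugate derivative.\<close>

lemma S_weak_solution:
  assumes nu: "- A_integral = 2 * of_real pi * \<i> * (of_int j + of_int k * \<tau>)"
    and uS: "\<And>P. u (tproj P) = S k (Z P)"
  shows "weak_solution a b u (\<lambda>p. A p * u p)"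
  unfolding weak_solution_def
proof (intro allI impI)
  fix \<phi> assume sm: "smooth_plane (\<phi> \<circ> tproj)"
  define f where "f = \<phi> \<circ> tproj"
  have f: "C1_on UNIV f" using smooth_plane_C1[OF sm] by (simp add: f_def)
  note fc = C1_on_UNIV_D(2-4)[OF f]
  have fp: "per2 f" unfolding f_def by (rule tproj_per2)
  define L where "L P = b (tproj P) * pdx f P - a (tproj P) * pdy f P" for P
  have Lc: "continuous_on UNIV L" unfolding L_def[abs_def] by (intro continuous_intros fc coeff_continuous)
  have ck: "continuous_on UNIV (\<lambda>P. twist (- k) (Z P))"
    by (intro continuous_compose_Z holomorphic_on_imp_continuous_on twist_holomorphic)
  have cv: "continuous_on UNIV (\<lambda>P. v n (Z P))" "continuous_on UNIV (\<lambda>P. dzb (v n) (Z P))" "continuous_on UNIV (\<lambda>P. w (Z P))" for n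
    by (intro continuous_compose_Z C1c_continuous C1cD v_C1 w_continuous)+
  have uc: "sq_uconv (\<lambda>n P. exp (v n (Z P))) (\<lambda>P. exp (w (Z P)))"
    using exp_v_uconv[of 1] by simp
  define \<Phi> where "\<Phi> n P = f P * twist (- k) (Z P) * exp (v n (Z P))" for n P
  define \<Phi>0 where "\<Phi>0 P = f P * twist (- k) (Z P) * exp (w (Z P))" for P
  have c\<Phi>: "continuous_on UNIV (\<Phi> n)" "continuous_on UNIV \<Phi>0" for n
    unfolding \<Phi>_def[abs_def] \<Phi>0_def[abs_def] by (intro continuous_intros ck cv fc)+
  have conv: "sq_uconv \<Phi> \<Phi>0"
    unfolding \<Phi>_def[abs_def] \<Phi>0_def[abs_def] by (intro sq_uconv_mult uc continuous_intros ck fc)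
  have \<Phi>0S: "\<Phi>0 P = f P * S k (Z P)" for P by (simp add: \<Phi>0_def)
  have "per2 (\<lambda>P. S k (Z P))" unfolding per2_def Z_shift S_period[OF nu] by simp
  then have per: "per2 \<Phi>0" unfolding \<Phi>0S[abs_def] by (rule per2_mult[OF fp])
  \<comment> \<open>Green's formula with \<beta> = 0 for the product of the regularised solution and
    the test function.\<close>
  have eq: "(LINT P|sq. \<Phi> n P * (2 * \<i> * of_real (Jac P) * dzb (v n) (Z P))) + (LINT P|sq. L P * twist (- k) (Z P) * exp (v n (Z P))) = 0" for n
  proof -
    define X where "X = (\<lambda>z. exp (1 * v n z) * twist (- k) z)"
    note X = C1c_mult[OF C1c_exp_v(1)[of 1 n] C1c_holomorphic(1)[OF twist_holomorphic[of "- k"]], folded X_def]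
    have dX: "dzb X z = X z * dzb (v n) z" for z
      unfolding X(2) C1c_exp_v(2) C1c_holomorphic(2)[OF twist_holomorphic] by (simp add: X_def)
    have X1: "X (z + 1) = X z" "X (z + \<tau>) = X z" for z unfolding X_def using S_period(3,4)[OF nu] by simp_all
    note g = C1_on_mult[OF compose_Z(1)[OF X(1)] f]
    have fp': "f (1, y) = f (0, y)" "f (x, 1) = f (x, 0)" for x y
      using fp unfolding per2_def by (metis add_0)+
    have "(LINT P|sq. b (tproj P) * pdx (\<lambda>P. X (Z P) * f P) P - a (tproj P) * pdy (\<lambda>P. X (Z P) * f P) P) = - 0"
    proof (rule green_torus[OF g(1)])
      show "X (Z (1, y)) * f (1, y) = X (Z (0, y)) * f (0, y)" for y using Z_shift(1)[of 0 y] X1(1)[of "Z (0, y)"] fp'(1)[of y] by simp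
      show "X (Z (x, 1)) * f (x, 1) = X (Z (x, 0)) * f (x, 0) + 0" for x using Z_shift(2)[of x 0] X1(2)[of "Z (x, 0)"] fp'(2)[of x] by simp
    qed
    moreover have "b (tproj P) * pdx (\<lambda>P. X (Z P) * f P) P - a (tproj P) * pdy (\<lambda>P. X (Z P) * f P) P
      = \<Phi> n P * (2 * \<i> * of_real (Jac P) * dzb (v n) (Z P)) + L P * twist (- k) (Z P) * exp (v n (Z P))" for P
    proof -
      have "b (tproj P) * pdx (\<lambda>P. X (Z P) * f P) P - a (tproj P) * pdy (\<lambda>P. X (Z P) * f P) P
        = (b (tproj P) * pdx (\<lambda>P. X (Z P)) P - a (tproj P) * pdy (\<lambda>P. X (Z P)) P) * f P + X (Z P) * L P"
        unfolding g(2,3) L_def by (simp add: algebra_simps)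
      also have "\<dots> = 2 * \<i> * of_real (Jac P) * (X (Z P) * dzb (v n) (Z P)) * f P + X (Z P) * L P"
        unfolding compose_Z(2)[OF X(1)] dX ..
      finally show ?thesis by (simp add: X_def \<Phi>_def algebra_simps)
    qed
    moreover have "(LINT P|sq. \<Phi> n P * (2 * \<i> * of_real (Jac P) * dzb (v n) (Z P)) + L P * twist (- k) (Z P) * exp (v n (Z P)))
      = (LINT P|sq. \<Phi> n P * (2 * \<i> * of_real (Jac P) * dzb (v n) (Z P))) + (LINT P|sq. L P * twist (- k) (Z P) * exp (v n (Z P)))"
      by (intro Bochner_Integration.integral_add sq_integrable_continuous continuous_intros Lc ck cv c\<Phi> Jac_continuous)
    ultimately show ?thesis by simp
  qed
  have "(\<lambda>n. (LINT P|sq. \<Phi> n P * (2 * \<i> * of_real (Jac P) * dzb (v n) (Z P))) + (LINT P|sq. L P * twist (- k) (Z P) * exp (v n (Z P)))) \<longlonglongrightarrow> (LINT P|sq. Am P * \<Phi>0 P) + (LINT P|sq. L P * twist (- k) (Z P) * exp (w (Z P)))"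
    by (intro tendsto_add weak_limit sq_uconv_integral c\<Phi> per conv uc sq_integrable_continuous continuous_intros Lc ck cv)
  then have "(LINT P|sq. Am P * \<Phi>0 P) + (LINT P|sq. L P * twist (- k) (Z P) * exp (w (Z P))) = 0"
    unfolding eq by (simp add: LIMSEQ_const_iff)
  moreover have "(LINT P|sq. L P * twist (- k) (Z P) * exp (w (Z P))) = (LINT P|sq. u (tproj P) * L P)"
    by (rule Bochner_Integration.integral_cong) (simp_all add: uS)
  moreover have "(LINT P|sq. Am P * \<Phi>0 P) = torus_integral (\<lambda>p. A p * u p * \<phi> p)"
    unfolding torus_integral_def by (rule Bochner_Integration.integral_cong) (simp_all add: uS \<Phi>0S f_def)
  ultimately have "- (LINT P|sq. u (tproj P) * L P) = torus_integral (\<lambda>p. A p * u p * \<phi> p)"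
    unfolding neg_eq_iff_add_eq_0 by (simp add: add.commute)
  then show "- (LINT P|sq. u (tproj P) * (b (tproj P) * pdx (\<phi> \<circ> tproj) P - a (tproj P) * pdy (\<phi> \<circ> tproj) P)) = torus_integral (\<lambda>p. A p * u p * \<phi> p)"
    by (simp add: L_def f_def)
qed

text \<open>The estimates for \<open>V\<close> hold on bounded sets only and the exponent
  \<open>G\<close> is not periodic. But the function itself is: pairs at distance at most 1 are
  translated into a fixed box, and for more distant pairs its boundedness suffices.\<close>

lemma S_hoelder:
  assumes nu: "- A_integral = 2 * of_real pi * \<i> * (of_int j + of_int k * \<tau>)"
  shows "holder_on hoelder_exp UNIV (\<lambda>P. S k (Z P))"
proof -
  define f where "f P = S k (Z P)" for P
  define G where "G z = w z - 2 * of_real pi * \<i> * of_int k * z" for z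
  have fG: "f P = exp (G (Z P))" for P
    unfolding f_def G_def twist_def exp_add[symmetric] by simp
  have Gc: "continuous_on UNIV G" unfolding G_def by (intro continuous_intros w_continuous)
  have fc: "continuous_on UNIV f" unfolding fG[abs_def] by (intro continuous_intros continuous_compose_Z Gc)
  have fp: "per2 f" unfolding per2_def f_def Z_shift S_period[OF nu] by simp
  obtain B where B: "B > 0" "\<And>P. norm (f P) \<le> B" using per2_bounded[OF fc fp] by blast
  obtain LZ where LZ: "LZ \<ge> 0" "\<And>P Q. norm (Z P - Z Q) \<le> LZ * dist P Q" by (rule Z_lipschitz) blast
  let ?K = "cbox (-1, -1) (2, 2) :: (real \<times> real) set"
  have "bounded (Z ` ?K)" "bounded ((\<lambda>P. G (Z P)) ` ?K)"
    by (intro compact_imp_bounded compact_continuous_image Z_continuous continuous_on_subset[OF continuous_compose_Z[OF Gc]]; simp)+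
  then obtain B1 B2 where "\<forall>P\<in>?K. norm (Z P) \<le> B1" "\<forall>P\<in>?K. norm (G (Z P)) \<le> B2" by (auto simp: bounded_iff)
  then have B12: "\<And>P. P \<in> ?K \<Longrightarrow> norm (Z P) \<le> B1" "\<And>P. P \<in> ?K \<Longrightarrow> norm (G (Z P)) \<le> B2" by auto
  have "C1c exp" by (rule C1c_holomorphic) (intro holomorphic_intros)
  then obtain L where L: "L \<ge> 0" "\<And>z z'. norm z \<le> B2 \<Longrightarrow> norm z' \<le> B2 \<Longrightarrow> norm (exp z - exp z' :: complex) \<le> L * norm (z - z')"
    using C1c_lipschitz by blast
  obtain K1 L1 where K1: "K1 \<ge> 0" "L1 \<ge> 0" "\<And>z z'. norm z \<le> B1 \<Longrightarrow> norm z' \<le> B1 \<Longrightarrow> norm (V z - V z') \<le> K1 * norm (z - z') powr hoelder_exp + L1 * norm (z - z')"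
    using V_hoelder[of B1] by blast
  define L2 where "L2 = L1 + norm (2 * of_real pi * \<i> * of_int k :: complex)"
  have L2: "L2 \<ge> 0" using K1(2) by (simp add: L2_def)
  define M where "M = L * (K1 * LZ powr hoelder_exp + L2 * LZ)"
  have M: "M \<ge> 0" using L(1) K1(1) L2 LZ(1) by (simp add: M_def)
  have local: "norm (f P - f Q) \<le> M * dist P Q powr hoelder_exp" if PQ: "P \<in> ?K" "Q \<in> ?K" "dist P Q \<le> 1" for P Q
  proof -
    let ?z = "Z P" and ?z' = "Z Q"
    have "norm (w ?z - w ?z') \<le> norm (V ?z - V ?z')"
    proof -
      have "norm (w ?z - w ?z') = norm (V ?z - V ?z') / (2 * pi)"
        unfolding w_def right_diff_distrib[symmetric] by (simp add: norm_mult norm_divide)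
      also have "\<dots> \<le> norm (V ?z - V ?z') / 1" using pi_gt3 by (intro divide_left_mono) auto
      finally show ?thesis by simp
    qed
    also have "\<dots> \<le> K1 * norm (?z - ?z') powr hoelder_exp + L1 * norm (?z - ?z')" by (intro K1(3) B12 PQ)
    finally have 1: "norm (w ?z - w ?z') \<le> K1 * norm (?z - ?z') powr hoelder_exp + L1 * norm (?z - ?z')" .
    have "G ?z - G ?z' = (w ?z - w ?z') - 2 * of_real pi * \<i> * of_int k * (?z - ?z')" by (simp add: G_def algebra_simps)
    then have "norm (G ?z - G ?z') \<le> norm (w ?z - w ?z') + norm (2 * of_real pi * \<i> * of_int k * (?z - ?z'))"
      using norm_triangle_ineq4[of "w ?z - w ?z'" "2 * of_real pi * \<i> * of_int k * (?z - ?z')"] by simp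
    also have "\<dots> = norm (w ?z - w ?z') + norm (2 * of_real pi * \<i> * of_int k :: complex) * norm (?z - ?z')" by (simp only: norm_mult)
    also have "\<dots> \<le> K1 * norm (?z - ?z') powr hoelder_exp + L2 * norm (?z - ?z')" using 1 by (simp add: L2_def algebra_simps)
    also have "\<dots> \<le> K1 * (LZ * dist P Q) powr hoelder_exp + L2 * (LZ * dist P Q)"
      using K1(1) L2 LZ(2) hoelder_exp by (intro add_mono mult_left_mono powr_mono2) auto
    also have "\<dots> = K1 * LZ powr hoelder_exp * dist P Q powr hoelder_exp + L2 * LZ * dist P Q" using LZ(1) by (simp add: powr_mult)
    also have "\<dots> \<le> K1 * LZ powr hoelder_exp * dist P Q powr hoelder_exp + L2 * LZ * dist P Q powr hoelder_exp"
    proof (intro add_left_mono mult_left_mono)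
      show "dist P Q \<le> dist P Q powr hoelder_exp"
      proof (cases "dist P Q = 0")
        case False
        then have "dist P Q powr 1 \<le> dist P Q powr hoelder_exp" using PQ(3) hoelder_exp by (intro powr_mono') auto
        then show ?thesis using False by simp
      qed simp
    qed (use L2 LZ in auto)
    finally have 2: "norm (G ?z - G ?z') \<le> (K1 * LZ powr hoelder_exp + L2 * LZ) * dist P Q powr hoelder_exp" by (simp add: algebra_simps)
    have "norm (f P - f Q) \<le> L * norm (G ?z - G ?z')" unfolding fG by (intro L(2) B12 PQ)
    also have "\<dots> \<le> L * ((K1 * LZ powr hoelder_exp + L2 * LZ) * dist P Q powr hoelder_exp)" by (intro mult_left_mono 2 L(1))
    finally show ?thesis by (simp add: M_def mult.assoc)
  qed
  \<comment> \<open>\<open>M\<close> serves close pairs and \<open>2 * B\<close> distant ones; their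
    sum covers both cases with one constant.\<close>
  have "dist (f P) (f Q) \<le> (M + 2 * B) * dist P Q powr hoelder_exp" for P Q
  proof (cases "dist P Q \<le> 1")
    case True
    obtain P0 m n where P0: "P0 \<in> unit_square" "P = (fst P0 + of_int m, snd P0 + of_int n)" by (rule unit_square_representative)
    define Q0 where "Q0 = (fst Q - of_int m, snd Q - of_int n)"
    have Q: "Q = (fst Q0 + of_int m, snd Q0 + of_int n)" by (simp add: Q0_def)
    have d: "dist P0 Q0 = dist P Q" unfolding P0(2) Q by (simp add: dist_prod_def dist_real_def)
    have "\<bar>fst P0 - fst Q0\<bar> \<le> 1" "\<bar>snd P0 - snd Q0\<bar> \<le> 1"
      using True dist_fst_le[of P0 Q0] dist_snd_le[of P0 Q0] unfolding d by (auto simp: dist_real_def)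
    moreover have "0 \<le> fst P0" "fst P0 \<le> 1" "0 \<le> snd P0" "snd P0 \<le> 1" using P0(1) by (auto simp: unit_square_def)
    ultimately have "P0 \<in> ?K" "Q0 \<in> ?K" unfolding cbox_Pair_eq mem_Times_iff by auto
    then have "norm (f P0 - f Q0) \<le> M * dist P0 Q0 powr hoelder_exp" using True d by (intro local) auto
    moreover have "f P = f P0" "f Q = f Q0" unfolding P0(2) Q using per2_int[OF fp] by simp_all
    moreover have "0 \<le> 2 * B * dist P Q powr hoelder_exp" using B(1) by simp
    ultimately show ?thesis unfolding d dist_norm[of "f P"] by (simp add: distrib_right)
  next
    case False
    then have "1 \<le> dist P Q powr hoelder_exp" using hoelder_exp by (intro ge_one_powr_ge_zero) auto
    then have "(M + 2 * B) * 1 \<le> (M + 2 * B) * dist P Q powr hoelder_exp" using M B(1) by (intro mult_left_mono) auto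
    moreover have "dist (f P) (f Q) \<le> 2 * B" using norm_triangle_ineq4[of "f P" "f Q"] B(2)[of P] B(2)[of Q] by (simp add: dist_norm)
    moreover have "2 * B \<le> (M + 2 * B) * 1" using M by simp
    ultimately show ?thesis by (meson order_trans)
  qed
  then show ?thesis unfolding holder_on_def f_def[symmetric] by blast
qed

section \<open>Uniqueness\<close>

text \<open>For c outside the lattice the Szego kernel exists and has precisely the multiplier
  \<open>exp (- A_integral)\<close> that \<open>weak_solution_test\<close> demands, with a single
  pole modulo the lattice, placed at Z Q. The test gives 0, \<open>concentration\<close> gives
  nearly 2 pi i H Q, and so u vanishes at Q. The residues \<open>exp (- A_integral * n)\<close>
  compensate the multiplier of \<open>H\<close>.\<close>

lemma solution_unique_off_lattice:
  assumes ws: "weak_solution a b u (\<lambda>p. A p * u p)" and u: "continuous_on UNIV (\<lambda>P. u (tproj P))"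
    and c: "c \<notin> lattice \<tau>" and Ac: "A_integral = 2 * of_real pi * \<i> * c"
  shows "u (tproj P) = 0"
proof -
  let ?E = "szego_num \<tau> c"
  note sz = szego[OF tau c]
  have eA: "exp (- 2 * of_real pi * \<i> * c) = exp (- A_integral)" by (simp add: Ac)
  have res_m: "theta_res \<tau> ?E (z + of_int m) = theta_res \<tau> ?E z" for z m
  proof (induction m rule: int_induct[where k = 0])
    case (step1 i) then show ?case using sz(2)[of "z + of_int i"] by (simp add: add_ac)
  next
    case (step2 i) then show ?case using sz(2)[of "z + of_int (i - 1)"] by (simp add: add_ac)
  qed simp
  have res_n: "theta_res \<tau> ?E (of_int n * \<tau>) = exp (- A_integral * of_int n)" for n
  proof (induction n rule: int_induct[where k = 0])
    case base show ?case using sz(1) by simp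
  next
    case (step1 i)
    have "theta_res \<tau> ?E (of_int i * \<tau> + \<tau>) = exp (- A_integral) * theta_res \<tau> ?E (of_int i * \<tau>)"
      using sz(3)[of "of_int i * \<tau>"] latticeI[of 0 i \<tau>] eA by simp
    then show ?case using step1 by (simp add: algebra_simps mult_exp_exp)
  next
    case (step2 i)
    have "theta_res \<tau> ?E (of_int (i - 1) * \<tau> + \<tau>) = exp (- A_integral) * theta_res \<tau> ?E (of_int (i - 1) * \<tau>)"
      using sz(3)[of "of_int (i - 1) * \<tau>"] latticeI[of 0 "i - 1" \<tau>] eA by simp
    then have "exp (- A_integral) * theta_res \<tau> ?E (of_int (i - 1) * \<tau>) = exp (- A_integral * of_int i)"
      using step2 by (simp add: algebra_simps)
    also have "\<dots> = exp (- A_integral) * exp (- A_integral * of_int (i - 1))" by (simp add: mult_exp_exp algebra_simps)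
    finally show ?case by simp
  qed
  have res: "theta_res \<tau> ?E (of_int m + of_int n * \<tau>) = exp (- A_integral * of_int n)" for m n
    using res_m[of "of_int n * \<tau>" m] res_n[of n] by (simp add: add.commute)
  define H where "H P = u (tproj P) * exp (- w (Z P))" for P
  have Hc: "continuous_on UNIV H"
    unfolding H_def[abs_def] by (intro continuous_intros u continuous_compose_Z w_continuous)
  have upx: "u (tproj (x + 1, y)) = u (tproj (x, y))" "u (tproj (x, y + 1)) = u (tproj (x, y))" for x y
    using tproj_per2[of u] by (simp_all add: per2_def)
  \<comment> \<open>An exponential in y turns the quasi-periodic \<open>H\<close> into a periodic
    function, so that \<open>per2_int\<close> handles all integer translations at once.\<close>
  have "per2 (\<lambda>P. H P * exp (- A_integral * of_real (snd P)))"
    unfolding per2_def H_def Z_shift w_period upx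
    by (simp add: algebra_simps mult_exp_exp)
  from per2_int[OF this] have "H (x + of_int m, y + of_int n) * exp (- A_integral * (of_real y + of_int n)) = H (x, y) * exp (- A_integral * of_real y)" for x y m n
    by simp
  then have Hqp: "H (x + of_int m, y + of_int n) * exp (- A_integral * of_int n) = H (x, y)" for x y m n
  proof -
    have "exp (- A_integral * (of_real y + of_int n)) = exp (- A_integral * of_int n) * exp (- A_integral * of_real y)"
      by (simp add: mult_exp_exp algebra_simps)
    then show ?thesis
      using \<open>\<And>x y m n. H (x + of_int m, y + of_int n) * exp (- A_integral * (of_real y + of_int n)) = H (x, y) * exp (- A_integral * of_real y)\<close>[of x m y n]
      by (simp add: mult.assoc[symmetric])
  qed
  have HQ: "H Q = 0" if Q: "Q \<in> unit_square" for Q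
  proof (rule norm_le_all_imp_zero)
    fix \<eta> :: real assume \<eta>: "\<eta> > 0"
    obtain d where d: "d > 0" "\<And>P Q l. Q \<in> unit_square \<Longrightarrow> l \<in> lattice \<tau> \<Longrightarrow> norm (Z P - Z Q - l) < d \<Longrightarrow> norm (H P * theta_res \<tau> ?E l - H Q) < \<eta>"
      by (rule quasi_periodic_close[OF Hc _ \<eta>, of ?E]) (use res Hqp in auto)
    define e where "e = min d 1"
    have e: "0 < e" "e \<le> 1" using d(1) by (auto simp: e_def)
    let ?k = "theta_reg \<tau> ?E e"
    note k = theta_reg_C1[OF tau sz(6) e]
    note ks = C1c_shift[OF k(1), of "Z Q"]
    have s1: "?k (z + 1) = 1 * ?k z + 0" for z
      by (rule theta_reg_shift[OF tau sz(6) e lattice_1]) (simp_all add: sz)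
    have s2: "?k (z + \<tau>) = exp (- A_integral) * ?k z + 0" for z
      by (rule theta_reg_shift[OF tau sz(6) e lattice_tau]) (simp_all only: sz(3,5) eA add_0_right)
    have "(LINT P|sq. (u (tproj P) * (2 * \<i> * of_real (Jac P) * dzb (\<lambda>z. ?k (z - Z Q)) (Z P))) * exp (- w (Z P))) = 0"
    proof (rule weak_solution_test[OF ws u ks(1)])
      show "?k (z + 1 - Z Q) = ?k (z - Z Q)" for z using s1[of "z - Z Q"] by (simp add: algebra_simps)
      show "?k (z + \<tau> - Z Q) = exp (- A_integral) * ?k (z - Z Q)" for z using s2[of "z - Z Q"] by (simp add: algebra_simps)
    qed
    moreover have "(u (tproj P) * (2 * \<i> * of_real (Jac P) * dzb (\<lambda>z. ?k (z - Z Q)) (Z P))) * exp (- w (Z P))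
      = H P * (2 * \<i> * of_real (Jac P) * theta_delta \<tau> ?E e (Z P - Z Q))" for P
      unfolding ks(2) k(2) H_def by simp
    ultimately have 0: "(LINT P|sq. H P * (2 * \<i> * of_real (Jac P) * theta_delta \<tau> ?E e (Z P - Z Q))) = 0" by simp
    have "norm ((LINT P|sq. H P * (2 * \<i> * of_real (Jac P) * theta_delta \<tau> ?E e (Z P - Z Q))) - 2 * of_real pi * \<i> * H Q) \<le> 2 * pi * \<eta>"
    proof (rule concentration[OF sz(6) e Hc])
      fix P l assume "l \<in> lattice \<tau>" "norm (Z P - Z Q - l) < e"
      then show "norm (H P * theta_res \<tau> ?E l - H Q) \<le> \<eta>" using d(2)[OF Q, of l P] by (simp add: e_def less_imp_le)
    qed (use \<eta> in simp)
    then show "norm (H Q) \<le> \<eta>" unfolding 0 by (simp add: norm_mult)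
  qed
  obtain Q m n where Q: "Q \<in> unit_square" "P = (fst Q + of_int m, snd Q + of_int n)" by (rule unit_square_representative)
  have "u (tproj P) = u (tproj Q)" using per2_int[OF tproj_per2[of u]] unfolding Q(2) by simp
  then show ?thesis using HQ[OF Q(1)] by (simp add: H_def)
qed

text \<open>Here a kernel with one pole and the required multiplier is replaced by the logarithmic
  derivative, whose additive jump cancels in a difference of two translates. Poles at Z Q1 and Z Q2
  contribute with opposite signs, so the test only compares H Q1 with H Q2, and the quotient
  \<open>H\<close> of u by the known solution is constant.\<close>

lemma solution_unique_on_lattice:
  assumes ws: "weak_solution a b u (\<lambda>p. A p * u p)" and u: "continuous_on UNIV (\<lambda>P. u (tproj P))"
    and nu: "- A_integral = 2 * of_real pi * \<i> * (of_int j + of_int k * \<tau>)"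
  obtains c where "\<And>P. u (tproj P) = c * S k (Z P)"
proof -
  define H where "H P = u (tproj P) * exp (- w (Z P)) * twist k (Z P)" for P
  have kc: "continuous_on UNIV (twist k)" by (intro holomorphic_on_imp_continuous_on twist_holomorphic)
  have Hc: "continuous_on UNIV H"
    unfolding H_def[abs_def] by (intro continuous_intros u continuous_compose_Z w_continuous kc)
  have uH: "u (tproj P) = H P * S k (Z P)" for P
  proof -
    have "exp (- w (Z P)) * exp (w (Z P)) = 1" by (simp add: mult_exp_exp)
    then show ?thesis using twist_nonzero[of k "Z P"] by (simp add: H_def twist_minus)
  qed
  have pS: "per2 (\<lambda>P. S k (Z P))" unfolding per2_def Z_shift S_period[OF nu] by simp
  have "H = (\<lambda>P. u (tproj P) / S k (Z P))"
    by (rule ext) (simp add: uH twist_nonzero)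
  moreover have "per2 (\<lambda>P. u (tproj P) / S k (Z P))"
    using tproj_per2[of u] pS unfolding per2_def o_def by simp
  ultimately have Hp: "per2 H" by simp
  have Hd: "H Q1 - H Q2 = 0" if Q: "Q1 \<in> unit_square" "Q2 \<in> unit_square" for Q1 Q2
  proof (rule norm_le_all_imp_zero)
    fix r :: real assume "r > 0"
    define \<eta> where "\<eta> = r / 2"
    have \<eta>: "\<eta> > 0" using \<open>r > 0\<close> by (simp add: \<eta>_def)
    obtain d where d: "d > 0" "\<And>P Q l. Q \<in> unit_square \<Longrightarrow> l \<in> lattice \<tau> \<Longrightarrow> norm (Z P - Z Q - l) < d \<Longrightarrow> norm (H P * theta_res \<tau> dtheta l - H Q) < \<eta>"
      by (rule quasi_periodic_close[OF Hc _ \<eta>, of dtheta]) (use theta_res_dtheta per2_int[OF Hp] in auto)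
    define e where "e = min d 1"
    have e: "0 < e" "e \<le> 1" using d(1) by (auto simp: e_def)
    let ?k = "Kreg e" and ?D = "\<lambda>Q P. theta_delta \<tau> dtheta e (Z P - Z Q)"
    note k = theta_reg_C1[OF tau dtheta_holomorphic e]
    note ks = C1c_shift[OF k(1)]
    have W: "has_wirt (\<lambda>z. ?k (z - Z Q1) - ?k (z - Z Q2)) (dz (\<lambda>z. ?k (z - Z Q1)) z - dz (\<lambda>z. ?k (z - Z Q2)) z)
      (dzb (\<lambda>z. ?k (z - Z Q1)) z - dzb (\<lambda>z. ?k (z - Z Q2)) z) z" for z
      by (intro has_wirt_diff C1c_has_wirt ks(1))
    have kd: "C1c (\<lambda>z. ?k (z - Z Q1) - ?k (z - Z Q2))"
      by (rule C1cI[OF W]; intro continuous_intros C1cD ks(1))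
    have dkd: "dzb (\<lambda>z. ?k (z - Z Q1) - ?k (z - Z Q2)) z = theta_delta \<tau> dtheta e (z - Z Q1) - theta_delta \<tau> dtheta e (z - Z Q2)" for z
      unfolding has_wirt_unique(2)[OF W] ks(2) k(2) ..
    \<comment> \<open>The difference of kernels is doubly periodic; the factor
      \<open>twist k\<close> supplies the multiplier \<open>exp (- A_integral)\<close> and is
      absorbed into \<open>H\<close> afterwards.\<close>
    define X where "X = (\<lambda>z. twist k z * (?k (z - Z Q1) - ?k (z - Z Q2)))"
    note X = C1c_mult[OF C1c_holomorphic(1)[OF twist_holomorphic[of k]] kd, folded X_def]
    have dX: "dzb X z = twist k z * (theta_delta \<tau> dtheta e (z - Z Q1) - theta_delta \<tau> dtheta e (z - Z Q2))" for z
      unfolding X(2) C1c_holomorphic(2)[OF twist_holomorphic] dkd by simp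
    have ksh: "?k (z + 1 - x) = ?k (z - x)" "?k (z + \<tau> - x) = ?k (z - x) - 2 * of_real pi * \<i>" for z x
      using theta_reg_period[OF e, of "z - x"] by (simp_all add: algebra_simps)
    have "(LINT P|sq. (u (tproj P) * (2 * \<i> * of_real (Jac P) * dzb X (Z P))) * exp (- w (Z P))) = 0"
    proof (rule weak_solution_test[OF ws u X(1)])
      show "X (z + 1) = X z" for z unfolding X_def ksh twist_period[OF nu] ..
      show "X (z + \<tau>) = exp (- A_integral) * X z" for z unfolding X_def ksh twist_period[OF nu] by simp
    qed
    moreover have "(u (tproj P) * (2 * \<i> * of_real (Jac P) * dzb X (Z P))) * exp (- w (Z P))
      = H P * (2 * \<i> * of_real (Jac P) * ?D Q1 P) - H P * (2 * \<i> * of_real (Jac P) * ?D Q2 P)" for P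
      unfolding dX H_def by (simp add: algebra_simps)
    moreover have "(LINT P|sq. H P * (2 * \<i> * of_real (Jac P) * ?D Q1 P) - H P * (2 * \<i> * of_real (Jac P) * ?D Q2 P))
      = (LINT P|sq. H P * (2 * \<i> * of_real (Jac P) * ?D Q1 P)) - (LINT P|sq. H P * (2 * \<i> * of_real (Jac P) * ?D Q2 P))"
      by (intro Bochner_Integration.integral_diff sq_integrable_continuous continuous_intros Hc Jac_continuous theta_delta_continuous' dtheta_holomorphic e)
    ultimately have eq: "(LINT P|sq. H P * (2 * \<i> * of_real (Jac P) * ?D Q1 P)) = (LINT P|sq. H P * (2 * \<i> * of_real (Jac P) * ?D Q2 P))" by simp
    have conc: "norm ((LINT P|sq. H P * (2 * \<i> * of_real (Jac P) * ?D Q P)) - 2 * of_real pi * \<i> * H Q) \<le> 2 * pi * \<eta>" if "Q \<in> unit_square" for Q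
    proof (rule concentration[OF dtheta_holomorphic e Hc])
      fix P l assume "l \<in> lattice \<tau>" "norm (Z P - Z Q - l) < e"
      then show "norm (H P * theta_res \<tau> dtheta l - H Q) \<le> \<eta>" using d(2)[OF that, of l P] by (simp add: e_def less_imp_le)
    qed (use \<eta> in simp)
    have tri: "norm (x - y) \<le> norm (I - x) + norm (I - y)" for x y I :: complex
      using norm_triangle_ineq4[of "I - y" "I - x"] by simp
    have "norm (2 * of_real pi * \<i> * H Q1 - 2 * of_real pi * \<i> * H Q2) \<le> 2 * pi * \<eta> + 2 * pi * \<eta>"
      by (rule order_trans[OF tri add_mono[OF conc[OF Q(1), unfolded eq] conc[OF Q(2)]]])
    then have "2 * pi * norm (H Q1 - H Q2) \<le> 2 * pi * r"
      unfolding right_diff_distrib[symmetric] by (simp add: norm_mult \<eta>_def)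
    then show "norm (H Q1 - H Q2) \<le> r" by simp
  qed
  have "(0, 0) \<in> unit_square" by (simp add: unit_square_def)
  from Hd[OF _ this] have Hsq: "H P = H (0, 0)" if "P \<in> unit_square" for P
    unfolding eq_iff_diff_eq_0[of "H P"] using that by blast
  have "per2 (\<lambda>_::real \<times> real. H (0, 0))" unfolding per2_def by blast
  from per2_eqI[OF Hp this Hsq] have "H P = H (0, 0)" for P .
  then have "u (tproj P) = H (0, 0) * S k (Z P)" for P using uH[of P] by (rule subst)
  then show thesis by (rule that)
qed

end

section \<open>Assembly of existence, uniqueness and the representation formula\<close>

lemma (in similarity) holder_solution_continuous:
  assumes "holder_torus hoelder_exp u" shows "continuous_on UNIV (\<lambda>P. u (tproj P))"
  using holder_on_continuous[OF _ hoelder_exp(1)] assms unfolding holder_torus_def o_def by blast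

lemma (in similarity) nu_lattice:
  assumes "- 1 / (2 * of_real pi * \<i>) * A_integral = of_int j + of_int k * \<tau>"
  shows "- A_integral = 2 * of_real pi * \<i> * (of_int j + of_int k * \<tau>)"
  unfolding assms[symmetric] by simp

theorem theorem4p1:
  fixes a b A :: "torus \<Rightarrow> complex" and \<epsilon> \<sigma> q r \<mu> \<alpha> :: real
    and N :: nat and C :: "nat \<Rightarrow> torus set" and sg :: "nat \<Rightarrow> real" and \<tau> \<nu> :: complex
  assumes form: "hypocomplex_form a b \<epsilon> N C sg \<tau>"
    and sigma: "\<sigma> = Max (sg ` {1..N})"
    and q: "q > 2 + \<sigma>"
    and A: "A \<in> Lq_torus q"
    and r: "r = q / (q - 1)"
    and mu: "\<mu> = \<sigma> / (\<sigma> + 1)"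
    and alpha: "\<alpha> = (2 - r - \<mu>) / r"
    and nu: "\<nu> = - 1 / (2 * of_real pi * \<i>) * torus_integral A"
  shows "((\<exists>u. holder_torus \<alpha> u \<and> u \<noteq> (\<lambda>_. 0) \<and> weak_solution a b u (\<lambda>p. A p * u p))
            \<longleftrightarrow> (\<exists>j k :: int. \<nu> = of_int j + of_int k * \<tau>))
       \<and> (\<forall>j k :: int. \<nu> = of_int j + of_int k * \<tau> \<longrightarrow>
            (\<forall>u. holder_torus \<alpha> u \<and> weak_solution a b u (\<lambda>p. A p * u p) \<longrightarrow>
              (\<exists>c. \<forall>P. (u \<circ> tproj) P =
                 c * exp (T_op a b \<tau> (A \<circ> tproj) P - 2 * of_real pi * \<i> * of_int k * Zint a b P))))"
proof -
  interpret hypocomplex_form a b \<epsilon> N C sg \<tau> by (rule form)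
  have \<sigma>: "\<sigma> = sigma_max" by (simp add: sigma sigma_max_def)
  interpret similarity a b \<epsilon> N C sg \<tau> A q
    by unfold_locales (use q A \<sigma> in auto)
  have \<alpha>: "\<alpha> = hoelder_exp" by (simp add: hoelder_exp_def alpha r mu \<sigma>)
  have \<nu>: "\<nu> = - 1 / (2 * of_real pi * \<i>) * A_integral" by (simp add: nu torus_integral_def A_integral_def)
  have S_eq: "S k (Z P) = exp (T_op a b \<tau> (A \<circ> tproj) P - 2 * of_real pi * \<i> * of_int k * Z P)" for k P
    unfolding T_op_eq w_def[symmetric] twist_def exp_add[symmetric] by simp
  have formula: "\<exists>c. \<forall>P. (u \<circ> tproj) P = c * exp (T_op a b \<tau> (A \<circ> tproj) P - 2 * of_real pi * \<i> * of_int k * Z P)"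
    if jk: "\<nu> = of_int j + of_int k * \<tau>" and u: "holder_torus \<alpha> u" "weak_solution a b u (\<lambda>p. A p * u p)" for j k u
  proof -
    obtain c where "\<And>P. u (tproj P) = c * S k (Z P)"
      using solution_unique_on_lattice[OF u(2) holder_solution_continuous nu_lattice] u(1) jk unfolding \<alpha> \<nu> by blast
    then show ?thesis unfolding S_eq by auto
  qed
  have "\<exists>u. holder_torus \<alpha> u \<and> u \<noteq> (\<lambda>_. 0) \<and> weak_solution a b u (\<lambda>p. A p * u p)"
    if jk: "\<nu> = of_int j + of_int k * \<tau>" for j k
  proof -
    note nu' = nu_lattice[OF jk[unfolded \<nu>]]
    have "per2 (\<lambda>P. S k (Z P))" unfolding per2_def Z_shift S_period[OF nu'] by simp
    then obtain u where u: "u \<circ> tproj = (\<lambda>P. S k (Z P))" by (rule periodic_descends)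
    then have uS: "u (tproj P) = S k (Z P)" for P by (metis comp_apply)
    have "holder_torus \<alpha> u" unfolding holder_torus_def u \<alpha> by (rule S_hoelder[OF nu'])
    moreover have "u \<noteq> (\<lambda>_. 0)" using uS[of "(0, 0)"] twist_nonzero by auto
    moreover have "weak_solution a b u (\<lambda>p. A p * u p)" by (rule S_weak_solution[OF nu' uS])
    ultimately show ?thesis by blast
  qed
  moreover have "\<exists>j k :: int. \<nu> = of_int j + of_int k * \<tau>"
    if u: "holder_torus \<alpha> u" "u \<noteq> (\<lambda>_. 0)" "weak_solution a b u (\<lambda>p. A p * u p)" for u
  proof (rule ccontr)
    assume no: "\<not> ?thesis"
    \<comment> \<open>The parameter c of the Szego kernel is -\<nu>, because the integral of A
      equals -2 pi i \<nu>.\<close>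
    have "- \<nu> \<notin> lattice \<tau>"
    proof
      assume "- \<nu> \<in> lattice \<tau>"
      then have "\<nu> \<in> lattice \<tau>" using lattice_uminus by fastforce
      then show False using no unfolding lattice_def by blast
    qed
    moreover have "A_integral = 2 * of_real pi * \<i> * - \<nu>" by (simp add: \<nu>)
    ultimately have "u (tproj P) = 0" for P
      using solution_unique_off_lattice[OF u(3) holder_solution_continuous] u(1) unfolding \<alpha> by blast
    then have "u p = 0" for p using surj_tproj by (metis surjD)
    then show False using u(2) by auto
  qed
  ultimately show ?thesis using formula by blast
qed

end
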